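(* Let $x$ be a base tuple for a quasinormal circulant scheme $\mathcal X$ over a finite cyclic group $G$. Then for every section $\mathfrak S\in\mathrm{Sec}_0(\mathcal X)$, the coherent configuration $\mathcal X_{x,\mathfrak S}$ is discrete (all its basis relations are singletons).
   Context: A coherent configuration on $\Omega$ is $(\Omega,S)$ with $S$ a partition of $\Omega\times\Omega$ (basis relations) such that $1_\Omega$ is a union of basis relations, $S$ is closed under transposition, and $|\{\gamma:(\alpha,\gamma)\in r,(\gamma,\beta)\in s\}|$ is independent of $(\alpha,\beta)\in t$. It is trivial if its basis relations are $1_\Omega$ and its complement (only $1_\Omega$ if $|\Omega|=1$). $\mathrm{Aut}(\mathcal X)$ is the group of permutations of $\Omega$ fixing every basis relation. $\mathcal X\le\mathcal Y$ if each basis relation of $\mathcal X$ is a union of basis relations of $\mathcal Y$. For a tuple $x=(x_1,\dots,x_m)$, $\Omega(x)=\{x_1,\dots,x_m\}$ and the point extension $\mathcal X_x$ is the smallest coherent configuration $\ge\mathcal X$ in which each $\{(x_i,x_i)\}$ is a basis relation. A circulant scheme over a cyclic group $G$ is a coherent configuration $\mathcal X=(G,S)$ with $(\alpha,\beta)\in s\Rightarrow(\alpha g,\beta g)\in s$. $H\le G$ is an $\mathcal X$-group if its coset partition $e(H)$ is a union of basis relations. For $\mathcal X$-groups $L\le U$, $\mathfrak S=U/L$ is a section, $U(\mathfrak S)=U$, $L(\mathfrak S)=L$; $\mathrm{Sec}_1(\mathcal X)$ is the set of such sections. For a coherent configuration $\mathcal Y=(G,S_{\mathcal Y})\ge\mathcal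 X$, $\mathcal Y_{\mathfrak S}$ is the coherent configuration on $\mathfrak S$ with basis relations the nonempty sets $s_{\mathfrak S}=\{(\Gamma,\Gamma')\in\mathfrak S^2:s\cap(\Gamma\times\Gamma')\ne\varnothing\}$ ($s\in S_{\mathcal Y}$, $s\subseteq U\times U$); $\mathcal X_{\mathfrak S}$ is a circulant scheme over $U/L$, and $\mathcal X_{x,\mathfrak S}:=(\mathcal X_x)_{\mathfrak S}$. $\mathfrak S$ is a subsection of $\mathfrak T$ if $L(\mathfrak T)\le L(\mathfrak S)\le U(\mathfrak S)\le U(\mathfrak T)$. A section is trivial/normal if $\mathcal X_{\mathfrak S}$ is trivial/normal, where a circulant scheme $\mathcal Y$ over a cyclic group $K$ is normal if the group of right translations of $K$ is normal in $\mathrm{Aut}(\mathcal Y)$. The radical of such $\mathcal Y$ is $\{h\in K:Th=T\}$ where $T=\{t:(1_K,t)\in r\}$ and $r$ is the basis relation containing $(1_K,g)$ for a generator $g$ of $K$; $\mathfrak S$ is principal if the radical of $\mathcal X_{\mathfrak S}$ is trivial. $\mathfrak S$ is a multiple of $\mathfrak T$ if $L(\mathfrak T)=U(\mathfrak T)\cap L(\mathfrak S)$ and $U(\mathfrak S)=U(\mathfrak T)L(\mathfrak S)$; projective equivalence $\sim$ is the equivalence relation on $\mathrm{Sec}_1(\mathcal X)$ generated by this. $\mathrm{Sec}_0(\mathcal X)$ is the set of sections in $\mathrm{Sec}_1(\mathcal X)$ projectively equivalent to some principal section. $\mathcal X$ is quasinormal if every trivial section in $\mathrm{Sec}_1(\mathcal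 X)$ is projectively equivalent to a subsection of a normal section. For $g\in G$, $g_{\mathfrak S}=gL$ if $g\in U$, else $\varnothing$. A tuple $x$ of elements of $G$ is a base tuple for $\mathcal X$ if $1_G\in\Omega(x)$ and for every $\mathfrak S\in\mathrm{Sec}_1(\mathcal X)$ of prime power order there is $g\in\Omega(x)\cap U(\mathfrak S)$ with $\mathfrak S=\langle g_{\mathfrak S}\rangle$. *)

theory Defs
  imports
    "HOL-Algebra.Algebra"
    "HOL-Library.Disjoint_Sets"
    "HOL-Number_Theory.Prime_Powers"
begin

section \<open>Coherent configurations\<close>

definition union_of_basis :: "('a \<times> 'a) set set \<Rightarrow> ('a \<times> 'a) set \<Rightarrow> bool" where
  "union_of_basis S r \<longleftrightarrow> (\<exists>T \<subseteq> S. r = \<Union>T)"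

definition coherent_configuration :: "'a set \<Rightarrow> ('a \<times> 'a) set set \<Rightarrow> bool" where
  "coherent_configuration \<Omega> S \<longleftrightarrow>
     finite \<Omega> \<and>
     partition_on (\<Omega> \<times> \<Omega>) S \<and>
     union_of_basis S (Id_on \<Omega>) \<and>
     (\<forall>s\<in>S. s\<inverse> \<in> S) \<and>
     (\<forall>r\<in>S. \<forall>s\<in>S. \<forall>t\<in>S. \<exists>c. \<forall>(\<alpha>, \<beta>)\<in>t.
        card {\<gamma>. (\<alpha>, \<gamma>) \<in> r \<and> (\<gamma>, \<beta>) \<in> s} = c)"

text \<open>Removing the empty set covers the case of a one-point set, where only the diagonal remains.\<close>

definition trivial_cc :: "'a set \<Rightarrow> ('a \<times> 'a) set set \<Rightarrow> bool" where
  "trivial_cc \<Omega> S \<longleftrightarrow> S = {Id_on \<Omega>, \<Omega> \<times> \<Omega> - Id_on \<Omega>} - {{}}"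

definition discrete_cc :: "('a \<times> 'a) set set \<Rightarrow> bool" where
  "discrete_cc S \<longleftrightarrow> (\<forall>s\<in>S. is_singleton s)"

definition Aut_cc :: "'a set \<Rightarrow> ('a \<times> 'a) set set \<Rightarrow> ('a \<Rightarrow> 'a) set" where
  "Aut_cc \<Omega> S = {f \<in> Bij \<Omega>. \<forall>s\<in>S. map_prod f f ` s = s}"

definition cc_le :: "('a \<times> 'a) set set \<Rightarrow> ('a \<times> 'a) set set \<Rightarrow> bool" where
  "cc_le S T \<longleftrightarrow> (\<forall>s\<in>S. union_of_basis T s)"

definition is_point_extension ::
  "'a set \<Rightarrow> ('a \<times> 'a) set set \<Rightarrow> 'a list \<Rightarrow> ('a \<times> 'a) set set \<Rightarrow> bool" where
  "is_point_extension \<Omega> S x T \<longleftrightarrow>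
     coherent_configuration \<Omega> T \<and> cc_le S T \<and> (\<forall>a\<in>set x. {(a, a)} \<in> T)"

definition point_extension ::
  "'a set \<Rightarrow> ('a \<times> 'a) set set \<Rightarrow> 'a list \<Rightarrow> ('a \<times> 'a) set set" where
  "point_extension \<Omega> S x =
     (THE T. is_point_extension \<Omega> S x T \<and>
        (\<forall>T'. is_point_extension \<Omega> S x T' \<longrightarrow> cc_le T T'))"


section \<open>Circulant schemes\<close>

text \<open>The group is not assumed cyclic here; this is a separate hypothesis.\<close>

definition circulant_scheme :: "('a, 'b) monoid_scheme \<Rightarrow> ('a \<times> 'a) set set \<Rightarrow> bool" where
  "circulant_scheme G S \<longleftrightarrow>
     coherent_configuration (carrier G) S \<and>
     (\<forall>s\<in>S. \<forall>(\<alpha>, \<beta>)\<in>s. \<forall>g\<in>carrier G. (\<alpha> \<otimes>\<^bsub>G\<^esub> g, \<beta> \<otimes>\<^bsub>G\<^esub> g) \<in> s)"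

definition right_translations :: "('a, 'b) monoid_scheme \<Rightarrow> ('a \<Rightarrow> 'a) set" where
  "right_translations G = (\<lambda>g. \<lambda>x\<in>carrier G. x \<otimes>\<^bsub>G\<^esub> g) ` carrier G"

definition normal_scheme :: "('a, 'b) monoid_scheme \<Rightarrow> ('a \<times> 'a) set set \<Rightarrow> bool" where
  "normal_scheme G S \<longleftrightarrow>
     right_translations G \<lhd> (BijGroup (carrier G))\<lparr>carrier := Aut_cc (carrier G) S\<rparr>"

definition group_generator :: "('a, 'b) monoid_scheme \<Rightarrow> 'a \<Rightarrow> bool" where
  "group_generator G g \<longleftrightarrow> g \<in> carrier G \<and> generate G {g} = carrier G"

definition neighbours_of_one ::
  "('a, 'b) monoid_scheme \<Rightarrow> ('a \<times> 'a) set set \<Rightarrow> 'a \<Rightarrow> 'a set" where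
  "neighbours_of_one G S g = {t. \<exists>r\<in>S. (\<one>\<^bsub>G\<^esub>, g) \<in> r \<and> (\<one>\<^bsub>G\<^esub>, t) \<in> r}"

text \<open>
  If \<open>G\<close> is cyclic, the radical does not depend on the generator \<open>g\<close>: by Schur's theorem on
  multipliers, the sets \<open>neighbours_of_one G S g\<close> for different generators are images of each other
  under automorphisms of \<open>G\<close>, and these automorphisms fix all subgroups.
\<close>

definition radical :: "('a, 'b) monoid_scheme \<Rightarrow> ('a \<times> 'a) set set \<Rightarrow> 'a \<Rightarrow> 'a set" where
  "radical G S g =
     {h \<in> carrier G. neighbours_of_one G S g #>\<^bsub>G\<^esub> h = neighbours_of_one G S g}"

definition coset_relation :: "('a, 'b) monoid_scheme \<Rightarrow> 'a set \<Rightarrow> ('a \<times> 'a) set" where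
  "coset_relation G H = (\<Union>C \<in> rcosets\<^bsub>G\<^esub> H. C \<times> C)"

definition scheme_group ::
  "('a, 'b) monoid_scheme \<Rightarrow> ('a \<times> 'a) set set \<Rightarrow> 'a set \<Rightarrow> bool" where
  "scheme_group G S H \<longleftrightarrow> subgroup H G \<and> union_of_basis S (coset_relation G H)"


section \<open>Sections\<close>

text \<open>A section \<open>U/L\<close> is represented by the pair \<open>(U, L)\<close>.\<close>

type_synonym 'a sec = "'a set \<times> 'a set"

abbreviation sec_U :: "'a sec \<Rightarrow> 'a set" where "sec_U \<equiv> fst"
abbreviation sec_L :: "'a sec \<Rightarrow> 'a set" where "sec_L \<equiv> snd"

definition Sec1 :: "('a, 'b) monoid_scheme \<Rightarrow> ('a \<times> 'a) set set \<Rightarrow> 'a sec set" where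
  "Sec1 G S = {(U, L). scheme_group G S U \<and> scheme_group G S L \<and> L \<subseteq> U}"

definition sec_group :: "('a, 'b) monoid_scheme \<Rightarrow> 'a sec \<Rightarrow> 'a set monoid" where
  "sec_group G A = (G\<lparr>carrier := sec_U A\<rparr>) Mod (sec_L A)"

text \<open>
  No condition \<open>s \<subseteq> U \<times> U\<close> is imposed on the basis relations \<open>s\<close>: a basis relation of the scheme
  itself is invariant under all translations of \<open>G\<close> and so never lies inside \<open>U \<times> U\<close> when \<open>U\<close> is
  proper. If \<open>U\<close> is a union of fibers, as for a point extension at a tuple containing the
  identity, every basis relation is either contained in \<open>U \<times> U\<close> or disjoint from it, and the
  condition would make no difference.
\<close>

definition sec_cc ::
  "('a, 'b) monoid_scheme \<Rightarrow> ('a \<times> 'a) set set \<Rightarrow> 'a sec \<Rightarrow> ('a set \<times> 'a set) set set" where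
  "sec_cc G S A =
     (\<lambda>s. {(\<Gamma>, \<Gamma>') \<in> carrier (sec_group G A) \<times> carrier (sec_group G A).
             s \<inter> (\<Gamma> \<times> \<Gamma>') \<noteq> {}}) ` S - {{}}"

definition subsection_of :: "'a sec \<Rightarrow> 'a sec \<Rightarrow> bool" where
  "subsection_of A B \<longleftrightarrow> sec_L B \<subseteq> sec_L A \<and> sec_L A \<subseteq> sec_U A \<and> sec_U A \<subseteq> sec_U B"

definition trivial_sec ::
  "('a, 'b) monoid_scheme \<Rightarrow> ('a \<times> 'a) set set \<Rightarrow> 'a sec \<Rightarrow> bool" where
  "trivial_sec G S A \<longleftrightarrow> trivial_cc (carrier (sec_group G A)) (sec_cc G S A)"

definition normal_sec ::
  "('a, 'b) monoid_scheme \<Rightarrow> ('a \<times> 'a) set set \<Rightarrow> 'a sec \<Rightarrow> bool" where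
  "normal_sec G S A \<longleftrightarrow> normal_scheme (sec_group G A) (sec_cc G S A)"

definition principal_sec ::
  "('a, 'b) monoid_scheme \<Rightarrow> ('a \<times> 'a) set set \<Rightarrow> 'a sec \<Rightarrow> bool" where
  "principal_sec G S A \<longleftrightarrow>
     (\<exists>g. group_generator (sec_group G A) g \<and>
        radical (sec_group G A) (sec_cc G S A) g = {\<one>\<^bsub>sec_group G A\<^esub>})"

definition multiple_of :: "('a, 'b) monoid_scheme \<Rightarrow> 'a sec \<Rightarrow> 'a sec \<Rightarrow> bool" where
  "multiple_of G A B \<longleftrightarrow>
     sec_L B = sec_U B \<inter> sec_L A \<and> sec_U A = sec_U B <#>\<^bsub>G\<^esub> sec_L A"

definition proj_equiv ::
  "('a, 'b) monoid_scheme \<Rightarrow> ('a \<times> 'a) set set \<Rightarrow> 'a sec \<Rightarrow> 'a sec \<Rightarrow> bool" where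
  "proj_equiv G S A B \<longleftrightarrow> A \<in> Sec1 G S \<and> B \<in> Sec1 G S \<and>
     equivclp (\<lambda>A B. A \<in> Sec1 G S \<and> B \<in> Sec1 G S \<and> multiple_of G A B) A B"

definition Sec0 :: "('a, 'b) monoid_scheme \<Rightarrow> ('a \<times> 'a) set set \<Rightarrow> 'a sec set" where
  "Sec0 G S = {A \<in> Sec1 G S. \<exists>B \<in> Sec1 G S. principal_sec G S B \<and> proj_equiv G S A B}"

definition quasinormal :: "('a, 'b) monoid_scheme \<Rightarrow> ('a \<times> 'a) set set \<Rightarrow> bool" where
  "quasinormal G S \<longleftrightarrow>
     (\<forall>A \<in> Sec1 G S. trivial_sec G S A \<longrightarrow>
        (\<exists>B \<in> Sec1 G S. \<exists>N \<in> Sec1 G S.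
           proj_equiv G S A B \<and> subsection_of B N \<and> normal_sec G S N))"

definition sec_elem :: "('a, 'b) monoid_scheme \<Rightarrow> 'a sec \<Rightarrow> 'a \<Rightarrow> 'a set" where
  "sec_elem G A g = (if g \<in> sec_U A then g <#\<^bsub>G\<^esub> sec_L A else {})"

text \<open>
  \<open>primepow\<close> excludes the order 1, but for sections of order 1 the condition below holds
  automatically, since \<open>g\<close> can be taken to be the identity.
\<close>

definition base_tuple ::
  "('a, 'b) monoid_scheme \<Rightarrow> ('a \<times> 'a) set set \<Rightarrow> 'a list \<Rightarrow> bool" where
  "base_tuple G S x \<longleftrightarrow>
     set x \<subseteq> carrier G \<and> \<one>\<^bsub>G\<^esub> \<in> set x \<and>
     (\<forall>A \<in> Sec1 G S. primepow (order (sec_group G A)) \<longrightarrow>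
        (\<exists>g \<in> set x \<inter> sec_U A. group_generator (sec_group G A) (sec_elem G A g)))"

end

(* Identify G with the integers modulo N, so that the scheme becomes a Schur ring and the point
	extension a coherent algebra above it. Discreteness of sections is invariant under projective
	equivalence, hence only principal sections matter. If the basic set T generating such a section
	contains a non-generator, counting representations modulo a prime l, where the l-fold convolution
	is a Frobenius map, shows that T is a direct product with a nontrivial factor C - {0}; otherwise all
	subgroups are section groups, and the layers of prime index are made discrete by the base points,
	either by coset arguments or by an algebra of polynomials modulo a prime. The factors C yield trivial
	sections, which lie in normal ones: were such a section not discrete, translating two cosets
	against each other would give an automorphism that is not affine. *)
theory Submission
	imports Defs "HOL-Number_Theory.Cong" "HOL-Computational_Algebra.Polynomial"
begin

text \<open>The structure theory of circulant schemes is not presupposed. New unions of basic sets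
  are obtained as level sets of ring elements, also after reduction modulo a prime, so divisibility
  properties of representation numbers become statements about basic sets. The obstacle is that the
  basic set of a generator may contain non-generators, which no unit multiplier reaches.
  Principality is therefore stated for arbitrary basic sets, by a trivial radical and by not lying
  in a proper subgroup; this form passes to the factor of a product and holds for every basic set in
  the section between its span and its radical. The latter is what connects one non-discrete trivial
  section with all basic sets at once: the section is recorded as a prime filter on the lattice of
  section groups, and the filter is followed into the section of each basic set. It yields two fixed
  subgroups such that translation by the one keeps a difference in its basic set unless the result
  enters the other, which makes a coset exchange an automorphism. The prime 2 is treated apart,
  since representation numbers must be compared modulo 4 there.\<close>

hide_const (open) Divisibility.prime Congruence.partition

declare sum_of_bool_eq [simp del] sum_mult_of_bool_eq [simp del] sum_of_bool_mult_eq [simp del]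

section \<open>Periodic functions on the integers\<close>

lemma dvd_iff_diff: "(N::int) dvd a - b ==> N dvd a \<longleftrightarrow> N dvd b" by (metis diff_add_cancel dvd_add_right_iff)

definition per :: "int => (int => 'b) => bool" where
	"per N f \<longleftrightarrow> (\<forall>x. f (x + N) = f x)"

abbreviation rsum :: "int => (int => int) => int" where
	"rsum N f \<equiv> sum f {0..<N}"

definition conv :: "int => (int => int) => (int => int) => int => int" where
	"conv N f g z = rsum N (\<lambda>y. f y * g (z - y))"

definition delta :: "int => int => int" where
	"delta N z = of_bool (N dvd z)"

text \<open>The push-forward along multiplication by \<open>p\<close>, that is, the substitution of
  X^p for X in the group ring. It makes sense for every \<open>p\<close>; the case where
  \<open>p\<close> divides \<open>N\<close> carries the main arguments below.\<close>

definition frob :: "int => int => (int => int) => int => int" where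
	"frob N p f z = rsum N (\<lambda>x. of_bool (N dvd p * x - z) * f x)"

primrec convpow :: "int => (int => int) => nat => int => int" where
	"convpow N f 0 = delta N"
| "convpow N f (Suc n) = conv N f (convpow N f n)"

lemma per_mult_nat:
	assumes "per N f"
	shows "f (x + N * int k) = f x"
proof (induction k)
	case (Suc k)
	have "f (x + N * int (Suc k)) = f ((x + N * int k) + N)" by (simp add: algebra_simps)
	also have "... = f (x + N * int k)" using assms by (simp add: per_def)
	finally show ?case using Suc by simp
qed simp

lemma per_mult:
	assumes "per N f"
	shows "f (x + N * k) = f x"
proof (cases "k \<ge> 0")
	case True
	then show ?thesis using per_mult_nat[OF assms, of x "nat k"] by simp
next
	case False
	then show ?thesis using per_mult_nat[OF assms, of "x + N * k" "nat (- k)"] by (simp add: algebra_simps)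
qed

lemma per_cong: "per N f ==> N dvd x - y ==> f x = f y"
proof -
	assume f: "per N f" and "N dvd x - y"
	then obtain k where "x - y = N * k" by (auto elim: dvdE)
	then have "x = y + N * k" by simp
	with per_mult[OF f] show "f x = f y" by simp
qed

lemma perI: "(\<And>x y. N dvd x - y ==> f x = f y) ==> per N f" by (simp add: per_def)

lemma per_iff: "per N f \<longleftrightarrow> (\<forall>x y. N dvd x - y --> f x = f y)" by (meson perI per_cong)

lemma per_mod: "per N f ==> f (x mod N) = f x" by (rule per_cong) (auto simp: mod_eq_dvd_iff[symmetric])

lemma per_delta: "per N (delta N)" by (simp add: per_def delta_def)

lemma per_conv: "per N g ==> per N (conv N f g)"
proof (rule perI)
	fix x y assume g: "per N g" and "N dvd x - y"
	then have "g (x - t) = g (y - t)" for t by (intro per_cong[OF g]) simp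
	then show "conv N f g x = conv N f g y" by (simp add: conv_def)
qed

lemma per_frob: "per N (frob N p f)"
proof (rule perI)
	fix x y assume "N dvd x - y"
	then have "(N dvd c - x) = (N dvd c - y)" for c by (smt (verit, best) dvd_diff_commute dvd_add_right_iff)
	then show "frob N p f x = frob N p f y" by (simp add: frob_def)
qed

lemma per_convpow: "per N f ==> per N (convpow N f n)" by (induction n) (auto intro: per_delta per_conv)

section \<open>Sums over a period: change of variable, point evaluation, quotients and
  multiples\<close>

lemma rsum_reindex:
	assumes N: "N > 0" and f: "per N f" and g: "\<And>x y. N dvd g x - g y ==> N dvd x - y"
	shows "rsum N (\<lambda>x. f (g x)) = rsum N f"
proof -
	let ?h = "\<lambda>x. g x mod N"
	have inj: "inj_on ?h {0..<N}"
	proof (rule inj_onI)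
		fix x y assume "x \<in> {0..<N}" "y \<in> {0..<N}" "g x mod N = g y mod N"
		then have "N dvd x - y" using g by (simp add: mod_eq_dvd_iff)
		with \<open>x \<in> {0..<N}\<close> \<open>y \<in> {0..<N}\<close> show "x = y" by (metis atLeastLessThan_iff mod_eq_dvd_iff mod_pos_pos_trivial)
	qed
	have "?h ` {0..<N} \<subseteq> {0..<N}" using N by auto
	then have im: "?h ` {0..<N} = {0..<N}" using inj by (intro endo_inj_surj) auto
	have "rsum N (\<lambda>x. f (g x)) = sum (\<lambda>x. f (?h x)) {0..<N}" using per_mod[OF f] by simp
	also have "... = sum f (?h ` {0..<N})" using inj by (simp add: sum.reindex)
	finally show ?thesis using im by simp
qed

lemma rsum_shift: "N > 0 ==> per N f ==> rsum N (\<lambda>x. f (x + c)) = rsum N f" by (rule rsum_reindex) auto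

lemma rsum_unit: "N > 0 ==> per N f ==> coprime m N ==> rsum N (\<lambda>x. f (m * x)) = rsum N f" by (rule rsum_reindex)
		(auto simp: right_diff_distrib[symmetric] coprime_commute coprime_dvd_mult_right_iff)

lemma rsum_delta:
	assumes N: "N > 0" and f: "per N f"
	shows "rsum N (\<lambda>x. of_bool (N dvd x - z) * f x) = f z"
proof -
	have "N dvd x - z \<longleftrightarrow> x = z mod N" if "x \<in> {0..<N}" for x
		using that by (metis atLeastLessThan_iff mod_eq_dvd_iff mod_pos_pos_trivial mod_mod_trivial)
	then have "rsum N (\<lambda>x. of_bool (N dvd x - z) * f x) = sum (\<lambda>x. if x = z mod N then f x else 0) {0..<N}"
		by (intro sum.cong) auto
	also have "... = f (z mod N)" using N by simp
	finally show ?thesis using per_mod[OF f] by simp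
qed

lemma rsum_delta':
	assumes N: "N > 0" and f: "per N f"
	shows "rsum N (\<lambda>x. of_bool (N dvd z - x) * f x) = f z"
	using rsum_delta[OF assms, of z] by (simp add: dvd_diff_commute[of N z])

lemma rsum_periods:
	assumes v: "v > 0" and f: "per v f"
	shows "rsum (v * int k) f = int k * rsum v f"
proof (induction k)
	case (Suc k)
	have "{0..<v * int (Suc k)} = {0..<v * int k} \<union> (\<lambda>x. x + v * int k) ` {0..<v}"
		using v by (auto simp: algebra_simps image_iff intro: bexI[of _ "x - v * int k" for x])
			(smt (verit) mult_less_0_iff of_nat_less_0_iff zero_le_mult_iff)+
	moreover have "{0..<v * int k} \<inter> (\<lambda>x. x + v * int k) ` {0..<v} = {}" by auto
	ultimately have "rsum (v * int (Suc k)) f = rsum (v * int k) f + sum f ((\<lambda>x. x + v * int k) ` {0..<v})"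
		by (simp add: sum.union_disjoint)
	also have "sum f ((\<lambda>x. x + v * int k) ` {0..<v}) = rsum v f" by (subst sum.reindex) (auto simp: per_mult[OF f])
	finally show ?case using Suc by (simp add: algebra_simps)
qed simp

lemma rsum_quotient:
	assumes "0 < v" "0 < N" "v dvd N" and f: "per v f"
	shows "rsum N f = (N div v) * rsum v f"
proof -
	have "N = v * int (nat (N div v))" using assms by (simp add: pos_imp_zdiv_nonneg_iff)
	moreover have "int (nat (N div v)) = N div v" using assms by (simp add: pos_imp_zdiv_nonneg_iff)
	ultimately show ?thesis using rsum_periods[OF assms(1) f, of "nat (N div v)"] by simp
qed

lemma rsum_multiples:
	assumes "u > 0"
	shows "rsum (u * w) (\<lambda>y. of_bool (u dvd y) * f y) = rsum w (\<lambda>y. f (u * y))"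
proof -
	have "rsum (u * w) (\<lambda>y. of_bool (u dvd y) * f y) = sum f {y \<in> {0..<u * w}. u dvd y}"
		by (subst sum.inter_filter[OF finite_atLeastLessThan_int]) (auto intro!: sum.cong)
	also have "{y \<in> {0..<u * w}. u dvd y} = (\<lambda>y. u * y) ` {0..<w}" using assms by (auto elim!: dvdE simp: zero_le_mult_iff)
	also have "sum f ... = rsum w (\<lambda>y. f (u * y))" using assms by (subst sum.reindex) (auto intro: inj_onI)
	finally show ?thesis .
qed

subsection \<open>The group ring as a quotient of a polynomial ring\<close>

text \<open>The coefficients of \<open>P\<close> modulo X^N - 1, read as a periodic function. Every
  periodic function arises in this way and products become convolutions, so the laws of
  \<open>conv\<close> are inherited from polynomials.\<close>

definition ev :: "int => int poly => int => int" where
	"ev N P z = (\<Sum>i\<le>degree P. coeff P i * of_bool (N dvd z - int i))"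

lemma ev_bound:
	assumes "degree P \<le> n"
	shows "ev N P z = (\<Sum>i\<le>n. coeff P i * of_bool (N dvd z - int i))" unfolding ev_def
	by (rule sum.mono_neutral_left) (use assms in \<open>auto simp: coeff_eq_0\<close>)

lemma ev_0 [simp]: "ev N 0 z = 0" by (simp add: ev_def)

lemma ev_add: "ev N (P + Q) z = ev N P z + ev N Q z"
proof -
	let ?n = "max (degree P) (degree Q)"
	show ?thesis unfolding ev_bound[OF degree_add_le_max] ev_bound[OF max.cobounded1[of "degree P" "degree Q"]]
			ev_bound[OF max.cobounded2[of "degree Q" "degree P"]] by (simp add: sum.distrib distrib_right)
qed

lemma ev_smult: "ev N (smult c P) z = c * ev N P z"
	by (simp add: ev_bound[OF degree_smult_le] sum_distrib_left mult.assoc ev_def)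

lemma ev_monom: "ev N (monom c n) z = c * of_bool (N dvd z - int n)"
proof -
	have "ev N (monom c n) z = (\<Sum>i\<le>n. coeff (monom c n) i * of_bool (N dvd z - int i))"
		by (rule ev_bound) (rule degree_monom_le)
	also have "... = (\<Sum>i\<le>n. if i = n then c * of_bool (N dvd z - int n) else 0)" by (intro sum.cong) auto
	finally show ?thesis by simp
qed

lemma ev_sum: "ev N (\<Sum>i\<in>A. P i) z = (\<Sum>i\<in>A. ev N (P i) z)" by (induction A rule: infinite_finite_induct) (auto simp: ev_add)

lemma per_ev: "per N (ev N P)"
proof (rule perI)
	fix x y assume "N dvd x - y"
	then have "(N dvd x - c) = (N dvd y - c)" for c by (smt (verit, best) dvd_diff_commute dvd_add_right_iff)
	then show "ev N P x = ev N P y" by (simp add: ev_def)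
qed

lemma ev_1: "ev N 1 = delta N" using ev_monom[of N 1 0] by (auto simp: delta_def one_pCons[symmetric] monom_0)

lemma poly_monom_induct:
	assumes "\<And>a n. P (monom a n)" "\<And>p q. P p ==> P q ==> P (p + q)"
	shows "P p"
proof -
	have "P (\<Sum>i\<in>A. monom (coeff p i) i)" if "finite A" for A using that
	proof (induction A)
		case empty
		then show ?case using assms(1)[of 0 0] by simp
	qed (simp add: assms)
	from this[of "{..degree p}"] show ?thesis by (simp add: poly_as_sum_of_monoms)
qed

lemma ev_monom_mult: "ev N (monom c n * P) z = c * ev N P (z - int n)"
proof (induction P rule: poly_monom_induct)
	case (1 a m)
	show ?case by (simp add: mult_monom ev_monom diff_diff_eq add.commute)
next
	case (2 P Q)
	then show ?case by (simp add: ev_add distrib_left)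
qed

lemma ev_mult:
	assumes N: "N > 0"
	shows "ev N (P * Q) = conv N (ev N P) (ev N Q)"
proof
	fix z
	show "ev N (P * Q) z = conv N (ev N P) (ev N Q) z"
	proof (induction P rule: poly_monom_induct)
		case (1 a m)
		have "conv N (ev N (Polynomial.monom a m)) (ev N Q) z
				= a * rsum N (\<lambda>y. of_bool (N dvd y - int m) * ev N Q (z - y))"
			by (simp add: conv_def ev_monom sum_distrib_left mult.assoc)
		also have "per N (\<lambda>y. ev N Q (z - y))"
			using per_ev by (intro perI) (auto intro!: per_cong[OF per_ev] simp: dvd_diff_commute)
		then have "rsum N (\<lambda>y. of_bool (N dvd y - int m) * ev N Q (z - y)) = ev N Q (z - int m)" by (rule rsum_delta[OF N])
		finally show ?case by (simp add: ev_monom_mult)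
	next
		case (2 P R)
		then show ?case by (simp add: distrib_right ev_add conv_def sum.distrib)
	qed
qed

lemma ev_power:
	assumes N: "N > 0"
	shows "ev N (P ^ n) = convpow N (ev N P) n" by (induction n) (simp_all add: ev_1 ev_mult[OF N])

definition poly_of :: "int => (int => int) => int poly" where
	"poly_of N f = (\<Sum>x\<in>{0..<N}. monom (f x) (nat x))"

lemma ev_poly_of:
	assumes "N > 0" "per N f"
	shows "ev N (poly_of N f) = f"
proof
	fix z
	have "ev N (poly_of N f) z = rsum N (\<lambda>x. of_bool (N dvd z - x) * f x)"
		unfolding poly_of_def ev_sum by (intro sum.cong) (auto simp: ev_monom)
	then show "ev N (poly_of N f) z = f z" using rsum_delta'[OF assms] by simp
qed

lemma conv_commute: "N > 0 ==> per N f ==> per N g ==> conv N f g = conv N g f"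
	using ev_mult[of N "poly_of N f" "poly_of N g"] ev_mult[of N "poly_of N g" "poly_of N f"]
	by (simp add: ev_poly_of mult.commute)

lemma conv_assoc:
	"N > 0 ==> per N f ==> per N g ==> per N h ==> conv N (conv N f g) h = conv N f (conv N g h)"
	using ev_mult[of N "poly_of N f * poly_of N g" "poly_of N h"]
		ev_mult[of N "poly_of N f" "poly_of N g * poly_of N h"] by (simp only: ev_mult ev_poly_of mult.assoc)

lemma convpow_add:
	"N > 0 ==> per N f ==> conv N (convpow N f m) (convpow N f n) = convpow N f (m + n)"
	using ev_mult[of N "poly_of N f ^ m" "poly_of N f ^ n"] ev_power[of N "poly_of N f"]
	by (simp add: ev_poly_of power_add[symmetric])

lemma convpow_mult:
	"N > 0 ==> per N f ==> convpow N (convpow N f m) n = convpow N f (m * n)"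
	using ev_power[of N "poly_of N f ^ m" n] ev_power[of N "poly_of N f"] by (simp add: ev_poly_of power_mult[symmetric])

section \<open>Convolution powers modulo a prime\<close>

lemma conv_cong:
	assumes "\<And>z. [f z = f' z] (mod m)" "\<And>z. [g z = g' z] (mod m)"
	shows "[conv N f g z = conv N f' g' z] (mod m)" unfolding conv_def by (intro cong_sum cong_mult assms)

text \<open>All binomial coefficients except the two outer ones are divisible by the prime.\<close>

lemma dvd_prime_power_add:
	fixes a b :: "'a::comm_ring_1"
	assumes "prime p"
	shows "of_nat p dvd (a + b) ^ p - a ^ p - b ^ p"
proof -
	have p: "p > 0" using assms by (simp add: prime_gt_0_nat)
	let ?t = "\<lambda>k. of_nat (p choose k) * a ^ k * b ^ (p - k)"
	have "{..p} = insert 0 (insert p {0<..<p})" using p by auto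
	then have "(a + b) ^ p = b ^ p + a ^ p + sum ?t {0<..<p}" unfolding binomial_ring using p by (simp add: algebra_simps)
	moreover have "of_nat p dvd sum ?t {0<..<p}"
	proof (rule dvd_sum)
		fix k assume "k \<in> {0<..<p}"
		then have "p dvd p choose k" using assms by (intro dvd_choose_prime) auto
		then show "of_nat p dvd ?t k" by (auto elim!: dvdE)
	qed
	ultimately show ?thesis by (simp add: algebra_simps)
qed

lemma dvd_prime_power_sum:
	fixes f :: "'b => 'a::comm_ring_1"
	assumes "prime p" "finite A"
	shows "of_nat p dvd (\<Sum>x\<in>A. f x) ^ p - (\<Sum>x\<in>A. f x ^ p)" using assms(2)
proof (induction A)
	case empty
	then show ?case using prime_gt_0_nat[OF assms(1)] by (simp add: power_0_left)
next
	case (insert x A)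
	have "of_nat p dvd (f x + sum f A) ^ p - f x ^ p - sum f A ^ p" by (rule dvd_prime_power_add) fact
	from dvd_add[OF this insert.IH] show ?case using insert by (simp add: algebra_simps)
qed

lemma dvd_prime_power_nat: "prime p ==> int p dvd int a ^ p - int a"
proof (induction a)
	case (Suc a)
	have "int p dvd (int a + 1) ^ p - int a ^ p - 1 ^ p" using dvd_prime_power_add[OF Suc.prems, of "int a" 1] by simp
	from dvd_add[OF this Suc.IH[OF Suc.prems]] show ?case by (simp add: algebra_simps)
next
	case 0
	then show ?case using prime_gt_0_nat[of p] by (simp add: power_0_left)
qed

lemma fermat_cong:
	fixes a :: int
	assumes "prime p"
	shows "[a ^ p = a] (mod int p)"
proof -
	have p: "int p > 0" using assms by (simp add: prime_gt_0_nat)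
	let ?b = "nat (a mod int p)"
	have "[a = int ?b] (mod int p)" using p by (simp add: cong_def)
	moreover from this have "[a ^ p = int ?b ^ p] (mod int p)" by (rule cong_pow)
	moreover have "[int ?b ^ p = int ?b] (mod int p)" unfolding cong_iff_dvd_diff by (rule dvd_prime_power_nat) fact
	ultimately show ?thesis by (meson cong_sym cong_trans)
qed

text \<open>The polynomial of \<open>f\<close> is a sum of monomials, and modulo \<open>p\<close>
  the \<open>p\<close>-th power may be taken monomial by monomial. This multiplies the exponents by
  \<open>p\<close>, and Fermat's theorem restores the coefficients.\<close>

lemma convpow_prime:
	assumes N: "N > 0" and f: "per N f" and p: "prime p"
	shows "[convpow N f p z = frob N (int p) f z] (mod int p)"
proof -
	let ?P = "\<lambda>x. monom (f x) (nat x)"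
	have "of_nat p dvd poly_of N f ^ p - (\<Sum>x\<in>{0..<N}. ?P x ^ p)"
		unfolding poly_of_def using p by (intro dvd_prime_power_sum) auto
	then obtain Q where "poly_of N f ^ p - (\<Sum>x\<in>{0..<N}. ?P x ^ p) = of_nat p * Q" by (auto elim: dvdE)
	then have "poly_of N f ^ p = (\<Sum>x\<in>{0..<N}. ?P x ^ p) + smult (int p) Q" by (simp add: of_nat_poly algebra_simps)
	then have "convpow N f p z = (\<Sum>x\<in>{0..<N}. ev N (?P x ^ p) z) + int p * ev N Q z"
		by (metis (no_types) ev_power[OF N] ev_poly_of[OF N f] ev_add ev_sum ev_smult)
	then have "[convpow N f p z = (\<Sum>x\<in>{0..<N}. ev N (?P x ^ p) z)] (mod int p)" by (simp add: cong_def)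
	also have "[(\<Sum>x\<in>{0..<N}. ev N (?P x ^ p) z) = frob N (int p) f z] (mod int p)" unfolding frob_def
	proof (rule cong_sum)
		fix x assume "x \<in> {0..<N}"
		then have "ev N (?P x ^ p) z = of_bool (N dvd int p * x - z) * f x ^ p"
			by (simp add: monom_power ev_monom dvd_diff_commute[of N z] mult.commute)
		moreover have "[of_bool (N dvd int p * x - z) * f x ^ p = of_bool (N dvd int p * x - z) * f x] (mod int p)"
			using fermat_cong[OF p] by (intro cong_mult) auto
		ultimately show "[ev N (?P x ^ p) z = of_bool (N dvd int p * x - z) * f x] (mod int p)" by simp
	qed
	finally show ?thesis .
qed

lemma frob_frob:
	assumes N: "N > 0"
	shows "frob N p (frob N q f) = frob N (p * q) f"
proof
	fix z
	have "frob N p (frob N q f) z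
			= rsum N (\<lambda>x. rsum N (\<lambda>y. of_bool (N dvd p * x - z) * of_bool (N dvd q * y - x) * f y))"
		by (simp add: frob_def sum_distrib_left mult.assoc)
	also have "... = rsum N (\<lambda>y. rsum N (\<lambda>x. of_bool (N dvd q * y - x) * of_bool (N dvd p * x - z)) * f y)"
		by (subst sum.swap) (simp add: sum_distrib_right sum_distrib_left ac_simps)
	also have "... = rsum N (\<lambda>y. of_bool (N dvd p * (q * y) - z) * f y)"
	proof (intro sum.cong refl arg_cong2[where f="(*)"])
		fix y
		have "per N (\<lambda>x. of_bool (N dvd p * x - z) :: int)"
		proof (rule perI)
			fix x y assume "N dvd x - y"
			then have "N dvd (p * x - z) - (p * y - z)" by (simp add: right_diff_distrib[symmetric])
			then show "of_bool (N dvd p * x - z) = (of_bool (N dvd p * y - z) :: int)" by (simp only: dvd_iff_diff)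
		qed
		from rsum_delta'[OF N this]
		show "rsum N (\<lambda>x. of_bool (N dvd q * y - x) * of_bool (N dvd p * x - z)) = (of_bool (N dvd p * (q * y) - z) :: int)" .
	qed
	finally show "frob N p (frob N q f) z = frob N (p * q) f z" by (simp add: frob_def mult.assoc)
qed

lemma frob_1: "N > 0 ==> per N f ==> frob N 1 f = f" by (auto simp: frob_def rsum_delta)

lemma frob_cong:
	assumes "\<And>z. [f z = f' z] (mod m)"
	shows "[frob N p f z = frob N p f' z] (mod m)" unfolding frob_def by (intro cong_sum cong_mult assms) simp

lemma convpow_prime_pow:
	assumes N: "N > 0" and f: "per N f" and p: "prime p"
	shows "[convpow N f (p ^ k) z = frob N (int p ^ k) f z] (mod int p)"
proof (induction k arbitrary: z)
	case 0
	have "convpow N f 1 = f" using ev_power[OF N, of "poly_of N f" 1] by (simp add: ev_poly_of[OF N f])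
	then show ?case by (simp add: frob_1[OF N f])
next
	case (Suc k)
	have "convpow N f (p ^ Suc k) = convpow N (convpow N f (p ^ k)) p" by (simp add: convpow_mult[OF N f] mult.commute)
	moreover have "[convpow N (convpow N f (p ^ k)) p z = frob N (int p) (convpow N f (p ^ k)) z] (mod int p)"
		by (intro convpow_prime N per_convpow f p)
	moreover have "[frob N (int p) (convpow N f (p ^ k)) z = frob N (int p) (frob N (int p ^ k) f) z] (mod int p)"
		by (intro frob_cong Suc.IH)
	ultimately show ?case by (simp add: frob_frob[OF N]) (meson cong_trans)
qed

text \<open>For invertible \<open>p\<close> the push-forward has one-point fibres and becomes
  substitution of the inverse multiplier.\<close>

lemma frob_unit:
	assumes N: "N > 0" and f: "per N f" and m: "[m * p = 1] (mod N)"
	shows "frob N p f z = f (m * z)"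
proof -
	have d: "N dvd m * p - 1" using m by (simp add: cong_iff_dvd_diff)
	have "N dvd p * x - z \<longleftrightarrow> N dvd x - m * z" for x
	proof
		assume "N dvd p * x - z"
		then have "N dvd m * (p * x - z) - (m * p - 1) * x" by (rule dvd_diff[OF dvd_mult dvd_mult2[OF d]])
		then show "N dvd x - m * z" by (simp add: algebra_simps)
	next
		assume "N dvd x - m * z"
		then have "N dvd p * (x - m * z) + (m * p - 1) * z" by (rule dvd_add[OF dvd_mult dvd_mult2[OF d]])
		then show "N dvd p * x - z" by (simp add: algebra_simps)
	qed
	then show ?thesis by (simp add: frob_def rsum_delta[OF N f])
qed

section \<open>Schur rings over the integers modulo N\<close>

text \<open>The Schur ring is represented by the set of integer-valued \<open>N\<close>-periodic functions that are
	constant on its basic sets; closure under all pointwise binary operations replaces the linear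
	structure.\<close>

locale sring =
	fixes N :: int and I :: "(int => int) set"
	assumes N_pos: "N > 0"
		and I_per: "f \<in> I ==> per N f"
		and I_map2: "f \<in> I ==> g \<in> I ==> (\<lambda>x. h (f x) (g x)) \<in> I"
		and I_refl: "f \<in> I ==> (\<lambda>x. f (- x)) \<in> I"
		and I_conv: "f \<in> I ==> g \<in> I ==> conv N f g \<in> I"
		and I_delta: "delta N \<in> I"
begin

definition aset :: "int set => bool" where
	"aset A \<longleftrightarrow> (\<lambda>x. of_bool (x \<in> A)) \<in> I"

text \<open>The class of points that no element of \<open>I\<close> separates from \<open>t\<close>.
  That the indicator of this class is again in the ring is \<open>aset_bs\<close>.\<close>

definition bs :: "int => int set" where
	"bs t = {z. \<forall>f\<in>I. f z = f t}"

definition agrp :: "int => bool" where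
	"agrp d \<longleftrightarrow> d > 0 \<and> d dvd N \<and> aset {x. d dvd x}"

definition msum :: "int set => int set => int set" where
	"msum A B = {z. \<exists>x\<in>A. z - x \<in> B}"

text \<open>The stabiliser under translation. One inclusion suffices for members of the ring, which
  are finite sets of residues; \<open>rad_add\<close> gives the equivalence.\<close>

definition rad :: "int set => int set" where
	"rad A = {e. \<forall>x\<in>A. x - e \<in> A}"

lemma I_map: "f \<in> I ==> (\<lambda>x. h (f x)) \<in> I" using I_map2[of f f "\<lambda>a b. h a"] by simp

lemma I_const: "(\<lambda>x. c) \<in> I" using I_map[OF I_delta, of "\<lambda>_. c"] by simp

lemma I_congD: "f \<in> I ==> N dvd x - y ==> f x = f y" using I_per per_cong by blast

lemma I_sum: "(\<And>i. i \<in> A ==> f i \<in> I) ==> (\<lambda>x. \<Sum>i\<in>A. f i x) \<in> I"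
proof (induction A rule: infinite_finite_induct)
	case (insert i A)
	then show ?case using I_map2[of "f i" "\<lambda>x. \<Sum>i\<in>A. f i x" "(+)"] by simp
qed (auto simp: I_const)

lemma aset_level: "f \<in> I ==> aset {x. P (f x)}" unfolding aset_def using I_map[of f "\<lambda>a. of_bool (P a)"] by simp

lemma aset_comb: "aset A ==> aset B ==> aset {x. P (x \<in> A) (x \<in> B)}"
	unfolding aset_def using I_map2[of _ _ "\<lambda>a b. of_bool (P (a = 1) (b = 1))"] by fastforce

lemma aset_Int: "aset A ==> aset B ==> aset (A \<inter> B)" using aset_comb[of A B "(\<and>)"] by (simp add: Int_def)

lemma aset_Un: "aset A ==> aset B ==> aset (A \<union> B)" using aset_comb[of A B "(\<or>)"] by (simp add: Un_def)

lemma aset_Diff: "aset A ==> aset B ==> aset (A - B)" using aset_comb[of A B "\<lambda>a b. a \<and> \<not> b"] by (simp add: set_diff_eq)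

lemma aset_Compl: "aset A ==> aset (- A)" using aset_comb[of A A "\<lambda>a b. \<not> a"] by (simp add: Compl_eq)

lemma aset_UNIV: "aset UNIV" using I_const[of 1] by (simp add: aset_def)

lemma aset_N: "aset {x. N dvd x}" using I_delta by (simp add: aset_def delta_def[abs_def])

lemma aset_cong: "aset A ==> N dvd x - y ==> x \<in> A \<longleftrightarrow> y \<in> A" unfolding aset_def using I_congD by fastforce

lemma aset_mod: "aset A ==> x mod N \<in> A \<longleftrightarrow> x \<in> A" by (rule aset_cong) (auto simp: mod_eq_dvd_iff[symmetric])

lemma bs_refl: "t \<in> bs t" by (simp add: bs_def)

lemma bs_eq: "z \<in> bs t ==> bs z = bs t" by (auto simp: bs_def)

lemma bs_sym: "z \<in> bs t \<longleftrightarrow> t \<in> bs z" by (auto simp: bs_def)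

lemma I_bs: "f \<in> I ==> z \<in> bs t ==> f z = f t" by (auto simp: bs_def)

lemma bs_cong: "N dvd x - y ==> x \<in> bs y" by (auto simp: bs_def intro: I_congD)

lemma bs_sub: "aset A ==> t \<in> A ==> bs t \<subseteq> A" unfolding aset_def bs_def by auto

lemma aset_bs_iff: "aset A ==> z \<in> bs t ==> z \<in> A \<longleftrightarrow> t \<in> A" by (meson bs_sub bs_sym subsetD)

lemma aset_finite_INT:
	assumes "finite K" "\<And>k. k \<in> K ==> aset (A k)"
	shows "aset (\<Inter>k\<in>K. A k)" using assms by (induction K) (auto intro: aset_UNIV aset_Int)

lemma aset_finite_UN:
	assumes "finite K" "\<And>k. k \<in> K ==> aset (A k)"
	shows "aset (\<Union>k\<in>K. A k)"
proof -
	have "aset (- (\<Inter>k\<in>K. - A k))" using assms by (intro aset_Compl aset_finite_INT)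
	then show ?thesis by simp
qed

text \<open>Each of the finitely many residues outside \<open>bs t\<close> is separated from
  \<open>t\<close> by some element of \<open>I\<close>; the common level set of these elements
  through \<open>t\<close> is \<open>bs t\<close>.\<close>

lemma aset_bs: "aset (bs t)"
proof -
	let ?K = "{0..<N} - bs t"
	have "\<forall>x\<in>?K. \<exists>f\<in>I. f x ~= f t" by (auto simp: bs_def)
	then obtain F where F: "\<And>x. x \<in> ?K ==> F x \<in> I \<and> F x x ~= F x t" by metis
	have "bs t = (\<Inter>x\<in>?K. {z. F x z = F x t})"
	proof (intro subset_antisym subsetI)
		fix z assume z: "z \<in> (\<Inter>x\<in>?K. {z. F x z = F x t})"
		have "z mod N \<in> bs z" by (intro bs_cong) (auto simp: mod_eq_dvd_iff[symmetric])
		have "z mod N \<in> bs t"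
		proof (rule ccontr)
			assume "z mod N \<notin> bs t"
			with N_pos have K: "z mod N \<in> ?K" by simp
			with z have "F (z mod N) z = F (z mod N) t" by auto
			moreover have "F (z mod N) (z mod N) = F (z mod N) z" using F[OF K] I_bs[OF _ \<open>z mod N \<in> bs z\<close>] by blast
			ultimately show False using F[OF K] by simp
		qed
		then have "bs (z mod N) = bs t" by (rule bs_eq)
		then show "z \<in> bs t" using \<open>z mod N \<in> bs z\<close> bs_sym[of "z mod N" z] by simp
	qed (use F I_bs in auto)
	also have "aset ..." using F by (intro aset_finite_INT aset_level[where P="\<lambda>a. a = _"]) auto
	finally show ?thesis .
qed

lemma aset_iff: "aset A \<longleftrightarrow> (\<forall>t\<in>A. bs t \<subseteq> A)"
proof
	assume A: "\<forall>t\<in>A. bs t \<subseteq> A"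
	have "A = (\<Union>t\<in>A \<inter> {0..<N}. bs t)"
	proof (intro subset_antisym subsetI)
		fix z assume "z \<in> A"
		have m: "z mod N \<in> bs z" by (intro bs_cong) (auto simp: mod_eq_dvd_iff[symmetric])
		then have "z mod N \<in> A \<inter> {0..<N}" using A N_pos \<open>z \<in> A\<close> by auto
		then show "z \<in> (\<Union>t\<in>A \<inter> {0..<N}. bs t)" using m bs_sym by blast
	qed (use A in auto)
	also have "aset ..." by (intro aset_finite_UN aset_bs) auto
	finally show "aset A" .
qed (use bs_sub in auto)

lemma aset_UN: "(\<And>k. k \<in> K ==> aset (A k)) ==> aset (\<Union>k\<in>K. A k)" unfolding aset_iff by blast

text \<open>A function constant on basic sets takes finitely many values and is a combination of the
  indicators of its level sets, which are unions of basic sets.\<close>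

lemma I_iff: "f \<in> I \<longleftrightarrow> (\<forall>t. \<forall>z\<in>bs t. f z = f t)"
proof
	assume f: "\<forall>t. \<forall>z\<in>bs t. f z = f t"
	have a: "aset {x. f x = c}" for c unfolding aset_iff using f by auto
	have "f x = (\<Sum>c\<in>f ` {0..<N}. c * of_bool (x \<in> {x. f x = c}))" for x
	proof -
		have "f (x mod N) = f x"
		proof -
			have "x mod N \<in> bs x" by (intro bs_cong) (auto simp: mod_eq_dvd_iff[symmetric])
			then show ?thesis using f by blast
		qed
		then have "f x \<in> f ` {0..<N}" using N_pos by (intro image_eqI[of _ _ "x mod N"]) auto
		then have "(\<Sum>c\<in>f ` {0..<N}. c * of_bool (x \<in> {x. f x = c})) = (\<Sum>c\<in>{f x}. c * of_bool (x \<in> {x. f x = c}))"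
			by (intro sum.mono_neutral_right) auto
		then show ?thesis by simp
	qed
	then have "f = (\<lambda>x. \<Sum>c\<in>f ` {0..<N}. c * of_bool (x \<in> {x. f x = c}))" by blast
	also have "... \<in> I" using I_map[OF a[unfolded aset_def], of "\<lambda>b. _ * b"] by (intro I_sum)
	finally show "f \<in> I" .
qed (auto simp: I_bs)

lemma aset_neg: "aset A ==> aset {x. - x \<in> A}" unfolding aset_def using I_refl by fastforce

text \<open>The sumset is the set where the convolution of the two indicators is positive.\<close>

lemma aset_msum:
	assumes "aset A" "aset B"
	shows "aset (msum A B)"
proof -
	let ?f = "\<lambda>C x. of_bool (x \<in> C) :: int"
	have "conv N (?f A) (?f B) z > 0 \<longleftrightarrow> z \<in> msum A B" for z
	proof
		assume "conv N (?f A) (?f B) z > 0"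
		then have "\<exists>x\<in>{0..<N}. ?f A x * ?f B (z - x) ~= 0"
			unfolding conv_def by (metis (no_types, lifting) less_irrefl sum.neutral)
		then show "z \<in> msum A B" by (auto simp: msum_def)
	next
		assume "z \<in> msum A B"
		then obtain x where x: "x \<in> A" "z - x \<in> B" by (auto simp: msum_def)
		then have "x mod N \<in> A" using assms aset_mod by blast
		have "N dvd (z - x mod N) - (z - x)" by (simp add: mod_eq_dvd_iff[symmetric])
		then have "z - x mod N \<in> B" using x assms aset_cong by blast
		have "0 < ?f A (x mod N) * ?f B (z - x mod N)" using \<open>x mod N \<in> A\<close> \<open>z - x mod N \<in> B\<close> by simp
		then show "conv N (?f A) (?f B) z > 0" unfolding conv_def using N_pos by (intro sum_pos2[of _ "x mod N"]) auto
	qed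
	moreover have "conv N (?f A) (?f B) \<in> I" using assms by (auto simp: aset_def intro: I_conv)
	ultimately show ?thesis using aset_level[of _ "\<lambda>a. a > 0"] by fastforce
qed

lemma aset_rad: "aset A ==> aset (rad A)"
proof -
	assume A: "aset A"
	\<comment> \<open>A shift \<open>e\<close> fails exactly when it is the sum of some
	  \<open>x\<close> in \<open>A\<close> and \<open>e - x\<close>, where \<open>x - e\<close> lies
	  outside \<open>A\<close>.\<close>
	have "rad A = - msum A {x. - x \<in> - A}" unfolding rad_def msum_def by auto
	then show ?thesis using A by (simp only:) (intro aset_Compl aset_msum aset_neg)
qed

text \<open>Closure under addition is enough: \<open>- x\<close> is \<open>(N - 1) * x\<close>
  modulo \<open>N\<close>, and the least positive element generates by division with
  remainder.\<close>

lemma subgroup_dvd: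
	assumes M: "aset M" "0 \<in> M" "\<And>x y. x \<in> M ==> y \<in> M ==> x + y \<in> M"
	obtains d where "agrp d" "M = {x. d dvd x}"
proof -
	have mult: "x * int k \<in> M" if "x \<in> M" for x k
	proof (induction k)
		case (Suc k)
		then show ?case using M(3)[OF that Suc] by (simp add: algebra_simps)
	qed (use M in simp)
	have neg: "- x \<in> M" if "x \<in> M" for x
	proof -
		have "x * int (nat (N - 1)) \<in> M" by (rule mult) fact
		moreover have "N dvd x * int (nat (N - 1)) - (- x)" using N_pos by (simp add: algebra_simps)
		ultimately show ?thesis using aset_cong M(1) by blast
	qed
	have NM: "N \<in> M" using aset_cong[OF M(1), of N 0] M(2) by simp
	define n where "n = (LEAST n. n > 0 \<and> int n \<in> M)"
	have "nat N > 0 \<and> int (nat N) \<in> M" using N_pos NM by simp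
	then have n: "n > 0" "int n \<in> M" unfolding n_def by (metis (mono_tags, lifting) LeastI)+
	have least: "n \<le> m" if "m > 0" "int m \<in> M" for m unfolding n_def using that by (intro Least_le) auto
	have all: "x * k \<in> M" if "x \<in> M" for x k
		using mult[OF that, of "nat k"] neg[OF mult[OF that, of "nat (- k)"]] by (cases "k \<ge> 0") auto
	have eq: "M = {x. int n dvd x}"
	proof (intro subset_antisym subsetI)
		fix x assume "x \<in> M"
		have "x + int n * (- (x div int n)) \<in> M" by (intro M(3) all n \<open>x \<in> M\<close>)
		moreover have "x + int n * (- (x div int n)) = x mod int n" by (simp add: minus_mult_div_eq_mod)
		moreover have "x mod int n = int (nat (x mod int n))" using n by simp
		ultimately have "int (nat (x mod int n)) \<in> M" by simp
		moreover have "nat (x mod int n) < n" using n by (simp add: nat_less_iff)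
		ultimately have "nat (x mod int n) = 0" using least[of "nat (x mod int n)"] by linarith
		then have "x mod int n = 0" using n pos_mod_sign[of "int n" x] by linarith
		then show "x \<in> {x. int n dvd x}" by auto
	qed (use all n in \<open>auto elim!: dvdE\<close>)
	have "agrp (int n)" unfolding agrp_def using n NM eq M(1) by auto
	then show thesis using eq that by blast
qed

section \<open>Subgroups as divisors: intersection is lcm, sum is gcd\<close>

lemma agrp_N: "agrp N" using N_pos aset_N by (simp add: agrp_def)

lemma agrp_1: "agrp 1" using aset_UNIV by (simp add: agrp_def)

lemma agrp_aset: "agrp d ==> aset {x. d dvd x}" by (simp add: agrp_def)

lemma agrp_lcm: "agrp a ==> agrp b ==> agrp (lcm a b)" using aset_Int[of "{x. a dvd x}" "{x. b dvd x}"]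
	by (auto simp: agrp_def lcm_pos_int lcm_least Collect_conj_eq[symmetric] lcm_least_iff)

lemma agrp_gcd:
	assumes "agrp a" "agrp b"
	shows "agrp (gcd a b)"
proof -
	have "{x. gcd a b dvd x} = msum {x. a dvd x} {x. b dvd x}"
	proof (intro subset_antisym subsetI)
		fix x assume "x \<in> {x. gcd a b dvd x}"
		then obtain k where k: "x = gcd a b * k" by auto
		obtain u w where "u * a + w * b = gcd a b" using bezout_int by blast
		with k have "x = (u * a + w * b) * k" by simp
		then have "x - k * u * a = b * (k * w)" by (simp add: algebra_simps)
		then show "x \<in> msum {x. a dvd x} {x. b dvd x}" by (auto simp: msum_def intro!: exI[of _ "k * u * a"])
	next
		fix x assume "x \<in> msum {x. a dvd x} {x. b dvd x}"
		then obtain y where "a dvd y" "b dvd x - y" by (auto simp: msum_def)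
		then have "gcd a b dvd y" "gcd a b dvd x - y" by (meson dvd_trans gcd_dvd1 gcd_dvd2)+
		then show "x \<in> {x. gcd a b dvd x}" using dvd_add[of "gcd a b" y "x - y"] by simp
	qed
	then show ?thesis using assms aset_msum[of "{x. a dvd x}" "{x. b dvd x}"]
		by (auto simp: agrp_def intro: dvd_trans[OF gcd_dvd1])
qed

text \<open>The subgroup generated by \<open>A\<close> is the union of the iterated sumsets of
  \<open>A\<close>, each of which belongs to the ring. The conclusions characterize \<open>d\<close>
  as the greatest common divisor of \<open>N\<close> and the elements of \<open>A\<close>.\<close>

lemma gen_agrp:
	assumes A: "aset A"
	obtains d where "agrp d" "\<And>x. x \<in> A ==> d dvd x" "\<And>e. e dvd N ==> (\<And>x. x \<in> A ==> e dvd x) ==> e dvd d"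
proof -
	define S where "S = (\<lambda>n. ((\<lambda>B. msum A B) ^^ n) {x. N dvd x})"
	have S: "aset (S n)" for n by (induction n) (auto simp: S_def aset_N aset_msum[OF A])
	define M where "M = (\<Union>n. S n)"
	have "aset M" unfolding M_def using S by (rule aset_UN)
	have 0: "0 \<in> M" unfolding M_def S_def by (auto intro!: exI[of _ 0])
	have add: "x + y \<in> S (m + n)" if "x \<in> S m" "y \<in> S n" for x y m n using that(1)
	proof (induction m arbitrary: x)
		case 0
		then have "N dvd (x + y) - y" by (simp add: S_def)
		then show ?case using that(2) aset_cong[OF S] by (metis add_0)
	next
		case (Suc m)
		then obtain a where "a \<in> A" "x - a \<in> S m" by (auto simp: S_def msum_def)
		then have "x - a + y \<in> S (m + n)" using Suc.IH by blast
		then have "x + y - a \<in> S (m + n)" by (simp add: algebra_simps)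
		then show ?case using \<open>a \<in> A\<close> by (auto simp: S_def msum_def)
	qed
	have "x + y \<in> M" if "x \<in> M" "y \<in> M" for x y using that add unfolding M_def by blast
	then obtain d where d: "agrp d" "M = {x. d dvd x}" using subgroup_dvd \<open>aset M\<close> 0 by metis
	show thesis
	proof
		show "agrp d" by fact
		fix x assume "x \<in> A"
		then have "x \<in> S 1" by (auto simp: S_def msum_def intro!: bexI[of _ x])
		then show "d dvd x" using d by (auto simp: M_def)
	next
		fix e assume e: "e dvd N" "\<And>x. x \<in> A ==> e dvd x"
		have "e dvd x" if "x \<in> S n" for x n using that
		proof (induction n arbitrary: x)
			case 0
			then show ?case using e dvd_trans by (auto simp: S_def)
		next
			case (Suc n)
			then obtain a where "a \<in> A" "x - a \<in> S n" by (auto simp: S_def msum_def)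
			then have "e dvd a" "e dvd x - a" using e Suc.IH by auto
			then show ?case using dvd_add by fastforce
		qed
		moreover have "d \<in> M" using d by simp
		ultimately show "e dvd d" by (auto simp: M_def)
	qed
qed

lemma rad_agrp:
	assumes "aset A"
	obtains d where "agrp d" "rad A = {x. d dvd x}"
proof (rule subgroup_dvd[OF aset_rad[OF assms]])
	show "0 \<in> rad A" by (simp add: rad_def)
	show "x + y \<in> rad A" if "x \<in> rad A" "y \<in> rad A" for x y using that by (auto simp: rad_def) (metis diff_diff_eq)
qed

lemma rad_add: "e \<in> rad A ==> aset A ==> x + e \<in> A \<longleftrightarrow> x \<in> A"
proof -
	assume e: "e \<in> rad A" and A: "aset A"
	obtain d where d: "rad A = {x. d dvd x}" using rad_agrp A by blast
	then have "- e \<in> rad A" using e by simp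
	show ?thesis
	proof
		assume "x \<in> A"
		then show "x + e \<in> A" using \<open>- e \<in> rad A\<close> by (force simp: rad_def)
	next
		assume "x + e \<in> A"
		then show "x \<in> A" using e by (force simp: rad_def)
	qed
qed

subsection \<open>Multipliers\<close>

text \<open>Modulo the prime, the \<open>p ^ k\<close>-fold convolution, which is in the ring, turns
  into a push-forward. The prime may divide \<open>N\<close>.\<close>

lemma I_frob:
	assumes "prime p" "f \<in> I"
	shows "(\<lambda>z. frob N (int p ^ k) f z mod int p) \<in> I"
proof -
	have "convpow N f n \<in> I" for n by (induction n) (auto simp: I_delta I_conv assms)
	then have "(\<lambda>z. convpow N f (p ^ k) z mod int p) \<in> I" by (rule I_map)
	moreover have "convpow N f (p ^ k) z mod int p = frob N (int p ^ k) f z mod int p" for z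
		using convpow_prime_pow[OF N_pos I_per[OF assms(2)] assms(1)] by (simp add: cong_def)
	ultimately show ?thesis by simp
qed

text \<open>The values of this push-forward are 0 and 1, so reducing them modulo \<open>p\<close>
  loses nothing.\<close>

lemma aset_prime_div:
	assumes p: "prime p" "coprime (int p) N" and m: "[m * int p = 1] (mod N)" and A: "aset A"
	shows "aset {x. m * x \<in> A}"
proof -
	let ?f = "\<lambda>x. of_bool (x \<in> A) :: int"
	have f: "?f \<in> I" using A by (simp add: aset_def)
	have "(\<lambda>z. frob N (int p ^ 1) ?f z mod int p) = (\<lambda>z. of_bool (m * z \<in> A))"
		using frob_unit[OF N_pos I_per[OF f] m] prime_gt_1_nat[OF p(1)] by (auto simp: fun_eq_iff)
	then show ?thesis using I_frob[OF p(1) f, of 1] by (simp add: aset_def)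
qed

text \<open>Schur's theorem on multipliers, one prime factor at a time. It is stated for division;
  \<open>bs_mult\<close> recovers multiplication by dividing with the inverse multiplier.\<close>

lemma bs_div_nat:
	assumes "m > 0" "coprime (int m) N" "m * x \<in> bs (m * t)"
	shows "x \<in> bs t" using assms
proof (induction m arbitrary: x t rule: prime_divisors_induct)
	case (factor p m)
	have cop: "coprime (int p) N" "coprime (int m) N" and "m > 0" using factor.prems by auto
	obtain i where i: "[i * int p = 1] (mod N)" using cop(1) by (metis cong_solve_coprime_int mult.commute)
	have "aset {y. i * y \<in> bs (m * t)}" by (rule aset_prime_div[OF factor.hyps(1) cop(1) i aset_bs])
	moreover have "[i * (int (p * m) * c) = int m * c] (mod N)" for c
		using cong_mult[OF i cong_refl[of "int m * c"]] by (simp add: ac_simps)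
	then have e: "N dvd i * (int (p * m) * c) - int m * c" for c by (simp add: cong_iff_dvd_diff)
	have "int (p * m) * t \<in> {y. i * y \<in> bs (m * t)}" using bs_cong[OF e[of t]] by simp
	ultimately have "i * (int (p * m) * x) \<in> bs (m * t)" using factor.prems(3) bs_sub by blast
	then have "int m * x \<in> bs (m * t)" using aset_cong[OF aset_bs e[of x]] by blast
	then show ?case using factor.IH[OF \<open>m > 0\<close> cop(2)] by simp
qed (auto simp: coprime_iff_invertible_int)

lemma bs_mult:
	assumes "coprime m N"
	shows "m * x \<in> bs (m * t) \<longleftrightarrow> x \<in> bs t"
proof -
	obtain i where i: "[m * i = 1] (mod N)" using assms cong_solve_coprime_int by blast
	have div: "x \<in> bs t" if c: "coprime m N" and b: "m * x \<in> bs (m * t)" for m x t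
	proof (cases "N = 1")
		case True
		then show ?thesis by (simp add: bs_cong)
	next
		case False
		have "[int (nat (m mod N)) = m] (mod N)" using N_pos by (simp add: cong_def)
		then have e: "N dvd int (nat (m mod N)) * c - m * c" for c by (simp add: cong_iff_dvd_diff left_diff_distrib[symmetric])
		have "coprime (int (nat (m mod N))) N" using N_pos c by (simp add: coprime_mod_left_iff[OF less_imp_neq[THEN not_sym]])
		moreover from this have "nat (m mod N) ~= 0" using False N_pos by (metis coprime_0_left_iff int_nat_eq of_nat_0 zdvd1_eq abs_of_pos)
		then have "nat (m mod N) > 0" by simp
		moreover have "int (nat (m mod N)) * x \<in> bs (int (nat (m mod N)) * t)"
			using aset_cong[OF aset_bs e[of x]] b bs_eq[OF bs_cong[OF e[of t]]] by simp
		ultimately show ?thesis using bs_div_nat by blast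
	qed
	show ?thesis
	proof
		assume x: "x \<in> bs t"
		have e: "N dvd i * (m * c) - c" for c using i cong_mult[OF i cong_refl[of c]] by (simp add: cong_iff_dvd_diff ac_simps)
		have "coprime i N" using i by (metis cong_imp_coprime cong_sym coprime_1_left coprime_mult_left_iff)
		moreover have "i * (m * x) \<in> bs (i * (m * t))"
			using aset_cong[OF aset_bs e[of x]] x bs_eq[OF bs_cong[OF e[of t]]] by simp
		ultimately show "m * x \<in> bs (m * t)" using div by blast
	qed (use div assms in blast)
qed

lemma I_mult: "f \<in> I ==> coprime m N ==> (\<lambda>x. f (m * x)) \<in> I" unfolding I_iff[of "\<lambda>x. f (m * x)"] using I_bs bs_mult by blast

lemma aset_mult: "aset A ==> coprime m N ==> aset {x. m * x \<in> A}" unfolding aset_def using I_mult by fastforce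

subsection \<open>Sections\<close>

text \<open>The ring of the section of \<open>u\<close>-multiples modulo \<open>v\<close>-multiples:
  ring elements constant on \<open>v\<close>-cosets are restricted to the multiples of
  \<open>u\<close>, which are renumbered through division by \<open>u\<close>. The new modulus is
  \<open>v div u\<close>.\<close>

definition secI :: "int => int => (int => int) set" where
	"secI u v = {g. \<exists>f\<in>I. per v f \<and> g = (\<lambda>x. f (u * x))}"

text \<open>Summation over the larger group counts each residue modulo \<open>v\<close> exactly
  \<open>N div v\<close> times; dividing by this number stays in the ring because all pointwise
  operations are allowed.\<close>

lemma secI_conv:
	assumes u: "u > 0" "u dvd v" and v: "v > 0" "v dvd N" and f: "per v f" "per v g"
	shows "conv (v div u) (\<lambda>x. f (u * x)) (\<lambda>x. g (u * x)) z
		= conv N (\<lambda>x. of_bool (u dvd x) * f x) g (u * z) div (N div v)"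
proof -
	have uv: "u * (v div u) = v" using u by simp
	have pos: "N div v > 0" using v N_pos by (simp add: pos_imp_zdiv_pos_iff zdvd_imp_le)
	have "conv (v div u) (\<lambda>x. f (u * x)) (\<lambda>x. g (u * x)) z
			= rsum (v div u) (\<lambda>y. f (u * y) * g (u * z - u * y))" by (simp add: conv_def right_diff_distrib)
	also have "... = rsum v (\<lambda>y. of_bool (u dvd y) * (f y * g (u * z - y)))"
		using rsum_multiples[OF u(1), where w="v div u" and f="\<lambda>y. f y * g (u * z - y)"] uv by simp
	also have "... * (N div v) = rsum N (\<lambda>y. of_bool (u dvd y) * (f y * g (u * z - y)))"
	proof -
		have "per v (\<lambda>y. of_bool (u dvd y) * (f y * g (u * z - y)))"
		proof (rule perI)
			fix x y assume d: "v dvd x - y"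
			then have "f x = f y" using f(1) per_cong by blast
			moreover have "g (u * z - x) = g (u * z - y)" by (rule per_cong[OF f(2)]) (use d in \<open>simp add: dvd_diff_commute\<close>)
			moreover have "u dvd x \<longleftrightarrow> u dvd y" using d u(2) dvd_iff_diff dvd_trans by blast
			ultimately show "of_bool (u dvd x) * (f x * g (u * z - x)) = of_bool (u dvd y) * (f y * g (u * z - y))" by simp
		qed
		then show ?thesis using rsum_quotient[OF v(1) N_pos v(2)] by simp
	qed
	finally have "conv (v div u) (\<lambda>x. f (u * x)) (\<lambda>x. g (u * x)) z * (N div v)
			= conv N (\<lambda>x. of_bool (u dvd x) * f x) g (u * z)" by (simp add: conv_def mult.assoc)
	then show ?thesis using pos by (metis less_irrefl nonzero_mult_div_cancel_right)
qed

lemma sec_sring: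
	assumes u: "agrp u" and v: "agrp v" and uv: "u dvd v"
	shows "sring (v div u) (secI u v)"
proof
	have pos: "u > 0" "v > 0" "v dvd N" using u v by (auto simp: agrp_def)
	have uvu: "u * (v div u) = v" using uv by simp
	show "v div u > 0" using pos uv by (simp add: pos_imp_zdiv_pos_iff zdvd_imp_le)
	fix g assume "g \<in> secI u v"
	then obtain f where f: "f \<in> I" "per v f" "g = (\<lambda>x. f (u * x))" by (auto simp: secI_def)
	show "per (v div u) g" using f uvu by (auto simp: per_def distrib_left)
	show "(\<lambda>x. g (- x)) \<in> secI u v" unfolding secI_def using I_refl[OF f(1)] f
		by (auto intro!: bexI[of _ "\<lambda>x. f (- x)"] simp: per_iff dvd_diff_commute)
	fix g' assume "g' \<in> secI u v"
	then obtain f' where f': "f' \<in> I" "per v f'" "g' = (\<lambda>x. f' (u * x))" by (auto simp: secI_def)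
	show "(\<lambda>x. h (g x) (g' x)) \<in> secI u v" for h unfolding secI_def using I_map2[OF f(1) f'(1), of h] f f'
		by (auto intro!: bexI[of _ "\<lambda>x. h (f x) (f' x)"] simp: per_def)
	have uf: "(\<lambda>x. of_bool (u dvd x) * f x) \<in> I" using I_map2[OF u[THEN agrp_aset, unfolded aset_def] f(1), of "(*)"] by simp
	show "conv (v div u) g g' \<in> secI u v" unfolding secI_def
	proof (intro CollectI bexI conjI)
		let ?F = "\<lambda>x. conv N (\<lambda>x. of_bool (u dvd x) * f x) f' x div (N div v)"
		show "?F \<in> I" by (rule I_map[OF I_conv[OF uf f'(1)]])
		have "f' (x - y) = f' (x' - y)" if "v dvd x - x'" for x x' y using that by (intro per_cong[OF f'(2)]) simp
		then show "per v ?F" by (intro perI) (simp add: conv_def)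
		show "conv (v div u) g g' = (\<lambda>x. ?F (u * x))" using secI_conv[OF pos(1) uv pos(2,3) f(2) f'(2)] f(3) f'(3) by auto
	qed
next
	have pos: "u > 0" using u by (auto simp: agrp_def)
	show "delta (v div u) \<in> secI u v" unfolding secI_def
	proof (intro CollectI bexI conjI)
		show "(\<lambda>x. of_bool (v dvd x)) \<in> I" using v by (simp add: agrp_def aset_def)
		show "per v (\<lambda>x. of_bool (v dvd x) :: int)" by (simp add: per_def)
		show "delta (v div u) = (\<lambda>x. of_bool (v dvd u * x))" using uv pos by (auto simp: delta_def elim!: dvdE)
	qed
qed

end

section \<open>Principal basic sets containing non-generators\<close>

lemma crt_unit:
	fixes A B :: int
	assumes "coprime A B" "coprime x A" "coprime y B"
	obtains m where "coprime m (A * B)" "[m = x] (mod A)" "[m = y] (mod B)"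
proof -
	obtain m where m: "[m = x] (mod A)" "[m = y] (mod B)" using binary_chinese_remainder_int[OF assms(1)] by blast
	have "coprime m A" "coprime m B" using m assms(2,3) cong_imp_coprime cong_sym by blast+
	then show thesis using m that by simp
qed

lemma prime_linear_solve:
	fixes L :: int
	assumes "prime L" "\<not> L dvd u"
	obtains j where "L dvd k + u * j"
proof -
	have "coprime u L" using assms by (metis coprime_commute prime_imp_coprime)
	then obtain i where "[u * i = 1] (mod L)" using cong_solve_coprime_int by blast
	then have "L dvd (u * i - 1) * (- k)" by (simp add: cong_iff_dvd_diff)
	then have "L dvd k + u * (i * (- k))" by (simp add: algebra_simps)
	then show thesis by (rule that)
qed

lemma rsum_coset:
	assumes "p > 0" "L > 0" "per (L * p) f"
	shows "rsum (L * p) (\<lambda>x. of_bool (p dvd x - t) * f x) = rsum L (\<lambda>j. f (t + p * j))"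
proof -
	have per: "per (L * p) (\<lambda>x. of_bool (p dvd x - t) * f x)"
	proof (rule perI)
		fix x y assume d: "L * p dvd x - y"
		then have "p dvd (x - t) - (y - t)" by (auto elim: dvd_mult_right)
		then have "p dvd x - t \<longleftrightarrow> p dvd y - t" by (rule dvd_iff_diff)
		then show "of_bool (p dvd x - t) * f x = of_bool (p dvd y - t) * f y" using per_cong[OF assms(3) d] by simp
	qed
	have "rsum (L * p) (\<lambda>x. of_bool (p dvd x - t) * f x)
			= rsum (L * p) (\<lambda>x. of_bool (p dvd x) * f (x + t))" using rsum_shift[OF _ per, of t] assms by simp
	also have "... = rsum L (\<lambda>j. f (p * j + t))"
		using rsum_multiples[OF assms(1), where w=L and f="\<lambda>x. f (x + t)"] by (simp add: mult.commute)
	finally show ?thesis by (simp add: add.commute)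
qed

context sring
begin

definition ind :: "int set => int => int" where
	"ind A x = of_bool (x \<in> A)"

lemma I_ind: "aset A \<longleftrightarrow> ind A \<in> I" by (simp add: aset_def ind_def[abs_def])

lemma mult_bs:
	assumes "coprime m N" "t \<in> bs s" "m * t \<in> bs s" "x \<in> bs s"
	shows "m * x \<in> bs s"
proof -
	have "x \<in> bs t" using assms(2,4) bs_eq by blast
	then have "m * x \<in> bs (m * t)" using bs_mult[OF assms(1)] by simp
	then show ?thesis using bs_eq[OF assms(3)] by simp
qed

text \<open>The set \<open>C\<close> of multiples of \<open>c\<close> and the set \<open>V\<close> of multiples of \<open>v\<close> are complementary
	direct factors, \<open>C\<close> carries the trivial Schur ring, and \<open>T\<close> is the product of \<open>C - {0}\<close> with the
	basic set \<open>W\<close> of \<open>V\<close>.\<close>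

definition tens :: "int set => int => int => int set => bool" where
	"tens T c v W \<longleftrightarrow> agrp c \<and> agrp v \<and> coprime c v \<and> c * v = N \<and> c < N \<and>
		 (\<exists>w. v dvd w \<and> W = bs w) \<and>
		 (\<forall>t. t \<in> T \<longleftrightarrow> (\<exists>b\<in>W. c dvd t - b \<and> \<not> N dvd t - b)) \<and>
		 (\<forall>x y. c dvd x --> \<not> N dvd x --> c dvd y --> \<not> N dvd y --> y \<in> bs x)"

text \<open>The solutions \<open>x\<close> of \<open>K * x = z\<close> modulo \<open>N\<close> form
  one coset of the subgroup of order \<open>K\<close>, which consists of the multiples of
  \<open>p\<close>.\<close>

lemma frob_coset:
	assumes "per N f" "N = K * p" "K > 0" "N dvd K * t - z"
	shows "frob N K f z = rsum K (\<lambda>j. f (t + p * j))"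
proof -
	have p: "p > 0" using assms N_pos by (simp add: zero_less_mult_iff)
	have "N dvd K * x - z \<longleftrightarrow> p dvd x - t" for x
	proof -
		have "N dvd (K * x - z) - K * (x - t)" using assms(4) by (simp add: algebra_simps dvd_diff_commute)
		then have "N dvd K * x - z \<longleftrightarrow> N dvd K * (x - t)" by (rule dvd_iff_diff)
		also have "... \<longleftrightarrow> p dvd x - t" using assms(2,3) by simp
		finally show ?thesis .
	qed
	then have "frob N K f z = rsum (K * p) (\<lambda>x. of_bool (p dvd x - t) * f x)" by (simp add: frob_def assms(2))
	then show ?thesis using rsum_coset[OF p assms(3)] assms(1,2) by simp
qed

text \<open>At \<open>l * t\<close> the push-forward counts the elements of \<open>A\<close> in the
  coset of \<open>t\<close> by the subgroup of order \<open>l\<close>. Modulo \<open>l\<close> this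
  count vanishes exactly for the cosets that miss \<open>A\<close> or lie inside it.\<close>

lemma aset_partial_cosets:
	assumes l: "prime l" and N: "N = int l * p" and A: "aset A"
	shows "aset {z. \<exists>t\<in>A. (\<exists>e. p dvd e \<and> t + e \<notin> A) \<and> N dvd int l * t - z}"
proof -
	let ?f = "ind A"
	have f: "?f \<in> I" using A by (simp add: I_ind)
	have l0: "int l > 0" using prime_gt_0_nat[OF l] by simp
	have "frob N (int l) ?f z mod int l ~= 0 \<longleftrightarrow> (\<exists>t\<in>A. (\<exists>e. p dvd e \<and> t + e \<notin> A) \<and> N dvd int l * t - z)" for z
	proof
		assume nz: "frob N (int l) ?f z mod int l ~= 0"
		then have "\<exists>x\<in>{0..<N}. of_bool (N dvd int l * x - z) * ?f x ~= 0"
			unfolding frob_def by (metis (no_types, lifting) mod_0 sum.neutral)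
		then obtain t where t: "t \<in> A" "N dvd int l * t - z" by (auto simp: ind_def)
		have "\<exists>e. p dvd e \<and> t + e \<notin> A"
		proof (rule ccontr)
			assume "\<not> (\<exists>e. p dvd e \<and> t + e \<notin> A)"
			then have "frob N (int l) ?f z = rsum (int l) (\<lambda>j. 1)"
				using frob_coset[OF I_per[OF f] N l0 t(2)] by (simp add: ind_def)
			then show False using nz by simp
		qed
		then show "\<exists>t\<in>A. (\<exists>e. p dvd e \<and> t + e \<notin> A) \<and> N dvd int l * t - z" using t by blast
	next
		assume "\<exists>t\<in>A. (\<exists>e. p dvd e \<and> t + e \<notin> A) \<and> N dvd int l * t - z"
		then obtain t e where t: "t \<in> A" "N dvd int l * t - z" "p dvd e" "t + e \<notin> A" by blast
		then obtain j where j: "e = p * j" by (auto elim: dvdE)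
		have eq: "frob N (int l) ?f z = rsum (int l) (\<lambda>j. ?f (t + p * j))" using frob_coset[OF I_per[OF f] N l0 t(2)] .
		have "rsum (int l) (\<lambda>j. ?f (t + p * j)) > 0" using t l0 by (intro sum_pos2[of _ 0]) (auto simp: ind_def)
		moreover have "rsum (int l) (\<lambda>j. ?f (t + p * j)) < rsum (int l) (\<lambda>j. 1)"
		proof (rule sum_strict_mono_ex1)
			have "N dvd (t + p * (j mod int l)) - (t + e)"
				unfolding N j by (simp add: right_diff_distrib[symmetric] mult.commute[of "int l"] mod_eq_dvd_iff[symmetric])
			then have "t + p * (j mod int l) \<notin> A" using t A aset_cong by blast
			then show "\<exists>j\<in>{0..<int l}. ?f (t + p * j) < 1" using l0 by (intro bexI[of _ "j mod int l"]) (auto simp: ind_def)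
		qed (auto simp: ind_def)
		ultimately show "frob N (int l) ?f z mod int l ~= 0" using eq by simp
	qed
	then show ?thesis using aset_level[OF I_frob[OF l f, of 1], of "\<lambda>a. a ~= 0"] by simp
qed

end

text \<open>\<open>p\<close> generates the subgroup of order \<open>l\<close>, and \<open>T1\<close>
  is the part of \<open>T\<close> in cosets of that subgroup that \<open>T\<close> does not fill.
  The section group \<open>v\<close> is generated by \<open>l * T1\<close>, and \<open>vp\<close> is
  its preimage under multiplication by \<open>l\<close>. The non-generator is
  \<open>x0\<close>.\<close>

locale nonunit_basic = sring +
	fixes l a :: nat and r :: int and t0 x0 :: int and T :: "int set" and v vp p :: int and T1 :: "int set"
	assumes prime: "prime l" and a_pos: "a > 0" and N_eq: "N = int l ^ a * r" and r: "\<not> int l dvd r"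
		and T_bs: "T = bs t0"
		and gen: "\<And>e. e > 0 ==> e dvd N ==> (\<And>x. x \<in> T ==> e dvd x) ==> e = 1"
		and radT: "\<And>e. e \<in> rad T ==> N dvd e"
		and x0: "x0 \<in> T" "int l dvd x0"
		and p_def: "p = int l ^ (a - 1) * r"
		and T1_def: "T1 = {t \<in> T. \<exists>e. p dvd e \<and> t + e \<notin> T}"
		and v: "agrp v" "\<And>t. t \<in> T1 ==> v dvd int l * t"
			"\<And>e. e dvd N ==> (\<And>t. t \<in> T1 ==> e dvd int l * t) ==> e dvd v"
		and vp_def: "vp = v div int l"
begin

abbreviation "L \<equiv> int l"

lemma L_prime: "Factorial_Ring.prime L" using prime by simp

lemma L_gt: "L > 1" using prime_gt_1_nat[OF prime] by simp

lemma N_p: "N = L * p" unfolding N_eq p_def using a_pos by (cases a) auto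

lemma r_pos: "r > 0" using N_pos L_gt unfolding N_eq by (simp add: zero_less_mult_iff)

lemma p_pos: "p > 0" using r_pos L_gt by (simp add: p_def)

lemma cop: "coprime (L ^ a) r" using prime_imp_coprime[OF L_prime r] by simp

lemma asetT: "aset T" by (simp add: T_bs aset_bs)

lemma T_basic: "aset A ==> x \<in> A ==> x \<in> T ==> T \<subseteq> A" using bs_sub[of A x] bs_eq[of x t0] by (simp add: T_bs)

lemma T1_T: "t \<in> T1 ==> t \<in> T" by (simp add: T1_def)

lemma T2_shift: "t \<in> T ==> t \<notin> T1 ==> p dvd e ==> t + e \<in> T \<and> t + e \<notin> T1"
proof -
	assume t: "t \<in> T" "t \<notin> T1" "p dvd e"
	then have a: "t + e' \<in> T" if "p dvd e'" for e' using that by (auto simp: T1_def)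
	then have "(t + e) + e' \<in> T" if "p dvd e'" for e' using a[of "e + e'"] that t(3) by (simp add: add.assoc)
	then show ?thesis using a t(3) by (auto simp: T1_def)
qed

text \<open>If \<open>T\<close> filled every coset it meets, the subgroup of order \<open>l\<close>
  would lie in the radical.\<close>

lemma T1_ne: "\<exists>t. t \<in> T1"
proof (rule ccontr)
	assume n: "\<nexists>t. t \<in> T1"
	have "p \<in> rad T" unfolding rad_def using T2_shift[of _ "- p"] n by auto
	then have "N dvd p" by (rule radT)
	then show False using p_pos L_gt N_p zdvd_imp_le[of N p] by (simp add: mult_le_cancel_right1)
qed

definition D :: "int set" where
	"D = {z. \<exists>t\<in>T1. N dvd L * t - z}"

lemma aset_D: "aset D"
	using aset_partial_cosets[OF prime N_p asetT] unfolding D_def by (simp add: T1_def Bex_def conj_assoc)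

lemma L_v: "L dvd v" by (rule v(3)) (simp_all add: N_p)

lemma v_vp: "v = L * vp" using L_v by (simp add: vp_def)

lemma v_pos: "v > 0" "v dvd N" using v(1) by (auto simp: agrp_def)

lemma vp_pos: "vp > 0" using v_pos L_gt by (simp add: v_vp zero_less_mult_iff)

lemma vp_T1: "t \<in> T1 ==> vp dvd t" using v(2)[of t] L_gt by (simp add: v_vp)

text \<open>One element in \<open>v\<close> would pull all of \<open>T\<close> into the subgroup
  \<open>v\<close>; but \<open>T\<close> generates, and \<open>l\<close> divides
  \<open>v\<close>.\<close>

lemma T_not_v: "t \<in> T ==> \<not> v dvd t"
proof
	assume "t \<in> T" "v dvd t"
	then have "T \<subseteq> {x. v dvd x}" using T_basic[of "{x. v dvd x}" t] v(1) by (simp add: agrp_def)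
	then have "v = 1" using gen v_pos by auto
	then show False using L_v L_gt by simp
qed

text \<open>The support together with \<open>v\<close> generates a section group between
  \<open>vp\<close> and \<open>v\<close>, whose index is the prime \<open>l\<close>. If it were
  \<open>vp\<close>, then \<open>T\<close> would lie in \<open>vp\<close>, so \<open>vp = 1\<close>
  and \<open>v = l\<close>, against the presence of \<open>x0\<close> in \<open>T\<close>. The
  contradictions below come from feeding convolutions modulo \<open>l\<close> to this lemma.\<close>

lemma support:
	assumes f: "f \<in> I" and z: "\<And>z. f z ~= 0 ==> vp dvd z" and z0: "f z0 ~= 0"
	shows "v dvd z0"
proof (rule ccontr)
	assume nv: "\<not> v dvd z0"
	have A: "aset ({x. f x ~= 0} \<union> {x. v dvd x})"
		using aset_level[OF f, of "\<lambda>a. a ~= 0"] v(1) by (intro aset_Un) (auto simp: agrp_def)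
	from gen_agrp[OF this] obtain d where d: "agrp d"
		"\<And>x. x \<in> {x. f x ~= 0} \<union> {x. v dvd x} ==> d dvd x"
		"\<And>e. e dvd N ==> (\<And>x. x \<in> {x. f x ~= 0} \<union> {x. v dvd x} ==> e dvd x) ==> e dvd d" by blast
	have "vp dvd d"
	proof (rule d(3))
		show "vp dvd N" using v_pos(2) by (simp add: v_vp dvd_mult_right)
		show "vp dvd x" if "x \<in> {x. f x ~= 0} \<union> {x. v dvd x}" for x using that z by (auto simp: v_vp dvd_mult_right)
	qed
	then obtain k where k: "d = vp * k" by (auto elim: dvdE)
	have "d dvd v" using d(2)[of v] by simp
	then have kL: "k dvd L" using vp_pos by (simp add: k v_vp mult.commute)
	have "k > 0" using d(1) vp_pos by (simp add: agrp_def k zero_less_mult_iff)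
	have "k = 1 \<or> k = L" using kL L_prime \<open>k > 0\<close> by (simp add: prime_int_iff)
	then show False
	proof
		assume "k = L"
		then have "d = v" by (simp add: k v_vp)
		then show False using d(2)[of z0] z0 nv by simp
	next
		assume "k = 1"
		then have "agrp vp" using d(1) k by simp
		then have "aset {x. vp dvd x}" "vp dvd N" by (auto simp: agrp_def)
		obtain t where t: "t \<in> T1" using T1_ne by blast
		have "T \<subseteq> {x. vp dvd x}" by (rule T_basic[of _ t]) (use \<open>aset {x. vp dvd x}\<close> t vp_T1 T1_T in auto)
		then have "vp = 1" using gen vp_pos \<open>vp dvd N\<close> by auto
		then have "v dvd x0" using x0 by (simp add: v_vp)
		then show False using T_not_v x0 by blast
	qed
qed

lemma mT: "coprime m N ==> t \<in> T ==> m * t \<in> T ==> x \<in> T ==> m * x \<in> T" unfolding T_bs by (rule mult_bs)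

lemma T_cong: "N dvd x - y ==> x \<in> T \<longleftrightarrow> y \<in> T" by (rule aset_cong[OF asetT])

lemma unit_lift:
	assumes "\<not> L dvd k" "coprime y r"
	obtains m where "coprime m N" "[m = k] (mod L ^ a)" "[m = y] (mod r)"
proof -
	have "coprime k (L ^ a)" using prime_imp_coprime[OF L_prime assms(1)] by (simp add: coprime_commute)
	then show thesis using crt_unit[OF cop _ assms(2), of k] that N_eq by metis
qed

end

subsection \<open>The case where the incomplete cosets meet the socle\<close>

text \<open>Every element of \<open>T1\<close> has its \<open>l\<close>-component in the subgroup of
  order \<open>l\<close>. Consequently \<open>L ^ a\<close> divides \<open>v\<close>, so the
  subgroup \<open>v\<close> has order prime to \<open>l\<close>.\<close>

locale nonunit_socle = nonunit_basic +
	assumes A: "\<And>t. t \<in> T1 ==> int l ^ (a - 1) dvd t"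
begin

lemma La_v: "L ^ a dvd v"
proof (rule v(3))
	show "L ^ a dvd N" by (simp add: N_eq)
	show "L ^ a dvd L * t" if "t \<in> T1" for t
		using mult_dvd_mono[OF dvd_refl A[OF that], of L] a_pos by (simp add: power_eq_if)
qed

definition w :: int where "w = v div L ^ a"

lemma v_w: "v = L ^ a * w" using La_v by (simp add: w_def)

lemma w_r: "w dvd r"
proof -
	have "L ^ a * w dvd L ^ a * r" using v_pos(2) by (metis v_w N_eq)
	then show ?thesis using L_gt by simp
qed

lemma vp_w: "vp = L ^ (a - 1) * w" using v_w a_pos L_gt by (simp add: v_vp power_eq_if)

text \<open>Modulo \<open>N\<close>, the subgroup \<open>vp\<close> is the direct sum of
  \<open>v\<close> and the subgroup of order \<open>l\<close>; the component in the latter is found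
  by a linear congruence modulo \<open>l\<close>.\<close>

lemma split_vp:
	assumes "vp dvd t"
	obtains b where "v dvd b" "p dvd t - b"
proof -
	obtain k where k: "t = vp * k" using assms by (auto elim: dvdE)
	obtain u where u: "r = w * u" using w_r by (auto elim: dvdE)
	have "\<not> L dvd u" using r u by auto
	from prime_linear_solve[OF L_prime this] obtain j where j: "L dvd k + u * j" .
	have "t + p * j = vp * (k + u * j)" by (simp add: k p_def u vp_w algebra_simps)
	then have "v dvd t + p * j" using j by (simp add: v_vp mult.commute[of L])
	then show thesis using that[of "t + p * j"] by simp
qed

text \<open>The projection of \<open>T1\<close> to the subgroup \<open>v\<close> along the subgroup
  of order \<open>l\<close>.\<close>

definition W :: "int set" where
	"W = {b. v dvd b \<and> (\<exists>t\<in>T1. p dvd t - b)}"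

text \<open>Multiplication by \<open>l\<close> is not a unit multiplier, but on the subgroup
  \<open>v\<close> it agrees with one: take \<open>m\<close> congruent to 1 modulo
  \<open>L ^ a\<close> and to \<open>l\<close> modulo \<open>r\<close>. Hence \<open>W\<close> is
  the preimage in \<open>v\<close> of \<open>D\<close> under \<open>m\<close>.\<close>

lemma aset_W: "aset W"
proof -
	have "coprime L r" using prime_imp_coprime[OF L_prime r] .
	moreover have "\<not> L dvd 1" using L_gt by simp
	ultimately obtain m where m: "coprime m N" "[m = 1] (mod L ^ a)" "[m = L] (mod r)" using unit_lift by metis
	have "b \<in> W \<longleftrightarrow> m * b \<in> D" if "v dvd b" for b
	proof -
		have "L ^ a dvd b" using La_v that by (rule dvd_trans)
		moreover have "r dvd m - L" using m(3) by (simp add: cong_iff_dvd_diff)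
		ultimately have "N dvd (m - L) * b" unfolding N_eq by (metis mult.commute mult_dvd_mono)
		then have "m * b \<in> D \<longleftrightarrow> L * b \<in> D" using aset_cong[OF aset_D, of "m * b" "L * b"] by (simp add: left_diff_distrib)
		also have "... \<longleftrightarrow> (\<exists>t\<in>T1. N dvd L * (t - b))" unfolding D_def by (simp add: right_diff_distrib)
		also have "... \<longleftrightarrow> b \<in> W" using that L_gt unfolding W_def N_p by simp
		finally show ?thesis by simp
	qed
	then have "W = {x. v dvd x} \<inter> {x. m * x \<in> D}" by (auto simp: W_def)
	then show ?thesis using aset_Int[OF agrp_aset[OF v(1)] aset_mult[OF aset_D m(1)]] by simp
qed

lemma W_T: "b \<in> W ==> b \<notin> T" using T_not_v by (auto simp: W_def)

text \<open>Under invariance by all local units, \<open>T\<close> contains over each point of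
  \<open>W\<close> the whole punctured coset of the subgroup of order \<open>l\<close>. Filling in
  the missing points gives \<open>T \<union> W\<close>, whose radical is the wanted direct factor
  \<open>c\<close>.\<close>

lemma full_tens:
	assumes full: "\<And>m x. coprime m N ==> [m = 1] (mod r) ==> x \<in> T ==> m * x \<in> T"
	shows "\<exists>c v W. tens T c v W"
proof -
	\<comment> \<open>Write some \<open>t\<close> in \<open>T1\<close> as \<open>b + p * j0\<close>. A
	  unit that is 1 modulo \<open>r\<close> and sends \<open>j0\<close> to \<open>j\<close> modulo
	  \<open>l\<close> fixes \<open>b\<close> and carries \<open>t\<close> to
	  \<open>b + e\<close>.\<close>
	have WP: "b + e \<in> T" if b: "b \<in> W" and e: "p dvd e" "\<not> N dvd e" for b e
	proof -
		obtain t where t: "t \<in> T1" "p dvd t - b" "v dvd b" using b by (auto simp: W_def)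
		obtain j0 j where j0: "t - b = p * j0" and j: "e = p * j" using t e by (auto elim!: dvdE)
		have nj0: "\<not> L dvd j0"
		proof
			assume "L dvd j0"
			then have "v dvd t - b" using j0 v_pos(2) N_p by (metis dvd_trans mult.commute mult_dvd_mono dvd_refl)
			then have "v dvd t" using t(3) dvd_iff_diff by blast
			then show False using T_not_v T1_T t by blast
		qed
		have nj: "\<not> L dvd j" using e(2) by (auto simp: j N_p)
		obtain i where i: "L dvd j + j0 * i" using prime_linear_solve[OF L_prime nj0] by blast
		have "\<not> L dvd - i"
		proof
			assume "L dvd - i"
			then have "L dvd j" using i dvd_iff_diff[of L "j + j0 * i" j] by simp
			then show False using nj by simp
		qed
		then obtain m where m: "coprime m N" "[m = - i] (mod L ^ a)" "[m = 1] (mod r)" using unit_lift[of "- i" 1] by auto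
		have "L ^ a dvd b" using La_v t(3) by (rule dvd_trans)
		moreover have "r dvd m - 1" using m(3) by (simp add: cong_iff_dvd_diff)
		ultimately have 1: "N dvd (m - 1) * b" unfolding N_eq by (metis mult.commute mult_dvd_mono)
		have "L dvd m + i" using m(2) a_pos by (metis cong_iff_dvd_diff diff_minus_eq_add dvd_power dvd_trans)
		then have "L dvd (m + i) * j0 - (j + j0 * i)" using i by (intro dvd_diff dvd_mult2)
		then have "L dvd m * j0 - j" by (simp add: algebra_simps)
		then have 2: "N dvd p * (m * j0 - j)" by (simp add: N_p mult.commute)
		have "m * t \<in> T" using full[OF m(1,3)] t T1_T by blast
		moreover have "m * t - (b + e) = (m - 1) * b + p * (m * j0 - j)" using j0 j by (simp add: algebra_simps)
		then have "N dvd m * t - (b + e)" using dvd_add[OF 1 2] by simp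
		ultimately show ?thesis using T_cong by blast
	qed
	define U where "U = T \<union> W"
	have "aset U" unfolding U_def by (intro aset_Un asetT aset_W)
	then obtain c where c: "agrp c" "rad U = {x. c dvd x}" using rad_agrp by blast
	have T1_split: "\<exists>b\<in>W. p dvd t - b" if t: "t \<in> T1" for t
	proof -
		obtain b where "v dvd b" "p dvd t - b" using split_vp[OF vp_T1[OF t]] by blast
		then show ?thesis unfolding W_def using t by blast
	qed
	have U_P: "x + e \<in> U" if "x \<in> U" "p dvd e" for x e
	proof (cases "x \<in> T \<and> x \<notin> T1")
		case True
		then show ?thesis using T2_shift that(2) by (auto simp: U_def)
	next
		case False
		then have "x \<in> T1 \<or> x \<in> W" using that(1) by (auto simp: U_def)
		then have "\<exists>b\<in>W. p dvd x - b" using T1_split by (auto intro: bexI[of _ x])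
		then obtain b where b: "b \<in> W" "p dvd x - b" by blast
		have pe: "p dvd x + e - b" using b(2) that(2) by (metis add_diff_eq dvd_add add.commute)
		show ?thesis
		proof (cases "N dvd x + e - b")
			case True
			then show ?thesis using aset_cong[OF aset_W] b(1) by (auto simp: U_def)
		next
			case False
			then show ?thesis using WP[OF b(1) pe] by (simp add: U_def)
		qed
	qed
	have "p \<in> rad U" unfolding rad_def using U_P[of _ "- p"] by auto
	then have cp: "c dvd p" using c by simp
	\<comment> \<open>A common element of \<open>c\<close> and \<open>v\<close> shifts \<open>T\<close>
	  into \<open>U\<close> but never into \<open>W\<close>, so it lies in the radical of
	  \<open>T\<close>.\<close>
	have CV: "N dvd x" if "c dvd x" "v dvd x" for x
	proof (rule radT)
		show "x \<in> rad T" unfolding rad_def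
		proof (intro CollectI ballI)
			fix y assume y: "y \<in> T"
			have "y - x \<in> U" using that(1) c(2) y by (auto simp: rad_def U_def)
			moreover have "y - x \<notin> W"
			proof
				assume "y - x \<in> W"
				then have "v dvd y - x" by (simp add: W_def)
				then show False using T_not_v[OF y] that(2) dvd_iff_diff by blast
			qed
			ultimately show "y - x \<in> T" by (simp add: U_def)
		qed
	qed
	have U_C: "x + e \<in> U \<longleftrightarrow> x \<in> U" if "c dvd e" for x e
	proof -
		have "e \<in> rad U" using c(2) that by blast
		then show ?thesis using rad_add \<open>aset U\<close> by blast
	qed
	obtain t1 where "t1 \<in> T1" using T1_ne by blast
	then obtain b1 where b1: "b1 \<in> W" using T1_split by blast
	have Np: "\<not> N dvd p" using p_pos L_gt N_p zdvd_imp_le[of N p] by (auto simp: mult_le_cancel_right1)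
	have T_iff: "t \<in> T \<longleftrightarrow> (\<exists>b\<in>W. c dvd t - b \<and> \<not> N dvd t - b)" for t
	proof
		assume "\<exists>b\<in>W. c dvd t - b \<and> \<not> N dvd t - b"
		then obtain b where b: "b \<in> W" "c dvd t - b" "\<not> N dvd t - b" by blast
		have "t \<in> U" using U_C[OF b(2), of b] b(1) by (simp add: U_def)
		moreover have "t \<notin> W"
		proof
			assume "t \<in> W"
			then have "v dvd t - b" using b(1) by (auto simp: W_def)
			then show False using CV b by blast
		qed
		ultimately show "t \<in> T" by (simp add: U_def)
	next
		assume t: "t \<in> T"
		have "aset (msum W {x. c dvd x} - W)" by (intro aset_Diff aset_msum aset_W agrp_aset c)
		moreover have "b1 + p \<in> T" using WP[OF b1 dvd_refl Np] .
		moreover have "b1 + p \<in> msum W {x. c dvd x} - W"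
			using b1 cp W_T \<open>b1 + p \<in> T\<close> by (auto simp: msum_def intro!: bexI[of _ b1])
		ultimately have "T \<subseteq> msum W {x. c dvd x} - W" using T_basic by blast
		then obtain b where b: "b \<in> W" "c dvd t - b" using t by (auto simp: msum_def)
		moreover have "\<not> N dvd t - b" using aset_cong[OF aset_W, of t b] W_T t b(1) by blast
		ultimately show "\<exists>b\<in>W. c dvd t - b \<and> \<not> N dvd t - b" by blast
	qed
	have cpos: "c > 0" "c dvd N" using c by (auto simp: agrp_def)
	have "gcd c v = 1"
	proof (rule gen)
		show "gcd c v dvd N" using cpos by (meson dvd_trans gcd_dvd1)
		fix x assume "x \<in> T"
		then obtain b where "b \<in> W" "c dvd x - b" using T_iff by blast
		then have "gcd c v dvd b" "gcd c v dvd x - b" by (auto simp: W_def intro: dvd_trans[OF gcd_dvd1] dvd_trans[OF gcd_dvd2])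
		then show "gcd c v dvd x" using dvd_iff_diff by blast
	qed (use cpos in simp)
	then have cop_cv: "coprime c v" by (simp add: coprime_iff_gcd_eq_1)
	have "N dvd c * v" by (rule CV) auto
	moreover have "c * v dvd N" using cop_cv cpos v_pos by (simp add: divides_mult)
	ultimately have cv: "c * v = N" using zdvd_antisym_nonneg cpos v_pos N_pos by (metis less_imp_le mult_nonneg_nonneg)
	have cN: "c < N" using cp p_pos L_gt N_p zdvd_imp_le[OF cp p_pos] by (smt (verit) mult_less_cancel_right1)
	\<comment> \<open>\<open>T\<close> lies in the sumset of \<open>W\<close> and \<open>bs x\<close>.
	  As \<open>c\<close> and \<open>v\<close> meet trivially, the point \<open>y + b1\<close> of
	  \<open>T\<close> forces its \<open>c\<close>-component \<open>y\<close> into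
	  \<open>bs x\<close>.\<close>
	have rank2: "y \<in> bs x" if x: "c dvd x" "\<not> N dvd x" and y: "c dvd y" "\<not> N dvd y" for x y
	proof -
		have ac: "aset ({x. c dvd x} - {x. N dvd x})" by (intro aset_Diff agrp_aset c aset_N)
		then have sub: "bs x \<subseteq> {x. c dvd x} - {x. N dvd x}" using bs_sub x by blast
		have "aset (msum W (bs x))" by (intro aset_msum aset_W aset_bs)
		moreover have "x + b1 \<in> msum W (bs x)" using b1 bs_refl by (auto simp: msum_def intro!: bexI[of _ b1])
		moreover have "x + b1 \<in> T" using T_iff b1 x by (metis add_diff_cancel_right')
		ultimately have "T \<subseteq> msum W (bs x)" using T_basic by blast
		moreover have "y + b1 \<in> T" using T_iff b1 y by (metis add_diff_cancel_right')
		ultimately obtain b where b: "b \<in> W" "y + b1 - b \<in> bs x" by (auto simp: msum_def)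
		have "c dvd y + b1 - b" using b sub by auto
		then have "c dvd b1 - b" using y(1) dvd_iff_diff[of c "y + b1 - b" "b1 - b"] by simp
		moreover have "v dvd b1 - b" using b b1 by (auto simp: W_def)
		ultimately have "N dvd b1 - b" by (rule CV)
		then show ?thesis using aset_cong[OF aset_bs, of "y + b1 - b" y] b(2) by simp
	qed
	have "W = bs b1"
	proof
		show "bs b1 \<subseteq> W" using bs_sub aset_W b1 by blast
		show "W \<subseteq> bs b1"
		proof
			fix b assume b: "b \<in> W"
			have "aset (msum (bs b1) ({x. c dvd x} - {x. N dvd x}))" by (intro aset_msum aset_Diff agrp_aset c aset_N aset_bs)
			moreover have "p + b1 \<in> msum (bs b1) ({x. c dvd x} - {x. N dvd x})"
				using bs_refl[of b1] cp Np by (auto simp: msum_def intro!: bexI[of _ b1])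
			moreover have "p + b1 \<in> T" using T_iff b1 cp Np by (metis add_diff_cancel_right')
			ultimately have "T \<subseteq> msum (bs b1) ({x. c dvd x} - {x. N dvd x})" using T_basic by blast
			moreover have "p + b \<in> T" using T_iff b cp Np by (metis add_diff_cancel_right')
			ultimately obtain b' where b': "b' \<in> bs b1" "c dvd p + b - b'" by (auto simp: msum_def)
			then have "b' \<in> W" using \<open>bs b1 \<subseteq> W\<close> by blast
			have "c dvd b - b'" using b'(2) cp dvd_iff_diff[of c "p + b - b'" "b - b'"] by simp
			moreover have "v dvd b - b'" using b \<open>b' \<in> W\<close> by (auto simp: W_def)
			ultimately have "N dvd b - b'" by (rule CV)
			then show "b \<in> bs b1" using aset_cong[OF aset_bs] b'(1) by blast
		qed
	qed
	moreover have "v dvd b1" using b1 by (simp add: W_def)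
	ultimately have "tens T c v W" unfolding tens_def using c(1) v(1) cop_cv cv cN T_iff rank2 by blast
	then show ?thesis by blast
qed

end

subsection \<open>Power sums modulo a prime\<close>

lemma rsum_int: "rsum (int l) f = (\<Sum>k<l. f (int k))"
proof -
	have "{0..<int l} = int ` {..<l}" using image_int_atLeastLessThan[of 0 l] by (simp add: lessThan_atLeast0)
	then show ?thesis by (simp add: sum.reindex)
qed

lemma rsum_split:
	assumes p: "p > 0" and L: "L > 0" and f: "per (L * p) f"
	shows "rsum (L * p) f = rsum p (\<lambda>y. rsum L (\<lambda>j. f (y + p * j)))"
proof -
	have "rsum p (\<lambda>y. rsum L (\<lambda>j. f (y + p * j)))
			= rsum p (\<lambda>y. rsum (L * p) (\<lambda>x. of_bool (p dvd x - y) * f x))" using rsum_coset[OF p L f] by simp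
	also have "... = rsum (L * p) (\<lambda>x. rsum p (\<lambda>y. of_bool (p dvd x - y) * 1) * f x)"
		by (subst sum.swap) (simp add: sum_distrib_right)
	also have "... = rsum (L * p) f" by (subst rsum_delta'[OF p]) (simp_all add: per_def)
	finally show ?thesis by simp
qed

text \<open>Telescoping the differences of \<open>k ^ (n + 1)\<close> expresses \<open>n + 1\<close>
  times the power sum through the lower ones, and \<open>n + 1\<close> is invertible modulo
  \<open>l\<close>.\<close>

lemma psum_small:
	assumes l: "prime l"
	shows "n + 1 < l ==> int l dvd (\<Sum>k<l. int k ^ n)"
proof (induction n rule: less_induct)
	case (less n)
	let ?S = "\<lambda>i. \<Sum>k<l. int k ^ i"
	have "(\<Sum>i\<le>n. int (Suc n choose i) * ?S i) = (\<Sum>k<l. \<Sum>i\<le>n. int (Suc n choose i) * int k ^ i)"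
		by (subst sum.swap) (simp add: sum_distrib_left)
	also have "... = (\<Sum>k<l. int (Suc k) ^ Suc n - int k ^ Suc n)"
	proof (rule sum.cong[OF refl])
		fix k
		have "int (Suc k) ^ Suc n = (int k + 1) ^ Suc n" by (simp add: add.commute)
		also have "... = (\<Sum>i\<le>Suc n. int (Suc n choose i) * int k ^ i)" by (subst binomial_ring) simp
		finally show "(\<Sum>i\<le>n. int (Suc n choose i) * int k ^ i) = int (Suc k) ^ Suc n - int k ^ Suc n" by simp
	qed
	also have "... = int l ^ Suc n" by (subst sum_lessThan_telescope) simp
	finally have eq: "(\<Sum>i\<le>n. int (Suc n choose i) * ?S i) = int l ^ Suc n" .
	have split: "(\<Sum>i\<le>n. int (Suc n choose i) * ?S i) = (\<Sum>i<n. int (Suc n choose i) * ?S i) + int (Suc n) * ?S n"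
		by (simp add: lessThan_Suc_atMost[symmetric])
	have "int l dvd (\<Sum>i<n. int (Suc n choose i) * ?S i)"
	proof (rule dvd_sum)
		fix i assume "i \<in> {..<n}"
		then show "int l dvd int (Suc n choose i) * ?S i" using less by (intro dvd_mult) auto
	qed
	moreover have "int l dvd (\<Sum>i<n. int (Suc n choose i) * ?S i) + int (Suc n) * ?S n" unfolding split[symmetric] eq by simp
	ultimately have "int l dvd int (Suc n) * ?S n" using dvd_add_right_iff by blast
	moreover have "\<not> int l dvd int (Suc n)"
		using less.prems by (metis Suc_eq_plus1 int_dvd_int_iff nat_dvd_not_less zero_less_Suc)
	ultimately show ?case using l prime_dvd_mult_iff by (metis prime_nat_int_transfer)
qed

lemma psum_reduce:
	assumes l: "prime l" and "n > 0"
	shows "[(\<Sum>k<l. int k ^ (n + (l - 1))) = (\<Sum>k<l. int k ^ n)] (mod int l)"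
proof (rule cong_sum)
	fix k
	have "int k ^ (n + (l - 1)) = int k ^ (n - 1) * int k ^ l"
		using assms prime_gt_0_nat[OF l] by (simp add: power_add[symmetric])
	moreover have "[int k ^ (n - 1) * int k ^ l = int k ^ (n - 1) * int k] (mod int l)"
		by (intro cong_mult fermat_cong l cong_refl)
	moreover have "int k ^ (n - 1) * int k = int k ^ n" using assms(2) by (rule power_minus_mult)
	ultimately show "[int k ^ (n + (l - 1)) = int k ^ n] (mod int l)" by metis
qed

lemma psum_pred:
	assumes l: "prime l"
	shows "[(\<Sum>k<l. int k ^ (l - 1)) = -1] (mod int l)"
proof -
	have l1: "l > 1" by (rule prime_gt_1_nat[OF l])
	have "[int k ^ (l - 1) = 1] (mod int l)" if "k \<in> {..<l} - {0}" for k
	proof -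
		have "\<not> int l dvd int k" using that by (auto dest: dvd_imp_le)
		have "[int k * int k ^ (l - 1) = int k * 1] (mod int l)"
			using fermat_cong[OF l, of "int k"] l1 by (simp add: power_eq_if)
		moreover have "coprime (int k) (int l)"
			using prime_imp_coprime \<open>\<not> int l dvd int k\<close> l by (metis coprime_commute prime_nat_int_transfer)
		ultimately show ?thesis using cong_mult_lcancel by blast
	qed
	then have "[(\<Sum>k\<in>{..<l} - {0}. int k ^ (l - 1)) = (\<Sum>k\<in>{..<l} - {0}. 1)] (mod int l)" by (rule cong_sum)
	moreover have "(\<Sum>k<l. int k ^ (l - 1)) = (\<Sum>k\<in>{..<l} - {0}. int k ^ (l - 1))"
		using l1 by (intro sum.mono_neutral_right) auto
	moreover have "(\<Sum>k\<in>{..<l} - {0}. 1 :: int) = int l - 1" using l1 by simp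
	ultimately have "[(\<Sum>k<l. int k ^ (l - 1)) = int l - 1] (mod int l)" by metis
	moreover have "[int l - 1 = -1] (mod int l)" by (simp add: cong_iff_dvd_diff)
	ultimately show ?thesis by (rule cong_trans)
qed

text \<open>A finite analogue of the beta integral. After expanding \<open>(1 - j) ^ e\<close>, the
  power sum of exponent \<open>e + i\<close> vanishes modulo \<open>l\<close> except for
  \<open>i = d\<close>, where the exponent is \<open>l - 1\<close>. What remains is a signed
  binomial coefficient, prime to \<open>l\<close> since \<open>e < l\<close>.\<close>

lemma beta_sum:
	assumes l: "prime l" and d: "0 < d" "d \<le> e" "d + e = l - 1"
	shows "\<not> int l dvd rsum (int l) (\<lambda>j. j ^ e * (1 - j) ^ e)"
proof -
	let ?S = "\<lambda>n. \<Sum>k<l. int k ^ n"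
	have "(1 - int j) ^ e = (\<Sum>i\<le>e. int (e choose i) * (-1) ^ i * int j ^ i)" for j
	proof -
		have "(1 - int j) ^ e = ((- int j) + 1) ^ e" by simp
		also have "... = (\<Sum>i\<le>e. int (e choose i) * (- int j) ^ i)" by (subst binomial_ring) simp
		finally show ?thesis by (simp add: power_minus[of "int j"] mult.assoc)
	qed
	then have "rsum (int l) (\<lambda>j. j ^ e * (1 - j) ^ e)
			= (\<Sum>j<l. \<Sum>i\<le>e. int (e choose i) * (-1) ^ i * int j ^ (e + i))"
		by (simp add: rsum_int sum_distrib_left power_add ac_simps)
	also have "... = (\<Sum>i\<le>e. int (e choose i) * (-1) ^ i * ?S (e + i))" by (subst sum.swap) (simp add: sum_distrib_left)
	also have "[... = (\<Sum>i\<le>e. if i = d then int (e choose d) * (-1) ^ d * (-1) else 0)] (mod int l)"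
	proof (rule cong_sum)
		fix i assume i: "i \<in> {..e}"
		show "[int (e choose i) * (- 1) ^ i * ?S (e + i)
			= (if i = d then int (e choose d) * (-1) ^ d * (-1) else 0)] (mod int l)"
		proof (cases "i = d")
			case True
			then have "[int (e choose i) * (- 1) ^ i * ?S (e + i) = int (e choose i) * (- 1) ^ i * (-1)] (mod int l)"
				using psum_pred[OF l] d by (intro cong_mult cong_refl) (simp add: add.commute)
			then show ?thesis using True by simp
		next
			case False
			have "int l dvd ?S (e + i)"
			proof (cases "i < d")
				case True
				then show ?thesis using d by (intro psum_small[OF l]) auto
			next
				case False
				define n where "n = i - d"
				have n: "n > 0" "e + i = n + (l - 1)" "n + 1 < l" using False \<open>i ~= d\<close> d i by (auto simp: n_def)
				then show ?thesis using psum_reduce[OF l n(1)] psum_small[OF l n(3)] by (metis cong_dvd_iff)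
			qed
			then show ?thesis using False by (simp add: cong_0_iff)
		qed
	qed
	also have "(\<Sum>i\<le>e. if i = d then int (e choose d) * (-1) ^ d * (-1) else 0) = int (e choose d) * (-1) ^ d * (-1)"
		using d by simp
	finally have c: "[rsum (int l) (\<lambda>j. j ^ e * (1 - j) ^ e) = int (e choose d) * (-1) ^ d * (-1)] (mod int l)" .
	have "\<not> l dvd fact e"
		using d l prime_dvd_fact_iff[of l e] by (metis Suc_leI add_lessD1 diff_less leD less_add_same_cancel2 less_imp_diff_less prime_gt_0_nat zero_less_one le_less_trans lessI)
	then have "\<not> l dvd (e choose d)"
		using binomial_fact_lemma[OF d(2)] by (metis dvd_mult dvd_triv_right mult.commute dvd_mult2)
	then have "\<not> int l dvd int (e choose d)" by simp
	then have "\<not> int l dvd int (e choose d) * (-1) ^ d * (-1)" by (cases "even d") auto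
	then show ?thesis using c cong_dvd_iff by blast
qed

lemma mult_mod_prime:
	fixes D :: "int set"
	assumes q: "prime q" and D: "D \<subseteq> {1..<int q}" and j: "\<not> int q dvd j"
	shows "inj_on (\<lambda>h. j * h mod int q) D" "(\<lambda>h. j * h mod int q) ` D \<subseteq> {1..<int q}"
proof -
	have cop: "coprime j (int q)" using prime_imp_coprime[of "int q" j] q j by (simp add: coprime_commute)
	show "inj_on (\<lambda>h. j * h mod int q) D"
	proof (rule inj_onI)
		fix h h' assume h: "h \<in> D" "h' \<in> D" "j * h mod int q = j * h' mod int q"
		then have "[h = h'] (mod int q)" using cong_mult_lcancel[OF cop] by (simp add: cong_def)
		moreover have "h \<in> {1..<int q}" "h' \<in> {1..<int q}" using h D by auto
		ultimately show "h = h'" by (simp add: cong_def)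
	qed
	have "j * h mod int q \<in> {1..<int q}" if "h \<in> D" for h
	proof -
		have "\<not> int q dvd h" using that D zdvd_not_zless by fastforce
		then have "j * h mod int q ~= 0" using q j by (simp add: dvd_eq_mod_eq_0[symmetric] prime_dvd_mult_iff)
		moreover have "0 \<le> j * h mod int q" "j * h mod int q < int q" using prime_gt_0_nat[OF q] by simp_all
		ultimately show ?thesis by simp
	qed
	then show "(\<lambda>h. j * h mod int q) ` D \<subseteq> {1..<int q}" by auto
qed

text \<open>Lagrange's theorem, by comparing the product of all elements before and after
  multiplication by \<open>k\<close>.\<close>

lemma subgroup_power:
	fixes D :: "int set"
	assumes q: "prime q" and D: "D \<subseteq> {1..<int q}" "\<And>k h. k \<in> D ==> h \<in> D ==> k * h mod int q \<in> D"
		and k: "k \<in> D"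
	shows "[k ^ card D = 1] (mod int q)"
proof -
	have nd: "\<not> int q dvd h" if "h \<in> D" for h using that D(1) zdvd_not_zless by fastforce
	note inj = mult_mod_prime(1)[OF q D(1) nd[OF k]]
	have "(\<lambda>h. k * h mod int q) ` D = D" using finite_subset[OF D(1)] inj by (intro endo_inj_surj) (use D(2)[OF k] in auto)
	then have "(\<Prod>h\<in>D. h) = (\<Prod>h\<in>(\<lambda>h. k * h mod int q) ` D. h)" by simp
	also have "... = (\<Prod>h\<in>D. k * h mod int q)" by (subst prod.reindex[OF inj]) simp
	also have "[... = (\<Prod>h\<in>D. k * h)] (mod int q)" by (rule cong_prod) simp
	also have "(\<Prod>h\<in>D. k * h) = k ^ card D * (\<Prod>h\<in>D. h)" by (simp add: prod.distrib)
	finally have "[1 * (\<Prod>h\<in>D. h) = k ^ card D * (\<Prod>h\<in>D. h)] (mod int q)" by simp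
	moreover have "coprime (\<Prod>h\<in>D. h) (int q)"
		by (rule prod_coprime_left) (use nd prime_imp_coprime[of "int q"] q in \<open>auto simp: coprime_commute\<close>)
	ultimately have "[1 = k ^ card D] (mod int q)" using cong_mult_rcancel by blast
	then show ?thesis by (rule cong_sym)
qed

text \<open>The translate of \<open>D\<close> by \<open>j\<close> is disjoint from \<open>D\<close>
  and has the same size.\<close>

lemma proper_subgroup_card:
	fixes D :: "int set"
	assumes q: "prime q" and D: "D \<subseteq> {1..<int q}"
		and j: "\<not> int q dvd j" "\<And>h. h \<in> D ==> j * h mod int q \<notin> D"
	shows "2 * card D \<le> q - 1"
proof -
	let ?J = "(\<lambda>h. j * h mod int q) ` D"
	note m = mult_mod_prime[OF q D j(1)]
	have "D \<inter> ?J = {}" using j(2) by auto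
	then have "card (D \<union> ?J) = 2 * card D" using card_image[OF m(1)] finite_subset[OF D] by (simp add: card_Un_disjoint)
	moreover have "card (D \<union> ?J) \<le> card {1..<int q}" using m(2) D by (intro card_mono) auto
	ultimately show ?thesis by simp
qed

subsection \<open>Incomplete orbits of local multipliers\<close>

context nonunit_socle
begin

text \<open>A unit acting as \<open>k\<close> on the subgroup of order \<open>l\<close> and
  trivially on the component modulo \<open>r\<close>. Its residue modulo \<open>L ^ a\<close> is
  otherwise free; \<open>T_agree\<close> shows that membership in \<open>T\<close> does not depend
  on it.\<close>

definition nu :: "int => int" where
	"nu k = (SOME m. coprime m N \<and> [m = k] (mod L) \<and> [m = 1] (mod r))"

lemma nu:
	assumes "\<not> L dvd k"
	shows "coprime (nu k) N" "[nu k = k] (mod L)" "[nu k = 1] (mod r)"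
proof -
	obtain m where "coprime m N" "[m = k] (mod L ^ a)" "[m = 1] (mod r)" using unit_lift[OF assms, of 1] by auto
	moreover from this have "[m = k] (mod L)" using a_pos by (meson cong_dvd_modulus dvd_power)
	ultimately have "\<exists>m. coprime m N \<and> [m = k] (mod L) \<and> [m = 1] (mod r)" by blast
	from someI_ex[OF this] show "coprime (nu k) N" "[nu k = k] (mod L)" "[nu k = 1] (mod r)" by (simp_all add: nu_def)
qed

lemma nu_cong: "[k = k'] (mod L) ==> nu k = nu k'" by (simp add: nu_def cong_def)

text \<open>Divisibility of \<open>T1\<close> by \<open>L ^ (a - 1)\<close> makes such a unit fix
  every element of \<open>T1\<close>, and a unit mapping one element of a basic set into that set
  preserves the whole set.\<close>

lemma T_inv:
	assumes "coprime m N" "[m = 1] (mod L)" "[m = 1] (mod r)" "x \<in> T"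
	shows "m * x \<in> T"
proof -
	obtain t where t: "t \<in> T1" using T1_ne by blast
	have "coprime L r" using prime_imp_coprime[OF L_prime r] .
	then have "L * r dvd m - 1" using assms(2,3) by (simp add: cong_iff_dvd_diff divides_mult)
	then have "(L * r) * L ^ (a - 1) dvd (m - 1) * t" using A[OF t] by (rule mult_dvd_mono)
	moreover have "(L * r) * L ^ (a - 1) = N" using a_pos by (simp add: N_eq power_eq_if)
	ultimately have "N dvd m * t - t" by (simp add: left_diff_distrib)
	then have "m * t \<in> T" using T_cong T1_T[OF t] by blast
	then show ?thesis using mT assms(1,4) T1_T[OF t] by blast
qed

lemma T_agree:
	assumes "coprime m N" "coprime m' N" "[m = m'] (mod L)" "[m = 1] (mod r)" "[m' = 1] (mod r)" "m' * z \<in> T"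
	shows "m * z \<in> T"
proof -
	obtain i where i: "[m' * i = 1] (mod N)" using assms(2) cong_solve_coprime_int by blast
	have "coprime i N" using i by (metis cong_imp_coprime cong_sym coprime_1_left coprime_mult_left_iff)
	have "L dvd N" using N_p by simp
	moreover have "r dvd N" using N_eq by simp
	ultimately have iL: "[m' * i = 1] (mod L)" "[m' * i = 1] (mod r)" using i cong_dvd_modulus by blast+
	have "[m * i = 1] (mod L)" using cong_mult[OF assms(3) cong_refl[of i]] iL(1) cong_trans by blast
	moreover have "[m * i = m' * i] (mod r)" using assms(4,5) by (meson cong_mult cong_refl cong_sym cong_trans)
	then have "[m * i = 1] (mod r)" using iL(2) cong_trans by blast
	ultimately have "(m * i) * (m' * z) \<in> T" using T_inv assms(1,6) \<open>coprime i N\<close> by simp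
	moreover have "N dvd (m' * i - 1) * (m * z)" using i by (simp add: cong_iff_dvd_diff)
	then have "N dvd (m * i) * (m' * z) - m * z" by (simp add: algebra_simps)
	ultimately show ?thesis using T_cong by blast
qed

lemma nu_T:
	assumes "coprime m N" "[m = k] (mod L)" "[m = 1] (mod r)"
	shows "m * z \<in> T \<longleftrightarrow> nu k * z \<in> T"
proof -
	have "coprime m L" using assms(1) by (simp add: N_p)
	then have "\<not> L dvd k" using assms(2) by (metis cong_dvd_iff coprime_common_divisor dvd_refl not_prime_unit L_prime)
	note nu = nu[OF this]
	show ?thesis using T_agree[OF assms(1) nu(1) _ assms(3) nu(3)] T_agree[OF nu(1) assms(1) _ nu(3) assms(3)]
			assms(2) nu(2) by (meson cong_sym cong_trans)
qed

lemma nu_mult: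
	assumes "\<not> L dvd j" "\<not> L dvd k"
	shows "nu j * (nu k * z) \<in> T \<longleftrightarrow> nu (j * k) * z \<in> T" using nu_T[of "nu j * nu k" "j * k" z] nu[OF assms(1)] nu[OF assms(2)]
		cong_mult[of "nu j" 1 r "nu k" 1] by (simp add: cong_mult mult.assoc)

lemma nu_p: "\<not> L dvd k ==> N dvd nu k * (p * x) - k * (p * x)"
proof -
	assume k: "\<not> L dvd k"
	have "L dvd nu k - k" using nu[OF k] by (simp add: cong_iff_dvd_diff)
	then have "L * p dvd (nu k - k) * (p * x)" by (intro mult_dvd_mono) auto
	then show ?thesis by (simp add: N_p left_diff_distrib)
qed

lemma nu_v: "\<not> L dvd k ==> v dvd b ==> N dvd nu k * b - b"
proof -
	assume k: "\<not> L dvd k" and "v dvd b"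
	then have "L ^ a dvd b" using La_v dvd_trans by blast
	moreover have "r dvd nu k - 1" using nu[OF k] by (simp add: cong_iff_dvd_diff)
	ultimately have "r * L ^ a dvd (nu k - 1) * b" by (intro mult_dvd_mono)
	then have "N dvd (nu k - 1) * b" by (metis N_eq mult.commute)
	then show ?thesis by (simp add: left_diff_distrib)
qed

lemma nu_div: "\<not> L dvd k ==> vp dvd nu k * z \<longleftrightarrow> vp dvd z"
proof -
	assume k: "\<not> L dvd k"
	have "vp dvd N" using v_pos(2) by (simp add: v_vp dvd_mult_right)
	then have "coprime vp (nu k)" using nu(1)[OF k] by (meson coprime_commute coprime_divisors dvd_refl)
	then show ?thesis by (simp add: coprime_dvd_mult_right_iff)
qed

definition Hl :: "int => int set" where
	"Hl t = {h \<in> {0..<L}. \<not> L dvd h \<and> nu h * t \<in> T}"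

lemma finite_Hl: "finite (Hl t)" by (rule finite_subset[of _ "{0..<L}"]) (auto simp: Hl_def)

end

text \<open>The residues \<open>h\<close> with \<open>nu h * t1\<close> in \<open>T\<close> form a
  subgroup of order \<open>d\<close> in the units modulo \<open>l\<close>, and \<open>j0\<close>
  witnesses that it is proper, whence \<open>d \<le> e\<close>. As \<open>d + e = l - 1\<close>, the
  power \<open>j ^ e\<close> is inverse to \<open>j ^ d\<close> for units \<open>j\<close>.\<close>

locale incomplete_orbit = nonunit_socle +
	fixes t1 j0 :: int and d e :: nat
	assumes t1: "t1 \<in> T1"
		and j0: "\<not> int l dvd j0" "nu j0 * t1 \<notin> T"
		and d_def: "d = card (Hl t1)"
		and e_def: "e = l - 1 - d"
begin

abbreviation "H \<equiv> Hl t1"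

lemma H_stab:
	assumes "h \<in> H" "\<not> L dvd k"
	shows "nu (h * k) * t1 \<in> T \<longleftrightarrow> nu k * t1 \<in> T"
proof -
	have h: "\<not> L dvd h" "nu h * t1 \<in> T" using assms(1) by (auto simp: Hl_def)
	have *: "coprime (nu h) N" "coprime (nu k) N" using nu h assms by auto
	show ?thesis
	proof
		assume "nu k * t1 \<in> T"
		then have "nu h * (nu k * t1) \<in> T" using mT[OF *(1) T1_T[OF t1] h(2)] by blast
		then show "nu (h * k) * t1 \<in> T" using nu_mult[OF h(1) assms(2)] by simp
	next
		assume "nu (h * k) * t1 \<in> T"
		then have "nu k * (nu h * t1) \<in> T" using nu_mult[OF assms(2) h(1)] by (simp add: mult.commute)
		then show "nu k * t1 \<in> T" using mT[OF *(2) h(2)] T1_T[OF t1] by blast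
	qed
qed

lemma nu_mod: "nu (k mod L) = nu k" by (rule nu_cong) simp

lemma H_sub: "H \<subseteq> {1..<L}" by (auto simp: Hl_def) (metis dvd_0_right int_one_le_iff_zero_less le_less)

lemma H_power:
	assumes k: "k \<in> H"
	shows "[k ^ d = 1] (mod L)" unfolding d_def
proof (rule subgroup_power[OF prime H_sub _ k])
	fix k h assume "k \<in> H" "h \<in> H"
	then show "k * h mod L \<in> H" using H_stab[of k h] L_prime L_gt by (auto simp: Hl_def nu_mod prime_dvd_mult_iff dvd_mod_iff)
qed

lemma H_1: "1 \<in> H"
proof -
	have "\<not> L dvd 1" using L_gt by simp
	have "1 * t1 \<in> T \<longleftrightarrow> nu 1 * t1 \<in> T" by (rule nu_T) auto
	then show ?thesis using T1_T[OF t1] L_gt \<open>\<not> L dvd 1\<close> by (simp add: Hl_def)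
qed

lemma d_bounds: "d > 0" "d \<le> e" "d + e = l - 1" "e > 0" "e < l - 1" "\<not> L dvd int d"
proof -
	have fin: "finite H" by (rule finite_Hl)
	then show d0: "d > 0" using H_1 by (auto simp: d_def card_gt_0_iff)
	have "2 * d \<le> l - 1" unfolding d_def
	proof (rule proper_subgroup_card[OF prime H_sub j0(1)])
		fix h assume h: "h \<in> H"
		show "j0 * h mod L \<notin> H" using H_stab[OF h j0(1)] j0(2) by (auto simp: Hl_def nu_mod mult.commute)
	qed
	then show "d \<le> e" "d + e = l - 1" "e > 0" "e < l - 1" using d0 by (auto simp: e_def)
	then have "d < l" by simp
	then show "\<not> L dvd int d" using d0 by (auto dest: dvd_imp_le)
qed

text \<open>The component of the indicator of \<open>T\<close> that transforms by a power character
  under the local multipliers. With the exponent \<open>d\<close>, the nonzero terms at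
  \<open>t1\<close> are all 1 modulo \<open>l\<close> and add up to \<open>d\<close>, which is prime
  to \<open>l\<close>.\<close>

definition psi :: "int => int" where
	"psi z = rsum L (\<lambda>k. (k mod L) ^ d * of_bool (\<not> L dvd k \<and> nu k * z \<in> T))"

lemma psi_I: "psi \<in> I"
proof -
	have "(\<lambda>z. (k mod L) ^ d * of_bool (\<not> L dvd k \<and> nu k * z \<in> T)) \<in> I" for k
	proof (cases "L dvd k")
		case False
		then show ?thesis using I_map[OF I_mult[OF asetT[unfolded I_ind] nu(1)[OF False]], of "\<lambda>b. (k mod L) ^ d * b"]
			by (simp add: ind_def)
	qed (simp add: I_const)
	then show ?thesis unfolding psi_def[abs_def] by (rule I_sum)
qed

lemma psi_per: "per N psi" by (rule I_per[OF psi_I])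

text \<open>Substitution of \<open>j * k\<close> for \<open>k\<close> in the defining sum.\<close>

lemma psi_nu:
	assumes j: "\<not> L dvd j"
	shows "[j ^ d * psi (nu j * z) = psi z] (mod L)"
proof -
	let ?G = "\<lambda>z k. (k mod L) ^ d * of_bool (\<not> L dvd k \<and> nu k * z \<in> T)"
	have cop: "coprime j L" using prime_imp_coprime[OF L_prime j] by (simp add: coprime_commute)
	have "per L (?G z)"
	proof (rule perI)
		fix x y assume d: "L dvd x - y"
		then have "x mod L = y mod L" by (simp add: mod_eq_dvd_iff)
		moreover from this have "nu x = nu y" by (intro nu_cong) (simp add: cong_def)
		moreover have "L dvd x \<longleftrightarrow> L dvd y" using d by (rule dvd_iff_diff)
		ultimately show "?G z x = ?G z y" by simp
	qed
	then have 1: "psi z = rsum L (\<lambda>k. ?G z (j * k))" unfolding psi_def using rsum_unit[OF _ _ cop, of "?G z"] L_gt by simp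
	have 2: "[rsum L (\<lambda>k. ?G z (j * k)) = rsum L (\<lambda>k. j ^ d * ?G (nu j * z) k)] (mod L)"
	proof (rule cong_sum)
		fix k
		have eq: "\<not> L dvd j * k \<and> nu (j * k) * z \<in> T \<longleftrightarrow> \<not> L dvd k \<and> nu k * (nu j * z) \<in> T"
			using L_prime j nu_mult[of k j z] by (auto simp: prime_dvd_mult_iff mult.commute)
		have "[(j * k mod L) ^ d = (j * (k mod L)) ^ d] (mod L)" by (rule cong_pow) (simp add: cong_def mod_mult_right_eq)
		then show "[?G z (j * k) = j ^ d * ?G (nu j * z) k] (mod L)" unfolding eq by (simp add: power_mult_distrib cong_mult)
	qed
	have 3: "rsum L (\<lambda>k. j ^ d * ?G (nu j * z) k) = j ^ d * psi (nu j * z)" by (simp add: psi_def sum_distrib_left)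
	show ?thesis using 2 unfolding 1[symmetric] 3 by (rule cong_sym)
qed

lemma psi_t1: "\<not> L dvd psi t1"
proof -
	have "psi t1 = (\<Sum>k\<in>{0..<L}. if k \<in> H then k ^ d else 0)" unfolding psi_def by (intro sum.cong) (auto simp: Hl_def)
	also have "... = (\<Sum>k\<in>H. k ^ d)" by (subst sum.inter_restrict[symmetric]) (auto simp: Hl_def intro!: sum.cong)
	also have "[... = (\<Sum>k\<in>H. 1)] (mod L)" by (rule cong_sum) (rule H_power)
	finally have "[psi t1 = int d] (mod L)" by (simp add: d_def)
	then show ?thesis using d_bounds(6) cong_dvd_iff by blast
qed

lemma psi_v: "v dvd b ==> psi b = 0"
proof -
	assume "v dvd b"
	then have "nu k * b \<notin> T" for k using T_not_v dvd_mult by blast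
	then show ?thesis by (simp add: psi_def)
qed

text \<open>On the coset of \<open>b\<close> by the subgroup of order \<open>l\<close>, the unit
  \<open>nu j\<close> fixes \<open>b\<close> and multiplies the other coordinate by
  \<open>j\<close>. Hence \<open>psi\<close> is homogeneous of degree \<open>- d\<close>, that is,
  of degree \<open>e\<close>.\<close>

lemma psi_vp: "v dvd b ==> [psi (b + p * j) = j ^ e * psi (b + p)] (mod L)"
proof (cases "L dvd j")
	case True
	assume b: "v dvd b"
	have "N dvd (b + p * j) - b" using True by (auto simp: N_p mult.commute[of p])
	then have "psi (b + p * j) = 0" using psi_v[OF b] per_cong[OF psi_per] by metis
	moreover have "L dvd j ^ e" using True d_bounds(4) by (simp add: dvd_power_same prime_dvd_power_iff[OF L_prime])
	then have "[j ^ e * psi (b + p) = 0] (mod L)" by (simp add: cong_0_iff)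
	ultimately show ?thesis using cong_sym by metis
next
	case False
	assume b: "v dvd b"
	have "N dvd (nu j * b - b) + (nu j * (p * 1) - j * (p * 1))" by (intro dvd_add nu_v nu_p False b)
	then have "N dvd nu j * (b + p) - (b + p * j)" by (simp add: algebra_simps)
	then have "psi (b + p * j) = psi (nu j * (b + p))" using per_cong[OF psi_per] by metis
	then have "[j ^ d * psi (b + p * j) = psi (b + p)] (mod L)" using psi_nu[OF False] by simp
	then have "[j ^ e * (j ^ d * psi (b + p * j)) = j ^ e * psi (b + p)] (mod L)" by (intro cong_mult cong_refl)
	moreover have "j ^ e * (j ^ d * x) = j ^ (l - 1) * x" for x using d_bounds(3) by (metis add.commute mult.assoc power_add)
	moreover have "[j ^ (l - 1) * psi (b + p * j) = 1 * psi (b + p * j)] (mod L)"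
	proof (rule cong_mult[OF _ cong_refl])
		have "[j * j ^ (l - 1) = j * 1] (mod L)"
			using fermat_cong[OF prime, of j] prime_gt_0_nat[OF prime] by (simp add: power_eq_if)
		moreover have "coprime j L" using prime_imp_coprime[OF L_prime False] by (simp add: coprime_commute)
		ultimately show "[j ^ (l - 1) = 1] (mod L)" using cong_mult_lcancel by blast
	qed
	ultimately show ?thesis by (metis cong_sym cong_trans mult_1)
qed

lemma vp_dvd_p: "vp dvd p" using w_r by (simp add: vp_w p_def mult_dvd_mono)

lemma psi_not_vp:
	assumes "\<not> vp dvd z" "p dvd x"
	shows "psi (z + x) = psi z"
proof -
	have *: "nu k * (z + x) \<in> T \<longleftrightarrow> nu k * z \<in> T" if "\<not> L dvd k" for k
	proof -
		have s: "y + x' \<in> T" if "y \<in> T" "\<not> vp dvd y" "p dvd x'" for y x' using T2_shift[of y x'] that vp_T1 by blast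
		have "\<not> vp dvd nu k * z" using nu_div[OF that] assms(1) by simp
		moreover have "\<not> vp dvd nu k * (z + x)" using nu_div[OF that] assms vp_dvd_p by (metis dvd_add_left_iff dvd_trans)
		moreover have "p dvd nu k * x" "p dvd - (nu k * x)" using assms(2) by auto
		ultimately show ?thesis using s[of "nu k * z" "nu k * x"] s[of "nu k * (z + x)" "- (nu k * x)"]
			by (auto simp: distrib_left)
	qed
	show ?thesis unfolding psi_def by (rule sum.cong[OF refl]) (use * in auto)
qed

text \<open>Off \<open>vp\<close> the function is constant on the coset, which has \<open>l\<close>
  elements; on \<open>vp\<close> the sum is a multiple of the power sum of exponent
  \<open>e\<close>, and \<open>0 < e < l - 1\<close>.\<close>

lemma psi_coset: "L dvd rsum L (\<lambda>j. psi (z + p * j))"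
proof (cases "vp dvd z")
	case False
	then have "rsum L (\<lambda>j. psi (z + p * j)) = rsum L (\<lambda>j. psi z)" using psi_not_vp by simp
	then show ?thesis by simp
next
	case True
	then obtain b where b: "v dvd b" "p dvd z - b" using split_vp by blast
	then obtain i where i: "z = b + p * i" by (metis add.commute diff_eq_eq dvdE)
	have "per L (\<lambda>j. psi (b + p * j))"
	proof (rule perI)
		fix x y assume "L dvd x - y"
		then have "N dvd (b + p * x) - (b + p * y)" by (simp add: N_p right_diff_distrib[symmetric] mult.commute[of L])
		then show "psi (b + p * x) = psi (b + p * y)" using per_cong[OF psi_per] by blast
	qed
	then have "rsum L (\<lambda>j. psi (b + p * (j + i))) = rsum L (\<lambda>j. psi (b + p * j))"
		using L_gt by (intro rsum_shift[of L "\<lambda>j. psi (b + p * j)" i]) auto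
	then have "rsum L (\<lambda>j. psi (z + p * j)) = rsum L (\<lambda>j. psi (b + p * j))" by (simp add: i algebra_simps)
	also have "[... = rsum L (\<lambda>j. j ^ e * psi (b + p))] (mod L)" by (rule cong_sum) (rule psi_vp[OF b(1)])
	also have "rsum L (\<lambda>j. j ^ e * psi (b + p)) = (\<Sum>k<l. int k ^ e) * psi (b + p)" by (simp add: rsum_int sum_distrib_right)
	finally have "[rsum L (\<lambda>j. psi (z + p * j)) = (\<Sum>k<l. int k ^ e) * psi (b + p)] (mod L)" .
	moreover have "L dvd (\<Sum>k<l. int k ^ e)" using d_bounds by (intro psum_small[OF prime]) auto
	ultimately show ?thesis using cong_dvd_iff by (metis dvd_mult2)
qed

end

lemma conv_invariant_dvd:
	assumes "p > 0" "L > 0" "N = L * p" "per N f" "per N g"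
		and g: "\<And>z j. g (z + p * j) = g z"
		and f: "\<And>z. m dvd rsum L (\<lambda>j. f (z + p * j))"
	shows "m dvd conv N f g z"
proof -
	have "per N (\<lambda>y. f y * g (z - y))" using assms(4,5) by (auto simp: per_iff dvd_diff_commute)
	then have "conv N f g z = rsum p (\<lambda>y. rsum L (\<lambda>j. f (y + p * j) * g (z - (y + p * j))))"
		unfolding conv_def assms(3) using rsum_split[OF assms(1,2)] by simp
	also have "g (z - (y + p * j)) = g (z - y)" for y j using g[of "z - y" "- j"] by (simp add: algebra_simps)
	then have "rsum p (\<lambda>y. rsum L (\<lambda>j. f (y + p * j) * g (z - (y + p * j))))
			= rsum p (\<lambda>y. rsum L (\<lambda>j. f (y + p * j)) * g (z - y))" by (simp add: sum_distrib_right)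
	finally show ?thesis using f by (simp add: dvd_sum)
qed

context incomplete_orbit
begin

text \<open>Modulo \<open>l\<close>, the convolution square of \<open>psi\<close> is supported on
  \<open>vp\<close>, hence on \<open>v\<close> by \<open>support\<close>. At the points
  \<open>v * s + p\<close>, which are outside \<open>v\<close>, it is a nonzero constant times a
  convolution square on a cyclic group of order prime to \<open>l\<close>. Modulo \<open>l\<close>
  the group ring of such a group has no nilpotent elements, so \<open>psi\<close> would vanish at
  \<open>t1\<close>.\<close>

lemma False_orbit: False
proof -
	\<comment> \<open>\<open>f2\<close> is constant on cosets of the subgroup of order
	  \<open>l\<close>, and the coset sums of \<open>f1\<close> and \<open>f2\<close> vanish modulo
	  \<open>l\<close>; so only the product of \<open>f1\<close> with itself survives.\<close>
	define f1 where "f1 = (\<lambda>z. of_bool (vp dvd z) * psi z)"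
	define f2 where "f2 = (\<lambda>z. of_bool (\<not> vp dvd z) * psi z)"
	have vpN: "vp dvd N" using v_pos(2) by (simp add: v_vp dvd_mult_right)
	have vp_shift: "vp dvd z + p * j \<longleftrightarrow> vp dvd z" for z j using vp_dvd_p by (metis dvd_add_left_iff dvd_mult2)
	have "vp dvd x + N \<longleftrightarrow> vp dvd x" for x using vpN by (simp add: dvd_add_left_iff)
	then have per12: "per N f1" "per N f2" unfolding f1_def f2_def using psi_per by (simp_all add: per_def)
	have L0: "L > 0" using L_gt by simp
	have psi12: "psi = (\<lambda>z. f1 z + f2 z)" by (auto simp: f1_def f2_def)
	have f2_inv: "f2 (z + p * j) = f2 z" for z j using psi_not_vp vp_shift by (auto simp: f2_def)
	have f1_coset: "L dvd rsum L (\<lambda>j. f1 (z + p * j))" for z using psi_coset[of z] vp_shift by (simp add: f1_def)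
	have f2_coset: "L dvd rsum L (\<lambda>j. f2 (z + p * j))" for z using f2_inv by simp
	have "conv N psi psi z = conv N f1 f1 z + conv N f1 f2 z + conv N f2 f1 z + conv N f2 f2 z" for z
		by (simp add: psi12 conv_def distrib_left distrib_right sum.distrib)
	moreover have "L dvd conv N f1 f2 z" "L dvd conv N f2 f2 z" for z
		using conv_invariant_dvd[OF p_pos L0 N_p] per12 f2_inv f1_coset f2_coset by blast+
	moreover have "conv N f2 f1 = conv N f1 f2" using conv_commute N_pos per12 by blast
	ultimately have c1: "[conv N psi psi z = conv N f1 f1 z] (mod L)" for z by (simp add: cong_iff_dvd_diff)
	let ?c = "\<lambda>z. conv N psi psi z mod L"
	have cI: "?c \<in> I" by (rule I_map[OF I_conv[OF psi_I psi_I]])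
	have c_supp: "vp dvd z" if "?c z ~= 0" for z
	proof (rule ccontr)
		assume nz: "\<not> vp dvd z"
		have "f1 y * f1 (z - y) = 0" for y using nz dvd_add[of vp y "z - y"] by (auto simp: f1_def)
		then have "conv N f1 f1 z = 0" unfolding conv_def by (intro sum.neutral) blast
		then show False using c1[of z] that by (simp add: cong_def)
	qed
	obtain u where u: "r = w * u" using w_r by (auto elim: dvdE)
	have upos: "u > 0" using r_pos vp_pos L_gt by (simp add: u vp_w zero_less_mult_iff)
	have Nvu: "N = v * u" by (metis N_eq u v_w mult.assoc)
	have puv: "p = vp * u" by (simp add: p_def u vp_w)
	have cu: "coprime L u" using prime_imp_coprime[OF L_prime, of u] r u dvd_mult by blast
	define al where "al = (\<lambda>x. psi (v * x + p))"
	have al_per: "per u al"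
		unfolding al_def by (intro perI per_cong[OF psi_per]) (simp add: Nvu right_diff_distrib[symmetric])
	\<comment> \<open>Arises from distributing the coordinate 1 of \<open>v * s + p\<close> along the
	  subgroup of order \<open>l\<close> over the two factors; it is prime to \<open>l\<close> by
	  \<open>beta_sum\<close>.\<close>
	define K where "K = rsum L (\<lambda>j. j ^ e * (1 - j) ^ e)"
	have K: "\<not> L dvd K" unfolding K_def using d_bounds by (intro beta_sum[OF prime]) auto
	have val: "[conv N f1 f1 (v * s + p) = K * conv u al al s] (mod L)" for s
	proof -
		let ?F = "\<lambda>y. psi y * psi (v * s + p - y)"
		let ?G = "\<lambda>x. ?F (vp * x)"
		have F: "f1 y * f1 (v * s + p - y) = of_bool (vp dvd y) * ?F y" for y
		proof -
			have "vp dvd v * s + p" using vp_dvd_p by (simp add: v_vp)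
			then have "vp dvd v * s + p - y \<longleftrightarrow> vp dvd y" by (metis dvd_diff_right_iff)
			then show ?thesis by (simp add: f1_def)
		qed
		have Gper: "per (L * u) ?G"
		proof (rule perI)
			fix x y assume "L * u dvd x - y"
			then have "vp * (L * u) dvd vp * (x - y)" by (rule mult_dvd_mono[OF dvd_refl])
			then have d: "N dvd vp * x - vp * y" by (simp add: Nvu v_vp right_diff_distrib ac_simps)
			then have "N dvd (v * s + p - vp * x) - (v * s + p - vp * y)" by (simp add: dvd_diff_commute)
			then show "?G x = ?G y" using d per_cong[OF psi_per] by metis
		qed
		have "conv N f1 f1 (v * s + p) = rsum (vp * (L * u)) (\<lambda>y. of_bool (vp dvd y) * ?F y)"
			unfolding conv_def F by (simp add: Nvu v_vp ac_simps)
		also have "... = rsum (L * u) ?G" by (rule rsum_multiples[OF vp_pos])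
		also have "... = rsum u (\<lambda>x. rsum L (\<lambda>j. ?G (x + u * j)))" by (rule rsum_split[OF upos L0 Gper])
		\<comment> \<open>Since \<open>u\<close> is prime to \<open>l\<close>, \<open>L * i\<close> runs
		  through all residues modulo \<open>u\<close>; with this choice \<open>vp * (L * i)\<close> is
		  the multiple \<open>v * i\<close> of \<open>v\<close>.\<close>
		also have "... = rsum u (\<lambda>i. rsum L (\<lambda>j. ?G (L * i + u * j)))"
		proof -
			have "per u (\<lambda>x. rsum L (\<lambda>j. ?G (x + u * j)))" unfolding per_def
			proof
				fix x
				have "per L (\<lambda>j. ?G (x + u * j))"
				proof (rule perI)
					fix y y' assume "L dvd y - y'"
					then have "L * u dvd (x + u * y) - (x + u * y')" by (simp add: right_diff_distrib[symmetric] mult.commute[of L])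
					then show "?G (x + u * y) = ?G (x + u * y')" by (rule per_cong[OF Gper])
				qed
				from rsum_shift[OF L0 this, of 1]
				have "rsum L (\<lambda>j. ?G (x + u * (j + 1))) = rsum L (\<lambda>j. ?G (x + u * j))" .
				moreover have "x + u + u * j = x + u * (j + 1)" for j by (simp add: distrib_left)
				ultimately show "rsum L (\<lambda>j. ?G (x + u + u * j)) = rsum L (\<lambda>j. ?G (x + u * j))" by (simp only:)
			qed
			from rsum_unit[OF upos this cu] show ?thesis by simp
		qed
		also have "... = rsum u (\<lambda>i. rsum L (\<lambda>j. psi (v * i + p * j) * psi (v * (s - i) + p * (1 - j))))"
			by (simp add: puv v_vp algebra_simps)
		finally have 1: "conv N f1 f1 (v * s + p) = ..." .
		have 2: "[rsum u (\<lambda>i. rsum L (\<lambda>j. psi (v * i + p * j) * psi (v * (s - i) + p * (1 - j))))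
				= rsum u (\<lambda>i. rsum L (\<lambda>j. (j ^ e * al i) * ((1 - j) ^ e * al (s - i))))] (mod L)"
			unfolding al_def by (intro cong_sum cong_mult psi_vp) auto
		have 3: "rsum u (\<lambda>i. rsum L (\<lambda>j. (j ^ e * al i) * ((1 - j) ^ e * al (s - i)))) = K * conv u al al s"
		proof -
			have "rsum L (\<lambda>j. (j ^ e * al i) * ((1 - j) ^ e * al (s - i))) = K * (al i * al (s - i))" for i
				unfolding K_def sum_distrib_right by (simp add: ac_simps)
			then show ?thesis unfolding conv_def sum_distrib_left by simp
		qed
		show ?thesis using 2 unfolding 1[symmetric] 3 .
	qed
	have al0: "L dvd conv u al al s" for s
	proof -
		have "?c (v * s + p) = 0"
		proof (rule ccontr)
			assume "?c (v * s + p) ~= 0"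
			then have "v dvd v * s + p" using support[OF cI c_supp] by blast
			then have "v dvd p" by (metis dvd_add_right_iff dvd_triv_left)
			then have "vp * L dvd vp * u" by (metis puv v_vp mult.commute)
			then have "L dvd u" using vp_pos by simp
			then show False using cu L_prime by (metis coprime_common_divisor dvd_refl not_prime_unit)
		qed
		then have "L dvd K * conv u al al s"
			using c1[of "v * s + p"] val[of s] by (metis cong_0_iff cong_def cong_sym cong_trans mod_0)
		then show ?thesis using K L_prime by (simp add: prime_dvd_mult_iff)
	qed
	\<comment> \<open>Vanishing of the square kills the \<open>l\<close>-th power as well. That power
	  is the Frobenius image of \<open>al\<close>, and multiplication by \<open>l\<close> is invertible
	  modulo \<open>u\<close>.\<close>
	have "L dvd convpow u al l s" for s
	proof -
		obtain n where n: "l = Suc (Suc n)" using prime_gt_1_nat[OF prime] by (metis Suc_lessE less_imp_Suc_add add_0 One_nat_def)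
		have "convpow u al l = conv u (conv u al al) (convpow u al n)"
			using conv_assoc[OF upos al_per al_per per_convpow[OF al_per]] by (simp add: n)
		moreover have "[conv u (conv u al al) (convpow u al n) s = conv u (\<lambda>_. 0) (convpow u al n) s] (mod L)"
			using al0 by (intro conv_cong) (auto simp: cong_0_iff)
		ultimately show ?thesis by (simp add: conv_def cong_0_iff)
	qed
	then have fr: "L dvd frob u L al s" for s using convpow_prime[OF upos al_per prime, of s] cong_dvd_iff by blast
	obtain m where m: "[m * L = 1] (mod u)" using cu by (metis cong_solve_coprime_int mult.commute)
	have al_zero: "L dvd al x" for x
	proof -
		have "frob u L al (L * x) = al (m * (L * x))" by (rule frob_unit[OF upos al_per m])
		also have "u dvd (m * L - 1) * x" using m by (simp add: cong_iff_dvd_diff)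
		then have "al (m * (L * x)) = al x" by (intro per_cong[OF al_per]) (simp add: algebra_simps)
		finally show ?thesis using fr by metis
	qed
	obtain b where b: "v dvd b" "p dvd t1 - b" using split_vp[OF vp_T1[OF t1]] by blast
	then obtain j where j: "t1 = b + p * j" by (metis add.commute diff_eq_eq dvdE)
	obtain x where x: "b = v * x" using b by (auto elim: dvdE)
	have "[psi t1 = j ^ e * al x] (mod L)" using psi_vp[OF b(1), of j] by (simp add: j x al_def)
	then show False using psi_t1 al_zero cong_dvd_iff by (metis dvd_mult)
qed

end

context nonunit_socle
begin

lemma full:
	assumes m: "coprime m N" "[m = 1] (mod r)" and x: "x \<in> T"
	shows "m * x \<in> T"
proof (rule ccontr)
	assume n: "m * x \<notin> T"
	obtain t1 where t1: "t1 \<in> T1" using T1_ne by blast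
	have "coprime m L" using m(1) by (simp add: N_p)
	then have nL: "\<not> L dvd m" using L_prime by (metis coprime_common_divisor dvd_refl not_prime_unit)
	have "nu m * t1 \<notin> T"
	proof
		assume "nu m * t1 \<in> T"
		then have "nu m * x \<in> T" using mT[OF nu(1)[OF nL] T1_T[OF t1]] x by blast
		then show False using nu_T[OF m(1) cong_refl m(2)] n by simp
	qed
	then interpret incomplete_orbit N I l a r t0 x0 T v vp p T1 t1 m "card (Hl t1)" "l - 1 - card (Hl t1)"
		using t1 nL by unfold_locales auto
	show False by (rule False_orbit)
qed

lemma tens_socle: "\<exists>c v W. tens T c v W" using full_tens full by blast

end

subsection \<open>Lifting the exponent\<close>

text \<open>Expanding \<open>m ^ k\<close> to first order, the linear terms add up to a multiple of
  \<open>l ^ 2\<close> when \<open>l\<close> is odd; for \<open>l = 2\<close> the sum is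
  \<open>1 + m\<close> and the hypothesis modulo 4 decides.\<close>

lemma geometric_sum_valuation:
	fixes m :: int
	assumes l: "prime l" and m: "int l dvd m - 1" "l = 2 ==> 4 dvd m - 1"
	shows "int l dvd (\<Sum>k<l. m ^ k)" "\<not> int l ^ 2 dvd (\<Sum>k<l. m ^ k)"
proof -
	have l1: "l > 1" by (rule prime_gt_1_nat[OF l])
	have "[(\<Sum>k<l. m ^ k) = int l] (mod int l ^ 2)"
	proof (cases "l = 2")
		case True
		then have "4 dvd m - 1" using m(2) by blast
		then have "4 dvd (1 + m) - 2" by simp
		then show ?thesis using True by (simp add: cong_iff_dvd_diff numeral_2_eq_2)
	next
		case False
		then have "odd l" using l l1 prime_odd_nat by fastforce
		then obtain h where h: "l = 2 * h + 1" by (auto elim: oddE)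
		obtain u where u: "m = 1 + int l * u" using m(1) by (metis add.commute diff_eq_eq dvdE)
		have pw: "[m ^ k = 1 + int k * int l * u] (mod int l ^ 2)" for k
		proof (induction k)
			case (Suc k)
			have "[m * m ^ k = (1 + int l * u) * (1 + int k * int l * u)] (mod int l ^ 2)"
				using Suc by (intro cong_mult) (simp_all add: u)
			moreover have "(1 + int l * u) * (1 + int k * int l * u)
					= 1 + int (Suc k) * int l * u + int l ^ 2 * (int k * u * u)" by (simp add: algebra_simps power2_eq_square)
			ultimately show ?case by (metis cong_add_lcancel_0 cong_mult_self_left cong_trans power_Suc)
		qed simp
		have "2 * (\<Sum>k<n. int k) = int n * (int n - 1)" for n by (induction n) (auto simp: algebra_simps)
		from this[of l] have s: "(\<Sum>k<l. int k) = int l * int h" by (simp add: h)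
		have "(\<Sum>k<l. 1 + int k * int l * u) = int l + int l * u * (\<Sum>k<l. int k)"
			by (simp add: sum.distrib sum_distrib_left ac_simps)
		also have "... = int l + int l ^ 2 * (u * int h)" by (simp add: s power2_eq_square)
		finally have "[(\<Sum>k<l. 1 + int k * int l * u) = int l] (mod int l ^ 2)" by (simp add: cong_iff_dvd_diff)
		moreover have "[(\<Sum>k<l. m ^ k) = (\<Sum>k<l. 1 + int k * int l * u)] (mod int l ^ 2)" by (rule cong_sum) (rule pw)
		ultimately show ?thesis using cong_trans by blast
	qed
	then have d: "int l ^ 2 dvd (\<Sum>k<l. m ^ k) - int l" by (simp add: cong_iff_dvd_diff)
	then have "int l dvd (\<Sum>k<l. m ^ k) - int l" by (rule dvd_trans[rotated]) (simp add: power2_eq_square)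
	then show "int l dvd (\<Sum>k<l. m ^ k)" using dvd_iff_diff[of "int l" "\<Sum>k<l. m ^ k" "int l"] by simp
	have "\<not> int l ^ 2 dvd int l"
	proof
		assume "int l ^ 2 dvd int l"
		then have "l ^ 2 dvd l" by (metis int_dvd_int_iff of_nat_power)
		then show False using l1 by (auto dest!: dvd_imp_le simp: power2_eq_square)
	qed
	then show "\<not> int l ^ 2 dvd (\<Sum>k<l. m ^ k)" using dvd_iff_diff[OF d] by blast
qed

lemma lte_step:
	fixes m :: int
	assumes l: "prime l" and c: "c > 0" "l = 2 ==> c > 1"
		and m: "int l ^ c dvd m - 1" "\<not> int l ^ Suc c dvd m - 1"
	shows "int l ^ Suc c dvd m ^ l - 1" "\<not> int l ^ Suc (Suc c) dvd m ^ l - 1"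
proof -
	let ?S = "\<Sum>k<l. m ^ k"
	have lp: "Factorial_Ring.prime (int l)" using l by simp
	have l0: "int l ~= 0" using l by auto
	have "int l dvd m - 1" using c(1) m(1) by (metis dvd_power dvd_trans)
	moreover have "4 dvd m - 1" if "l = 2"
	proof -
		have "int l ^ 2 dvd int l ^ c" using c(2)[OF that] by (intro le_imp_power_dvd) simp
		then show ?thesis using m(1) that by (auto intro: dvd_trans)
	qed
	ultimately have S: "int l dvd ?S" "\<not> int l ^ 2 dvd ?S" using geometric_sum_valuation[OF l] by blast+
	have eq: "m ^ l - 1 = (m - 1) * ?S" by (rule power_diff_1_eq)
	obtain x where x: "m - 1 = int l ^ c * x" using m(1) by (auto elim: dvdE)
	obtain y where y: "?S = int l * y" using S(1) by (auto elim: dvdE)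
	have nx: "\<not> int l dvd x" using m(2) l0 by (simp add: x)
	have ny: "\<not> int l dvd y" using S(2) l0 by (simp add: y power2_eq_square)
	have e: "m ^ l - 1 = int l ^ Suc c * (x * y)" by (simp add: eq x y)
	show "int l ^ Suc c dvd m ^ l - 1" by (simp add: e)
	have "\<not> int l dvd x * y" using nx ny lp by (simp add: prime_dvd_mult_iff)
	moreover have "int l ^ Suc (Suc c) dvd m ^ l - 1 \<longleftrightarrow> int l ^ Suc c * int l dvd int l ^ Suc c * (x * y)"
		by (simp add: e mult.commute)
	ultimately show "\<not> int l ^ Suc (Suc c) dvd m ^ l - 1" using l0 by (simp del: power_Suc)
qed

text \<open>Each \<open>l\<close>-th power raises the valuation of \<open>m - 1\<close> by exactly
  one, so every valuation from the initial one upwards is attained, in particular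
  \<open>n - 1\<close>.\<close>

lemma lte:
	fixes m :: int
	assumes l: "prime l" and m: "int l dvd m - 1" "l = 2 ==> 4 dvd m - 1" and n: "\<not> int l ^ n dvd m - 1"
	obtains k where "int l ^ (n - 1) dvd m ^ k - 1" "\<not> int l ^ n dvd m ^ k - 1"
proof -
	define c where "c = (GREATEST c. int l ^ c dvd m - 1)"
	have bound: "c < n" if "int l ^ c dvd m - 1" for c using that n by (metis dvd_trans le_imp_power_dvd not_le)
	have "int l ^ 1 dvd m - 1" using m by simp
	then have c: "int l ^ c dvd m - 1"
		unfolding c_def by (rule GreatestI_nat[where b=n]) (use bound in \<open>auto intro: less_imp_le\<close>)
	have le: "c' \<le> c" if "int l ^ c' dvd m - 1" for c'
		unfolding c_def by (rule Greatest_le_nat[where b=n]) (use bound that in \<open>auto intro: less_imp_le\<close>)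
	have nc: "\<not> int l ^ Suc c dvd m - 1" using le by fastforce
	have c0: "c > 0" using le[of 1] m(1) by simp
	have c2: "c > 1" if "l = 2" using le[of 2] m(2)[OF that] that by simp
	have "\<exists>k. int l ^ (c + j) dvd m ^ k - 1 \<and> \<not> int l ^ Suc (c + j) dvd m ^ k - 1" for j
	proof (induction j)
		case 0
		then show ?case using c nc by (intro exI[of _ 1]) simp
	next
		case (Suc j)
		then obtain k where k: "int l ^ (c + j) dvd m ^ k - 1" "\<not> int l ^ Suc (c + j) dvd m ^ k - 1" by blast
		have cj: "c + j > 0" "l = 2 ==> c + j > 1" using c0 c2 by auto
		have "int l ^ Suc (c + j) dvd (m ^ k) ^ l - 1" "\<not> int l ^ Suc (Suc (c + j)) dvd (m ^ k) ^ l - 1"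
			using lte_step[OF l cj k] by blast+
		then show ?case by (intro exI[of _ "k * l"]) (simp add: power_mult)
	qed
	from this[of "n - 1 - c"] show thesis using that bound[OF c] by auto
qed

text \<open>Two commuting involutions whose nontrivial products have no fixed points give orbits of
  four elements, which are removed one at a time.\<close>

lemma klein_four_dvd_card_free:
	assumes "finite A" "\<And>x. x \<in> A ==> s x \<in> A \<and> s (s x) = x" "\<And>x. x \<in> A ==> t x \<in> A \<and> t (t x) = x"
		"\<And>x. x \<in> A ==> s (t x) = t (s x)"
		"\<And>x. x \<in> A ==> s x ~= x \<and> t x ~= x \<and> s (t x) ~= x"
	shows "4 dvd card A" using assms
proof (induction A rule: finite_psubset_induct)
	case (psubset A)
	show ?case
	proof (cases "A = {}")
		case False
		then obtain x where x: "x \<in> A" by blast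
		let ?O = "{x, s x, t x, s (t x)}"
		have O: "?O \<subseteq> A" using x psubset.prems by blast
		have ne: "s x ~= x" "t x ~= x" "s (t x) ~= x" "s x ~= t x" "s (t x) ~= t x" "s (t x) ~= s x" using x psubset.prems by metis+
		then have c: "card ?O = 4" by auto
		have clos: "s y \<in> A - ?O \<and> t y \<in> A - ?O" if "y \<in> A - ?O" for y
			using that x psubset.prems by (smt (verit, del_insts) Diff_iff insert_iff singletonD)
		have "4 dvd card (A - ?O)"
		proof (rule psubset.IH)
			show "A - ?O \<subset> A" using x by blast
		qed (use clos psubset.prems in blast)+
		moreover have "card A = card (A - ?O) + 4" using card_Diff_subset[of ?O A] O c card_mono[OF psubset.hyps O] by simp
		ultimately show ?thesis by simp
	qed simp
qed

lemma klein_four_dvd_card: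
	assumes "finite A" "\<And>x. x \<in> A ==> s x \<in> A \<and> s (s x) = x" "\<And>x. x \<in> A ==> t x \<in> A \<and> t (t x) = x"
		"\<And>x. x \<in> A ==> s (t x) = t (s x)"
	shows "4 dvd card {x \<in> A. s x ~= x \<and> t x ~= x \<and> s (t x) ~= x}" (is "4 dvd card ?D")
proof (rule klein_four_dvd_card_free)
	show "finite ?D" using assms(1) by simp
	fix x assume x: "x \<in> ?D"
	show "s x \<in> ?D \<and> s (s x) = x" "t x \<in> ?D \<and> t (t x) = x" "s (t x) = t (s x)"
		"s x ~= x \<and> t x ~= x \<and> s (t x) ~= x" using x assms(2-4) by (simp_all, metis+)
qed

text \<open>The involutions \<open>x \<mapsto> z - x\<close> and \<open>tau\<close> generate a Klein four-group acting on the
	representations of \<open>z\<close>; only the points with a nontrivial stabiliser count modulo 4.\<close>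

lemma card_representations_mod_4:
	fixes N z :: int and tau :: "int => int"
	assumes N: "N > 0" and A: "\<And>x y. N dvd x - y ==> x \<in> A \<longleftrightarrow> y \<in> A"
		and tau: "\<And>x y. N dvd x - y ==> N dvd tau x - tau y"
		and C: "\<And>x. x \<in> A ==> z - x \<in> A ==>
			tau x \<in> A \<and> z - tau x \<in> A \<and> N dvd tau (tau x) - x \<and> N dvd tau (z - x) - (z - tau x)"
	shows "card {x \<in> {0..<N}. x \<in> A \<and> z - x \<in> A} mod 4 = card {x \<in> {x \<in> {0..<N}. x \<in> A \<and> z - x \<in> A}.
		N dvd 2 * x - z \<or> N dvd tau x - x \<or> N dvd x + tau x - z} mod 4"
proof -
	define C where "C = {x \<in> {0..<N}. x \<in> A \<and> z - x \<in> A}"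
	let ?s = "\<lambda>x. (z - x) mod N" and ?t = "\<lambda>x. tau x mod N"
	let ?B = "\<lambda>x. N dvd 2 * x - z \<or> N dvd tau x - x \<or> N dvd x + tau x - z"
	have fin: "finite C" unfolding C_def by (rule finite_subset[of _ "{0..<N}"]) auto
	have m: "N dvd x mod N - x" for x by (simp add: mod_eq_dvd_iff[symmetric])
	have modx: "y mod N = x \<longleftrightarrow> N dvd y - x" if "x \<in> C" for x y
		using that by (simp add: C_def) (metis mod_eq_dvd_iff mod_pos_pos_trivial)
	have modC: "y mod N \<in> C \<longleftrightarrow> y \<in> A \<and> z - y \<in> A" for y
		using N A[OF m] A[of "z - y mod N" "z - y"] m[of y] by (simp add: C_def dvd_diff_commute)
	have sC: "?s x \<in> C \<and> ?s (?s x) = x" if x: "x \<in> C" for x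
	proof -
		have "N dvd (z - ?s x) - x" using m[of "z - x"] by Groebner_Basis.algebra
		then show ?thesis using x by (simp add: modC modx[OF x]) (simp add: C_def)
	qed
	have tC: "?t x \<in> C \<and> ?t (?t x) = x \<and> ?s (?t x) = ?t (?s x)" if x: "x \<in> C" for x
	proof -
		have c: "x \<in> A" "z - x \<in> A" using x by (simp_all add: C_def)
		have 1: "N dvd tau (?t x) - tau (tau x)" "N dvd tau (?s x) - tau (z - x)" by (intro tau m)+
		have 2: "N dvd tau (?t x) - x" using 1(1) C[OF c] by Groebner_Basis.algebra
		have "N dvd (z - ?t x) - tau (?s x)" using 1(2) m[of "tau x"] C[OF c] by Groebner_Basis.algebra
		then show ?thesis using C[OF c] 2 modx[OF x] by (simp add: modC mod_eq_dvd_iff)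
	qed
	have iff: "\<not> ?B x \<longleftrightarrow> ?s x ~= x \<and> ?t x ~= x \<and> ?s (?t x) ~= x" if x: "x \<in> C" for x
	proof -
		have "N dvd (z - ?t x) - x \<longleftrightarrow> N dvd - (x + tau x - z)"
			by (rule dvd_iff_diff) (use m[of "tau x"] in \<open>simp add: dvd_diff_commute\<close>)
		moreover have "N dvd (z - x) - x \<longleftrightarrow> N dvd - (2 * x - z)" by simp
		ultimately show ?thesis unfolding modx[OF x] by (simp only: dvd_minus_iff) blast
	qed
	have "4 dvd card {x \<in> C. ?s x ~= x \<and> ?t x ~= x \<and> ?s (?t x) ~= x}" by (rule klein_four_dvd_card[OF fin]) (use sC tC in blast)+
	also have "{x \<in> C. ?s x ~= x \<and> ?t x ~= x \<and> ?s (?t x) ~= x} = {x \<in> C. \<not> ?B x}" using iff by blast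
	finally obtain k where k: "card {x \<in> C. \<not> ?B x} = 4 * k" by (elim dvdE)
	have "card C = card {x \<in> C. P x} + card {x \<in> C. \<not> P x}" for P
		using card_Int_Diff[OF fin, of "Collect P"] by (simp add: Int_def set_diff_eq)
	from this[of ?B] show ?thesis unfolding C_def[symmetric] k by simp
qed

context sring
begin

lemma conv_ind: "conv N (ind A) (ind B) z = int (card {x \<in> {0..<N}. x \<in> A \<and> z - x \<in> B})"
proof -
	have "conv N (ind A) (ind B) z = (\<Sum>x\<in>{0..<N}. of_bool (x \<in> A \<and> z - x \<in> B))"
		unfolding conv_def ind_def by (intro sum.cong) auto
	also have "... = int (card ({0..<N} \<inter> {x. x \<in> A \<and> z - x \<in> B}))" by (simp add: sum_of_bool_eq)
	also have "{0..<N} \<inter> {x. x \<in> A \<and> z - x \<in> B} = {x \<in> {0..<N}. x \<in> A \<and> z - x \<in> B}" by auto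
	finally show ?thesis .
qed

end

subsection \<open>The case where the incomplete cosets lie outside the socle\<close>

text \<open>\<open>s\<close> is the \<open>l\<close>-valuation of \<open>vp\<close>, and by
  \<open>T1_val\<close> of every element of \<open>T1\<close>. So the component modulo
  \<open>L ^ a\<close> of such an element is \<open>L ^ s\<close> times a unit, and multiplication
  by \<open>L ^ i\<close> sends it to zero.\<close>

locale nonunit_deep = nonunit_basic +
	fixes t1 w :: int and s i :: nat
	assumes t1: "t1 \<in> T1" "\<not> int l ^ (a - 1) dvd t1"
		and vp_w: "vp = int l ^ s * w" "\<not> int l dvd w"
		and i_def: "i = a - s"
begin

lemma L0: "L > 0" "L ~= 0" using L_gt by simp_all

lemma v_w: "v = L ^ Suc s * w" by (simp add: v_vp vp_w)

lemma cop_Lw: "coprime (L ^ k) w" using prime_imp_coprime[OF L_prime vp_w(2)] by simp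

lemma w_r: "w dvd r"
proof -
	have "w dvd L ^ a * r" using v_pos(2) by (simp add: v_w N_eq) (meson dvd_mult_right dvd_trans dvd_triv_right)
	then show ?thesis using cop_Lw[of a] coprime_dvd_mult_right_iff coprime_commute by blast
qed

lemma T1_val: "t \<in> T1 ==> L ^ s dvd t \<and> \<not> L ^ Suc s dvd t"
proof -
	assume t: "t \<in> T1"
	have "vp dvd t" by (rule vp_T1[OF t])
	then have "L ^ s dvd t" "w dvd t" using vp_w by (auto elim: dvd_mult_left dvd_mult_right)
	moreover have "\<not> L ^ Suc s dvd t" using T_not_v[OF T1_T[OF t]] \<open>w dvd t\<close> cop_Lw[of "Suc s"] by (metis v_w divides_mult)
	ultimately show ?thesis by blast
qed

lemma s_a: "s + 2 \<le> a"
proof (rule ccontr)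
	assume "\<not> s + 2 \<le> a"
	then have "L ^ (a - 1) dvd L ^ s" by (intro le_imp_power_dvd) simp
	then show False using t1 T1_val dvd_trans by blast
qed

lemma i: "i \<ge> 2" "s + i = a" "a - 1 = s + (i - 1)" using s_a by (auto simp: i_def)

lemma N_q: "N = L ^ i * (L ^ s * r)" unfolding N_eq i(2)[symmetric] by (simp add: power_add ac_simps)

lemma p_q: "p = L ^ (i - 1) * (L ^ s * r)" unfolding p_def i(3) by (simp add: power_add ac_simps)

lemma T1_decomp:
	assumes "t \<in> T1"
	obtains u where "t = L ^ s * u" "\<not> L dvd u"
proof -
	obtain u where u: "t = L ^ s * u" using T1_val[OF assms] by (auto elim: dvdE)
	have "\<not> L ^ s * L dvd L ^ s * u" using T1_val[OF assms] by (simp add: u mult.commute)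
	then have "\<not> L dvd u" using L0 by simp
	then show thesis using u that by blast
qed

text \<open>These units act on multiples of \<open>L ^ s\<close> as translations inside cosets of
  the subgroup of order \<open>l\<close>.\<close>

lemma shift_unit:
	fixes c :: int
	defines "m \<equiv> 1 + L ^ (i - 1) * r * c"
	shows "coprime m N" "L ^ s dvd x ==> m * x = x + p * (c * (x div L ^ s))" "L dvd m - 1"
proof -
	show d: "L dvd m - 1" using i(1) by (simp add: m_def dvd_mult2)
	have "[m = 1] (mod L)" using d by (simp add: cong_iff_dvd_diff)
	then have "coprime m L" using cong_imp_coprime cong_sym by (metis coprime_1_left)
	moreover have "[m = 1] (mod r)" by (simp add: m_def cong_iff_dvd_diff)
	then have "coprime m r" using cong_imp_coprime cong_sym by (metis coprime_1_left)
	ultimately show "coprime m N" by (simp add: N_eq)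
	assume "L ^ s dvd x"
	then obtain y where "x = L ^ s * y" by (auto elim: dvdE)
	then show "m * x = x + p * (c * (x div L ^ s))" using L0 by (simp add: m_def p_q algebra_simps)
qed

text \<open>A second point of \<open>T\<close> in the coset of \<open>t\<close> would be the image
  of \<open>t\<close> under a unit from \<open>shift_unit\<close>. This unit then preserves
  \<open>T\<close> and, iterated, moves \<open>t\<close> through the whole coset, which would be
  filled.\<close>

lemma T1_alone:
	assumes t: "t \<in> T1" "p dvd e" "t + e \<in> T"
	shows "N dvd e"
proof (rule ccontr)
	assume nN: "\<not> N dvd e"
	obtain j where j: "e = p * j" using t by (auto elim: dvdE)
	have nj: "\<not> L dvd j" using nN by (auto simp: j N_p mult.commute[of p])
	obtain u where u: "t = L ^ s * u" "\<not> L dvd u" using T1_decomp[OF t(1)] .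
	obtain c where c: "L dvd - j + u * c" using prime_linear_solve[OF L_prime u(2)] by blast
	define m where "m = 1 + L ^ (i - 1) * r * c"
	note m = shift_unit[where c=c, folded m_def]
	have mt: "m * t = t + p * (c * u)" using m(2)[of t] u L0 by simp
	have d: "N dvd m * t - (t + e)" using c mt j N_p by Groebner_Basis.algebra
	then have "m * t \<in> T" using T_cong t(3) by blast
	then have inv: "m * x \<in> T" if "x \<in> T" for x using mT[OF m(1) T1_T[OF t(1)]] that by blast
	have k: "t + e * int k \<in> T" for k
	proof (induction k)
		case 0
		then show ?case using T1_T[OF t(1)] by simp
	next
		case (Suc k)
		have "m * (t + e * int k) \<in> T" by (rule inv[OF Suc])
		moreover have "int (Suc k) = int k + 1" by simp
		then have "N dvd m * (t + e * int k) - (t + e * int (Suc k))" using d m(3) t(2) N_p by Groebner_Basis.algebra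
		ultimately show ?case using T_cong by blast
	qed
	obtain e' where e': "p dvd e'" "t + e' \<notin> T" using t(1) by (auto simp: T1_def)
	then obtain j' where j': "e' = p * j'" by (auto elim: dvdE)
	obtain k where kk: "L dvd - j' + j * k" using prime_linear_solve[OF L_prime nj] by blast
	have "L dvd k mod L - k" by (metis mod_0 mod_diff_left_eq mod_eq_0_iff_dvd diff_self)
	then have "N dvd (t + e * (k mod L)) - (t + e')" using kk j j' N_p by Groebner_Basis.algebra
	moreover have "t + e * (k mod L) \<in> T" using k[of "nat (k mod L)"] L0 by simp
	ultimately show False using T_cong e'(2) by blast
qed

lemma T1_cong: "N dvd x - y ==> x \<in> T1 \<longleftrightarrow> y \<in> T1"
proof -
	have "y \<in> T1" if d: "N dvd x - y" and x: "x \<in> T1" for x y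
	proof -
		obtain e where e: "p dvd e" "x + e \<notin> T" using x by (auto simp: T1_def)
		have "N dvd (x + e) - (y + e)" using d by simp
		then have "y + e \<notin> T" using e(2) T_cong by blast
		then show ?thesis using e(1) T1_T[OF x] T_cong[OF d] by (auto simp: T1_def)
	qed
	then show "N dvd x - y ==> x \<in> T1 \<longleftrightarrow> y \<in> T1" by (metis dvd_diff_commute)
qed

lemma per_ind1: "per N (ind T1)" by (rule perI) (simp add: ind_def T1_cong)

definition ind2 :: "int => int" where "ind2 x = of_bool (x \<in> T \<and> x \<notin> T1)"

lemma ind_split: "ind T x = ind T1 x + ind2 x" using T1_T by (auto simp: ind_def ind2_def)

lemma ind2_shift: "ind2 (x + p * j) = ind2 x"
	using T2_shift[of x "p * j"] T2_shift[of "x + p * j" "- (p * j)"] by (auto simp: ind2_def)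

lemma per_ind2: "per N ind2" by (rule perI) (simp add: ind2_def T1_cong T_cong)

text \<open>Such a \<open>y\<close> annihilates the complete cosets modulo \<open>l\<close>, so its product with \<open>T\<close> is supported
	where the lemma \<open>support\<close> forbids a nonzero value.\<close>

lemma kill:
	assumes y: "(\<lambda>z. y z mod L) \<in> I" "\<And>z j. y (z + p * j) = y z" "\<And>z. y z ~= 0 ==> v dvd z"
	shows "L dvd conv N y (ind T1) z"
proof -
	have yper: "per N y" using y(2)[of _ L] by (simp add: per_def N_p mult.commute)
	have c: "[conv N (\<lambda>z. y z mod L) (ind T) z = conv N y (ind T1) z] (mod L)" for z
	proof -
		have "[conv N (\<lambda>z. y z mod L) (ind T) z = conv N y (ind T) z] (mod L)" by (intro conv_cong) (auto simp: cong_def)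
		moreover have "conv N y (ind T) z = conv N y (ind T1) z + conv N y ind2 z"
			by (simp add: conv_def ind_split distrib_left sum.distrib)
		moreover have "L dvd conv N y ind2 z"
			by (rule conv_invariant_dvd[OF p_pos L0(1) N_p yper per_ind2]) (simp_all add: ind2_shift y(2))
		ultimately show ?thesis by (metis cong_add_rcancel_0 cong_0_iff cong_trans cong_sym add.commute cong_add_lcancel_0)
	qed
	show ?thesis
	proof (rule ccontr)
		assume nz: "\<not> L dvd conv N y (ind T1) z"
		let ?c = "\<lambda>z. conv N (\<lambda>z. y z mod L) (ind T) z mod L"
		have cI: "?c \<in> I" by (rule I_map[OF I_conv[OF y(1)]]) (use asetT in \<open>simp add: I_ind\<close>)
		have supp: "vp dvd x \<and> \<not> v dvd x" if cx: "?c x ~= 0" for x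
		proof -
			have "conv N y (ind T1) x ~= 0" using c[of x] cx by (auto simp: cong_def)
			then obtain u where u: "y u * ind T1 (x - u) ~= 0" unfolding conv_def by (meson sum.neutral)
			then have "v dvd u" "x - u \<in> T1" using y(3) by (auto simp: ind_def)
			then have *: "vp dvd x - u" "\<not> v dvd x - u" using vp_T1 T_not_v T1_T by blast+
			have "vp dvd x" using *(1) \<open>v dvd u\<close> v_vp by Groebner_Basis.algebra
			moreover have "\<not> v dvd x" using *(2) \<open>v dvd u\<close> dvd_diff by blast
			ultimately show ?thesis by simp
		qed
		have "?c z ~= 0" using nz c[of z] by (metis cong_def dvd_eq_mod_eq_0)
		then show False using support[OF cI, of z] supp by blast
	qed
qed

section \<open>Push-forwards of the incomplete part by powers of the prime\<close>

definition F :: "nat => int => int" where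
	"F k = frob N (L ^ k) (ind T1)"

text \<open>The filled cosets contribute multiples of \<open>l\<close> to the push-forward by
  \<open>l\<close>, hence also to all further ones.\<close>

lemma F_I: "k > 0 ==> (\<lambda>z. F k z mod L) \<in> I"
proof -
	assume k: "k > 0"
	have z: "L dvd frob N L ind2 z" for z
	proof (cases "\<exists>t. N dvd L * t - z")
		case True
		then obtain t where "N dvd L * t - z" by blast
		then show ?thesis using frob_coset[OF per_ind2 N_p L0(1)] ind2_shift by simp
	next
		case False
		then show ?thesis by (simp add: frob_def)
	qed
	have "L dvd frob N (L ^ k) ind2 z" for z
	proof -
		have "frob N (L ^ k) ind2 = frob N (L ^ (k - 1)) (frob N L ind2)"
			using k by (simp add: frob_frob[OF N_pos] power_Suc2[symmetric] del: power_Suc)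
		then show ?thesis using z by (simp add: frob_def dvd_sum)
	qed
	moreover have "frob N (L ^ k) (ind T) z = F k z + frob N (L ^ k) ind2 z" for z
		by (simp add: F_def frob_def ind_split distrib_left sum.distrib)
	ultimately have "frob N (L ^ k) (ind T) z mod L = F k z mod L" for z
		by (metis add.right_neutral dvd_eq_mod_eq_0 mod_add_right_eq)
	then show ?thesis using I_frob[OF prime, of "ind T" k] asetT by (simp add: I_ind)
qed

lemma F_coset: "k \<le> i ==> F k (L ^ k * t) = rsum (L ^ k) (\<lambda>j. ind T1 (t + L ^ (a - k) * r * j))"
proof -
	assume "k \<le> i"
	then have "k \<le> a" using i by simp
	then have "N = L ^ k * (L ^ (a - k) * r)" by (simp add: N_eq mult.assoc[symmetric] power_add[symmetric])
	then show ?thesis unfolding F_def using frob_coset[OF per_ind1, of "L ^ k"] L0 by simp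
qed

lemma F_i_sum: "F k z = rsum N (\<lambda>x. of_bool (N dvd L ^ k * x - z) * ind T1 x)" by (simp add: F_def frob_def)

lemma La_T1: "x \<in> T1 ==> L ^ a dvd L ^ i * x"
	using T1_val[of x] mult_dvd_mono[of "L ^ i" "L ^ i" "L ^ s" x] i(2) by (simp add: power_add[symmetric] add.commute)

text \<open>The push-forward of \<open>T1\<close> by \<open>L ^ i\<close>, spread evenly over the
  cosets of the subgroup of order \<open>l\<close>. The spreading gives the invariance required by
  \<open>kill\<close>; membership in the ring then needs the separate argument
  \<open>Y_I\<close>.\<close>

definition Y :: "int => int" where
	"Y z = rsum N (\<lambda>x. of_bool (p dvd L ^ i * x - z) * ind T1 x)"

lemma Y_shift: "Y (z + p * j) = Y z"
proof -
	have "p dvd u - (z + p * j) \<longleftrightarrow> p dvd u - z" for u by (rule dvd_iff_diff) simp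
	then show ?thesis by (simp add: Y_def)
qed

lemma Y_v: "Y z ~= 0 ==> v dvd z"
proof -
	assume "Y z ~= 0"
	then obtain x where "of_bool (p dvd L ^ i * x - z) * ind T1 x ~= 0" unfolding Y_def by (meson sum.neutral)
	then have x: "p dvd L ^ i * x - z" "x \<in> T1" by (auto simp: ind_def)
	have "L ^ Suc s dvd p" using i s_a unfolding p_def by (intro dvd_mult2 le_imp_power_dvd) simp
	moreover have "w dvd p" using w_r by (simp add: p_def)
	ultimately have vpp: "v dvd p" unfolding v_w using cop_Lw divides_mult by blast
	have "vp dvd x" by (rule vp_T1[OF x(2)])
	then have "L * vp dvd L ^ i * x" using i(1) by (intro mult_dvd_mono) simp_all
	then show "v dvd z" using dvd_trans[OF vpp x(1)] dvd_iff_diff v_vp by metis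
qed

text \<open>\<open>Y\<close> is assembled from \<open>F i\<close> and \<open>F (i - 1)\<close>. If
  \<open>z\<close> lies in the coset of \<open>L ^ i * x\<close>, then either its
  \<open>l\<close>-component is zero and \<open>F i\<close> counts \<open>x\<close>, or exactly one
  of the multipliers \<open>n k\<close>, with \<open>k\<close> from 1 to \<open>l - 1\<close>,
  carries \<open>z\<close> to \<open>L ^ (i - 1) * x\<close>.\<close>

lemma Y_I: "(\<lambda>z. Y z mod L) \<in> I"
proof -
	have cr: "coprime L r" using prime_imp_coprime[OF L_prime r] .
	\<comment> \<open>\<open>F (i - 1)\<close> pushes forward by one factor \<open>l\<close> less than
	  \<open>Y\<close>, so modulo \<open>r\<close> the multipliers must divide by
	  \<open>l\<close>.\<close>
	obtain y where y: "[y * L = 1] (mod r)" using cr by (metis cong_solve_coprime_int mult.commute)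
	have cy: "coprime y r" using y by (metis cong_imp_coprime cong_sym coprime_1_left coprime_mult_left_iff)
	have "\<exists>m. coprime m N \<and> [m = k] (mod L ^ a) \<and> [m = y] (mod r)" if k: "k \<in> {1..<L}" for k
	proof -
		have "\<not> L dvd k" using k zdvd_not_zless by auto
		then show ?thesis using unit_lift[OF _ cy] by metis
	qed
	then obtain n where n: "\<And>k. k \<in> {1..<L} ==> coprime (n k) N \<and> [n k = k] (mod L ^ a) \<and> [n k = y] (mod r)" by metis
	have pt: "of_bool (p dvd L ^ i * x - z) = (of_bool (N dvd L ^ i * x - z) :: int)
			+ (\<Sum>k\<in>{1..<L}. of_bool (N dvd L ^ (i - 1) * x - n k * z))" if x: "x \<in> T1" for x z
	proof -
		obtain x1 where x1: "x = L ^ s * x1" "\<not> L dvd x1" using T1_decomp[OF x] .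
		have x2: "L ^ (i - 1) * x = L ^ (a - 1) * x1"
			using i by (simp add: x1 mult.assoc[symmetric] power_add[symmetric] add.commute)
		have x3: "L ^ i * x = L * (L ^ (a - 1) * x1)" using i(1) x2 by (simp add: power_eq_if mult.assoc)
		have rk: "r dvd L ^ (i - 1) * x - n k * z \<longleftrightarrow> r dvd L ^ i * x - z" if k: "k \<in> {1..<L}" for k
		proof -
			have "r dvd y * L - 1" "r dvd n k - y" using y n[OF k] by (simp_all add: cong_iff_dvd_diff)
			let ?b = "L ^ (i - 1) * x"
			have "r dvd (L * ?b - z) - L * (?b - n k * z)" using \<open>r dvd y * L - 1\<close> \<open>r dvd n k - y\<close> by Groebner_Basis.algebra
			then have "r dvd L * ?b - z \<longleftrightarrow> r dvd L * (?b - n k * z)" by (rule dvd_iff_diff)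
			also have "... \<longleftrightarrow> r dvd ?b - n k * z" using cr by (simp add: coprime_commute coprime_dvd_mult_right_iff)
			also have "L * ?b = L ^ i * x" using i(1) by (simp add: power_eq_if mult.assoc)
			finally show ?thesis by simp
		qed
		have splitN: "N dvd u \<longleftrightarrow> L ^ a dvd u \<and> r dvd u" for u
			using cop by (auto simp: N_eq divides_mult elim: dvd_mult_left dvd_mult_right)
		have "coprime (L ^ (a - 1)) r" using cr by simp
		then have splitp: "p dvd u \<longleftrightarrow> L ^ (a - 1) dvd u \<and> r dvd u" for u
			by (auto simp: p_def divides_mult elim: dvd_mult_left dvd_mult_right)
		have La: "L ^ a = L ^ (a - 1) * L" using a_pos by (simp add: power_eq_if)
		have ps: "p dvd L ^ i * x - z \<longleftrightarrow> L ^ (a - 1) dvd z \<and> r dvd L ^ i * x - z"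
		proof -
			have "L ^ (a - 1) dvd L ^ i * x - z \<longleftrightarrow> L ^ (a - 1) dvd z" by (simp add: x3 dvd_diff_right_iff)
			then show ?thesis using splitp by blast
		qed
		have Ns: "N dvd L ^ i * x - z \<longleftrightarrow> L ^ a dvd z \<and> r dvd L ^ i * x - z"
		proof -
			have "L ^ a dvd L ^ i * x - z \<longleftrightarrow> L ^ a dvd z" using La_T1[OF x] by (simp add: dvd_diff_right_iff)
			then show ?thesis using splitN by blast
		qed
		show ?thesis
		proof (cases "r dvd L ^ i * x - z")
			case False
			then show ?thesis using rk ps Ns splitN by simp
		next
			case True
			have sum: "(\<Sum>k\<in>{1..<L}. of_bool (N dvd L ^ (i - 1) * x - n k * z))
					= (\<Sum>k\<in>{1..<L}. of_bool (L ^ a dvd L ^ (a - 1) * x1 - k * z) :: int)"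
			proof (rule sum.cong[OF refl])
				fix k assume k: "k \<in> {1..<L}"
				have "L ^ a dvd n k - k" using n[OF k] by (simp add: cong_iff_dvd_diff)
				then have "L ^ a dvd (n k - k) * z" by simp
				then have "L ^ a dvd (L ^ (a - 1) * x1 - k * z) - (L ^ (a - 1) * x1 - n k * z)" by (simp add: algebra_simps)
				then have "L ^ a dvd L ^ (a - 1) * x1 - k * z \<longleftrightarrow> L ^ a dvd L ^ (a - 1) * x1 - n k * z" by (rule dvd_iff_diff)
				then have "N dvd L ^ (i - 1) * x - n k * z \<longleftrightarrow> L ^ a dvd L ^ (a - 1) * x1 - k * z"
					using splitN[of "L ^ (i - 1) * x - n k * z"] rk[OF k] True unfolding x2 by blast
				then show "of_bool (N dvd L ^ (i - 1) * x - n k * z) = (of_bool (L ^ a dvd L ^ (a - 1) * x1 - k * z) :: int)"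
					by (simp only:)
			qed
			show ?thesis
			proof (cases "L ^ (a - 1) dvd z")
				case nz: False
				have "\<not> L ^ a dvd L ^ (a - 1) * x1 - k * z" if k: "k \<in> {1..<L}" for k
				proof
					assume "L ^ a dvd L ^ (a - 1) * x1 - k * z"
					then have "L ^ (a - 1) dvd L ^ (a - 1) * x1 - k * z" unfolding La by (rule dvd_mult_left)
					then have "L ^ (a - 1) dvd k * z" by (simp add: dvd_diff_right_iff)
					moreover have "\<not> L dvd k" using k zdvd_not_zless by auto
					then have "coprime (L ^ (a - 1)) k" using prime_imp_coprime[OF L_prime] by simp
					ultimately show False using nz coprime_dvd_mult_right_iff by blast
				qed
				moreover have "\<not> L ^ a dvd z" using nz by (auto simp: La elim: dvd_mult_left)
				ultimately show ?thesis using sum ps Ns nz by simp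
			next
				case True': True
				then obtain z1 where z1: "z = L ^ (a - 1) * z1" by (auto elim: dvdE)
				have e: "L ^ a dvd L ^ (a - 1) * x1 - k * z \<longleftrightarrow> L dvd x1 - k * z1" for k
				proof -
					have "L ^ (a - 1) * x1 - k * z = L ^ (a - 1) * (x1 - k * z1)" by (simp add: z1 algebra_simps)
					then show ?thesis using L0 by (simp add: La)
				qed
				show ?thesis
				proof (cases "L dvd z1")
					case True
					then have "\<not> L dvd x1 - k * z1" for k using x1(2) by (simp add: dvd_diff_left_iff)
					moreover have "L ^ a dvd z" using True by (simp add: La z1)
					ultimately show ?thesis using sum e ps Ns True' \<open>r dvd L ^ i * x - z\<close> by simp
				next
					case False
					have "coprime z1 L" using prime_imp_coprime[OF L_prime False] by (simp add: coprime_commute)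
					moreover have "per L (\<lambda>k. of_bool (L dvd x1 - k) * (1::int))"
						using dvd_iff_diff[of L "x1 - a" "x1 - b" for a b] by (intro perI) (simp add: dvd_diff_commute)
					ultimately have "rsum L (\<lambda>k. of_bool (L dvd x1 - z1 * k) * 1) = rsum L (\<lambda>k. of_bool (L dvd x1 - k) * 1)"
						using rsum_unit[OF L0(1)] by blast
					also have "... = 1" by (rule rsum_delta'[OF L0(1)]) (simp add: per_def)
					finally have "rsum L (\<lambda>k. of_bool (L dvd x1 - k * z1)) = 1" by (simp add: mult.commute)
					moreover have "{0..<L} = insert 0 {1..<L}" using L_gt by auto
					ultimately have "(\<Sum>k\<in>{1..<L}. of_bool (L dvd x1 - k * z1)) = (1::int)" using x1(2) by simp
					moreover have "\<not> L ^ a dvd z" using False L0 by (simp add: La z1)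
					ultimately show ?thesis using sum e ps Ns True' \<open>r dvd L ^ i * x - z\<close> by simp
				qed
			qed
		qed
	qed
	have "Y z = F i z + (\<Sum>k\<in>{1..<L}. F (i - 1) (n k * z))" for z
	proof -
		have "Y z = rsum N (\<lambda>x. (of_bool (N dvd L ^ i * x - z)
			+ (\<Sum>k\<in>{1..<L}. of_bool (N dvd L ^ (i - 1) * x - n k * z))) * ind T1 x)"
			unfolding Y_def by (intro sum.cong refl) (use pt in \<open>auto simp: ind_def\<close>)
		also have "... = F i z + rsum N (\<lambda>x. \<Sum>k\<in>{1..<L}. of_bool (N dvd L ^ (i - 1) * x - n k * z) * ind T1 x)"
			by (simp add: F_i_sum distrib_right sum.distrib sum_distrib_right)
		also have "rsum N (\<lambda>x. \<Sum>k\<in>{1..<L}. of_bool (N dvd L ^ (i - 1) * x - n k * z) * ind T1 x)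
				= (\<Sum>k\<in>{1..<L}. F (i - 1) (n k * z))" unfolding F_i_sum by (rule sum.swap)
		finally show ?thesis .
	qed
	moreover have "(x + (\<Sum>k\<in>{1..<L}. f k)) mod L = (x mod L + (\<Sum>k\<in>{1..<L}. f k mod L)) mod L"
		for x and f :: "int => int" by (metis mod_add_left_eq mod_add_right_eq mod_sum_eq)
	ultimately have "(\<lambda>z. Y z mod L) = (\<lambda>z. (F i z mod L + (\<Sum>k\<in>{1..<L}. F (i - 1) (n k * z) mod L)) mod L)" by simp
	moreover have "(\<lambda>z. (F i z mod L + (\<Sum>k\<in>{1..<L}. F (i - 1) (n k * z) mod L)) mod L) \<in> I"
	proof -
		have "(\<lambda>z. F i z mod L) \<in> I" using i by (intro F_I) simp
		moreover have "(\<lambda>z. \<Sum>k\<in>{1..<L}. F (i - 1) (n k * z) mod L) \<in> I"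
		proof (rule I_sum)
			fix k assume "k \<in> {1..<L}"
			then show "(\<lambda>z. F (i - 1) (n k * z) mod L) \<in> I" using I_mult[OF F_I[of "i - 1"], of "n k"] n i(1) by simp
		qed
		ultimately show ?thesis using I_map2[of _ _ "\<lambda>a b. (a + b) mod L"] by blast
	qed
	ultimately show ?thesis by simp
qed

lemma Y_conv: "Y = conv N (\<lambda>e. of_bool (p dvd e)) (F i)"
proof
	fix z
	have per: "per N (F k)" for k by (simp add: F_def per_frob)
	have "conv N (\<lambda>e. of_bool (p dvd e)) (F i) z = rsum (L * p) (\<lambda>e. of_bool (p dvd e - 0) * F i (z - e))"
		by (simp add: conv_def N_p)
	also have "... = rsum L (\<lambda>j. F i (z - (0 + p * j)))"
		by (rule rsum_coset[OF p_pos L0(1)]) (use per in \<open>auto simp: per_iff N_p[symmetric] dvd_diff_commute\<close>)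
	also have "... = rsum N (\<lambda>x. rsum L (\<lambda>j. of_bool (N dvd (L ^ i * x - z) + p * j)) * ind T1 x)"
		unfolding F_i_sum by (subst sum.swap) (simp add: sum_distrib_right sum_distrib_left algebra_simps)
	also have "... = Y z" unfolding Y_def
	proof (rule sum.cong[OF refl])
		fix x
		let ?u = "L ^ i * x - z"
		have "rsum L (\<lambda>j. of_bool (N dvd ?u + p * j)) = (of_bool (p dvd ?u) :: int)"
		proof (cases "p dvd ?u")
			case True
			then obtain k where k: "?u = p * k" by (auto elim: dvdE)
			have "N dvd ?u + p * j \<longleftrightarrow> L dvd j - (- k)" for j
				using p_pos by (simp add: k N_p mult.commute[of L] distrib_left[symmetric] add.commute)
			then have "rsum L (\<lambda>j. of_bool (N dvd ?u + p * j)) = rsum L (\<lambda>j. of_bool (L dvd j - (- k)) * (1::int))" by simp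
			also have "... = 1" by (rule rsum_delta[OF L0(1)]) (simp add: per_def)
			finally show ?thesis using True by simp
		next
			case False
			have "\<not> N dvd ?u + p * j" for j using False by (metis N_p dvd_add_left_iff dvd_mult_right dvd_triv_left)
			then show ?thesis using False by simp
		qed
		then show "rsum L (\<lambda>j. of_bool (N dvd ?u + p * j)) * ind T1 x = of_bool (p dvd ?u) * ind T1 x" by simp
	qed
	finally show "Y z = conv N (\<lambda>e. of_bool (p dvd e)) (F i) z" by simp
qed

end

context nonunit_deep
begin

lemma conv_Y_pow:
	assumes f: "per N f" and n: "n > 0" and z: "\<And>z. L dvd conv N g f z" and g: "per N g"
	shows "L dvd conv N g (convpow N f n) z"
proof -
	obtain k where k: "n = Suc k" using n by (auto elim: Nat.lessE)
	have "conv N g (convpow N f n) = conv N (conv N g f) (convpow N f k)"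
		using conv_assoc[OF N_pos g f per_convpow[OF f]] by (simp add: k)
	moreover have "[conv N (conv N g f) (convpow N f k) z = conv N (\<lambda>_. 0) (convpow N f k) z] (mod L)"
		using z by (intro conv_cong) (auto simp: cong_0_iff)
	ultimately show ?thesis by (simp add: conv_def cong_0_iff)
qed

text \<open>Modulo \<open>l\<close>, \<open>Y\<close> annihilates \<open>T1\<close> and hence its
  convolution power \<open>l ^ i\<close>, which is \<open>F i\<close>. As \<open>Y\<close> is the
  spread of \<open>F i\<close>, the spread of the \<open>l\<close>-th power of \<open>F i\<close>,
  its Frobenius image, vanishes. That image lives on the subgroup of order \<open>r\<close>, which
  meets each coset of the subgroup of order \<open>l\<close> at most once, so the spreading can be
  undone.\<close>

lemma F_i_zero: "L dvd F i z0"
proof (rule ccontr)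
	assume nz: "\<not> L dvd F i z0"
	let ?pi = "\<lambda>e. of_bool (p dvd e) :: int"
	have perF: "per N (F i)" by (simp add: F_def per_frob)
	have "p dvd N" by (simp add: N_p)
	then have pp: "per N ?pi" by (intro perI arg_cong[of _ _ of_bool] dvd_iff_diff) (rule dvd_trans)
	have perY: "per N Y" by (simp add: Y_conv per_conv[OF perF])
	have l: "l > 1" by (rule prime_gt_1_nat[OF prime])
	have "L dvd conv N Y (convpow N (ind T1) (l ^ i)) z" for z
		using l by (intro conv_Y_pow per_ind1 perY kill Y_I Y_shift Y_v) auto
	moreover have "[conv N Y (convpow N (ind T1) (l ^ i)) z = conv N Y (F i) z] (mod L)" for z
		using convpow_prime_pow[OF N_pos per_ind1 prime, of i] by (intro conv_cong) (auto simp: F_def)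
	ultimately have "L dvd conv N Y (F i) z" for z using cong_dvd_iff by blast
	then have a1: "L dvd conv N Y (convpow N (F i) (l - 1)) z" for z using l by (intro conv_Y_pow perF perY) auto
	have "conv N Y (convpow N (F i) (l - 1)) = conv N ?pi (convpow N (F i) l)"
		unfolding Y_conv conv_assoc[OF N_pos pp perF per_convpow[OF perF]] using l by (cases l) auto
	moreover have "[conv N ?pi (convpow N (F i) l) z = conv N ?pi (frob N L (F i)) z] (mod L)" for z
		using convpow_prime[OF N_pos perF prime] by (intro conv_cong) auto
	ultimately have a2: "L dvd conv N ?pi (frob N L (F i)) z" for z using a1 cong_dvd_iff by metis
	define g where "g = frob N L (F i)"
	have perg: "per N g" by (simp add: g_def per_frob)
	have "conv N ?pi g z = rsum (L * p) (\<lambda>e. of_bool (p dvd e - 0) * g (z - e))" for z by (simp add: conv_def N_p)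
	also have "... z = rsum L (\<lambda>j. g (z - (0 + p * j)))" for z
		by (rule rsum_coset[OF p_pos L0(1)]) (use perg in \<open>auto simp: per_iff N_p[symmetric] dvd_diff_commute\<close>)
	finally have a3: "L dvd rsum L (\<lambda>j. g (z - p * j))" for z using a2[of z] by (simp add: g_def)
	have Fs: "L ^ a dvd u" if F: "F i u ~= 0" for u
	proof -
		obtain x where "of_bool (N dvd L ^ i * x - u) * ind T1 x ~= 0" using F unfolding F_i_sum by (meson sum.neutral)
		then have x: "N dvd L ^ i * x - u" "x \<in> T1" by (auto simp: ind_def)
		have "L ^ a dvd N" by (simp add: N_eq)
		then have "L ^ a dvd L ^ i * x - u" using x(1) dvd_trans by blast
		then show ?thesis using La_T1[OF x(2)] dvd_iff_diff by blast
	qed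
	have gs: "L ^ a dvd x" if g: "g x ~= 0" for x
	proof -
		obtain u where "of_bool (N dvd L * u - x) * F i u ~= 0" using g unfolding g_def frob_def by (meson sum.neutral)
		then have u: "N dvd L * u - x" "L ^ a dvd L * u" using Fs by auto
		have "L ^ a dvd N" by (simp add: N_eq)
		then have "L ^ a dvd L * u - x" using u(1) dvd_trans by blast
		then show ?thesis using u(2) dvd_iff_diff by blast
	qed
	have z0: "L ^ a dvd z0" using nz Fs by (metis dvd_0_right)
	have La: "L ^ a = L ^ (a - 1) * L" using a_pos by (simp add: power_eq_if)
	have "g (L * z0 - p * j) = 0" if j: "j \<in> {1..<L}" for j
	proof (rule ccontr)
		assume "g (L * z0 - p * j) ~= 0"
		then have "L ^ a dvd L * z0 - p * j" by (rule gs)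
		then have "L ^ a dvd p * j" using z0 by (simp add: dvd_diff_right_iff)
		then have "L ^ (a - 1) * L dvd L ^ (a - 1) * (r * j)" by (simp add: La p_def mult.assoc)
		then have "L dvd r * j" using L0 by simp
		then show False using L_prime r j zdvd_not_zless[of j L] by (auto simp: prime_dvd_mult_iff)
	qed
	moreover have "{0..<L} = insert 0 {1..<L}" using L_gt by auto
	ultimately have "rsum L (\<lambda>j. g (L * z0 - p * j)) = g (L * z0)" by simp
	then have "L dvd g (L * z0)" using a3 by metis
	also have "g (L * z0) = rsum N (\<lambda>u. of_bool (N dvd u - z0) * F i u)" unfolding g_def frob_def
	proof (intro sum.cong refl)
		fix u
		show "of_bool (N dvd L * u - L * z0) * F i u = of_bool (N dvd u - z0) * F i u"
		proof (cases "F i u = 0")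
			case False
			then have La_u: "L ^ a dvd u - z0" using Fs z0 by simp
			have cr: "coprime r L" using prime_imp_coprime[OF L_prime r] by (simp add: coprime_commute)
			have "N dvd u - z0" if "N dvd L * (u - z0)"
			proof -
				have "r dvd L * (u - z0)" using that by (auto simp: N_eq elim: dvd_mult_right)
				then have "r dvd u - z0" using cr coprime_dvd_mult_right_iff by blast
				then show ?thesis unfolding N_eq using La_u cop divides_mult by blast
			qed
			then have "N dvd L * u - L * z0 \<longleftrightarrow> N dvd u - z0" by (auto simp: right_diff_distrib[symmetric])
			then show ?thesis by simp
		qed simp
	qed
	also have "... = F i z0" by (rule rsum_delta[OF N_pos perF])
	finally show False using nz by blast
qed

section \<open>Rigidity of the incomplete part under local units\<close>

lemma local_unit:
	assumes x: "x \<in> T1" "x' \<in> T1" and d: "r dvd x - x'"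
	obtains m where "coprime m N" "[m = 1] (mod r)" "N dvd m * x - x'"
		"\<forall>c\<le>i. L ^ (s + c) dvd x - x' --> L ^ c dvd m - 1"
proof -
	obtain u where u: "x = L ^ s * u" "\<not> L dvd u" using T1_decomp[OF x(1)] .
	obtain u' where u': "x' = L ^ s * u'" "\<not> L dvd u'" using T1_decomp[OF x(2)] .
	have cu: "coprime u (L ^ a)" using prime_imp_coprime[OF L_prime u(2)] by (simp add: coprime_commute)
	then obtain y where "[u * y = 1] (mod L ^ a)" using cong_solve_coprime_int by blast
	from cong_mult[OF this cong_refl[of u']] have k: "[u * (y * u') = u'] (mod L ^ a)" by (simp add: mult.assoc)
	have La: "L dvd L ^ a" using a_pos by simp
	have "\<not> L dvd y * u'"
	proof
		assume "L dvd y * u'"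
		then have "L dvd u * (y * u')" by (rule dvd_mult)
		then show False using u'(2) k La by (meson cong_dvd_iff cong_dvd_modulus)
	qed
	then obtain m where m: "coprime m N" "[m = y * u'] (mod L ^ a)" "[m = 1] (mod r)" using unit_lift[of "y * u'" 1] by auto
	have "[u * m = u'] (mod L ^ a)" using cong_mult[OF cong_refl m(2), of u] k cong_trans by blast
	then have mu: "L ^ a dvd m * u - u'" by (simp add: cong_iff_dvd_diff mult.commute)
	have rm: "r dvd m - 1" using m(3) by (simp add: cong_iff_dvd_diff)
	have "m * x - x' = L ^ s * (m * u - u')" by (simp add: u u' algebra_simps)
	then have "L ^ a dvd m * x - x'" using mu by simp
	moreover have "r dvd m * x - x'" using rm d by Groebner_Basis.algebra
	ultimately have 3: "N dvd m * x - x'" unfolding N_eq using cop divides_mult by blast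
	have 4: "L ^ c dvd m - 1" if c: "c \<le> i" "L ^ (s + c) dvd x - x'" for c
	proof -
		have "L ^ s * L ^ c dvd L ^ s * (u - u')" using c(2) by (simp add: u u' power_add right_diff_distrib)
		then have "L ^ c dvd u - u'" using L0 by simp
		moreover have "L ^ c dvd L ^ a" using c(1) i(2) by (intro le_imp_power_dvd) simp
		then have "L ^ c dvd m * u - u'" using mu dvd_trans by blast
		ultimately have "L ^ c dvd (m * u - u') - (u - u')" by (simp only: dvd_diff)
		then have "L ^ c dvd (m - 1) * u" by (simp add: algebra_simps)
		moreover have "coprime (L ^ c) u" using prime_imp_coprime[OF L_prime u(2)] by simp
		ultimately show ?thesis using coprime_dvd_mult_left_iff by blast
	qed
	show thesis using that[OF m(1,3) 3] 4 by blast
qed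

text \<open>Otherwise \<open>m ^ k - 1\<close> has valuation exactly \<open>i - 1\<close> for some
  \<open>k\<close>, and \<open>m ^ k\<close> shifts \<open>x\<close> inside \<open>T\<close> by a
  nonzero element of the subgroup of order \<open>l\<close>, against
  \<open>T1_alone\<close>.\<close>

lemma rigid:
	assumes m: "coprime m N" "[m = 1] (mod r)" and x: "x \<in> T1" "m * x \<in> T"
		and d: "L dvd m - 1" "l = 2 ==> 4 dvd m - 1"
	shows "L ^ i dvd m - 1"
proof (rule ccontr)
	assume "\<not> L ^ i dvd m - 1"
	then obtain k where k: "L ^ (i - 1) dvd m ^ k - 1" "\<not> L ^ i dvd m ^ k - 1" using lte[OF prime d] by blast
	have "m ^ n * x \<in> T" for n
	proof (induction n)
		case (Suc n)
		have "m * (m ^ n * x) \<in> T" by (rule mT[OF m(1) T1_T[OF x(1)] x(2) Suc])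
		then show ?case by (simp add: mult.assoc)
	qed (use T1_T[OF x(1)] in simp)
	then have mk: "x + (m ^ k - 1) * x \<in> T" by (simp add: left_diff_distrib)
	obtain u where u: "x = L ^ s * u" "\<not> L dvd u" using T1_decomp[OF x(1)] .
	have "[m ^ k = 1 ^ k] (mod r)" by (rule cong_pow) (rule m(2))
	then have "r dvd m ^ k - 1" by (simp add: cong_iff_dvd_diff)
	moreover have "coprime (L ^ (i - 1)) r" using prime_imp_coprime[OF L_prime r] by simp
	ultimately have "L ^ (i - 1) * r dvd m ^ k - 1" using k(1) divides_mult by blast
	then have "(L ^ (i - 1) * r) * L ^ s dvd (m ^ k - 1) * x" by (rule mult_dvd_mono) (simp add: u)
	then have "p dvd (m ^ k - 1) * x" by (simp add: p_q ac_simps)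
	then have "N dvd (m ^ k - 1) * x" using T1_alone[OF x(1)] mk by blast
	then have "L ^ s * L ^ i dvd L ^ s * ((m ^ k - 1) * u)"
		by (simp add: N_q u ac_simps) (meson dvd_mult_left dvd_mult_right dvd_trans dvd_triv_left mult.assoc mult_dvd_mono dvd_refl)
	then have "L ^ i dvd (m ^ k - 1) * u" using L0 by simp
	moreover have "coprime (L ^ i) u" using prime_imp_coprime[OF L_prime u(2)] by simp
	ultimately show False using k(2) coprime_dvd_mult_left_iff by blast
qed

text \<open>The local unit carrying \<open>x\<close> to \<open>x'\<close> is as close to 1 as the
  two points are to each other; then \<open>rigid\<close> makes it act trivially.\<close>

lemma T1_inj:
	assumes x: "x \<in> T1" "x' \<in> T1" and d: "r dvd x - x'"
		and L: "L ^ Suc s dvd x - x'" "l = 2 ==> L ^ (s + 2) dvd x - x'"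
	shows "N dvd x - x'"
proof -
	obtain m where m: "coprime m N" "[m = 1] (mod r)" "N dvd m * x - x'"
		"\<forall>c\<le>i. L ^ (s + c) dvd x - x' --> L ^ c dvd m - 1" using local_unit[OF x d] .
	have "m * x \<in> T" using T_cong[OF m(3)] T1_T[OF x(2)] by blast
	moreover have "L dvd m - 1" using m(4)[rule_format, of 1] L(1) i(1) by simp
	moreover have "4 dvd m - 1" if "l = 2" using m(4)[rule_format, of 2] L(2)[OF that] i(1) that by simp
	ultimately have "L ^ i dvd m - 1" using rigid[OF m(1,2) x(1)] by blast
	moreover have "L ^ s dvd x" using T1_val x by blast
	ultimately have "L ^ i * L ^ s dvd (m - 1) * x" by (rule mult_dvd_mono)
	then have 1: "L ^ a dvd (m - 1) * x" using i(2) by (simp add: power_add[symmetric] add.commute)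
	have "r dvd (m - 1) * x" using m(2) by (simp add: cong_iff_dvd_diff)
	then have "N dvd (m - 1) * x" unfolding N_eq using 1 cop divides_mult by blast
	then show ?thesis using m(3) by Groebner_Basis.algebra
qed

lemma F_card:
	assumes "k \<le> i"
	shows "F k (L ^ k * t) = int (card {j \<in> {0..<L ^ k}. t + L ^ (a - k) * r * j \<in> T1})"
proof -
	have "F k (L ^ k * t) = (\<Sum>j\<in>{0..<L ^ k}. of_bool (t + L ^ (a - k) * r * j \<in> T1))" by (simp add: F_coset[OF assms] ind_def)
	also have "... = int (card ({0..<L ^ k} \<inter> {j. t + L ^ (a - k) * r * j \<in> T1}))" by (simp add: sum_of_bool_eq)
	also have "{0..<L ^ k} \<inter> {j. t + L ^ (a - k) * r * j \<in> T1} = {j \<in> {0..<L ^ k}. t + L ^ (a - k) * r * j \<in> T1}" by auto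
	finally show ?thesis .
qed

text \<open>The points of \<open>T1\<close> in a coset of the subgroup of order \<open>L ^ i\<close>
  are told apart by their leading \<open>l\<close>-digit, which is not zero. So the coset of
  \<open>t1\<close> contains between 1 and \<open>l - 1\<close> of them, while
  \<open>F_i_zero\<close> makes their number divisible by \<open>l\<close>.\<close>

lemma False_odd:
	assumes "l ~= 2"
	shows False
proof -
	define J where "J = {j \<in> {0..<L ^ i}. t1 + L ^ s * r * j \<in> T1}"
	have "a - i = s" using i by simp
	then have F: "F i (L ^ i * t1) = int (card J)" using F_card[of i t1] by (simp add: J_def)
	have fin: "finite J" unfolding J_def by (rule finite_subset[of _ "{0..<L ^ i}"]) auto
	let ?h = "\<lambda>j. ((t1 + L ^ s * r * j) div L ^ s) mod L"
	have val: "\<exists>u. t1 + L ^ s * r * j = L ^ s * u \<and> \<not> L dvd u" if "j \<in> J" for j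
		using T1_decomp[of "t1 + L ^ s * r * j"] that unfolding J_def by blast
	have "inj_on ?h J"
	proof (rule inj_onI)
		fix j j' assume j: "j \<in> J" "j' \<in> J" "?h j = ?h j'"
		obtain u where u: "t1 + L ^ s * r * j = L ^ s * u" using val[OF j(1)] by blast
		obtain u' where u': "t1 + L ^ s * r * j' = L ^ s * u'" using val[OF j(2)] by blast
		have "L dvd u - u'" using j(3) L0 unfolding u u' by (simp add: mod_eq_dvd_iff)
		then have "L ^ s * L dvd L ^ s * (u - u')" by (rule mult_dvd_mono[OF dvd_refl])
		then have 1: "L ^ Suc s dvd (t1 + L ^ s * r * j) - (t1 + L ^ s * r * j')" unfolding u u' power_Suc2 right_diff_distrib .
		have "N dvd (t1 + L ^ s * r * j) - (t1 + L ^ s * r * j')"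
			by (rule T1_inj) (use j 1 assms in \<open>auto simp: J_def mult.assoc right_diff_distrib[symmetric]\<close>)
		then have "(L ^ s * r) * L ^ i dvd (L ^ s * r) * (j - j')" by (simp add: N_q algebra_simps)
		then have "L ^ i dvd j - j'" using L0 r_pos by simp
		then show "j = j'" using j unfolding J_def
			by (metis (no_types, lifting) atLeastLessThan_iff mem_Collect_eq mod_eq_dvd_iff mod_pos_pos_trivial)
	qed
	moreover have "?h ` J \<subseteq> {1..<L}"
	proof
		fix y assume "y \<in> ?h ` J"
		then obtain j where j: "j \<in> J" "y = ?h j" by blast
		obtain u where u: "t1 + L ^ s * r * j = L ^ s * u" "\<not> L dvd u" using val[OF j(1)] by blast
		have "y = u mod L" using j(2) L0 unfolding u by simp
		then have "y ~= 0" using u(2) by (simp add: dvd_eq_mod_eq_0)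
		moreover have "0 \<le> y" "y < L" using \<open>y = u mod L\<close> L0 by simp_all
		ultimately show "y \<in> {1..<L}" by simp
	qed
	ultimately have "card J \<le> card {1..<L}" by (metis card_inj_on_le finite_atLeastLessThan_int)
	then have "int (card J) < L" using L_gt by simp
	moreover have "0 \<in> J" using t1 L_gt by (simp add: J_def)
	then have "card J > 0" using fin card_gt_0_iff by blast
	ultimately have "\<not> L dvd int (card J)" by (simp add: nat_dvd_not_less)
	then show False using F_i_zero[of "L ^ i * t1"] F by simp
qed

end

subsection \<open>The prime two\<close>

locale nonunit_two = nonunit_deep + assumes two: "l = 2"
begin

lemma r_odd: "odd r" using r two by simp

text \<open>The number of points of \<open>T1\<close> in the coset of \<open>t\<close> is even by
  \<open>F_i_zero\<close>. A second point has the same leading binary digit as \<open>t\<close>, and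
  by \<open>T1_inj\<close> it cannot also share the next one, so \<open>u\<close> is odd.\<close>

lemma partner:
	assumes t: "t \<in> T1"
	obtains u where "odd u" "t + 2 ^ Suc s * r * u \<in> T1"
proof -
	define J where "J = {j \<in> {0..<L ^ i}. t + L ^ s * r * j \<in> T1}"
	have "a - i = s" using i by simp
	then have F: "F i (L ^ i * t) = int (card J)" using F_card[of i t] by (simp add: J_def)
	have fin: "finite J" unfolding J_def by (rule finite_subset[of _ "{0..<L ^ i}"]) auto
	have "0 \<in> J" using t L_gt by (simp add: J_def)
	moreover have "2 dvd card J" using F_i_zero[of "L ^ i * t"] F two by simp
	then have "card J ~= 1" by auto
	ultimately have "J ~= {0}" by auto
	then obtain j where j: "j \<in> J" "j ~= 0" using \<open>0 \<in> J\<close> by blast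
	then have jT: "t + L ^ s * r * j \<in> T1" by (simp add: J_def)
	obtain x where x: "t = L ^ s * x" "\<not> L dvd x" using T1_decomp[OF t] .
	obtain x' where x': "t + L ^ s * r * j = L ^ s * x'" "\<not> L dvd x'" using T1_decomp[OF jT] .
	have "L ^ s * (x + r * j) = L ^ s * x'" using x x' by (simp add: algebra_simps)
	then have "x' = x + r * j" using L0 by simp
	then have "even (r * j)" using x(2) x'(2) two by simp
	then have "even j" using r_odd by simp
	then obtain u where u: "j = 2 * u" by (auto elim: evenE)
	have "odd u"
	proof
		assume "even u"
		then have "4 dvd j" by (auto simp: u)
		then have "L ^ (s + 2) dvd L ^ s * (r * j)" using two by (simp add: power_add dvd_mult)
		then have d2: "L ^ (s + 2) dvd (t + L ^ s * r * j) - t" by (simp add: mult.assoc)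
		then have d1: "L ^ Suc s dvd (t + L ^ s * r * j) - t" by (rule dvd_trans[rotated]) (intro le_imp_power_dvd, simp)
		have "N dvd (t + L ^ s * r * j) - t" by (rule T1_inj[OF jT t _ d1 d2]) (simp add: mult.assoc)
		then have "(L ^ s * r) * L ^ i dvd (L ^ s * r) * j" by (simp add: N_q algebra_simps)
		then have "L ^ i dvd j" using L0 r_pos by simp
		then show False using j zdvd_not_zless[of j "L ^ i"] by (simp add: J_def)
	qed
	moreover have "t + 2 ^ Suc s * r * u \<in> T1" using jT two by (simp add: u algebra_simps)
	ultimately show thesis by (rule that)
qed

text \<open>For \<open>i = 2\<close> the shift to the partner would be an odd multiple of
  \<open>p\<close>, which \<open>T1_alone\<close> forbids.\<close>

lemma i3: "i \<ge> 3"
proof (rule ccontr)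
	assume "\<not> i \<ge> 3"
	then have i2: "i = 2" using i by simp
	obtain u where u: "odd u" "t1 + 2 ^ Suc s * r * u \<in> T1" using partner[OF t1(1)] .
	have "2 ^ Suc s * r = p" using two by (simp add: p_q i2)
	then have "N dvd p * u" using T1_alone[OF t1(1), of "p * u"] u(2) T1_T by simp
	then show False using u(1) p_pos two by (simp add: N_p mult.commute[of _ p])
qed

lemma pow_a: "(2::int) ^ a = 2 ^ (i - 2) * 2 ^ (s + 2)" "(2::int) ^ (a - 1) = 2 ^ (i - 2) * 2 ^ Suc s"
		"(2::int) ^ (a - 1) = 2 ^ (s + 2) * 2 ^ (i - 3)" "(2::int) ^ (a - 2) = 2 ^ (i - 2) * 2 ^ s"
proof -
	have "a = (i - 2) + (s + 2)" "a - 1 = (i - 2) + Suc s" "a - 1 = (s + 2) + (i - 3)" "a - 2 = (i - 2) + s"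
		using i i3 by auto
	then show "(2::int) ^ a = 2 ^ (i - 2) * 2 ^ (s + 2)" "(2::int) ^ (a - 1) = 2 ^ (i - 2) * 2 ^ Suc s"
		"(2::int) ^ (a - 1) = 2 ^ (s + 2) * 2 ^ (i - 3)" "(2::int) ^ (a - 2) = 2 ^ (i - 2) * 2 ^ s" by (metis power_add)+
qed

text \<open>\<open>2 ^ (i - 2)\<close> is the largest power of 2 for which the push-forward of
  \<open>T1\<close> still has one-point fibres; it turns the shift to the partner into translation
  by \<open>p\<close>.\<close>

definition E :: "int set" where
	"E = {z. \<exists>x\<in>T1. N dvd 2 ^ (i - 2) * x - z}"

lemma E_cong: "N dvd x - y ==> x \<in> E \<longleftrightarrow> y \<in> E"
proof -
	assume d: "N dvd x - y"
	have "N dvd (u - y) - (u - x)" for u using d by simp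
	then have "N dvd u - y \<longleftrightarrow> N dvd u - x" for u by (rule dvd_iff_diff)
	then show ?thesis by (simp add: E_def)
qed

lemma E_I: "aset E"
proof -
	have perF: "per N (F (i - 2))" by (simp add: F_def per_frob)
	have "F (i - 2) z = ind E z" for z
	proof (cases "z \<in> E")
		case True
		then obtain x where x: "x \<in> T1" "N dvd 2 ^ (i - 2) * x - z" by (auto simp: E_def)
		have "a - (i - 2) = s + 2" using i i3 by simp
		then have "F (i - 2) (2 ^ (i - 2) * x) = int (card {j \<in> {0..<2 ^ (i - 2)}. x + 2 ^ (s + 2) * r * j \<in> T1})"
			using F_card[of "i - 2" x] two by simp
		also have "{j \<in> {0..<2 ^ (i - 2)}. x + 2 ^ (s + 2) * r * j \<in> T1} = {0}"
		proof (intro subset_antisym subsetI)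
			fix j assume j: "j \<in> {j \<in> {0..<2 ^ (i - 2)}. x + 2 ^ (s + 2) * r * j \<in> T1}"
			have "N dvd (x + 2 ^ (s + 2) * r * j) - x" by (rule T1_inj) (use j x two in auto)
			then have "(2 ^ (s + 2) * r) * 2 ^ (i - 2) dvd (2 ^ (s + 2) * r) * j" using two pow_a(1) by (simp add: N_eq ac_simps)
			then have "2 ^ (i - 2) dvd j" using r_pos by simp
			moreover have "0 \<le> j" "j < 2 ^ (i - 2)" using j by auto
			ultimately show "j \<in> {0}" using zdvd_imp_le[of "2 ^ (i - 2)" j] by (cases "j = 0") auto
		qed (use x in auto)
		finally show ?thesis using per_cong[OF perF x(2)] True by (simp add: ind_def)
	next
		case False
		have *: "of_bool (N dvd L ^ (i - 2) * x - z) * ind T1 x = 0" for x using False two by (auto simp: ind_def E_def)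
		have "F (i - 2) z = 0" unfolding F_i_sum by (rule sum.neutral) (use * in blast)
		then show ?thesis using False by (simp add: ind_def)
	qed
	then have "(\<lambda>z. F (i - 2) z mod L) = ind E" using two by (auto simp: ind_def)
	then show ?thesis using F_I[of "i - 2"] i3 by (simp add: I_ind)
qed

lemma two_p: "N = 2 * p" using N_p two by simp

lemma E_p: "x \<in> E ==> x + p * k \<in> E"
proof (cases "even k")
	case True
	assume "x \<in> E"
	moreover have "N dvd (x + p * k) - x" using True by (auto simp: two_p)
	ultimately show ?thesis using E_cong by blast
next
	case False
	assume "x \<in> E"
	then obtain t where t: "t \<in> T1" "N dvd 2 ^ (i - 2) * t - x" by (auto simp: E_def)
	obtain u where u: "odd u" "t + 2 ^ Suc s * r * u \<in> T1" using partner[OF t(1)] .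
	have "2 ^ (i - 2) * (2 ^ Suc s * r * u) = p * u" using pow_a(2) two by (simp add: p_def mult.assoc)
	then have e: "2 ^ (i - 2) * (t + 2 ^ Suc s * r * u) - (x + p * k) = (2 ^ (i - 2) * t - x) + p * (u - k)"
		by (simp add: algebra_simps)
	have "even (u - k)" using u False by simp
	then have "N dvd p * (u - k)" by (auto simp: two_p)
	then have "N dvd 2 ^ (i - 2) * (t + 2 ^ Suc s * r * u) - (x + p * k)" unfolding e by (rule dvd_add[OF t(2)])
	then show ?thesis using u(2) by (auto simp: E_def)
qed

lemma E_decomp:
	assumes "x \<in> E"
	obtains u where "x = 2 ^ (a - 2) * u" "odd u"
proof -
	obtain t where t: "t \<in> T1" "N dvd 2 ^ (i - 2) * t - x" using assms by (auto simp: E_def)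
	obtain y where y: "t = L ^ s * y" "\<not> L dvd y" using T1_decomp[OF t(1)] .
	have e: "2 ^ (i - 2) * t = 2 ^ (a - 2) * y" using pow_a(4) two by (simp add: y)
	define c where "c = a - 2"
	have "a = c + 2" using s_a by (simp add: c_def)
	then have "N = 2 ^ c * (4 * r)" using two by (simp add: N_eq power_add)
	then have N: "N = 2 ^ (a - 2) * (4 * r)" by (simp add: c_def)
	obtain k where "2 ^ (i - 2) * t - x = N * k" using t(2) by (auto elim: dvdE)
	then have "x = 2 ^ (i - 2) * t - N * k" by simp
	then have "x = 2 ^ (a - 2) * y - (2 ^ (a - 2) * (4 * r)) * k" unfolding e N .
	then have "x = 2 ^ (a - 2) * (y - 4 * r * k)" by (simp add: algebra_simps)
	moreover have "odd (y - 4 * r * k)" using y(2) two by simp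
	ultimately show thesis by (rule that)
qed

definition Y2 :: "int set" where
	"Y2 = {z. \<exists>x\<in>E. p dvd 2 * x - z}"

text \<open>The Klein four-group is generated by \<open>x \<mapsto> z - x\<close> and
  \<open>x \<mapsto> x + p\<close>. The degenerate representations are those with
  \<open>p dvd 2 * x - z\<close>; for \<open>z\<close> in \<open>Y2\<close> they form a single coset
  of the subgroup of order 2.\<close>

lemma Y2_count: "card {x \<in> {0..<N}. x \<in> E \<and> z - x \<in> E} mod 4 = (if z \<in> Y2 then 2 else 0)"
proof -
	define A where "A = {x \<in> {0..<N}. x \<in> E \<and> z - x \<in> E}"
	define B where "B = {x \<in> A. p dvd 2 * x - z}"
	have bad: "N dvd 2 * x - z \<or> N dvd (x + p) - x \<or> N dvd x + (x + p) - z \<longleftrightarrow> p dvd 2 * x - z" for x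
	proof
		assume "N dvd 2 * x - z \<or> N dvd (x + p) - x \<or> N dvd x + (x + p) - z"
		moreover have "\<not> N dvd p" using p_pos zdvd_imp_le[of N p] by (auto simp: two_p)
		moreover have "N dvd x + (x + p) - z ==> p dvd 2 * x - z" "N dvd 2 * x - z ==> p dvd 2 * x - z"
			using two_p by Groebner_Basis.algebra+
		ultimately show "p dvd 2 * x - z" by auto
	next
		assume "p dvd 2 * x - z"
		then obtain k where k: "2 * x - z = p * k" by (elim dvdE)
		then have "x + (x + p) - z = p * (k + 1)" by (simp add: algebra_simps)
		moreover have "N dvd p * k \<or> N dvd p * (k + 1)" by (cases "even k") (auto simp: two_p mult.commute[of 2])
		ultimately show "N dvd 2 * x - z \<or> N dvd (x + p) - x \<or> N dvd x + (x + p) - z" using k by metis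
	qed
	have "card A mod 4 = card {x \<in> A. N dvd 2 * x - z \<or> N dvd (x + p) - x \<or> N dvd x + (x + p) - z} mod 4" unfolding A_def
	proof (rule card_representations_mod_4[OF N_pos E_cong])
		fix x assume x: "x \<in> E" "z - x \<in> E"
		have "x + p \<in> E" "z - (x + p) \<in> E" using E_p[OF x(1), of 1] E_p[OF x(2), of "-1"] by (simp_all add: algebra_simps)
		moreover have "N dvd (x + p + p) - x" "N dvd (z - x + p) - (z - (x + p))" by (simp_all add: two_p)
		ultimately show "x + p \<in> E \<and> z - (x + p) \<in> E \<and> N dvd (x + p + p) - x \<and> N dvd (z - x + p) - (z - (x + p))" by blast
	qed simp_all
	then have "card A mod 4 = card B mod 4" unfolding bad B_def .
	moreover have "card B = (if z \<in> Y2 then 2 else 0)"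
	proof (cases "z \<in> Y2")
		case True
		then obtain x where x: "x \<in> E" "p dvd 2 * x - z" by (auto simp: Y2_def)
		obtain u where u: "x = 2 ^ (a - 2) * u" "odd u" using E_decomp[OF x(1)] .
		have mem: "(x + p * k) mod N \<in> B" for k
		proof -
			obtain c where c: "2 * x - z = p * c" using x(2) by (auto elim: dvdE)
			have "z - (x + p * k) = x + p * (- c - k)" using c by (simp add: algebra_simps)
			then have "z - (x + p * k) \<in> E" using E_p[OF x(1)] by metis
			moreover have "p dvd 2 * (x + p * k) - z" using x(2) dvd_iff_diff[of p "2 * (x + p * k) - z" "2 * x - z"] by simp
			moreover have e: "N dvd (x + p * k) mod N - (x + p * k)" by (simp add: mod_eq_dvd_iff[symmetric])
			ultimately have "p dvd 2 * ((x + p * k) mod N) - z" using two_p by Groebner_Basis.algebra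
			moreover have "z - (x + p * k) mod N \<in> E"
				using E_cong[of "z - (x + p * k) mod N" "z - (x + p * k)"] e \<open>z - (x + p * k) \<in> E\<close> by (simp add: dvd_diff_commute)
			ultimately show ?thesis using E_p[OF x(1)] E_cong[OF e] N_pos by (simp add: A_def B_def)
		qed
		have "B = {x mod N, (x + p) mod N}"
		proof (intro subset_antisym subsetI)
			fix b assume "b \<in> B"
			then have b: "b \<in> E" "p dvd 2 * b - z" "0 \<le> b" "b < N" by (auto simp: A_def B_def)
			obtain u' where u': "b = 2 ^ (a - 2) * u'" "odd u'" using E_decomp[OF b(1)] .
			have "r dvd p" by (simp add: p_def)
			then have "r dvd 2 * (b - x)" using b(2) x(2) by Groebner_Basis.algebra
			moreover have "coprime r 2" using r_odd by simp
			ultimately have rb: "r dvd b - x" using coprime_dvd_mult_right_iff by blast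
			have "even (u' - u)" using u u' by simp
			then have "2 ^ (a - 2) * 2 dvd 2 ^ (a - 2) * (u' - u)" by simp
			moreover have "a - 1 = (a - 2) + 1" using s_a by simp
			then have "(2::int) ^ (a - 2) * 2 = 2 ^ (a - 1)" by (metis power_add power_one_right)
			ultimately have "2 ^ (a - 1) dvd 2 ^ (a - 2) * (u' - u)" by metis
			then have "2 ^ (a - 1) dvd b - x" by (simp add: u u' right_diff_distrib)
			moreover have "coprime (2 ^ (a - 1)) r" using r_odd by simp
			ultimately have "2 ^ (a - 1) * r dvd b - x" using rb divides_mult by blast
			then have "p dvd b - x" using two by (simp add: p_def)
			then obtain k where k: "b = x + p * k" by (metis add.commute diff_eq_eq dvdE)
			show "b \<in> {x mod N, (x + p) mod N}"
			proof (cases "even k")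
				case True
				then have "N dvd b - x" by (auto simp: k two_p)
				then have "b mod N = x mod N" by (simp add: mod_eq_dvd_iff)
				then show ?thesis using b by simp
			next
				case False
				then have "N dvd p * (k - 1)" by (auto simp: two_p)
				then have "N dvd b - (x + p)" by (simp add: k algebra_simps)
				then have "b mod N = (x + p) mod N" by (simp add: mod_eq_dvd_iff)
				then show ?thesis using b by simp
			qed
		qed (use mem[of 0] mem[of 1] in auto)
		moreover have "x mod N ~= (x + p) mod N"
		proof
			assume "x mod N = (x + p) mod N"
			then have "N dvd - p" by (simp add: mod_eq_dvd_iff)
			then show False using p_pos zdvd_imp_le[of N p] by (simp add: two_p)
		qed
		ultimately show ?thesis using True by simp
	next
		case False
		then have "B = {}" by (auto simp: A_def B_def Y2_def)
		then show ?thesis using False by simp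
	qed
	ultimately show ?thesis unfolding A_def[symmetric] by simp
qed

lemma Y2_aset: "aset Y2"
proof -
	have "conv N (ind E) (ind E) \<in> I" using E_I I_conv by (simp add: I_ind)
	then have "aset {z. conv N (ind E) (ind E) z mod 4 = 2}" by (rule aset_level[where P="\<lambda>a. a mod 4 = 2"])
	moreover have "conv N (ind E) (ind E) z mod 4 = 2 \<longleftrightarrow> z \<in> Y2" for z
	proof -
		have "int (card {x \<in> {0..<N}. x \<in> E \<and> z - x \<in> E}) mod 4 = int (card {x \<in> {0..<N}. x \<in> E \<and> z - x \<in> E} mod 4)"
			by (simp add: zmod_int)
		then show ?thesis unfolding conv_ind Y2_count by simp
	qed
	ultimately show ?thesis by simp
qed

end

context nonunit_two
begin

section \<open>Reduction of the case of the prime two modulo the odd part of N\<close>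

definition Wr :: "int set" where
	"Wr = {y. \<exists>x\<in>T1. r dvd 2 ^ (i - 1) * x - y}"

definition Wb :: "int set" where
	"Wb = {b. \<exists>x\<in>T1. r dvd x - b}"

lemma Wr_cong: "r dvd x - y ==> x \<in> Wr \<longleftrightarrow> y \<in> Wr"
proof -
	assume d: "r dvd x - y"
	have "r dvd (u - y) - (u - x)" for u using d by simp
	then have "r dvd u - y \<longleftrightarrow> r dvd u - x" for u by (rule dvd_iff_diff)
	then show ?thesis by (simp add: Wr_def)
qed

lemma Wb_cong: "r dvd x - y ==> x \<in> Wb \<longleftrightarrow> y \<in> Wb"
proof -
	assume d: "r dvd x - y"
	have "r dvd (u - y) - (u - x)" for u using d by simp
	then have "r dvd u - y \<longleftrightarrow> r dvd u - x" for u by (rule dvd_iff_diff)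
	then show ?thesis by (simp add: Wb_def)
qed

lemma pow_T1: "x \<in> T1 ==> 2 ^ (a - 1) dvd 2 ^ (i - 1) * x"
proof -
	assume x: "x \<in> T1"
	have "2 ^ (i - 1) * L ^ s dvd 2 ^ (i - 1) * x" using T1_val[OF x] by (intro mult_dvd_mono) auto
	moreover have "(2::int) ^ (i - 1) * L ^ s = 2 ^ (a - 1)" using i(3) two by (simp add: power_add)
	ultimately show ?thesis by metis
qed

lemma p_split: "p dvd u \<longleftrightarrow> 2 ^ (a - 1) dvd u \<and> r dvd u"
proof -
	have "coprime (2 ^ (a - 1)) r" using r_odd by simp
	then have "2 ^ (a - 1) * r dvd u \<longleftrightarrow> 2 ^ (a - 1) dvd u \<and> r dvd u"
		by (auto intro: divides_mult elim: dvd_mult_left dvd_mult_right)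
	then show ?thesis using two by (simp add: p_def)
qed

text \<open>Multiplication by \<open>2 ^ (i - 1)\<close> moves the 2-component of \<open>T1\<close>
  into the subgroup of order 2, so only the residue modulo \<open>r\<close> is left as a
  condition.\<close>

lemma Y2_iff: "y \<in> Y2 \<longleftrightarrow> 2 ^ (a - 1) dvd y \<and> y \<in> Wr"
proof -
	have pN: "p dvd N" by (simp add: two_p)
	have "i - 1 = Suc (i - 2)" using i3 by simp
	then have i1: "(2::int) ^ (i - 1) = 2 * 2 ^ (i - 2)" by simp
	have "y \<in> Y2 \<longleftrightarrow> (\<exists>x\<in>T1. p dvd 2 ^ (i - 1) * x - y)"
	proof
		assume "y \<in> Y2"
		then obtain e x where e: "p dvd 2 * e - y" "x \<in> T1" "N dvd 2 ^ (i - 2) * x - e" by (auto simp: Y2_def E_def)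
		have "p dvd 2 ^ (i - 2) * x - e" using e(3) pN dvd_trans by blast
		then have "p dvd 2 * (2 ^ (i - 2) * x - e)" by (rule dvd_mult)
		then have "p dvd 2 * (2 ^ (i - 2) * x - e) + (2 * e - y)" using e(1) by (rule dvd_add)
		then have "p dvd 2 ^ (i - 1) * x - y" unfolding i1 by (simp add: algebra_simps)
		then show "\<exists>x\<in>T1. p dvd 2 ^ (i - 1) * x - y" using e(2) by blast
	next
		assume "\<exists>x\<in>T1. p dvd 2 ^ (i - 1) * x - y"
		then obtain x where x: "x \<in> T1" "p dvd 2 ^ (i - 1) * x - y" by blast
		have "2 ^ (i - 2) * x \<in> E" unfolding E_def using x(1) by (auto intro!: bexI[of _ x])
		moreover have "p dvd 2 * (2 ^ (i - 2) * x) - y" using x(2) unfolding i1 by (simp add: mult.assoc)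
		ultimately show "y \<in> Y2" unfolding Y2_def by blast
	qed
	also have "... \<longleftrightarrow> 2 ^ (a - 1) dvd y \<and> y \<in> Wr"
	proof -
		have "2 ^ (a - 1) dvd 2 ^ (i - 1) * x - y \<longleftrightarrow> 2 ^ (a - 1) dvd y" if "x \<in> T1" for x
			using pow_T1[OF that] by (simp add: dvd_diff_right_iff)
		then show ?thesis unfolding p_split Wr_def by blast
	qed
	finally show ?thesis .
qed

lemma Y2_v: "y \<in> Y2 ==> v dvd y"
proof -
	assume y: "y \<in> Y2"
	have "(2::int) ^ Suc s dvd 2 ^ (a - 1)" using s_a by (intro le_imp_power_dvd) simp
	then have "2 ^ Suc s dvd y" using y Y2_iff dvd_trans by blast
	moreover obtain x where x: "x \<in> T1" "r dvd 2 ^ (i - 1) * x - y" using y by (auto simp: Y2_iff Wr_def)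
	have "w dvd x" using vp_T1[OF x(1)] vp_w by (auto elim: dvd_mult_right)
	then have "w dvd 2 ^ (i - 1) * x" by (rule dvd_mult)
	moreover have "w dvd 2 ^ (i - 1) * x - y" using x(2) w_r dvd_trans by blast
	ultimately have "2 ^ Suc s dvd y" "w dvd y" using dvd_iff_diff by blast+
	moreover have "coprime (2 ^ Suc s) w" using cop_Lw[of "Suc s"] two by simp
	ultimately have "2 ^ Suc s * w dvd y" using divides_mult by blast
	then show ?thesis using two by (simp add: v_w)
qed

lemma conv_Y2: "2 dvd conv N (ind T1) (ind Y2) z"
proof -
	have "(\<lambda>z. ind Y2 z mod L) = ind Y2" using two by (auto simp: ind_def)
	then have 1: "(\<lambda>z. ind Y2 z mod L) \<in> I" using Y2_aset by (simp add: I_ind)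
	have 2: "ind Y2 (z + p * j) = ind Y2 z" for z j
	proof -
		have "p dvd u - (z + p * j) \<longleftrightarrow> p dvd u - z" for u by (rule dvd_iff_diff) simp
		then show ?thesis by (simp add: ind_def Y2_def)
	qed
	have "L dvd conv N (ind Y2) (ind T1) z" by (rule kill[OF 1 2]) (auto simp: ind_def Y2_v split: if_splits)
	moreover have "conv N (ind Y2) (ind T1) = conv N (ind T1) (ind Y2)"
		using conv_commute[OF N_pos _ per_ind1] I_per Y2_aset I_ind by blast
	ultimately show ?thesis using two by simp
qed

text \<open>The even numbers of \<open>conv_Y2\<close> are summed over translates by multiples of
  \<open>2 ^ (s + 2) * r\<close>. The sum counts points of \<open>T1\<close> with a prescribed
  residue modulo \<open>2 ^ (s + 2)\<close>, and each class of \<open>Wb\<close> modulo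
  \<open>r\<close> contains exactly one such point.\<close>

lemma conv_quotient: "2 dvd card {x \<in> {0..<r}. x \<in> Wb \<and> b - x \<in> Wr}"
proof -
	let ?q = "2 ^ (s + 2) * r"
	have "coprime (2 ^ a) r" using r_odd by simp
	\<comment> \<open>With 2-component \<open>2 ^ s\<close> for \<open>z0\<close>, the points of
	  \<open>T1\<close> that count are \<open>2 ^ s\<close> times a number congruent to 1 modulo 4; of
	  a point and its partner exactly one qualifies.\<close>
	then obtain z0 where z0: "[z0 = 2 ^ s] (mod 2 ^ a)" "[z0 = b] (mod r)" using binary_chinese_remainder_int by blast
	have perY: "per N (ind Y2)" using I_per Y2_aset I_ind by blast
	have inner: "rsum (2 ^ (i - 3)) (\<lambda>j. ind Y2 (y + ?q * j)) = of_bool (2 ^ (s + 2) dvd y \<and> y \<in> Wr)" for y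
	proof -
		have W: "y + ?q * j \<in> Wr \<longleftrightarrow> y \<in> Wr" for j by (rule Wr_cong) simp
		show ?thesis
		proof (cases "2 ^ (s + 2) dvd y")
			case False
			have "\<not> 2 ^ (a - 1) dvd y + ?q * j" for j
			proof
				assume "2 ^ (a - 1) dvd y + ?q * j"
				then have "2 ^ (s + 2) dvd y + ?q * j" unfolding pow_a(3) by (rule dvd_mult_left)
				then show False using False by (simp add: mult.assoc dvd_add_left_iff)
			qed
			then show ?thesis using False by (simp add: ind_def Y2_iff)
		next
			case True
			then obtain y' where y': "y = 2 ^ (s + 2) * y'" by (auto elim: dvdE)
			have e: "2 ^ (a - 1) dvd y + ?q * j \<longleftrightarrow> 2 ^ (i - 3) dvd y' + r * j" for j
			proof -
				have "y + ?q * j = 2 ^ (s + 2) * (y' + r * j)" by (simp add: y' algebra_simps)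
				then show ?thesis unfolding pow_a(3) by simp
			qed
			have cr: "coprime r (2 ^ (i - 3))" using r_odd by simp
			let ?h = "\<lambda>j. of_bool (2 ^ (i - 3) dvd j - (- y')) * (1::int)"
			have "per (2 ^ (i - 3)) ?h"
			proof (rule perI)
				fix x x' :: int assume "2 ^ (i - 3) dvd x - x'"
				then have "2 ^ (i - 3) dvd (x - (- y')) - (x' - (- y'))" by simp
				then have "2 ^ (i - 3) dvd x - (- y') \<longleftrightarrow> 2 ^ (i - 3) dvd x' - (- y')" by (rule dvd_iff_diff)
				then show "?h x = ?h x'" by simp
			qed
			then have "rsum (2 ^ (i - 3)) (\<lambda>j. ?h (r * j)) = rsum (2 ^ (i - 3)) ?h" by (intro rsum_unit cr) auto
			also have "... = 1" by (rule rsum_delta) (simp_all add: per_def)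
			finally have "rsum (2 ^ (i - 3)) (\<lambda>j. of_bool (2 ^ (i - 3) dvd y' + r * j)) = (1::int)" by (simp add: add.commute)
			moreover have "y + ?q * j \<in> Y2 \<longleftrightarrow> 2 ^ (i - 3) dvd y' + r * j \<and> y \<in> Wr" for j using Y2_iff e W by blast
			ultimately show ?thesis using True by (cases "y \<in> Wr") (simp_all add: ind_def)
		qed
	qed
	define C where "C = {x \<in> {0..<N}. x \<in> T1 \<and> 2 ^ (s + 2) dvd z0 - x \<and> z0 - x \<in> Wr}"
	have "rsum (2 ^ (i - 3)) (\<lambda>j. conv N (ind T1) (ind Y2) (z0 + ?q * j))
			= rsum N (\<lambda>x. ind T1 x * rsum (2 ^ (i - 3)) (\<lambda>j. ind Y2 ((z0 - x) + ?q * j)))"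
		unfolding conv_def by (subst sum.swap) (simp add: sum_distrib_left algebra_simps)
	also have "... = (\<Sum>x\<in>{0..<N}. of_bool (x \<in> T1 \<and> 2 ^ (s + 2) dvd z0 - x \<and> z0 - x \<in> Wr))"
		unfolding inner by (intro sum.cong) (auto simp: ind_def)
	also have "... = int (card ({0..<N} \<inter> {x. x \<in> T1 \<and> 2 ^ (s + 2) dvd z0 - x \<and> z0 - x \<in> Wr}))" by (simp add: sum_of_bool_eq)
	also have "{0..<N} \<inter> {x. x \<in> T1 \<and> 2 ^ (s + 2) dvd z0 - x \<and> z0 - x \<in> Wr} = C" by (auto simp: C_def)
	finally have "rsum (2 ^ (i - 3)) (\<lambda>j. conv N (ind T1) (ind Y2) (z0 + ?q * j)) = int (card C)" .
	moreover have "2 dvd rsum (2 ^ (i - 3)) (\<lambda>j. conv N (ind T1) (ind Y2) (z0 + ?q * j))" using conv_Y2 by (intro dvd_sum)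
	ultimately have "2 dvd card C" by simp
	have rN: "r dvd N" by (simp add: N_eq)
	have z0r: "r dvd z0 - b" using z0(2) by (simp add: cong_iff_dvd_diff)
	have aN: "(2::int) ^ (s + 2) dvd 2 ^ a" using s_a by (intro le_imp_power_dvd) simp
	then have z0s: "2 ^ (s + 2) dvd z0 - 2 ^ s" using z0(1) dvd_trans by (auto simp: cong_iff_dvd_diff)
	have sN: "2 ^ (s + 2) dvd N" using aN two by (simp add: N_eq)
	have "bij_betw (\<lambda>x. x mod r) C {x \<in> {0..<r}. x \<in> Wb \<and> b - x \<in> Wr}"
	proof (rule bij_betw_imageI)
		show "inj_on (\<lambda>x. x mod r) C"
		proof (rule inj_onI)
			fix x x' assume x: "x \<in> C" "x' \<in> C" "x mod r = x' mod r"
			have "2 ^ (s + 2) dvd z0 - x'" "2 ^ (s + 2) dvd z0 - x" using x unfolding C_def by blast+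
			then have "2 ^ (s + 2) dvd (z0 - x') - (z0 - x)" by (rule dvd_diff)
			then have d2: "2 ^ (s + 2) dvd x - x'" by simp
			then have d1: "2 ^ Suc s dvd x - x'" by (rule dvd_trans[rotated]) (intro le_imp_power_dvd, simp)
			have "N dvd x - x'" by (rule T1_inj) (use x d1 d2 two in \<open>auto simp: C_def mod_eq_dvd_iff\<close>)
			then have "x mod N = x' mod N" by (simp add: mod_eq_dvd_iff)
			then show "x = x'" using x by (simp add: C_def)
		qed
		show "(\<lambda>x. x mod r) ` C = {x \<in> {0..<r}. x \<in> Wb \<and> b - x \<in> Wr}"
		proof (intro subset_antisym subsetI)
			fix y assume "y \<in> (\<lambda>x. x mod r) ` C"
			then obtain x where x: "x \<in> C" "y = x mod r" by blast
			have rx: "r dvd x - y" using x(2) by (simp add: mod_eq_dvd_iff[symmetric])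
			then have "y \<in> Wb" using x(1) by (auto simp: C_def Wb_def)
			moreover have "r dvd (z0 - x) - (b - y)" using dvd_diff[OF z0r rx] by (simp add: algebra_simps)
			then have "b - y \<in> Wr" using Wr_cong x(1) by (auto simp: C_def)
			ultimately show "y \<in> {x \<in> {0..<r}. x \<in> Wb \<and> b - x \<in> Wr}" using x(2) r_pos by simp
		next
			fix y assume "y \<in> {x \<in> {0..<r}. x \<in> Wb \<and> b - x \<in> Wr}"
			then have y: "0 \<le> y" "y < r" "y \<in> Wb" "b - y \<in> Wr" by auto
			then obtain t where t: "t \<in> T1" "r dvd t - y" by (auto simp: Wb_def)
			have "\<exists>t'\<in>T1. r dvd t' - y \<and> 2 ^ (s + 2) dvd z0 - t'"
			proof -
				obtain x where x: "t = L ^ s * x" "\<not> L dvd x" using T1_decomp[OF t(1)] .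
				have x': "t = 2 ^ s * x" "odd x" using x two by auto
				obtain u where u: "odd u" "t + 2 ^ Suc s * r * u \<in> T1" using partner[OF t(1)] .
				have "4 dvd 1 - x \<or> 4 dvd 1 - (x + 2 * (r * u))"
				proof -
					have "odd (r * u)" using u(1) r_odd by simp
					then obtain k where k: "r * u = 2 * k + 1" by (rule oddE)
					show ?thesis unfolding k using x'(2) by presburger
				qed
				then show ?thesis
				proof
					assume "4 dvd 1 - x"
					then have "2 ^ s * 4 dvd 2 ^ s * (1 - x)" by (rule mult_dvd_mono[OF dvd_refl])
					then have "2 ^ (s + 2) dvd 2 ^ s - t" by (simp add: x' power_add algebra_simps)
					then have "2 ^ (s + 2) dvd (z0 - 2 ^ s) + (2 ^ s - t)" by (rule dvd_add[OF z0s])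
					then show ?thesis using t by auto
				next
					let ?t = "t + 2 ^ Suc s * r * u"
					assume "4 dvd 1 - (x + 2 * (r * u))"
					then have "2 ^ s * 4 dvd 2 ^ s * (1 - (x + 2 * (r * u)))" by (rule mult_dvd_mono[OF dvd_refl])
					then have "2 ^ (s + 2) dvd 2 ^ s - ?t" by (simp add: x' power_add algebra_simps)
					then have "2 ^ (s + 2) dvd (z0 - 2 ^ s) + (2 ^ s - ?t)" by (rule dvd_add[OF z0s])
					then have "2 ^ (s + 2) dvd z0 - ?t" by (simp add: algebra_simps)
					moreover have "r dvd ?t - y" using t(2) dvd_iff_diff[of r "?t - y" "t - y"] by simp
					ultimately show ?thesis using u(2) by blast
				qed
			qed
			then obtain t' where t': "t' \<in> T1" "r dvd t' - y" "2 ^ (s + 2) dvd z0 - t'" by blast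
			let ?x = "t' mod N"
			have dN: "N dvd ?x - t'" by (simp add: mod_eq_dvd_iff[symmetric])
			have xr: "r dvd ?x - y" using dvd_add[OF dvd_trans[OF rN dN] t'(2)] by simp
			have "?x \<in> T1" using T1_cong[OF dN] t'(1) by simp
			moreover have "2 ^ (s + 2) dvd z0 - ?x" using dvd_diff[OF t'(3) dvd_trans[OF sN dN]] by simp
			moreover have "r dvd (z0 - ?x) - (b - y)" using dvd_diff[OF z0r xr] by (simp add: algebra_simps)
			then have "z0 - ?x \<in> Wr" using Wr_cong y(4) by blast
			ultimately have "?x \<in> C" using N_pos by (simp add: C_def)
			moreover have "?x mod r = y mod r" using xr by (simp add: mod_eq_dvd_iff)
			then have "y = ?x mod r" using y by simp
			ultimately show "y \<in> (\<lambda>x. x mod r) ` C" by blast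
		qed
	qed
	then have "card C = card {x \<in> {0..<r}. x \<in> Wb \<and> b - x \<in> Wr}" by (rule bij_betw_same_card)
	then show ?thesis using \<open>2 dvd card C\<close> by (simp only:)
qed

text \<open>In the group ring modulo 2 of the group of odd order \<open>r\<close>, \<open>Wr\<close>
  is the power \<open>2 ^ (i - 1)\<close> of \<open>Wb\<close>, and the product of \<open>Wb\<close>
  and \<open>Wr\<close> vanishes. Hence \<open>Wb\<close> is nilpotent and therefore zero, although
  it contains \<open>t1\<close>.\<close>

lemma False_two: False
proof -
	have perb: "per r (ind Wb)" by (rule perI) (simp add: ind_def Wb_cong)
	have perr: "per r (ind Wr)" by (rule perI) (simp add: ind_def Wr_cong)
	have p2: "prime (2::nat)" by simp
	have odd_cop: "coprime (2 ^ k) r" for k using r_odd by simp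
	have fr: "\<exists>m. \<forall>z. frob r (2 ^ k) (ind Wb) z = ind Wb (m * z) \<and> r dvd 2 ^ k * (m * z) - z" for k
	proof -
		obtain m where m: "[m * 2 ^ k = 1] (mod r)" using odd_cop[of k] by (metis cong_solve_coprime_int mult.commute)
		have "r dvd 2 ^ k * (m * z) - z" for z
		proof -
			have "r dvd (m * 2 ^ k - 1) * z" using m by (simp add: cong_iff_dvd_diff)
			then show ?thesis by (simp add: algebra_simps)
		qed
		then show ?thesis using frob_unit[OF r_pos perb m] by blast
	qed
	have Wr: "ind Wr z = frob r (2 ^ (i - 1)) (ind Wb) z" for z
	proof -
		obtain m where m: "\<forall>z. frob r (2 ^ (i - 1)) (ind Wb) z = ind Wb (m * z) \<and> r dvd 2 ^ (i - 1) * (m * z) - z"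
			using fr by blast
		have "r dvd x - m * z \<longleftrightarrow> r dvd 2 ^ (i - 1) * x - z" for x
		proof -
			have "r dvd 2 ^ (i - 1) * (m * z) - z" using m by blast
			then have "r dvd (2 ^ (i - 1) * x - z) - 2 ^ (i - 1) * (x - m * z)" by (simp add: algebra_simps)
			then have "r dvd 2 ^ (i - 1) * x - z \<longleftrightarrow> r dvd 2 ^ (i - 1) * (x - m * z)" by (rule dvd_iff_diff)
			then show ?thesis using odd_cop[of "i - 1"] by (simp add: coprime_commute coprime_dvd_mult_right_iff)
		qed
		then have "z \<in> Wr \<longleftrightarrow> m * z \<in> Wb" by (simp add: Wr_def Wb_def)
		then show ?thesis using m by (simp add: ind_def)
	qed
	let ?n = "(2::nat) ^ (i - 1)"
	have "[convpow r (ind Wb) ?n z = ind Wr z] (mod 2)" for z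
		using convpow_prime_pow[OF r_pos perb p2, of "i - 1" z] by (simp add: Wr)
	then have "[conv r (ind Wb) (convpow r (ind Wb) ?n) z = conv r (ind Wb) (ind Wr) z] (mod 2)" for z
		by (intro conv_cong) auto
	then have c1: "[convpow r (ind Wb) (Suc ?n) z = conv r (ind Wb) (ind Wr) z] (mod 2)" for z by simp
	have c2: "conv r (ind Wb) (ind Wr) z = int (card {x \<in> {0..<r}. x \<in> Wb \<and> z - x \<in> Wr})" for z
	proof -
		have "conv r (ind Wb) (ind Wr) z = (\<Sum>x\<in>{0..<r}. of_bool (x \<in> Wb \<and> z - x \<in> Wr))"
			unfolding conv_def ind_def by (intro sum.cong) auto
		also have "... = int (card ({0..<r} \<inter> {x. x \<in> Wb \<and> z - x \<in> Wr}))" by (simp add: sum_of_bool_eq)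
		also have "{0..<r} \<inter> {x. x \<in> Wb \<and> z - x \<in> Wr} = {x \<in> {0..<r}. x \<in> Wb \<and> z - x \<in> Wr}" by auto
		finally show ?thesis .
	qed
	have even1: "2 dvd convpow r (ind Wb) (Suc ?n) z" for z
	proof -
		have "2 dvd conv r (ind Wb) (ind Wr) z" unfolding c2 using conv_quotient[of z] by simp
		then show ?thesis using cong_dvd_iff[OF c1] by blast
	qed
	have "i = Suc (i - 1)" using i(1) by simp
	then have "(2::nat) ^ i = 2 * ?n" by (metis power_Suc)
	moreover have "?n \<ge> 1" by simp
	ultimately have "(2::nat) ^ i = Suc ?n + (?n - 1)" by linarith
	then have "convpow r (ind Wb) (2 ^ i) = conv r (convpow r (ind Wb) (Suc ?n)) (convpow r (ind Wb) (?n - 1))"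
		by (metis convpow_add[OF r_pos perb])
	moreover have "[conv r (convpow r (ind Wb) (Suc ?n)) (convpow r (ind Wb) (?n - 1)) z
			= conv r (\<lambda>_. 0) (convpow r (ind Wb) (?n - 1)) z] (mod 2)" for z
		using even1 by (intro conv_cong) (auto simp: cong_0_iff simp del: convpow.simps)
	ultimately have "2 dvd convpow r (ind Wb) (2 ^ i) z" for z by (simp add: conv_def cong_0_iff)
	then have ev: "2 dvd frob r (2 ^ i) (ind Wb) z" for z
		using convpow_prime_pow[OF r_pos perb p2, of i z] cong_dvd_iff[of _ _ 2] by (metis of_nat_numeral)
	obtain m where m: "\<forall>z. frob r (2 ^ i) (ind Wb) z = ind Wb (m * z) \<and> r dvd 2 ^ i * (m * z) - z" using fr by blast
	have "t1 \<in> Wb" using t1(1) by (auto simp: Wb_def intro!: bexI[of _ t1])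
	moreover have "r dvd 2 ^ i * (m * (2 ^ i * t1)) - 2 ^ i * t1" using m by blast
	then have "r dvd 2 ^ i * (m * (2 ^ i * t1) - t1)" by (simp only: right_diff_distrib)
	then have "r dvd m * (2 ^ i * t1) - t1"
		using odd_cop[of i] coprime_dvd_mult_right_iff[of r "2 ^ i"] by (simp add: coprime_commute)
	ultimately have "m * (2 ^ i * t1) \<in> Wb" using Wb_cong by blast
	then show False using ev[of "2 ^ i * t1"] m by (simp add: ind_def)
qed

end

context sring
begin

text \<open>The cases differ in whether the \<open>l\<close>-component of \<open>T1\<close> lies in
  the subgroup of order \<open>l\<close>; the other case is contradictory for every prime.\<close>

lemma nonunit_basic_tens:
	assumes gen: "\<And>e. e > 0 ==> e dvd N ==> (\<And>x. x \<in> bs t0 ==> e dvd x) ==> e = 1"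
		and rad: "\<And>e. e \<in> rad (bs t0) ==> N dvd e"
		and l: "prime l" "int l dvd N" and x0: "x0 \<in> bs t0" "int l dvd x0"
	shows "\<exists>c v W. tens (bs t0) c v W"
proof -
	have nu: "\<not> is_unit (int l)" using l(1) by (metis not_prime_unit prime_nat_int_transfer)
	obtain r where r: "N = int l ^ multiplicity (int l) N * r" "\<not> int l dvd r"
		using multiplicity_decompose'[of N "int l"] N_pos nu by auto
	define a where "a = multiplicity (int l) N"
	have a: "a > 0" unfolding a_def using l(2) N_pos nu by (simp add: multiplicity_gt_zero_iff)
	define p where "p = int l ^ (a - 1) * r"
	define T1 where "T1 = {t \<in> bs t0. \<exists>e. p dvd e \<and> t + e \<notin> bs t0}"
	have Np: "N = int l * p" using r(1) a by (simp add: p_def a_def[symmetric] power_eq_if)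
	have "aset {z. \<exists>t\<in>T1. N dvd int l * t - z}"
		using aset_partial_cosets[OF l(1) Np aset_bs, of t0] by (simp add: T1_def Bex_def conj_assoc)
	from gen_agrp[OF this] obtain v where v: "agrp v"
		"\<And>x. x \<in> {z. \<exists>t\<in>T1. N dvd int l * t - z} ==> v dvd x"
		"\<And>e. e dvd N ==> (\<And>x. x \<in> {z. \<exists>t\<in>T1. N dvd int l * t - z} ==> e dvd x) ==> e dvd v" by blast
	interpret nonunit_basic N I l a r t0 x0 "bs t0" v "v div int l" p T1
	proof
		show "N = int l ^ a * r" using r(1) by (simp add: a_def)
		show "v dvd int l * t" if "t \<in> T1" for t
		proof (rule v(2))
			show "int l * t \<in> {z. \<exists>t\<in>T1. N dvd int l * t - z}" using that by (auto intro!: bexI[of _ t])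
		qed
		show "e dvd v" if e: "e dvd N" "\<And>t. t \<in> T1 ==> e dvd int l * t" for e
		proof (rule v(3)[OF e(1)])
			fix x assume "x \<in> {z. \<exists>t\<in>T1. N dvd int l * t - z}"
			then obtain t where "t \<in> T1" "N dvd int l * t - x" by blast
			then have "e dvd int l * t" "e dvd int l * t - x" using e dvd_trans by blast+
			then show "e dvd x" using dvd_iff_diff by blast
		qed
	qed (use gen rad l x0 r(2) a v(1) in \<open>auto simp: p_def T1_def\<close>)
	show ?thesis
	proof (cases "\<forall>t\<in>T1. int l ^ (a - 1) dvd t")
		case True
		then interpret nonunit_socle N I l a r t0 x0 "bs t0" v "v div int l" p T1 by unfold_locales auto
		show ?thesis by (rule tens_socle)
	next
		case False
		then obtain t1 where t1: "t1 \<in> T1" "\<not> int l ^ (a - 1) dvd t1" by blast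
		have "v div int l ~= 0" using vp_pos by simp
		then obtain w where w: "v div int l = int l ^ multiplicity (int l) (v div int l) * w" "\<not> int l dvd w"
			using multiplicity_decompose'[of "v div int l" "int l"] nu by auto
		interpret nonunit_deep N I l a r t0 x0 "bs t0" v "v div int l" p T1 t1 w "multiplicity (int l) (v div int l)"
			"a - multiplicity (int l) (v div int l)" using t1 w by unfold_locales auto
		have "l = 2" using False_odd by blast
		then interpret nonunit_two N I l a r t0 x0 "bs t0" v "v div int l" p T1 t1 w "multiplicity (int l) (v div int l)"
			"a - multiplicity (int l) (v div int l)" by unfold_locales
		show ?thesis using False_two by blast
	qed
qed

end

section \<open>Sections\<close>

context sring
begin

definition triv :: "int => int => bool" where
	"triv u v \<longleftrightarrow> (\<forall>x y. u dvd x --> \<not> v dvd x --> u dvd y --> \<not> v dvd y --> (\<exists>z\<in>bs x. v dvd y - z))"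

text \<open>The set need not contain a generator: it spans the whole group and has trivial radical.
  In this form the notion applies to every basic set, viewed in the section between its span and its
  radical.\<close>

definition principal :: "int => bool" where
	"principal t \<longleftrightarrow> (\<forall>e. e > 0 --> e dvd N --> (\<forall>x\<in>bs t. e dvd x) --> e = 1) \<and> (\<forall>e\<in>rad (bs t). N dvd e)"

lemma aset_per_msum: "aset A ==> agrp v ==> aset {x. \<exists>z\<in>A. v dvd x - z}"
	using aset_msum[of A "{x. v dvd x}"] by (simp add: msum_def agrp_def)

end

locale sring_section = sring +
	fixes u v :: int
	assumes u: "agrp u" and v: "agrp v" and uv: "u dvd v"
begin

abbreviation M :: int where "M \<equiv> v div u"

lemma uM: "u * M = v" using uv by simp

lemma u_pos: "u > 0" and v_pos: "v > 0" and v_N: "v dvd N" using u v by (auto simp: agrp_def)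

sublocale Q: sring M "secI u v" by (rule sec_sring[OF u v uv])

lemma sec_asetI:
	assumes A: "aset A" "\<And>x y. v dvd x - y ==> x \<in> A \<longleftrightarrow> y \<in> A"
	shows "Q.aset {x. u * x \<in> A}"
proof -
	have "(\<lambda>x. of_bool (u * x \<in> A)) \<in> secI u v" unfolding secI_def using A
		by (auto simp: aset_def per_iff intro!: bexI[of _ "\<lambda>x. of_bool (x \<in> A)"])
	then show ?thesis by (simp add: Q.aset_def)
qed

lemma dvd_v: "u * d dvd v \<longleftrightarrow> d dvd M" using uM u_pos by (metis dvd_mult_cancel_left less_irrefl)

lemma dvd_M: "M dvd x - y \<longleftrightarrow> v dvd u * x - u * y"
proof -
	have "u * M dvd u * (x - y) \<longleftrightarrow> M dvd x - y" using u_pos by simp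
	then show ?thesis by (simp only: uM right_diff_distrib)
qed

lemma sec_asetD:
	assumes A: "Q.aset A"
	shows "aset {x. u dvd x \<and> x div u \<in> A}"
proof -
	have "(\<lambda>x. of_bool (x \<in> A)) \<in> secI u v" using A by (simp add: Q.aset_def)
	then obtain f where f: "f \<in> I" "\<And>x. of_bool (x \<in> A) = f (u * x)" by (auto simp: secI_def fun_eq_iff)
	have "{x. u dvd x \<and> x div u \<in> A} = {x. u dvd x} \<inter> {x. f x = 1}"
	proof -
		have "x div u \<in> A \<longleftrightarrow> f x = 1" if "u dvd x" for x
			using f(2)[of "x div u"] that by (simp add: of_bool_def split: if_splits)
		then show ?thesis by blast
	qed
	then show ?thesis using aset_Int[OF agrp_aset[OF u] aset_level[OF f(1), of "\<lambda>a. a = 1"]] by simp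
qed

lemma sec_agrp: "Q.agrp d \<longleftrightarrow> d dvd M \<and> agrp (u * d)"
proof
	assume d: "Q.agrp d"
	then have "aset {x. u dvd x \<and> x div u \<in> {x. d dvd x}}" using sec_asetD Q.agrp_aset by blast
	moreover have "{x. u dvd x \<and> x div u \<in> {x. d dvd x}} = {x. u * d dvd x}" using u_pos by (auto elim!: dvdE)
	moreover have "u * d dvd v" using d unfolding dvd_v by (simp add: Q.agrp_def)
	ultimately show "d dvd M \<and> agrp (u * d)" using d u_pos v_N dvd_trans by (auto simp: agrp_def Q.agrp_def)
next
	assume d: "d dvd M \<and> agrp (u * d)"
	have "Q.aset {x. u * x \<in> {x. u * d dvd x}}"
	proof (rule sec_asetI)
		show "aset {x. u * d dvd x}" using d by (simp add: agrp_def)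
		have "u * d dvd v" using d unfolding dvd_v by simp
		then show "x \<in> {x. u * d dvd x} \<longleftrightarrow> y \<in> {x. u * d dvd x}" if "v dvd x - y" for x y
			using that dvd_trans dvd_iff_diff by blast
	qed
	then show "Q.agrp d" using d u_pos by (simp add: Q.agrp_def agrp_def zero_less_mult_iff)
qed

text \<open>Basic sets of the quotient are images of basic sets, because the preimage of such an
  image is the sumset with the subgroup \<open>v\<close>, which belongs to the ring.\<close>

lemma sec_bs: "z \<in> Q.bs x \<longleftrightarrow> (\<exists>z'\<in>bs (u * x). v dvd u * z - z')"
proof
	assume z: "z \<in> Q.bs x"
	let ?A = "{y. \<exists>z'\<in>bs (u * x). v dvd y - z'}"
	have "Q.aset {x. u * x \<in> ?A}"
	proof (rule sec_asetI)
		show "aset ?A" by (rule aset_per_msum[OF aset_bs v])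
		show "a \<in> ?A \<longleftrightarrow> b \<in> ?A" if "v dvd a - b" for a b
		proof -
			have "v dvd a - z' \<longleftrightarrow> v dvd b - z'" for z' using that by (intro dvd_iff_diff) simp
			then show ?thesis by simp
		qed
	qed
	moreover have "x \<in> {x. u * x \<in> ?A}" using bs_refl by force
	ultimately show "\<exists>z'\<in>bs (u * x). v dvd u * z - z'" using z Q.bs_sub by blast
next
	assume "\<exists>z'\<in>bs (u * x). v dvd u * z - z'"
	then obtain z' where z': "z' \<in> bs (u * x)" "v dvd u * z - z'" by blast
	show "z \<in> Q.bs x" unfolding Q.bs_def
	proof (intro CollectI ballI)
		fix g assume "g \<in> secI u v"
		then obtain f where f: "f \<in> I" "per v f" "g = (\<lambda>x. f (u * x))" by (auto simp: secI_def)
		then show "g z = g x" using z' I_bs per_cong by metis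
	qed
qed

lemma sec_triv:
	assumes "Q.triv d e" "d dvd e" "e dvd M"
	shows "triv (u * d) (u * e)" unfolding triv_def
proof (intro allI impI)
	fix x y assume x: "u * d dvd x" "\<not> u * e dvd x" and y: "u * d dvd y" "\<not> u * e dvd y"
	obtain x' y' where x': "x = u * x'" and y': "y = u * y'" using x y by (meson dvd_mult_left dvdE)
	have "d dvd x'" "\<not> e dvd x'" "d dvd y'" "\<not> e dvd y'" using x y u_pos by (auto simp: x' y')
	then obtain z where z: "z \<in> Q.bs x'" "e dvd y' - z" using assms(1) by (auto simp: Q.triv_def)
	obtain z' where z': "z' \<in> bs x" "v dvd u * z - z'" using z(1) sec_bs x' by blast
	have "u * e dvd v" using assms(3) unfolding dvd_v by simp
	then have "u * e dvd u * z - z'" using z'(2) dvd_trans by blast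
	moreover have "u * e dvd u * y' - u * z" using z(2) by (simp add: right_diff_distrib[symmetric])
	ultimately have "u * e dvd (u * z - z') + (u * y' - u * z)" by (rule dvd_add)
	then show "\<exists>z\<in>bs x. u * e dvd y - z" using z'(1) by (auto simp: y')
qed

end

section \<open>Coherent algebras above a Schur ring\<close>

text \<open>\<open>J\<close> consists of the functions constant on the basis relations of a coherent configuration
	on the integers modulo \<open>N\<close> that refines the scheme of \<open>I\<close> and fixes the point \<open>0\<close>;
	the last assumption expresses that its fixed points form a base tuple.\<close>

locale ctx = sring +
	fixes J :: "(int => int => int) set"
	assumes J_per: "F \<in> J ==> N dvd x - x' ==> N dvd y - y' ==> F x y = F x' y'"
		and J_map2: "F \<in> J ==> G \<in> J ==> (\<lambda>x y. h (F x y) (G x y)) \<in> J"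
		and J_tr: "F \<in> J ==> (\<lambda>x y. F y x) \<in> J"
		and J_mul: "F \<in> J ==> G \<in> J ==> (\<lambda>x z. rsum N (\<lambda>y. F x y * G y z)) \<in> J"
		and J_I: "f \<in> I ==> (\<lambda>x y. f (y - x)) \<in> J"
		and J_zero: "(\<lambda>x y. of_bool (N dvd x)) \<in> J"
		and base: "agrp u ==> agrp (u * int p ^ k) ==> k > 0 ==> prime p ==>
			\<exists>y. u dvd y \<and> coprime (y div u) (int p) \<and> (\<lambda>x z. of_bool (N dvd x - y)) \<in> J"
begin

definition rel :: "(int => int => bool) => bool" where
	"rel R \<longleftrightarrow> (\<lambda>x y. of_bool (R x y)) \<in> J"

text \<open>A set of points is encoded as a relation that ignores its second argument.\<close>

definition fib :: "int set => bool" where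
	"fib E \<longleftrightarrow> rel (\<lambda>x y. x \<in> E)"

definition pt :: "int => bool" where
	"pt h \<longleftrightarrow> fib {x. N dvd x - h}"

text \<open>Fixing points is enough: if every point of a section is a fibre, each of its basis
  relations is a single pair, as used in \<open>disc_discrete\<close>.\<close>

definition disc :: "int => int => bool" where
	"disc u v \<longleftrightarrow> (\<forall>y. u dvd y --> fib {x. v dvd x - y})"

section \<open>Relations, fibres and fixed points of a coherent algebra\<close>

lemma J_map: "F \<in> J ==> (\<lambda>x y. h (F x y)) \<in> J" using J_map2[of F F "\<lambda>a b. h a"] by simp

lemma rel_level: "F \<in> J ==> rel (\<lambda>x y. P (F x y))" unfolding rel_def by (rule J_map)

lemma rel_comb: "rel R ==> rel Q ==> rel (\<lambda>x y. P (R x y) (Q x y))"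
	unfolding rel_def using J_map2[of _ _ "\<lambda>a b. of_bool (P (a = 1) (b = 1))"] by fastforce

lemma rel_and: "rel R ==> rel Q ==> rel (\<lambda>x y. R x y \<and> Q x y)" by (rule rel_comb)

lemma rel_tr: "rel R ==> rel (\<lambda>x y. R y x)" unfolding rel_def by (rule J_tr)

lemma rel_cong: "rel R ==> N dvd x - x' ==> N dvd y - y' ==> R x y \<longleftrightarrow> R x' y'" unfolding rel_def using J_per by fastforce

text \<open>The matrix product counts intermediate points, so it is positive exactly where one
  exists.\<close>

lemma rel_path:
	assumes "rel R" "rel Q"
	shows "rel (\<lambda>x z. \<exists>y. R x y \<and> Q y z)"
proof -
	let ?F = "\<lambda>x z. rsum N (\<lambda>y. of_bool (R x y) * of_bool (Q y z)) :: int"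
	have "?F \<in> J" using assms unfolding rel_def by (rule J_mul)
	moreover have "?F x z > 0 \<longleftrightarrow> (\<exists>y. R x y \<and> Q y z)" for x z
	proof
		assume "?F x z > 0"
		then have "\<exists>y\<in>{0..<N}. of_bool (R x y) * of_bool (Q y z) ~= (0::int)"
			by (metis (no_types, lifting) less_irrefl sum.neutral)
		then show "\<exists>y. R x y \<and> Q y z" by auto
	next
		assume "\<exists>y. R x y \<and> Q y z"
		then obtain y where y: "R x y" "Q y z" by blast
		have m: "N dvd y mod N - y" by (simp add: mod_eq_dvd_iff[symmetric])
		have "R x (y mod N)" using rel_cong[OF assms(1) _ m, of x x] y by simp
		moreover have "Q (y mod N) z" using rel_cong[OF assms(2) m, of z z] y by simp
		ultimately show "?F x z > 0" using N_pos by (intro sum_pos2[of _ "y mod N"]) auto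
	qed
	ultimately show ?thesis using rel_level[of ?F "\<lambda>a. a > 0"] by simp
qed

lemma rel_aset: "aset A ==> rel (\<lambda>x y. y - x \<in> A)" using J_I by (simp add: aset_def rel_def)

lemma rel_aset': "aset A ==> rel (\<lambda>x y. x - y \<in> A)" using rel_tr[OF rel_aset] .

lemma fib_comb: "fib A ==> fib B ==> fib {x. P (x \<in> A) (x \<in> B)}"
	unfolding fib_def using rel_comb[of "\<lambda>x y. x \<in> A" "\<lambda>x y. x \<in> B" P] by simp

lemma fib_Int: "fib A ==> fib B ==> fib (A \<inter> B)" using fib_comb[of A B "(\<and>)"] by (simp add: Int_def)

lemma fib_Diff: "fib A ==> fib B ==> fib (A - B)" using fib_comb[of A B "\<lambda>a b. a \<and> \<not> b"] by (simp add: set_diff_eq)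

lemma fib_path: "rel R ==> fib E ==> fib {x. \<exists>y\<in>E. R x y}"
	unfolding fib_def using rel_path[OF _ rel_def[THEN iffD2, unfolded rel_def[symmetric]], of R "\<lambda>x y. x \<in> E"]
	by (auto simp: Bex_def conj_commute)

lemma rel_fib2: "fib E ==> rel (\<lambda>x y. y \<in> E)" unfolding fib_def by (rule rel_tr)

lemma pt_0: "pt 0" using J_zero by (simp add: pt_def fib_def rel_def)

lemma fib_shift: "pt h ==> aset A ==> fib {x. x - h \<in> A}"
proof -
	assume h: "pt h" and A: "aset A"
	have "fib {x. \<exists>y\<in>{x. N dvd x - h}. x - y \<in> A}" by (rule fib_path[OF rel_aset'[OF A] h[unfolded pt_def]])
	moreover have "(\<exists>y\<in>{x. N dvd x - h}. x - y \<in> A) \<longleftrightarrow> x - h \<in> A" for x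
	proof -
		have "x - y \<in> A \<longleftrightarrow> x - h \<in> A" if "N dvd y - h" for y using aset_cong[OF A, of "x - h" "x - y"] that by simp
		moreover have "N dvd h - h" by simp
		ultimately show ?thesis by blast
	qed
	ultimately show ?thesis by simp
qed

lemma fib_aset: "aset A ==> fib A" using fib_shift[OF pt_0] by simp

lemma fib_agrp: "agrp d ==> fib {x. d dvd x}" by (simp add: fib_aset agrp_aset)

lemma fib_saturate: "fib E ==> agrp v ==> fib {x. \<exists>y\<in>E. v dvd x - y}"
	using fib_path[OF rel_aset', of "{x. v dvd x}" E] by (simp add: agrp_def)

lemma fib_cosetI:
	assumes "fib E" "z \<in> E" "\<And>x. x \<in> E ==> v dvd x - z" "agrp v"
	shows "fib {x. v dvd x - z}"
proof -
	have "v dvd x - y \<longleftrightarrow> v dvd x - z" if "y \<in> E" for x y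
		using assms(3)[OF that] by (intro dvd_iff_diff) (simp add: dvd_diff_commute)
	then have "{x. \<exists>y\<in>E. v dvd x - y} = {x. v dvd x - z}" using assms(2) by blast
	then show ?thesis using fib_saturate[OF assms(1,4)] by simp
qed

lemma fib_coset_dvd:
	assumes "fib {x. v dvd x - z}" "v' dvd v" "agrp v'"
	shows "fib {x. v' dvd x - z}"
	by (rule fib_cosetI[OF assms(1) _ _ assms(3), of z]) (simp, metis assms(2) dvd_trans mem_Collect_eq)

lemma fib_coset: "pt h ==> agrp v ==> fib {x. v dvd x - h}" using fib_shift[of h "{x. v dvd x}"] by (simp add: agrp_def)

lemma base_pt: "agrp u ==> agrp (u * int p ^ k) ==> k > 0 ==> prime p ==>
		\<exists>y. u dvd y \<and> coprime (y div u) (int p) \<and> pt y" using base by (simp add: pt_def fib_def rel_def)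

text \<open>The two sections are projectively equivalent. A coset of \<open>v\<close> in
  \<open>u\<close> is the intersection of \<open>u\<close> with a coset of \<open>v'\<close>, and by
  Bezout every coset of \<open>v'\<close> in \<open>u'\<close> is represented by an element of
  \<open>u\<close>.\<close>

lemma disc_transfer:
	assumes a: "agrp u" "agrp v'" and "v = lcm u v'" "u' = gcd u v'"
	shows "disc u v \<longleftrightarrow> disc u' v'"
proof
	assume d: "disc u v"
	show "disc u' v'" unfolding disc_def
	proof (intro allI impI)
		fix y assume "u' dvd y"
		then obtain k where k: "y = gcd u v' * k" using assms(4) by (auto elim: dvdE)
		obtain i j where "i * u + j * v' = gcd u v'" using bezout_int by blast
		with k have "y = (i * u + j * v') * k" by simp
		then have y: "y = u * (i * k) + v' * (j * k)" by (simp add: algebra_simps)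
		let ?a = "u * (i * k)"
		have "fib {x. v' dvd x - ?a}" by (rule fib_coset_dvd[of v]) (use d a assms(3) in \<open>simp_all add: disc_def\<close>)
		moreover have "v' dvd (x - ?a) - (x - y)" for x by (simp add: y)
		then have "v' dvd x - ?a \<longleftrightarrow> v' dvd x - y" for x by (rule dvd_iff_diff)
		ultimately show "fib {x. v' dvd x - y}" by simp
	qed
next
	assume d: "disc u' v'"
	show "disc u v" unfolding disc_def
	proof (intro allI impI)
		fix y assume y: "u dvd y"
		then have "u' dvd y" using assms(4) by (meson dvd_trans gcd_dvd1)
		then have "fib ({x. v' dvd x - y} \<inter> {x. u dvd x})" using d a by (intro fib_Int fib_agrp) (auto simp: disc_def)
		moreover have "v dvd x - y \<longleftrightarrow> v' dvd x - y \<and> u dvd x" for x using y by (auto simp: assms(3) dvd_diff_left_iff)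
		ultimately show "fib {x. v dvd x - y}" by (simp add: Int_def)
	qed
qed

lemma disc_lcm: "disc u v ==> disc u v' ==> disc u (lcm v v')"
proof -
	have "{x. lcm v v' dvd x - y} = {x. v dvd x - y} \<inter> {x. v' dvd x - y}" for y by auto
	then show "disc u v ==> disc u v' ==> disc u (lcm v v')" unfolding disc_def using fib_Int by simp
qed

lemma disc_dvd: "disc u v ==> agrp v' ==> v' dvd v ==> disc u v'"
proof (unfold disc_def, intro allI impI)
	fix y assume "\<forall>y. u dvd y --> fib {x. v dvd x - y}" "u dvd y" "agrp v'" "v' dvd v"
	then show "fib {x. v' dvd x - y}" by (intro fib_coset_dvd[of v y v']) simp_all
qed

lemma disc_refl: "agrp u ==> disc u u"
proof -
	assume u: "agrp u"
	have "{x. u dvd x - y} = {x. u dvd x}" if "u dvd y" for y using that by (simp add: dvd_diff_left_iff)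
	then show ?thesis using fib_agrp[OF u] by (simp add: disc_def)
qed

text \<open>Zero and the class of a base point are fixed, and a third class, if there is one, is
  what remains.\<close>

lemma disc_small:
	assumes u: "agrp u" and v: "agrp v" "v = u * k" and k: "k \<le> 3"
	shows "disc u v"
proof (cases "k = 1")
	case True
	then show ?thesis using disc_refl[OF u] v by simp
next
	case False
	have pos: "u > 0" "v > 0" using u v by (auto simp: agrp_def)
	then have "k > 0" using v(2) by (simp add: zero_less_mult_iff)
	then have k23: "k = 2 \<or> k = 3" using k False by linarith
	then have "\<exists>p. prime p \<and> k = int p" by (elim disjE) (intro exI[of _ 2], simp, intro exI[of _ 3], simp)
	then obtain p where p: "prime p" "k = int p" by blast
	have "agrp (u * int p ^ 1)" using v p by simp
	from base_pt[OF u this _ p(1)] obtain h where h: "u dvd h" "coprime (h div u) k" "pt h" using p by auto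
	obtain h' where h': "h = u * h'" using h(1) by (auto elim: dvdE)
	have "coprime h' k" using h(2) pos by (simp add: h')
	then have hk: "\<not> k dvd h'" using coprime_common_divisor[of h' k k] k23 by auto
	have fh: "fib {x. v dvd x - h}" by (rule fib_coset[OF h(3) v(1)])
	have vd: "v dvd u * a \<longleftrightarrow> k dvd a" for a using pos by (simp add: v)
	show ?thesis unfolding disc_def
	proof (intro allI impI)
		fix y assume "u dvd y"
		then obtain y' where y': "y = u * y'" by (auto elim: dvdE)
		consider "k dvd y'" | "k dvd y' - h'" | "\<not> k dvd y'" "\<not> k dvd y' - h'" by blast
		then show "fib {x. v dvd x - y}"
		proof cases
			case 1
			then have "v dvd y" by (simp add: y' vd)
			then show ?thesis using fib_agrp[OF v(1)] by (simp add: dvd_diff_left_iff)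
		next
			case 2
			then have "v dvd y - h" by (simp add: y' h' right_diff_distrib[symmetric] vd)
			then have "v dvd (x - h) - (x - y)" for x by simp
			then have "v dvd x - y \<longleftrightarrow> v dvd x - h" for x using dvd_iff_diff by blast
			then show ?thesis using fh by simp
		next
			case 3
			have "v dvd x - y \<longleftrightarrow> u dvd x \<and> \<not> v dvd x \<and> \<not> v dvd x - h" for x
			proof (cases "u dvd x")
				case True
				then obtain x' where x': "x = u * x'" by (auto elim: dvdE)
				have "k dvd x' - y' \<longleftrightarrow> \<not> k dvd x' \<and> \<not> k dvd x' - h'" using k23 hk 3 by (elim disjE) (hypsubst, presburger)+
				then show ?thesis by (simp add: x' y' h' right_diff_distrib[symmetric] vd)
			next
				case False
				then have "\<not> u dvd x - y" using \<open>u dvd y\<close> by (simp add: dvd_diff_left_iff)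
				then show ?thesis using False v(2) by (metis dvd_mult_left)
			qed
			then have "{x. v dvd x - y} = {x. u dvd x} - {x. v dvd x} - {x. v dvd x - h}" by auto
			then show ?thesis using fib_Diff[OF fib_Diff[OF fib_agrp[OF u] fib_agrp[OF v(1)]] fh] by simp
		qed
	qed
qed

definition secJ :: "int => int => (int => int => int) set" where
	"secJ u v = {G. \<exists>F\<in>J. (\<forall>x x' y y'. v dvd x - x' --> v dvd y - y' --> F x y = F x' y')
		 \<and> G = (\<lambda>x y. F (u * x) (u * y))}"

end

locale ctx_section = ctx + sring_section
begin

lemma sec_mul:
	assumes F: "\<And>x x' y y'. v dvd x - x' ==> v dvd y - y' ==> F x y = F x' y'"
		and G: "\<And>x x' y y'. v dvd x - x' ==> v dvd y - y' ==> G x y = (G x' y' :: int)"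
	shows "rsum M (\<lambda>y. F x (u * y) * G (u * y) z)
		= rsum N (\<lambda>y. (of_bool (u dvd y) * F x y) * G y z) div (N div v)"
proof -
	have pos: "N div v > 0" using v_pos v_N N_pos by (simp add: pos_imp_zdiv_pos_iff zdvd_imp_le)
	have "rsum M (\<lambda>y. F x (u * y) * G (u * y) z) = rsum v (\<lambda>y. of_bool (u dvd y) * (F x y * G y z))"
		using rsum_multiples[OF u_pos, where w=M and f="\<lambda>y. F x y * G y z"] uM by simp
	moreover have "per v (\<lambda>y. of_bool (u dvd y) * (F x y * G y z))"
	proof (rule perI)
		fix y y' assume d: "v dvd y - y'"
		then have "F x y = F x y'" "G y z = G y' z" using F[of x x] G[of _ _ z z] by auto
		moreover have "u dvd y \<longleftrightarrow> u dvd y'" using d uv dvd_iff_diff dvd_trans by blast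
		ultimately show "of_bool (u dvd y) * (F x y * G y z) = of_bool (u dvd y') * (F x y' * G y' z)" by simp
	qed
	then have "rsum N (\<lambda>y. of_bool (u dvd y) * (F x y * G y z))
			= (N div v) * rsum v (\<lambda>y. of_bool (u dvd y) * (F x y * G y z))" by (rule rsum_quotient[OF v_pos N_pos v_N])
	ultimately have "rsum N (\<lambda>y. (of_bool (u dvd y) * F x y) * G y z)
			= (N div v) * rsum M (\<lambda>y. F x (u * y) * G (u * y) z)" by (simp add: mult.assoc)
	then show ?thesis using pos by simp
qed

lemma secJ_I:
	assumes "F \<in> J" "\<And>x x' y y'. v dvd x - x' ==> v dvd y - y' ==> F x y = F x' y'"
	shows "(\<lambda>x y. F (u * x) (u * y)) \<in> secJ u v" using assms unfolding secJ_def by blast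

text \<open>All hypotheses, including the one on base points, pass to sections, since sections of a
  section are sections. This is what permits induction on the modulus.\<close>

sublocale QC: ctx M "secI u v" "secJ u v"
proof
	fix F assume "F \<in> secJ u v"
	then obtain F0 where F0: "F0 \<in> J" "\<And>x x' y y'. v dvd x - x' ==> v dvd y - y' ==> F0 x y = F0 x' y'"
		"F = (\<lambda>x y. F0 (u * x) (u * y))" by (auto simp: secJ_def)
	show "F x y = F x' y'" if "M dvd x - x'" "M dvd y - y'" for x x' y y' using that F0(2) by (simp add: F0(3) dvd_M)
	show "(\<lambda>x y. F y x) \<in> secJ u v" using secJ_I[OF J_tr[OF F0(1)]] F0 by simp
	fix G assume "G \<in> secJ u v"
	then obtain G0 where G0: "G0 \<in> J" "\<And>x x' y y'. v dvd x - x' ==> v dvd y - y' ==> G0 x y = G0 x' y'"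
		"G = (\<lambda>x y. G0 (u * x) (u * y))" by (auto simp: secJ_def)
	show "(\<lambda>x y. h (F x y) (G x y)) \<in> secJ u v" for h
		using secJ_I[OF J_map2[OF F0(1) G0(1), of h]] F0(2,3) G0(2,3) by fastforce
	let ?F = "\<lambda>x y. of_bool (u dvd y) * F0 x y"
	have "rel (\<lambda>x y. y \<in> {y. u dvd y})" by (rule rel_fib2[OF fib_agrp[OF u]])
	then have "?F \<in> J" using J_map2[OF _ F0(1), of _ "(*)"] by (simp add: rel_def)
	from J_map[OF J_mul[OF this G0(1)], of "\<lambda>a. a div (N div v)"]
	have "(\<lambda>x z. rsum N (\<lambda>y. ?F x y * G0 y z) div (N div v)) \<in> J" .
	moreover have "rsum N (\<lambda>y. ?F x y * G0 y z) div (N div v) = rsum N (\<lambda>y. ?F x' y * G0 y z') div (N div v)"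
		if "v dvd x - x'" "v dvd z - z'" for x x' z z'
	proof -
		have "F0 x y = F0 x' y" "G0 y z = G0 y z'" for y using F0(2)[of x x' y y] G0(2)[of y y z z'] that by auto
		then show ?thesis by simp
	qed
	ultimately have "(\<lambda>x z. rsum N (\<lambda>y. ?F (u * x) y * G0 y (u * z)) div (N div v)) \<in> secJ u v" by (rule secJ_I)
	then show "(\<lambda>x z. rsum M (\<lambda>y. F x y * G y z)) \<in> secJ u v"
	proof -
		have "rsum M (\<lambda>y. F x y * G y z) = rsum N (\<lambda>y. ?F (u * x) y * G0 y (u * z)) div (N div v)" for x z
			unfolding F0(3) G0(3) by (rule sec_mul) (rule F0(2) G0(2), assumption+)+
		then show ?thesis using \<open>(\<lambda>x y. rsum N (\<lambda>z. ?F (u * x) z * G0 z (u * y)) div (N div v)) \<in> secJ u v\<close> by simp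
	qed
next
	fix f assume "f \<in> secI u v"
	then obtain f0 where f0: "f0 \<in> I" "per v f0" "f = (\<lambda>x. f0 (u * x))" by (auto simp: secI_def)
	have "f0 (y - x) = f0 (y' - x')" if "v dvd x - x'" "v dvd y - y'" for x x' y y'
	proof (rule per_cong[OF f0(2)])
		show "v dvd y - x - (y' - x')" using dvd_diff[OF that(2) that(1)] by (simp add: algebra_simps)
	qed
	from secJ_I[OF J_I[OF f0(1)] this] show "(\<lambda>x y. f (y - x)) \<in> secJ u v" by (simp add: f0(3) right_diff_distrib)
next
	have "(\<lambda>x y. of_bool (v dvd x)) \<in> J" using fib_agrp[OF v] by (simp add: fib_def rel_def)
	moreover have "(of_bool (v dvd x) :: int) = of_bool (v dvd x')" if "v dvd x - x'" for x x'
		using dvd_iff_diff[OF that] by simp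
	ultimately have "(\<lambda>x y. of_bool (v dvd u * x)) \<in> secJ u v" by (intro secJ_I) blast+
	then show "(\<lambda>x y. of_bool (M dvd x)) \<in> secJ u v" using dvd_M[of _ 0] by simp
next
	fix d p k assume d: "Q.agrp d" "Q.agrp (d * int p ^ k)" and k: "0 < k" "prime p"
	have "agrp (u * d)" "agrp (u * d * int p ^ k)" using d sec_agrp by (auto simp: mult.assoc)
	from base_pt[OF this k] obtain y where y: "u * d dvd y" "coprime (y div (u * d)) (int p)" "pt y" by blast
	obtain y' where y': "y = u * y'" using y(1) by (meson dvd_mult_left dvdE)
	have "d dvd y'" using y(1) u_pos by (simp add: y')
	moreover have "coprime (y' div d) (int p)" using y(2) u_pos by (simp add: y')
	moreover have "(\<lambda>x z. of_bool (M dvd x - y')) \<in> secJ u v"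
	proof -
		have "(\<lambda>x z. of_bool (v dvd x - y)) \<in> J" using fib_coset[OF y(3) v] by (simp add: fib_def rel_def)
		moreover have "(of_bool (v dvd x - y) :: int) = of_bool (v dvd x' - y)" if "v dvd x - x'" for x x'
			using dvd_iff_diff[of v "x - y" "x' - y"] that by simp
		ultimately have "(\<lambda>x z. of_bool (v dvd u * x - y)) \<in> secJ u v" by (intro secJ_I) blast+
		then show ?thesis by (simp add: dvd_M y')
	qed
	ultimately show "\<exists>y. d dvd y \<and> coprime (y div d) (int p) \<and> (\<lambda>x z. of_bool (M dvd x - y)) \<in> secJ u v" by blast
qed

text \<open>The element of \<open>J\<close> that induces the indicator of \<open>E\<close> is
  uncontrolled off the multiples of \<open>u\<close>; asking for a path that ends in a multiple of
  \<open>u\<close> removes this dependence.\<close>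

lemma sec_fib: "QC.fib E ==> fib {x. u dvd x \<and> x div u \<in> E}"
proof -
	assume "QC.fib E"
	then have "(\<lambda>x y. of_bool (x \<in> E)) \<in> secJ u v" by (simp add: QC.fib_def QC.rel_def)
	then obtain F where F: "F \<in> J" "\<And>x y. of_bool (x \<in> E) = F (u * x) (u * y)" by (auto simp: secJ_def fun_eq_iff)
	have "fib ({x. u dvd x} \<inter> {x. \<exists>y\<in>{y. u dvd y}. F x y = 1})"
		using rel_level[OF F(1), of "\<lambda>a. a = 1"] by (intro fib_Int fib_path fib_agrp u)
	moreover have "x div u \<in> E \<longleftrightarrow> (\<exists>y\<in>{y. u dvd y}. F x y = 1)" if "u dvd x" for x
	proof -
		have *: "F x y = of_bool (x div u \<in> E)" if "u dvd y" for y using F(2)[of "x div u" "y div u"] \<open>u dvd x\<close> that by simp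
		then show ?thesis by (auto intro: exI[of _ 0])
	qed
	then have "{x. u dvd x} \<inter> {x. \<exists>y\<in>{y. u dvd y}. F x y = 1} = {x. u dvd x \<and> x div u \<in> E}" by blast
	ultimately show ?thesis by simp
qed

lemma sec_disc:
	assumes "QC.disc d e" "e dvd M"
	shows "disc (u * d) (u * e)" unfolding disc_def
proof (intro allI impI)
	fix y assume "u * d dvd y"
	then obtain y' where y': "y = u * y'" by (meson dvd_mult_left dvdE)
	have "d dvd y'" using \<open>u * d dvd y\<close> u_pos by (simp add: y')
	then have "fib {x. u dvd x \<and> x div u \<in> {x. e dvd x - y'}}" using assms(1) by (intro sec_fib) (simp add: QC.disc_def)
	moreover have "{x. u dvd x \<and> x div u \<in> {x. e dvd x - y'}} = {x. u * e dvd x - y}"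
	proof -
		have "u dvd x \<and> e dvd x div u - y' \<longleftrightarrow> u * e dvd x - y" for x
		proof
			assume "u dvd x \<and> e dvd x div u - y'"
			then obtain x' where x': "x = u * x'" "e dvd x div u - y'" by (metis dvdE)
			then show "u * e dvd x - y" using u_pos by (simp add: y' right_diff_distrib[symmetric])
		next
			assume a: "u * e dvd x - y"
			then have "u dvd x - y" by (rule dvd_mult_left)
			then have "u dvd x" by (simp add: y' dvd_diff_left_iff)
			then obtain x' where "x = u * x'" by (auto elim: dvdE)
			then show "u dvd x \<and> e dvd x div u - y'" using a u_pos by (simp add: y' right_diff_distrib[symmetric])
		qed
		then show ?thesis by auto
	qed
	ultimately show "fib {x. u * e dvd x - y}" by simp
qed

end

section \<open>Principal basic sets consisting of generators\<close>

text \<open>All elements of the basic set of 1 are units, and a unit mapping one of its points into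
  it preserves it. So this set is a group of multipliers, and the basic sets of units are its
  cosets.\<close>

locale ag = sring +
	assumes units: "x \<in> bs 1 ==> coprime x N"
		and radK: "e \<in> rad (bs 1) ==> N dvd e"
begin

abbreviation K :: "int set" where "K \<equiv> bs 1"

lemma one_K: "1 \<in> K" by (rule bs_refl)

lemma K_cong: "N dvd x - y ==> x \<in> K \<longleftrightarrow> y \<in> K" by (rule aset_cong[OF aset_bs])

lemma K_mult: "x \<in> K ==> y \<in> K ==> x * y \<in> K" using mult_bs[OF units one_K, of x y] by simp

lemma K_pow: "x \<in> K ==> x ^ n \<in> K" by (induction n) (auto intro: one_K K_mult)

lemma K_inverse:
	assumes "x \<in> K"
	obtains y where "y \<in> K" "N dvd x * y - 1"
proof -
	obtain y where y: "[x * y = 1] (mod N)" using units[OF assms] cong_solve_coprime_int by blast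
	then have d: "N dvd x * y - 1" by (simp add: cong_iff_dvd_diff)
	have "bs x = K" using bs_eq[OF assms] .
	then have "x * y \<in> bs (x * 1)" using K_cong[OF d] one_K by simp
	then have "y \<in> K" using bs_mult[OF units[OF assms]] by blast
	then show thesis using d that by blast
qed

lemma bs_unit:
	assumes "coprime z N" "x \<in> bs z"
	obtains k where "k \<in> K" "N dvd x - z * k"
proof -
	obtain y where y: "[z * y = 1] (mod N)" using assms(1) cong_solve_coprime_int by blast
	then have d: "N dvd x - z * (y * x)" unfolding cong_iff_dvd_diff by Groebner_Basis.algebra
	then have "z * (y * x) \<in> bs (z * 1)" using aset_cong[OF aset_bs d, of z] assms(2) by simp
	then have "y * x \<in> K" using bs_mult[OF assms(1)] by blast
	then show thesis using d that by blast
qed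

lemma K_quotient:
	assumes "x \<in> K" "y \<in> K"
	obtains k where "k \<in> K" "N dvd y - x * k"
proof -
	have "y \<in> bs x" using assms bs_eq by blast
	then show thesis using bs_unit[OF units[OF assms(1)]] that by blast
qed

text \<open>The multiplier inherits every congruence between the two elements, because
  \<open>k - 1\<close> times the unit \<open>x\<close> is their difference modulo
  \<open>N\<close>.\<close>

lemma K_ratio:
	assumes x: "x \<in> K" "x' \<in> K"
	obtains k where "k \<in> K" "N dvd x' - x * k" "\<forall>e. e dvd N --> e dvd x' - x --> e dvd k - 1"
proof -
	obtain k where k: "k \<in> K" "N dvd x' - x * k" using K_quotient[OF x] .
	have "e dvd k - 1" if e: "e dvd N" "e dvd x' - x" for e
	proof -
		have "e dvd x * (k - 1)" using e k(2) by Groebner_Basis.algebra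
		moreover have "coprime e x" using units[OF x(1)] e(1) coprime_commute coprime_divisors dvd_refl by blast
		ultimately show ?thesis using coprime_dvd_mult_right_iff by blast
	qed
	then show thesis using that k by blast
qed

end

section \<open>The component of the multiplier group at one prime\<close>

locale agq = ag +
	fixes q a :: nat and r :: int
	assumes q: "prime q" and a: "a > 0" and N_eq: "N = int q ^ a * r" and r: "\<not> int q dvd r"
begin

abbreviation Q :: int where "Q \<equiv> int q"

definition p :: int where "p = Q ^ (a - 1) * r"

lemma Q_prime: "Factorial_Ring.prime Q" using q by simp

lemma Q_gt: "Q > 1" using prime_gt_1_nat[OF q] by simp

lemma N_p: "N = Q * p" unfolding N_eq p_def using a by (cases a) auto

lemma r_pos: "r > 0" using N_pos Q_gt unfolding N_eq by (simp add: zero_less_mult_iff)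

lemma p_pos: "p > 0" using r_pos Q_gt by (simp add: p_def)

lemma not_N_p: "\<not> N dvd p"
proof
	assume "N dvd p"
	then have "N \<le> p" using p_pos zdvd_imp_le by blast
	moreover have "1 * p < Q * p" using Q_gt p_pos by (rule mult_strict_right_mono)
	ultimately show False by (simp add: N_p)
qed

lemma cop: "coprime (Q ^ k) r" using prime_imp_coprime[OF Q_prime r] by simp

lemma dvd_N: "N dvd x \<longleftrightarrow> Q ^ a dvd x \<and> r dvd x"
	unfolding N_eq using cop[of a] by (auto intro: divides_mult elim: dvd_mult_left dvd_mult_right)

lemma dvd_p: "p dvd x \<longleftrightarrow> Q ^ (a - 1) dvd x \<and> r dvd x"
	unfolding p_def using cop[of "a - 1"] by (auto intro: divides_mult elim: dvd_mult_left dvd_mult_right)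

lemma Q_N: "Q dvd N" and r_N: "r dvd N" and p_N: "p dvd N" by (simp_all add: N_p p_def)

lemma K_Q: "x \<in> K ==> \<not> Q dvd x" using units[of x] Q_N Q_prime by (metis coprime_common_divisor not_prime_unit)

text \<open>Otherwise the powers of \<open>k\<close> exhaust all \<open>1 + p * i\<close>, and
  multiplying by elements of \<open>K\<close> puts the subgroup of order \<open>q\<close> into the
  radical. The hypothesis \<open>a > 1\<close> gives \<open>N dvd p * p\<close>, so that powers of
  \<open>k\<close> are linear in the exponent.\<close>

lemma K_near_one:
	assumes "a > 1" "k \<in> K" "p dvd k - 1"
	shows "N dvd k - 1"
proof (rule ccontr)
	assume nN: "\<not> N dvd k - 1"
	obtain j where j: "k - 1 = p * j" using assms(3) by (auto elim: dvdE)
	have nj: "\<not> Q dvd j" using nN by (auto simp: j N_p mult.commute[of p])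
	have "Q dvd Q ^ (a - 1)" using assms(1) by simp
	then have "Q dvd p" by (simp add: p_def)
	then have pp: "N dvd p * p" unfolding N_p by (rule mult_dvd_mono) simp
	have pw: "N dvd k ^ n - (1 + p * (j * int n))" for n
	proof (induction n)
		case (Suc n)
		have "N dvd k * (k ^ n - (1 + p * (j * int n))) + p * p * (j * j * int n)"
			by (intro dvd_add dvd_mult Suc dvd_mult2[OF pp])
		moreover have "k = 1 + p * j" using j by simp
		ultimately show ?case by (simp add: algebra_simps)
	qed simp
	have near: "1 + p * i \<in> K" for i
	proof -
		obtain n where n: "Q dvd - i + j * n" using prime_linear_solve[OF Q_prime nj] by blast
		have "Q dvd n mod Q - n" by (simp add: mod_eq_dvd_iff[symmetric])
		moreover have "int (nat (n mod Q)) = n mod Q" using Q_gt by simp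
		ultimately have "N dvd (1 + p * (j * int (nat (n mod Q)))) - (1 + p * i)" using n N_p by Groebner_Basis.algebra
		from dvd_add[OF pw[of "nat (n mod Q)"] this] have "N dvd k ^ nat (n mod Q) - (1 + p * i)" by (simp only: add_diff_eq diff_add_cancel)
		then show ?thesis using K_cong K_pow[OF assms(2)] by blast
	qed
	have "p \<in> rad K" unfolding rad_def
	proof (intro CollectI ballI)
		fix x assume x: "x \<in> K"
		obtain i where i: "Q dvd 1 + x * i" using prime_linear_solve[OF Q_prime K_Q[OF x]] by blast
		have "x * (1 + p * i) \<in> K" by (rule K_mult[OF x near])
		moreover have "N dvd x * (1 + p * i) - (x - p)" using i N_p by Groebner_Basis.algebra
		ultimately show "x - p \<in> K" using K_cong by blast
	qed
	then show False using radK not_N_p by blast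
qed

text \<open>By \<open>lte\<close> some power of \<open>k\<close> differs from 1 by a number of
  \<open>q\<close>-valuation exactly \<open>a - 1\<close>, which contradicts
  \<open>K_near_one\<close>, or the congruence modulo \<open>q\<close> itself when
  \<open>a = 1\<close>.\<close>

lemma K_local:
	assumes k: "k \<in> K" "r dvd k - 1" "Q dvd k - 1" "q = 2 ==> 4 dvd k - 1"
	shows "N dvd k - 1"
proof (rule ccontr)
	assume "\<not> N dvd k - 1"
	then have "\<not> Q ^ a dvd k - 1" using k(2) dvd_N by blast
	then obtain n where n: "Q ^ (a - 1) dvd k ^ n - 1" "\<not> Q ^ a dvd k ^ n - 1" using lte[OF q k(3,4)] by blast
	have "[k ^ n = 1 ^ n] (mod r)" using k(2) by (intro cong_pow) (simp add: cong_iff_dvd_diff)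
	then have "r dvd k ^ n - 1" by (simp add: cong_iff_dvd_diff)
	then have "p dvd k ^ n - 1" using n(1) dvd_p by blast
	show False
	proof (cases "a > 1")
		case True
		then have "N dvd k ^ n - 1" using K_near_one K_pow[OF k(1)] \<open>p dvd k ^ n - 1\<close> by blast
		then show False using n(2) dvd_N by blast
	next
		case False
		then have "a = 1" using a by simp
		then show False using \<open>\<not> Q ^ a dvd k - 1\<close> k(3) by simp
	qed
qed

lemma K_inj:
	assumes x: "x \<in> K" "x' \<in> K" and d: "r dvd x' - x" "Q dvd x' - x" "q = 2 ==> 4 dvd x' - x"
		and "q = 2 ==> a > 1"
	shows "N dvd x' - x"
proof -
	obtain k where k: "k \<in> K" "N dvd x' - x * k" "\<forall>e. e dvd N --> e dvd x' - x --> e dvd k - 1" using K_ratio[OF x] .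
	have "4 dvd k - 1" if "q = 2"
	proof -
		have "Q ^ 2 dvd Q ^ a" using assms(6)[OF that] by (intro le_imp_power_dvd) simp
		then have "4 dvd N" using that by (simp add: N_eq)
		then show ?thesis using k(3) d(3) that by blast
	qed
	then have "N dvd k - 1" using K_local[OF k(1)] k(3) r_N Q_N d by blast
	then show ?thesis using k(2) by Groebner_Basis.algebra
qed

text \<open>Indexes the points of \<open>K\<close> in the coset of \<open>x\<close> by the subgroup
  of order \<open>Q ^ j\<close>; its size is the value at \<open>Q ^ j * x\<close> of the
  push-forward of \<open>K\<close> by \<open>Q ^ j\<close>.\<close>

definition fibre :: "nat => int => int set" where
	"fibre j x = {i \<in> {0..<Q ^ j}. x + Q ^ (a - j) * r * i \<in> K}"

lemma finite_fibre: "finite (fibre j x)" unfolding fibre_def by (rule finite_subset[of _ "{0..<Q ^ j}"]) auto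

lemma fibre_0: "x \<in> K ==> 0 \<in> fibre j x" using Q_gt by (simp add: fibre_def)

definition mK :: "nat => int set" where
	"mK j = {z. \<exists>x\<in>K. N dvd Q ^ j * x - z}"

text \<open>If no fibre has size divisible by \<open>q\<close>, the push-forward of \<open>K\<close>
  is nonzero modulo \<open>q\<close> exactly on the image of \<open>K\<close>.\<close>

lemma aset_mK:
	assumes j: "j \<le> a" and f: "\<And>x. x \<in> K ==> \<not> Q dvd int (card (fibre j x))"
	shows "aset (mK j)"
proof -
	have N: "N = Q ^ j * (Q ^ (a - j) * r)" using j by (simp add: N_eq mult.assoc[symmetric] power_add[symmetric])
	have perK: "per N (ind K)" using I_per aset_bs I_ind by blast
	have "frob N (Q ^ j) (ind K) z mod Q ~= 0 \<longleftrightarrow> z \<in> mK j" for z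
	proof
		assume "frob N (Q ^ j) (ind K) z mod Q ~= 0"
		then have "\<exists>x\<in>{0..<N}. of_bool (N dvd Q ^ j * x - z) * ind K x ~= 0"
			unfolding frob_def by (metis (no_types, lifting) mod_0 sum.neutral)
		then show "z \<in> mK j" by (auto simp: mK_def ind_def)
	next
		assume "z \<in> mK j"
		then obtain x where x: "x \<in> K" "N dvd Q ^ j * x - z" by (auto simp: mK_def)
		have "frob N (Q ^ j) (ind K) z = rsum (Q ^ j) (\<lambda>i. ind K (x + Q ^ (a - j) * r * i))"
			using frob_coset[OF perK N _ x(2)] Q_gt by simp
		also have "... = int (card ({0..<Q ^ j} \<inter> {i. x + Q ^ (a - j) * r * i \<in> K}))" by (simp add: ind_def sum_of_bool_eq)
		also have "{0..<Q ^ j} \<inter> {i. x + Q ^ (a - j) * r * i \<in> K} = fibre j x" by (auto simp: fibre_def)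
		finally show "frob N (Q ^ j) (ind K) z mod Q ~= 0" using f[OF x(1)] by (simp add: dvd_eq_mod_eq_0)
	qed
	then show ?thesis using aset_level[OF I_frob[OF q _, of "ind K" j], of "\<lambda>a. a ~= 0"] aset_bs by (simp add: I_ind)
qed

lemma Qj_N: "j \<le> a ==> Q ^ j dvd N" unfolding N_eq by (intro dvd_mult2 le_imp_power_dvd)

lemma agrp_from_aset:
	assumes j: "j \<le> a" and A: "aset A" "Q ^ j \<in> A" "\<And>z. z \<in> A ==> Q ^ j dvd z"
	shows "agrp (Q ^ j)"
proof -
	obtain d where d: "agrp d" "\<And>x. x \<in> A ==> d dvd x" "\<And>e. e dvd N ==> (\<And>x. x \<in> A ==> e dvd x) ==> e dvd d"
		using gen_agrp[OF A(1)] by blast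
	have "Q ^ j dvd d" using d(3) Qj_N[OF j] A(3) by blast
	moreover have "d dvd Q ^ j" using d(2) A(2) by blast
	moreover have "d \<ge> 0" "Q ^ j \<ge> 0" using d(1) by (auto simp: agrp_def)
	ultimately have "d = Q ^ j" using zdvd_antisym_nonneg by blast
	then show ?thesis using d(1) by simp
qed

lemma mK_dvd:
	assumes "j \<le> a" "z \<in> mK j"
	shows "Q ^ j dvd z"
proof -
	obtain x where x: "N dvd Q ^ j * x - z" using assms(2) by (auto simp: mK_def)
	have "Q ^ j dvd Q ^ j * x - z" using dvd_trans[OF Qj_N[OF assms(1)] x] .
	then show ?thesis using dvd_iff_diff[of "Q ^ j" "Q ^ j * x" z] by simp
qed

lemma mK_mem: "x \<in> K ==> Q ^ j * x \<in> mK j" by (auto simp: mK_def intro!: bexI[of _ x])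

lemma agrp_mK: "j \<le> a ==> aset (mK j) ==> agrp (Q ^ j)" using agrp_from_aset[of j "mK j"] mK_dvd mK_mem[OF one_K, of j] by simp

lemma fibre_single:
	assumes j: "j \<le> a" and x: "x \<in> K"
		and inj: "\<And>x'. x' \<in> K ==> Q ^ (a - j) * r dvd x' - x ==> N dvd x' - x"
	shows "fibre j x = {0}"
proof (intro subset_antisym subsetI)
	fix i assume i: "i \<in> fibre j x"
	have N: "N = (Q ^ (a - j) * r) * Q ^ j"
		using j by (simp add: N_eq mult.assoc mult.left_commute[of r] power_add[symmetric])
	have "N dvd (x + Q ^ (a - j) * r * i) - x" by (rule inj) (use i in \<open>auto simp: fibre_def mult.assoc\<close>)
	then have "(Q ^ (a - j) * r) * Q ^ j dvd (Q ^ (a - j) * r) * i" by (simp add: N)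
	then have "Q ^ j dvd i" using Q_gt r_pos by simp
	moreover have "0 \<le> i" "i < Q ^ j" using i by (auto simp: fibre_def)
	ultimately show "i \<in> {0}" using zdvd_imp_le[of "Q ^ j" i] by (cases "i = 0") auto
qed (use fibre_0[OF x] in auto)

lemma single_ok: "fibre j x = {0} ==> \<not> Q dvd int (card (fibre j x))" using Q_gt by simp

text \<open>By \<open>K_inj\<close> the points of a fibre are told apart by their residue modulo
  \<open>q\<close>, which is not zero; so each fibre has between 1 and \<open>q - 1\<close>
  elements.\<close>

lemma agrp_odd:
	assumes "q ~= 2" "j \<le> a"
	shows "agrp (Q ^ j)"
proof (rule agrp_mK[OF assms(2)], rule aset_mK[OF assms(2)])
	fix x assume x: "x \<in> K"
	let ?h = "\<lambda>i. (x + Q ^ (a - j) * r * i) mod Q"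
	have N: "N = (Q ^ (a - j) * r) * Q ^ j"
		using assms(2) by (simp add: N_eq mult.assoc mult.left_commute[of r] power_add[symmetric])
	have "inj_on ?h (fibre j x)"
	proof (rule inj_onI)
		fix i i' assume i: "i \<in> fibre j x" "i' \<in> fibre j x" "?h i = ?h i'"
		let ?u = "x + Q ^ (a - j) * r * i" and ?u' = "x + Q ^ (a - j) * r * i'"
		have "N dvd ?u - ?u'"
			by (rule K_inj) (use i assms(1) in \<open>auto simp: fibre_def mod_eq_dvd_iff mult.assoc right_diff_distrib[symmetric]\<close>)
		then have "(Q ^ (a - j) * r) * Q ^ j dvd (Q ^ (a - j) * r) * (i - i')" by (simp add: N algebra_simps)
		then have "Q ^ j dvd i - i'" using Q_gt r_pos by simp
		then show "i = i'" using i unfolding fibre_def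
			by (metis (no_types, lifting) atLeastLessThan_iff mem_Collect_eq mod_eq_dvd_iff mod_pos_pos_trivial)
	qed
	moreover have "?h ` fibre j x \<subseteq> {1..<Q}"
	proof
		fix y assume "y \<in> ?h ` fibre j x"
		then obtain i where i: "i \<in> fibre j x" "y = ?h i" by blast
		then have "\<not> Q dvd x + Q ^ (a - j) * r * i" using K_Q by (simp add: fibre_def)
		then have "y ~= 0" using i(2) by (simp add: dvd_eq_mod_eq_0)
		moreover have "0 \<le> y" "y < Q" using i(2) Q_gt by auto
		ultimately show "y \<in> {1..<Q}" by simp
	qed
	ultimately have "card (fibre j x) \<le> card {1..<Q}" by (metis card_inj_on_le finite_atLeastLessThan_int)
	then have "card (fibre j x) < q" using Q_gt by simp
	moreover have "card (fibre j x) > 0" using fibre_0[OF x] finite_fibre card_gt_0_iff by blast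
	ultimately show "\<not> Q dvd int (card (fibre j x))" by (simp add: nat_dvd_not_less)
qed

text \<open>If \<open>K\<close> contains no nontrivial local multiplier, all fibres are single
  points.\<close>

lemma agrp_two_untwisted:
	assumes "\<And>k. k \<in> K ==> r dvd k - 1 ==> N dvd k - 1" "j \<le> a"
	shows "agrp (Q ^ j)"
proof (rule agrp_mK[OF assms(2)], rule aset_mK[OF assms(2)])
	fix x assume x: "x \<in> K"
	have "fibre j x = {0}"
	proof (rule fibre_single[OF assms(2) x])
		fix x' assume x': "x' \<in> K" "Q ^ (a - j) * r dvd x' - x"
		obtain k where k: "k \<in> K" "N dvd x' - x * k" "\<forall>e. e dvd N --> e dvd x' - x --> e dvd k - 1" using K_ratio[OF x x'(1)] .
		have "r dvd x' - x" using x'(2) by (rule dvd_mult_right)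
		then have "N dvd k - 1" using assms(1) k r_N by blast
		then show "N dvd x' - x" using k(2) by Groebner_Basis.algebra
	qed
	then show "\<not> Q dvd int (card (fibre j x))" by (rule single_ok)
qed

text \<open>If a nontrivial multiplier \<open>mu\<close> in \<open>K\<close> is congruent to 1 modulo the odd part of \<open>N\<close>,
	the numbers of representations of \<open>1 + mu\<close> and \<open>1 + mu + N/2\<close> as sums of two elements of \<open>K\<close>
	differ modulo 4.\<close>

lemma agrp_two_twisted:
	assumes q2: "q = 2" and mu: "mu \<in> K" "r dvd mu - 1" "\<not> N dvd mu - 1" and j: "j \<le> a"
	shows "agrp (Q ^ j)"
proof -
	have odd_r: "odd r" using r q2 by simp
	have N2: "N = 2 * p" using N_p q2 by simp
	have odd_K: "odd x" if "x \<in> K" for x using K_Q[OF that] q2 by simp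
	have a3: "a \<ge> 3"
	proof (rule ccontr)
		assume "\<not> a \<ge> 3"
		then consider "a = 1" | "a = 2" using a by linarith
		then show False
		proof cases
			case 1
			then show False using mu dvd_N odd_K[OF mu(1)] q2 by simp
		next
			case 2
			then have "p dvd mu - 1" using dvd_p mu odd_K[OF mu(1)] q2 by simp
			then show False using K_near_one[OF _ mu(1)] 2 mu(3) by simp
		qed
	qed
	have mu4: "\<not> 4 dvd mu - 1" using K_local[OF mu(1,2)] mu(3) odd_K[OF mu(1)] q2 by auto
	have inj4: "N dvd x' - x" if "x \<in> K" "x' \<in> K" "r dvd x' - x" "4 dvd x' - x" for x x'
	proof -
		have "2 dvd x' - x" by (rule dvd_trans[OF _ that(4)]) simp
		then have "Q dvd x' - x" using q2 by simp
		then show ?thesis using K_inj[OF that(1,2,3)] that(4) a3 by simp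
	qed
	have small: "aset (mK j)" if jj: "j + 2 \<le> a" for j
	proof (rule aset_mK)
		show "j \<le> a" using jj by simp
		fix x assume x: "x \<in> K"
		have "fibre j x = {0}"
		proof (rule fibre_single[OF _ x])
			fix x' assume x': "x' \<in> K" "Q ^ (a - j) * r dvd x' - x"
			have "Q ^ 2 dvd Q ^ (a - j)" using jj by (intro le_imp_power_dvd) simp
			then have "4 dvd x' - x" using x'(2) q2 by (auto intro: dvd_trans dvd_mult_left)
			then show "N dvd x' - x" using inj4 x x' dvd_mult_right by blast
		qed (use jj in simp)
		then show "\<not> Q dvd int (card (fibre j x))" by (rule single_ok)
	qed
	\<comment> \<open>For the exponent \<open>a - 1\<close> a fibre contains both \<open>x\<close> and
	  \<open>mu * x\<close>, and the push-forward may vanish modulo 2. Sums of two elements of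
	  \<open>mK (a - 2)\<close> serve instead: they are divisible by \<open>Q ^ (a - 1)\<close>, and
	  this number is one of them.\<close>
	have pred: "agrp (Q ^ (a - 1))"
	proof (rule agrp_from_aset[of _ "msum (mK (a - 2)) (mK (a - 2))"])
		have s2: "a - 1 = Suc (a - 2)" using a3 by simp
		show "aset (msum (mK (a - 2)) (mK (a - 2)))" using small[of "a - 2"] a3 by (intro aset_msum) simp_all
		have "Q ^ (a - 2) \<in> mK (a - 2)" using mK_mem[OF one_K] by simp
		then show "Q ^ (a - 1) \<in> msum (mK (a - 2)) (mK (a - 2))"
			unfolding s2 using q2 by (auto simp: msum_def intro!: bexI[of _ "Q ^ (a - 2)"])
		fix z assume "z \<in> msum (mK (a - 2)) (mK (a - 2))"
		then obtain y where y: "y \<in> mK (a - 2)" "z - y \<in> mK (a - 2)" by (auto simp: msum_def)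
		obtain x x' where x: "x \<in> K" "N dvd Q ^ (a - 2) * x - y" "x' \<in> K" "N dvd Q ^ (a - 2) * x' - (z - y)"
			using y by (auto simp: mK_def)
		obtain q where q: "q = Q ^ (a - 2)" by blast
		have e: "Q ^ (a - 1) = q * 2" unfolding s2 q using q2 by simp
		have "2 dvd x + x'" using odd_K x by simp
		moreover have "q * 2 dvd N" unfolding e[symmetric] by (rule Qj_N) simp
		ultimately have "q * 2 dvd z" using x(2,4) unfolding q[symmetric] by Groebner_Basis.algebra
		then show "Q ^ (a - 1) dvd z" by (simp only: e)
	qed simp
	have musq: "N dvd mu * mu - 1"
	proof -
		obtain m where m: "mu = 2 * m + 1" using odd_K[OF mu(1)] by (rule oddE)
		have "mu * mu - 1 = 4 * (m * (m + 1))" by (simp add: m algebra_simps)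
		moreover have "r dvd mu * mu - 1" using mu(2) by Groebner_Basis.algebra
		ultimately show ?thesis using inj4[OF one_K K_mult[OF mu(1) mu(1)]] by simp
	qed
	\<comment> \<open>The exceptional representations of \<open>z\<close> will be the solutions of
	  \<open>z0 * x = z\<close>. Since \<open>mu\<close> squares to 1 and is 3 modulo 4,
	  \<open>2 ^ (a - 1)\<close> divides \<open>z0\<close>, so \<open>bs z0\<close> lies in the section
	  group just found.\<close>
	define z0 where "z0 = 1 + mu"
	have z0a: "2 ^ (a - 1) dvd z0"
	proof -
		obtain m where m: "mu = 2 * m + 1" using odd_K[OF mu(1)] by (rule oddE)
		have "odd m" using mu4 m by (auto elim!: evenE)
		have "2 * 2 ^ (a - 1) = (2::int) ^ a" using a by (cases a) auto
		moreover have "2 ^ a dvd mu * mu - 1" using musq dvd_N q2 by simp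
		moreover have "mu * mu - 1 = 2 * (m * z0)" by (simp add: m z0_def algebra_simps)
		ultimately have "2 * 2 ^ (a - 1) dvd 2 * (m * z0)" by simp
		then have "2 ^ (a - 1) dvd m * z0" by simp
		moreover have "coprime (2 ^ (a - 1)) m" using \<open>odd m\<close> by simp
		ultimately show ?thesis using coprime_dvd_mult_right_iff by blast
	qed
	have four_pow: "4 dvd (2::int) ^ (a - 1)"
	proof -
		have "(2::int) ^ 2 dvd 2 ^ (a - 1)" using a3 by (intro le_imp_power_dvd) simp
		then show ?thesis by simp
	qed
	have z04: "4 dvd z0" using four_pow z0a dvd_trans by blast
	have p4: "4 dvd p" unfolding p_def using four_pow q2 by simp
	have N4: "4 dvd N" using p4 by (simp add: N2)
	have muz0: "N dvd mu * z0 - z0" using musq by (simp add: z0_def algebra_simps)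
	have "2 dvd mu - 1" using odd_K[OF mu(1)] by simp
	then have "2 * p dvd (mu - 1) * p" by (rule mult_dvd_mono) simp
	then have mup: "N dvd mu * p - p" by (simp add: N2 left_diff_distrib)
	have r1: "x \<in> K ==> r dvd x - 1 ==> N dvd x - 1 \<or> N dvd x - mu" for x
	proof -
		assume x: "x \<in> K" "r dvd x - 1"
		show ?thesis
		proof (cases "4 dvd x - 1")
			case True
			then show ?thesis using inj4[OF one_K x(1)] x(2) by simp
		next
			case False
			have "4 dvd x - mu" using False mu4 odd_K[OF x(1)] odd_K[OF mu(1)] by presburger
			moreover have "r dvd x - mu" using x(2) mu(2) by Groebner_Basis.algebra
			ultimately show ?thesis using inj4[OF mu(1) x(1)] by simp
		qed
	qed
	define A where "A = (\<lambda>z. {x \<in> {0..<N}. x \<in> K \<and> z - x \<in> K})"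
	define B where "B = (\<lambda>z. {x \<in> A z. N dvd z0 * x - z})"
	have cAB: "card (A z) mod 4 = card (B z) mod 4" if z: "4 dvd z" "N dvd mu * z - z" for z
	proof -
		have "card (A z) mod 4 = card {x \<in> A z. N dvd 2 * x - z \<or> N dvd mu * x - x \<or> N dvd x + mu * x - z} mod 4"
			unfolding A_def
		proof (rule card_representations_mod_4[OF N_pos K_cong])
			show "N dvd mu * x - mu * y" if "N dvd x - y" for x y using that by Groebner_Basis.algebra
			fix x assume x: "x \<in> K" "z - x \<in> K"
			have e: "N dvd mu * (z - x) - (z - mu * x)" "N dvd mu * (mu * x) - x" using z(2) musq by - Groebner_Basis.algebra+
			have "mu * x \<in> K" "mu * (z - x) \<in> K" using K_mult[OF mu(1)] x by blast+
			then show "mu * x \<in> K \<and> z - mu * x \<in> K \<and> N dvd mu * (mu * x) - x \<and> N dvd mu * (z - x) - (z - mu * x)"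
				using e K_cong[OF e(1)] by blast
		qed
		also have "{x \<in> A z. N dvd 2 * x - z \<or> N dvd mu * x - x \<or> N dvd x + mu * x - z} = B z"
		proof -
			have "\<not> N dvd 2 * x - z \<and> \<not> N dvd mu * x - x" if x: "x \<in> K" for x
			proof
				show "\<not> N dvd 2 * x - z"
				proof
					assume "N dvd 2 * x - z"
					from dvd_add[OF dvd_trans[OF N4 this] z(1)] have "4 dvd 2 * x" by simp
					then show False using odd_K[OF x] by presburger
				qed
				show "\<not> N dvd mu * x - x"
				proof
					assume "N dvd mu * x - x"
					then have "N dvd x * (mu - 1)" by Groebner_Basis.algebra
					then show False using mu(3) units[OF x] coprime_dvd_mult_right_iff coprime_commute by blast
				qed
			qed
			moreover have "x + mu * x - z = z0 * x - z" for x by (simp add: z0_def algebra_simps)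
			ultimately show ?thesis by (auto simp: A_def B_def)
		qed
		finally show ?thesis .
	qed
	have modK: "x mod N \<in> K \<longleftrightarrow> x \<in> K" for x by (rule K_cong) (simp add: mod_eq_dvd_iff[symmetric])
	have cr: "coprime r 2" using odd_r by simp
	have z0r: "r dvd z0 - 2" using mu(2) by (simp add: z0_def)
	have Br: "r dvd x - 1" if "N dvd z0 * x - (z0 + p * c)" for x c
	proof -
		have "r dvd p" by (simp add: p_def)
		then have "r dvd 2 * (x - 1)" using that r_N z0r by Groebner_Basis.algebra
		then show ?thesis using cr coprime_dvd_mult_right_iff by blast
	qed
	have cardB0: "card (B z0) = 2"
	proof -
		have "B z0 = {1 mod N, mu mod N}"
		proof (intro subset_antisym subsetI)
			fix x assume "x \<in> B z0"
			then have x: "x \<in> K" "0 \<le> x" "x < N" "N dvd z0 * x - z0" by (auto simp: B_def A_def)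
			then have "N dvd x - 1 \<or> N dvd x - mu" using r1 Br[of x 0] by simp
			then have "x mod N = 1 mod N \<or> x mod N = mu mod N" by (simp add: mod_eq_dvd_iff)
			then show "x \<in> {1 mod N, mu mod N}" using x by simp
		next
			fix x assume "x \<in> {1 mod N, mu mod N}"
			moreover have "y mod N \<in> B z0" if y: "y \<in> K" "z0 - y \<in> K" "N dvd z0 * y - z0" for y
			proof -
				have m: "N dvd y mod N - y" by (simp add: mod_eq_dvd_iff[symmetric])
				then have "N dvd z0 * (y mod N) - z0" using y(3) by Groebner_Basis.algebra
				moreover have "z0 - y mod N \<in> K" using K_cong[of "z0 - y" "z0 - y mod N"] m y(2) by simp
				ultimately show ?thesis using y(1) modK N_pos by (simp add: A_def B_def)
			qed
			from this[of 1] this[of mu] have "1 mod N \<in> B z0" "mu mod N \<in> B z0"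
				using one_K mu(1) muz0 by (simp_all add: z0_def mult.commute)
			ultimately show "x \<in> B z0" by blast
		qed
		moreover have "1 mod N ~= mu mod N" using mu(3) by (metis mod_eq_dvd_iff)
		ultimately show ?thesis by simp
	qed
	have cardB1: "B (z0 + p) = {}"
	proof (rule ccontr)
		assume "B (z0 + p) ~= {}"
		then obtain x where x: "x \<in> K" "N dvd z0 * x - (z0 + p)" by (auto simp: A_def B_def)
		have "N dvd x - 1 \<or> N dvd x - mu" using r1[OF x(1)] Br[of x 1] x(2) by simp
		moreover have "N dvd x - 1 ==> N dvd p" using x(2) by Groebner_Basis.algebra
		moreover have "N dvd x - mu ==> N dvd p" using x(2) muz0 by Groebner_Basis.algebra
		ultimately show False using not_N_p by blast
	qed
	have "N dvd mu * (z0 + p) - (z0 + p)" using muz0 mup by Groebner_Basis.algebra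
	then have "card (A (z0 + p)) mod 4 = 0" using cAB[of "z0 + p"] z04 p4 cardB1 by simp
	moreover have "card (A z0) mod 4 = 2" using cAB[OF z04 muz0] cardB0 by simp
	ultimately have "card (A z0) ~= card (A (z0 + p))" by auto
	then have cne: "conv N (ind K) (ind K) (z0 + p) ~= conv N (ind K) (ind K) z0" by (simp add: conv_ind A_def)
	have "conv N (ind K) (ind K) \<in> I" using aset_bs I_conv by (simp add: I_ind)
	then have nb: "z0 + p \<notin> bs z0" using cne I_bs by blast
	have sub: "bs z0 \<subseteq> {x. Q ^ (a - 1) dvd x}" using pred z0a q2 by (intro bs_sub) (auto simp: agrp_def)
	\<comment> \<open>The coset of \<open>z0\<close> by the subgroup of order 2 is only partly in
	  \<open>bs z0\<close>, so \<open>2 * z0\<close> belongs to this set. The span of the set is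
	  divisible by \<open>2 ^ a\<close>, and its odd part divides both \<open>r\<close> and
	  \<open>2 * z0\<close>, which is 4 modulo \<open>r\<close>; so the span is exactly
	  \<open>Q ^ a\<close>.\<close>
	let ?D = "{z. \<exists>t\<in>bs z0. (\<exists>e. p dvd e \<and> t + e \<notin> bs z0) \<and> N dvd int q * t - z}"
	have aD: "aset ?D" by (rule aset_partial_cosets[OF q N_p aset_bs])
	have mem: "2 * z0 \<in> ?D"
	proof -
		have "p dvd p \<and> z0 + p \<notin> bs z0" using nb by simp
		moreover have "N dvd int q * z0 - 2 * z0" using q2 by simp
		ultimately show ?thesis using bs_refl[of z0] by blast
	qed
	obtain d where d: "agrp d" "\<And>x. x \<in> ?D ==> d dvd x" "\<And>e. e dvd N ==> (\<And>x. x \<in> ?D ==> e dvd x) ==> e dvd d"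
		using gen_agrp[OF aD] by blast
	have Qa: "Q ^ a = 2 * Q ^ (a - 1)" using a q2 by (cases a) auto
	have "Q ^ a dvd d"
	proof (rule d(3))
		show "Q ^ a dvd N" by (simp add: N_eq)
		fix z assume "z \<in> ?D"
		then obtain t where t: "t \<in> bs z0" "N dvd 2 * t - z" using q2 by auto
		have "2 * Q ^ (a - 1) dvd 2 * t" using sub t(1) by (intro mult_dvd_mono) auto
		moreover have "Q ^ a dvd 2 * t - z" using t(2) dvd_N by blast
		ultimately show "Q ^ a dvd z" using Qa dvd_iff_diff by metis
	qed
	then obtain d' where d': "d = Q ^ a * d'" by (auto elim: dvdE)
	have "d dvd N" "d > 0" using d(1) by (auto simp: agrp_def)
	then have d'r: "d' dvd r" "d' > 0" using Q_gt by (auto simp: d' N_eq zero_less_mult_iff)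
	have "d dvd 2 * z0" using d(2) mem by blast
	then have "d' dvd 2 * z0" by (simp add: d' dvd_mult_right)
	then have "d' dvd 2 ^ 2" using d'r(1) z0r by Groebner_Basis.algebra
	moreover have "odd d'" using d'r(1) odd_r dvd_trans by blast
	then have "coprime d' (2 ^ 2)" using coprime_right_2_iff_odd[of d'] by (simp only: coprime_power_right_iff simp_thms)
	ultimately have "is_unit d'" using coprime_common_divisor dvd_refl by blast
	then have "d' = 1" using d'r(2) by simp
	then have top: "agrp (Q ^ a)" using d(1) d' by simp
	show ?thesis
	proof (cases "j + 2 \<le> a")
		case True
		then show ?thesis using agrp_mK[OF j] small by blast
	next
		case False
		then have "j = a - 1 \<or> j = a" using j by linarith
		then show ?thesis using pred top by blast
	qed
qed

lemma agrp_Q: "j \<le> a ==> agrp (Q ^ j)"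
proof (cases "q = 2")
	case True
	assume j: "j \<le> a"
	show ?thesis
	proof (cases "\<forall>k\<in>K. r dvd k - 1 --> N dvd k - 1")
		case True
		then show ?thesis using agrp_two_untwisted j by blast
	next
		case False
		then show ?thesis using agrp_two_twisted \<open>q = 2\<close> j by blast
	qed
qed (rule agrp_odd)

end

section \<open>From prime powers to arbitrary divisors\<close>

lemma prime_power_split:
	fixes n :: int
	assumes "n > 0" "prime q" "int q dvd n"
	obtains a m where "a > 0" "n = int q ^ a * m" "\<not> int q dvd m" "m > 0" "m < n"
proof -
	have nu: "\<not> is_unit (int q)" using assms(2) by (metis not_prime_unit prime_nat_int_transfer)
	obtain m where m: "n = int q ^ multiplicity (int q) n * m" "\<not> int q dvd m"
		using multiplicity_decompose'[of n "int q"] assms nu by auto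
	have a: "multiplicity (int q) n > 0" using assms nu by (simp add: multiplicity_gt_zero_iff)
	have q1: "int q > 1" using prime_gt_1_nat[OF assms(2)] by simp
	then have mp: "m > 0" using m(1) assms(1) by (metis zero_less_mult_pos zero_less_power less_trans zero_less_one)
	have "1 < int q ^ multiplicity (int q) n" using q1 a by (rule one_less_power)
	then have "1 * m < int q ^ multiplicity (int q) n * m" using mp by (rule mult_strict_right_mono)
	then show thesis using that[OF a m mp] m(1) by simp
qed

lemma prime_divisor_int:
	fixes n :: int
	assumes "n > 1"
	obtains q where "prime q" "int q dvd n"
proof -
	have "nat n ~= 1" using assms by simp
	then obtain q where "prime q" "q dvd nat n" using prime_factor_nat by blast
	then show thesis using that assms by (metis int_dvd_int_iff int_nat_eq less_imp_le less_trans zero_less_one)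
qed

context ag
begin

text \<open>A divisor is the lcm of its prime-power components, and section groups are closed under
  lcm.\<close>

lemma agrp_all: "d > 0 ==> d dvd N ==> agrp d"
proof (induction "nat d" arbitrary: d rule: less_induct)
	case less
	show ?case
	proof (cases "d = 1")
		case True
		then show ?thesis using agrp_1 by simp
	next
		case False
		then have "d > 1" using less.prems by simp
		then obtain q where q: "prime q" "int q dvd d" using prime_divisor_int by blast
		obtain j m where jm: "j > 0" "d = int q ^ j * m" "\<not> int q dvd m" "m > 0" "m < d"
			using prime_power_split[OF less.prems(1) q] .
		obtain a r where ar: "a > 0" "N = int q ^ a * r" "\<not> int q dvd r"
			using prime_power_split[OF N_pos q(1)] q(2) less.prems(2) dvd_trans by metis
		interpret agq N I q a r by unfold_locales (use q ar in auto)
		have "int q ^ j dvd int q ^ a * r" using less.prems(2) ar(2) jm(2) dvd_mult_left by metis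
		then have "int q ^ j dvd int q ^ a" using prime_imp_coprime[OF Q_prime r] by (simp add: coprime_dvd_mult_left_iff)
		then have "int q ^ j \<le> int q ^ a" using Q_gt by (intro zdvd_imp_le) auto
		then have "j \<le> a" using Q_gt by (meson power_le_imp_le_exp)
		then have 1: "agrp (int q ^ j)" by (rule agrp_Q)
		have "m dvd N" using less.prems(2) jm(2) dvd_mult_right by metis
		then have 2: "agrp m" using less.hyps[of m] jm by simp
		have "coprime (int q ^ j) m" using prime_imp_coprime[OF Q_prime jm(3)] by simp
		then have "lcm (int q ^ j) m = d" using jm less.prems by (simp add: lcm_coprime abs_mult)
		then show ?thesis using agrp_lcm[OF 1 2] by simp
	qed
qed

end

section \<open>Discreteness of the prime layers\<close>

lemma psum_all:
	assumes q: "prime q" and m: "0 < m" "m < 2 * (q - 1)"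
	shows "[(\<Sum>k<q. int k ^ m) = (if m = q - 1 then - 1 else 0)] (mod int q)"
proof -
	consider "m < q - 1" | "m = q - 1" | "m > q - 1" by linarith
	then show ?thesis
	proof cases
		case 1
		then show ?thesis using psum_small[OF q, of m] by (simp add: cong_0_iff)
	next
		case 2
		then show ?thesis using psum_pred[OF q] by simp
	next
		case 3
		define n where "n = m - (q - 1)"
		have n: "n > 0" "m = n + (q - 1)" "n + 1 < q" using 3 m by (auto simp: n_def)
		have "int q dvd (\<Sum>k<q. int k ^ n)" by (rule psum_small[OF q n(3)])
		then have "[(\<Sum>k<q. int k ^ m) = 0] (mod int q)" using psum_reduce[OF q n(1)] n(2) cong_trans by (metis cong_0_iff)
		then show ?thesis using 3 by simp
	qed
qed

lemma unit_power_cong: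
	fixes x :: int
	assumes q: "prime q" and x: "\<not> int q dvd x"
	shows "[x ^ (q - 1) = 1] (mod int q)"
proof -
	have "[x * x ^ (q - 1) = x * 1] (mod int q)" using fermat_cong[OF q, of x] prime_gt_0_nat[OF q] by (simp add: power_eq_if)
	moreover have "coprime x (int q)" using prime_imp_coprime[of "int q" x] q x by (simp add: coprime_commute)
	ultimately show ?thesis using cong_mult_lcancel by blast
qed

text \<open>For \<open>x\<close> and \<open>y\<close> prime to \<open>q\<close>, \<open>coefmat q a x y\<close> is the value modulo \<open>q\<close> of the polynomial
	with coefficients \<open>a 0, ..., a (q - 2)\<close> at \<open>x / y\<close>. Coefficientwise products correspond to
	matrix products, cyclic convolutions of the coefficients to entrywise products.\<close>

definition coefsum :: "nat => (nat => int) => int => int => int" where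
	"coefsum q a x y = (\<Sum>k<q - 1. a k * x ^ k * y ^ (q - 1 - k))"

definition coefmat :: "nat => (nat => int) => int => int => int" where
	"coefmat q a x y = of_bool (\<not> int q dvd x \<and> \<not> int q dvd y) * (coefsum q a x y mod int q)"

lemma coefmat_cong:
	assumes "\<And>k. k < q - 1 ==> [a k = b k] (mod int q)"
	shows "coefmat q a = coefmat q b"
proof -
	have "[coefsum q a x y = coefsum q b x y] (mod int q)" for x y
		unfolding coefsum_def by (intro cong_sum cong_mult assms) auto
	then have "coefsum q a x y mod int q = coefsum q b x y mod int q" for x y by (simp add: cong_def)
	then show ?thesis by (simp add: coefmat_def fun_eq_iff)
qed

text \<open>Orthogonality of power characters: with \<open>n = q - 1\<close>, the sum of
  \<open>y ^ (n - k + j)\<close> over the units is -1 for \<open>j = k\<close> and 0 otherwise,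
  modulo \<open>q\<close>.\<close>

lemma coefsum_mult:
	assumes q: "prime q" and u: "\<not> int q dvd x" "\<not> int q dvd z"
	shows "[(\<Sum>y<q. of_bool (\<not> int q dvd int y) * (coefsum q a x (int y) * coefsum q b (int y) z))
		= - coefsum q (\<lambda>k. a k * b k) x z] (mod int q)"
proof -
	define n where n: "n = q - 1"
	have cs: "coefsum q a x y = (\<Sum>k<n. a k * x ^ k * y ^ (n - k))" for a x y by (simp add: coefsum_def n)
	have q1: "q > 1" by (rule prime_gt_1_nat[OF q])
	have ps: "(\<Sum>y<q. of_bool (\<not> int q dvd int y) * int y ^ m) = (\<Sum>y<q. int y ^ m)" if "m > 0" for m
	proof (rule sum.cong[OF refl])
		fix y assume "y \<in> {..<q}"
		then show "of_bool (\<not> int q dvd int y) * int y ^ m = int y ^ m" using that by (cases "y = 0") (auto dest: dvd_imp_le)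
	qed
	have "(\<Sum>y<q. of_bool (\<not> int q dvd int y) * (coefsum q a x (int y) * coefsum q b (int y) z))
			= (\<Sum>y<q. \<Sum>k<n. \<Sum>j<n. a k * b j * x ^ k * z ^ (n - j)
					* (of_bool (\<not> int q dvd int y) * int y ^ (n - k + j)))" unfolding cs sum_product
		by (simp only: sum_distrib_left) (intro sum.cong refl, simp only: power_add mult.assoc mult.commute mult.left_commute)
	also have "... = (\<Sum>k<n. \<Sum>y<q. \<Sum>j<n. a k * b j * x ^ k * z ^ (n - j)
					* (of_bool (\<not> int q dvd int y) * int y ^ (n - k + j)))" by (rule sum.swap)
	also have "... = (\<Sum>k<n. \<Sum>j<n. \<Sum>y<q. a k * b j * x ^ k * z ^ (n - j)
					* (of_bool (\<not> int q dvd int y) * int y ^ (n - k + j)))" by (intro sum.cong refl sum.swap)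
	also have "... = (\<Sum>k<n. \<Sum>j<n. a k * b j * x ^ k * z ^ (n - j) * (\<Sum>y<q. int y ^ (n - k + j)))"
	proof (intro sum.cong refl)
		fix k j assume "k \<in> {..<n}"
		then have "0 < n - k + j" by simp
		then show "(\<Sum>y<q. a k * b j * x ^ k * z ^ (n - j) * (of_bool (\<not> int q dvd int y) * int y ^ (n - k + j)))
				= a k * b j * x ^ k * z ^ (n - j) * (\<Sum>y<q. int y ^ (n - k + j))" by (simp only: sum_distrib_left[symmetric] ps)
	qed
	finally have 1: "(\<Sum>y<q. of_bool (\<not> int q dvd int y) * (coefsum q a x (int y) * coefsum q b (int y) z)) = ..." .
	have 2: "[(\<Sum>k<n. \<Sum>j<n. a k * b j * x ^ k * z ^ (n - j) * (\<Sum>y<q. int y ^ (n - k + j)))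
			= (\<Sum>k<n. \<Sum>j<n. a k * b j * x ^ k * z ^ (n - j) * (if j = k then - 1 else 0))] (mod int q)"
	proof (intro cong_sum cong_mult cong_refl)
		fix k j assume k: "k \<in> {..<n}" and j: "j \<in> {..<n}"
		have "0 < n - k + j" "n - k + j < 2 * n" using k j by auto
		then have "[(\<Sum>y<q. int y ^ (n - k + j)) = (if n - k + j = n then - 1 else 0)] (mod int q)"
			by (rule psum_all[OF q, folded n])
		moreover have "n - k + j = n \<longleftrightarrow> j = k" using k j by auto
		ultimately show "[(\<Sum>y<q. int y ^ (n - k + j)) = (if j = k then - 1 else 0)] (mod int q)" by (simp only:)
	qed
	have 3: "(\<Sum>k<n. \<Sum>j<n. a k * b j * x ^ k * z ^ (n - j) * (if j = k then - 1 else 0))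
			= - coefsum q (\<lambda>k. a k * b k) x z"
	proof -
		have "(\<Sum>j<n. a k * b j * x ^ k * z ^ (n - j) * (if j = k then - 1 else 0))
				= - (a k * b k * x ^ k * z ^ (n - k))" if "k < n" for k
		proof -
			have "(\<Sum>j<n. a k * b j * x ^ k * z ^ (n - j) * (if j = k then - 1 else 0))
				= (\<Sum>j<n. if j = k then - (a k * b k * x ^ k * z ^ (n - k)) else 0)" by (intro sum.cong) auto
			then show ?thesis using that by simp
		qed
		then show ?thesis unfolding cs sum_negf[symmetric] by (intro sum.cong) auto
	qed
	show ?thesis using 2 unfolding 1[symmetric] 3 .
qed

definition cycconv :: "nat => (nat => int) => (nat => int) => nat => int" where
	"cycconv n a b k = (\<Sum>i<n. \<Sum>j<n. of_bool ((i + j) mod n = k) * (a i * b j))"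

text \<open>In the product the exponent of \<open>x\<close> is reduced modulo \<open>q - 1\<close>
  and that of \<open>y\<close> adjusted to keep the total degree \<open>q - 1\<close>, both by
  Fermat's theorem.\<close>

lemma coefsum_conv:
	assumes q: "prime q" and u: "\<not> int q dvd x" "\<not> int q dvd y"
	shows "[coefsum q a x y * coefsum q b x y = coefsum q (cycconv (q - 1) a b) x y] (mod int q)"
proof -
	define n where n: "n = q - 1"
	have cs: "coefsum q a x y = (\<Sum>k<n. a k * x ^ k * y ^ (n - k))" for a x y by (simp add: coefsum_def n)
	have n0: "n > 0" using prime_gt_1_nat[OF q] by (simp add: n)
	have xy: "[x ^ n = 1] (mod int q)" "[y ^ n = 1] (mod int q)" unfolding n by (intro unit_power_cong q u)+
	have 1: "coefsum q a x y * coefsum q b x y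
			= (\<Sum>i<n. \<Sum>j<n. a i * b j * (x ^ (i + j) * y ^ (n - i + (n - j))))"
		unfolding cs sum_product by (intro sum.cong refl) (simp only: power_add mult.assoc mult.commute mult.left_commute)
	have 2: "[... = (\<Sum>i<n. \<Sum>j<n. a i * b j * (x ^ ((i + j) mod n) * y ^ (n - (i + j) mod n)))] (mod int q)"
	proof (intro cong_sum cong_mult[OF cong_refl])
		fix i j assume i: "i \<in> {..<n}" and j: "j \<in> {..<n}"
		show "[x ^ (i + j) * y ^ (n - i + (n - j)) = x ^ ((i + j) mod n) * y ^ (n - (i + j) mod n)] (mod int q)"
		proof (cases "i + j < n")
			case True
			then have "n - i + (n - j) = (n - (i + j)) + n" using i j by auto
			then have "x ^ (i + j) * y ^ (n - i + (n - j)) = x ^ (i + j) * (y ^ (n - (i + j)) * y ^ n)" by (simp only: power_add)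
			moreover have "[x ^ (i + j) * (y ^ (n - (i + j)) * y ^ n) = x ^ (i + j) * (y ^ (n - (i + j)) * 1)] (mod int q)"
				by (intro cong_mult cong_refl xy)
			moreover have "(i + j) mod n = i + j" using True by simp
			ultimately show ?thesis by (simp only: mult_1_right)
		next
			case False
			define k where "k = i + j - n"
			have k: "i + j = k + n" "k < n" using False i j by (auto simp: k_def)
			then have m: "(i + j) mod n = k" by simp
			have "n - i + (n - j) = n - k" using k i j by auto
			then have "x ^ (i + j) * y ^ (n - i + (n - j)) = x ^ k * x ^ n * y ^ (n - k)" unfolding k(1) by (simp only: power_add)
			moreover have "[x ^ k * x ^ n * y ^ (n - k) = x ^ k * 1 * y ^ (n - k)] (mod int q)" by (intro cong_mult cong_refl xy)
			ultimately show ?thesis unfolding m by simp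
		qed
	qed
	have 3: "(\<Sum>i<n. \<Sum>j<n. a i * b j * (x ^ ((i + j) mod n) * y ^ (n - (i + j) mod n)))
			= coefsum q (cycconv n a b) x y"
	proof -
		have "coefsum q (cycconv n a b) x y
				= (\<Sum>k<n. \<Sum>i<n. \<Sum>j<n. of_bool ((i + j) mod n = k) * (a i * b j * (x ^ k * y ^ (n - k))))"
			unfolding cs cycconv_def sum_distrib_right by (intro sum.cong refl) (simp add: ac_simps)
		also have "... = (\<Sum>i<n. \<Sum>k<n. \<Sum>j<n. of_bool ((i + j) mod n = k) * (a i * b j * (x ^ k * y ^ (n - k))))" by (rule sum.swap)
		also have "... = (\<Sum>i<n. \<Sum>j<n. \<Sum>k<n. of_bool ((i + j) mod n = k) * (a i * b j * (x ^ k * y ^ (n - k))))"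
			by (intro sum.cong refl sum.swap)
		also have "... = (\<Sum>i<n. \<Sum>j<n. a i * b j * (x ^ ((i + j) mod n) * y ^ (n - (i + j) mod n)))"
		proof (intro sum.cong refl)
			fix i j
			have "(\<Sum>k<n. of_bool ((i + j) mod n = k) * (a i * b j * (x ^ k * y ^ (n - k))))
					= (\<Sum>k<n. if k = (i + j) mod n then a i * b j * (x ^ k * y ^ (n - k)) else 0)" by (intro sum.cong) auto
			also have "... = a i * b j * (x ^ ((i + j) mod n) * y ^ (n - (i + j) mod n))" using n0 by simp
			finally show "(\<Sum>k<n. of_bool ((i + j) mod n = k) * (a i * b j * (x ^ k * y ^ (n - k))))
					= a i * b j * (x ^ ((i + j) mod n) * y ^ (n - (i + j) mod n))" .
		qed
		finally show ?thesis by simp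
	qed
	show ?thesis using 2 unfolding 1[symmetric] 3 unfolding n .
qed

context ctx
begin

lemma J_sum: "finite A ==> (\<And>i. i \<in> A ==> F i \<in> J) ==> (\<lambda>x y. \<Sum>i\<in>A. F i x y) \<in> J"
proof (induction A rule: finite_induct)
	case empty
	then show ?case using J_map[OF J_zero, of "\<lambda>_. 0"] by simp
next
	case (insert i A)
	then show ?case using J_map2[of "F i" "\<lambda>x y. \<Sum>i\<in>A. F i x y" "(+)"] by simp
qed

lemma rel_UN:
	assumes "finite A" "\<And>i. i \<in> A ==> rel (R i)"
	shows "rel (\<lambda>x y. \<exists>i\<in>A. R i x y)"
proof -
	have "(\<lambda>x y. \<Sum>i\<in>A. of_bool (R i x y)) \<in> J" using assms by (intro J_sum) (auto simp: rel_def)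
	then have "rel (\<lambda>x y. (\<Sum>i\<in>A. of_bool (R i x y) :: int) > 0)" by (rule rel_level)
	moreover have "(\<Sum>i\<in>A. of_bool (R i x y) :: int) > 0 \<longleftrightarrow> (\<exists>i\<in>A. R i x y)" for x y
	proof
		assume "(\<Sum>i\<in>A. of_bool (R i x y) :: int) > 0"
		show "\<exists>i\<in>A. R i x y"
		proof (rule ccontr)
			assume "\<not> (\<exists>i\<in>A. R i x y)"
			then have "(\<Sum>i\<in>A. of_bool (R i x y) :: int) = 0" by (intro sum.neutral) auto
			then show False using \<open>(\<Sum>i\<in>A. of_bool (R i x y) :: int) > 0\<close> by simp
		qed
	next
		assume "\<exists>i\<in>A. R i x y"
		then obtain i where "i \<in> A" "R i x y" by blast
		then show "(\<Sum>i\<in>A. of_bool (R i x y) :: int) > 0" using assms(1) by (intro sum_pos2[of _ i]) auto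
	qed
	ultimately show ?thesis by simp
qed

text \<open>Only finitely many pairs of residues have to be covered, so the local relations can be
  united.\<close>

lemma rel_cover:
	assumes per: "\<And>x x' y y'. N dvd x - x' ==> N dvd y - y' ==> R x y ==> R x' y'"
		and cover: "\<And>x y. R x y ==> \<exists>R'. rel R' \<and> R' x y \<and> (\<forall>x y. R' x y --> R x y)"
	shows "rel R"
proof -
	let ?A = "{xy \<in> {0..<N} \<times> {0..<N}. R (fst xy) (snd xy)}"
	have "\<forall>xy\<in>?A. \<exists>R'. rel R' \<and> R' (fst xy) (snd xy) \<and> (\<forall>x y. R' x y --> R x y)" using cover by blast
	from bchoice[OF this] obtain R' where
		"\<forall>xy\<in>?A. rel (R' xy) \<and> R' xy (fst xy) (snd xy) \<and> (\<forall>x y. R' xy x y --> R x y)" by blast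
	then have R': "\<And>xy. xy \<in> ?A ==> rel (R' xy) \<and> R' xy (fst xy) (snd xy) \<and> (\<forall>x y. R' xy x y --> R x y)" by blast
	have "rel (\<lambda>x y. \<exists>xy\<in>?A. R' xy x y)"
	proof (rule rel_UN)
		show "finite ?A" by (rule finite_subset[of _ "{0..<N} \<times> {0..<N}"]) auto
	qed (use R' in blast)
	moreover have "(\<exists>xy\<in>?A. R' xy x y) \<longleftrightarrow> R x y" for x y
	proof
		assume r: "R x y"
		have m: "N dvd x - x mod N" "N dvd y - y mod N" by (simp_all add: mod_eq_dvd_iff[symmetric])
		have "R (x mod N) (y mod N)" by (rule per[OF m r])
		then have in_A: "(x mod N, y mod N) \<in> ?A" using N_pos by simp
		then have "R' (x mod N, y mod N) (x mod N) (y mod N)" using R' by fastforce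
		then have "R' (x mod N, y mod N) x y" using rel_cong[OF conjunct1[OF R'[OF in_A]] m] by simp
		then show "\<exists>xy\<in>?A. R' xy x y" using in_A by blast
	qed (use R' in blast)
	ultimately show ?thesis by simp
qed

context
	fixes q :: nat
	assumes q: "prime q" and Nq: "N = int q"
begin

lemma rel_units: "rel (\<lambda>x y. \<not> int q dvd x \<and> \<not> int q dvd y)"
proof -
	have f: "fib {x. N dvd x}" using fib_agrp[OF agrp_N] .
	from rel_comb[OF f[unfolded fib_def] rel_fib2[OF f], of "\<lambda>a b. \<not> a \<and> \<not> b"]
	show ?thesis by (simp add: Nq)
qed

lemma coefmat_mult:
	assumes "coefmat q a \<in> J" "coefmat q b \<in> J"
	shows "coefmat q (\<lambda>k. a k * b k) \<in> J"
proof -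
	have "(\<lambda>x z. rsum N (\<lambda>y. coefmat q a x y * coefmat q b y z)) \<in> J" by (rule J_mul[OF assms])
	from J_map2[OF this rel_units[unfolded rel_def], of "\<lambda>s b. (- s) mod int q * b"]
	have "(\<lambda>x z. (- rsum N (\<lambda>y. coefmat q a x y * coefmat q b y z)) mod int q
			* of_bool (\<not> int q dvd x \<and> \<not> int q dvd z)) \<in> J" .
	moreover have "(- rsum N (\<lambda>y. coefmat q a x y * coefmat q b y z)) mod int q
			* of_bool (\<not> int q dvd x \<and> \<not> int q dvd z) = coefmat q (\<lambda>k. a k * b k) x z" for x z
	proof (cases "\<not> int q dvd x \<and> \<not> int q dvd z")
		case True
		have "rsum N (\<lambda>y. coefmat q a x y * coefmat q b y z)
				= (\<Sum>y<q. coefmat q a x (int y) * coefmat q b (int y) z)" unfolding Nq by (rule rsum_int)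
		moreover have A: "[(\<Sum>y<q. coefmat q a x (int y) * coefmat q b (int y) z)
				= (\<Sum>y<q. of_bool (\<not> int q dvd int y) * (coefsum q a x (int y) * coefsum q b (int y) z))] (mod int q)"
			using True by (intro cong_sum) (auto simp: coefmat_def cong_def mod_mult_eq)
		ultimately have "[rsum N (\<lambda>y. coefmat q a x y * coefmat q b y z) = - coefsum q (\<lambda>k. a k * b k) x z] (mod int q)"
			using cong_trans[OF A coefsum_mult[OF q]] True by simp
		then have "[- rsum N (\<lambda>y. coefmat q a x y * coefmat q b y z) = coefsum q (\<lambda>k. a k * b k) x z] (mod int q)"
			using cong_minus_minus_iff by fastforce
		then show ?thesis using True by (simp add: coefmat_def cong_def)
	qed (auto simp: coefmat_def)
	ultimately show ?thesis by simp
qed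

lemma coefmat_lin:
	assumes "coefmat q a \<in> J" "coefmat q b \<in> J"
	shows "coefmat q (\<lambda>k. c * a k + d * b k) \<in> J"
proof -
	have "(\<lambda>x y. (c * coefmat q a x y + d * coefmat q b x y) mod int q) \<in> J" by (rule J_map2[OF assms])
	moreover have "(c * coefmat q a x y + d * coefmat q b x y) mod int q = coefmat q (\<lambda>k. c * a k + d * b k) x y" for x y
	proof -
		have "coefsum q (\<lambda>k. c * a k + d * b k) x y = c * coefsum q a x y + d * coefsum q b x y"
			by (simp add: coefsum_def sum.distrib sum_distrib_left algebra_simps)
		moreover have "(c * (u mod int q) + d * (w mod int q)) mod int q = (c * u + d * w) mod int q" for u w
		proof -
			have "[c * (u mod int q) + d * (w mod int q) = c * u + d * w] (mod int q)"
				by (intro cong_add cong_mult cong_refl) (simp_all add: cong_def)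
			then show ?thesis by (simp add: cong_def)
		qed
		ultimately show ?thesis by (simp add: coefmat_def)
	qed
	ultimately show ?thesis by simp
qed

lemma coefmat_conv:
	assumes "coefmat q a \<in> J" "coefmat q b \<in> J"
	shows "coefmat q (cycconv (q - 1) a b) \<in> J"
proof -
	have "(\<lambda>x y. (coefmat q a x y * coefmat q b x y) mod int q) \<in> J" by (rule J_map2[OF assms])
	moreover have "(coefmat q a x y * coefmat q b x y) mod int q = coefmat q (cycconv (q - 1) a b) x y" for x y
	proof (cases "\<not> int q dvd x \<and> \<not> int q dvd y")
		case True
		then have "[coefsum q a x y * coefsum q b x y = coefsum q (cycconv (q - 1) a b) x y] (mod int q)"
			using coefsum_conv[OF q] by blast
		then show ?thesis using True by (simp add: coefmat_def cong_def mod_mult_eq)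
	qed (auto simp: coefmat_def)
	ultimately show ?thesis by simp
qed

lemma coefmat_power:
	assumes "coefmat q a \<in> J"
	shows "m > 0 ==> coefmat q (\<lambda>k. a k ^ m) \<in> J"
proof (induction m)
	case (Suc m)
	then show ?case
	proof (cases "m = 0")
		case False
		then show ?thesis using coefmat_mult[OF assms Suc.IH] by simp
	qed (simp add: assms)
qed simp

lemma coefmat_0: "coefmat q (\<lambda>k. of_bool (k = 0)) \<in> J"
proof -
	have n0: "q - 1 > 0" using prime_gt_1_nat[OF q] by simp
	have "coefmat q (\<lambda>k. of_bool (k = 0)) x y = of_bool (\<not> int q dvd x \<and> \<not> int q dvd y)" for x y
	proof (cases "\<not> int q dvd x \<and> \<not> int q dvd y")
		case True
		have "coefsum q (\<lambda>k. of_bool (k = 0)) x y = (\<Sum>k<q - 1. if k = 0 then y ^ (q - 1) else 0)"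
			unfolding coefsum_def by (intro sum.cong) auto
		also have "... = y ^ (q - 1)" using n0 by simp
		finally have "coefsum q (\<lambda>k. of_bool (k = 0)) x y mod int q = 1"
			using unit_power_cong[OF q, of y] True prime_gt_1_nat[OF q] by (simp add: cong_def)
		then show ?thesis using True by (simp add: coefmat_def)
	qed (auto simp: coefmat_def)
	then have "coefmat q (\<lambda>k. of_bool (k = 0)) = (\<lambda>x y. of_bool (\<not> int q dvd x \<and> \<not> int q dvd y))" by (intro ext)
	then show ?thesis using rel_units by (simp add: rel_def)
qed

text \<open>The relations say that the algebra contains \<open>(1 - x / y) ^ d\<close>. Its
  coefficients are signed binomials; their powers of exponent \<open>q - 1\<close> form the
  indicator of the degrees up to \<open>d\<close>, whose cyclic square has the coefficient
  \<open>k + 1\<close> in degree \<open>k\<close>. This isolates degree 1, so the algebra contains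
  \<open>x / y\<close>, and one base point then fixes every point.\<close>

lemma prime_scaling:
	assumes d: "d > 0" "2 * d \<le> q - 1"
		and R: "\<And>c. rel (\<lambda>x y. \<not> int q dvd x \<and> \<not> int q dvd y \<and> [(y - x) ^ d = c * y ^ d] (mod int q))"
	shows "disc 1 N"
proof -
	let ?n = "q - 1"
	have q1: "q > 1" by (rule prime_gt_1_nat[OF q])
	have dn: "d < ?n" using d by simp
	have q3: "q \<ge> 3" using d by simp
	define a0 where "a0 = (\<lambda>k. (- 1) ^ k * int (d choose k))"
	have a0: "coefmat q a0 \<in> J"
	proof -
		let ?F = "\<lambda>c x y. c * of_bool (\<not> int q dvd x \<and> \<not> int q dvd y \<and> [(y - x) ^ d = c * y ^ d] (mod int q))"
		have "(\<lambda>x y. \<Sum>c\<in>{0..<int q}. ?F c x y) \<in> J"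
			using R by (intro J_sum) (auto simp: rel_def intro!: J_map[of _ "\<lambda>b. _ * b"])
		moreover have "(\<Sum>c\<in>{0..<int q}. ?F c x y) = coefmat q a0 x y" for x y
		proof (cases "\<not> int q dvd x \<and> \<not> int q dvd y")
			case True
			let ?c0 = "coefsum q a0 x y mod int q"
			have cs: "coefsum q a0 x y = (y - x) ^ d * y ^ (?n - d)"
			proof -
				have "(y - x) ^ d = ((- x) + y) ^ d" by simp
				also have "... = (\<Sum>k\<le>d. int (d choose k) * (- x) ^ k * y ^ (d - k))" by (rule binomial_ring)
				finally have "(y - x) ^ d * y ^ (?n - d) = (\<Sum>k\<le>d. int (d choose k) * (- x) ^ k * y ^ (d - k) * y ^ (?n - d))"
					by (simp add: sum_distrib_right)
				also have "... = (\<Sum>k\<le>d. a0 k * x ^ k * y ^ (?n - k))"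
				proof (intro sum.cong refl)
					fix k assume "k \<in> {..d}"
					then have "?n - k = (d - k) + (?n - d)" using dn by auto
					then show "int (d choose k) * (- x) ^ k * y ^ (d - k) * y ^ (?n - d) = a0 k * x ^ k * y ^ (?n - k)"
						by (simp add: a0_def power_add power_minus[of x] ac_simps)
				qed
				also have "... = (\<Sum>k<?n. a0 k * x ^ k * y ^ (?n - k))" using dn by (intro sum.mono_neutral_left) (auto simp: a0_def)
				finally show ?thesis by (simp add: coefsum_def)
			qed
			have cop: "coprime (y ^ (?n - d)) (int q)" using prime_imp_coprime[of "int q" y] q True by (simp add: coprime_commute)
			have "d + (?n - d) = ?n" using dn by simp
			then have yn: "y ^ d * y ^ (?n - d) = y ^ ?n" by (metis power_add)
			have "[(y - x) ^ d = c * y ^ d] (mod int q) \<longleftrightarrow> c = ?c0" if c: "c \<in> {0..<int q}" for c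
			proof -
				have "[(y - x) ^ d = c * y ^ d] (mod int q)
						\<longleftrightarrow> [(y - x) ^ d * y ^ (?n - d) = c * y ^ d * y ^ (?n - d)] (mod int q)" using cong_mult_rcancel[OF cop] by blast
				also have "c * y ^ d * y ^ (?n - d) = c * y ^ ?n" by (simp only: mult.assoc yn)
				also have "[(y - x) ^ d * y ^ (?n - d) = c * y ^ ?n] (mod int q) \<longleftrightarrow> [coefsum q a0 x y = c * 1] (mod int q)"
					unfolding cs using cong_mult[OF cong_refl unit_power_cong[OF q, of y], of c] True by (meson cong_sym cong_trans)
				also have "... \<longleftrightarrow> c = ?c0" using c by (auto simp: cong_def)
				finally show ?thesis .
			qed
			then have "(\<Sum>c\<in>{0..<int q}. ?F c x y) = (\<Sum>c\<in>{0..<int q}. if c = ?c0 then ?c0 else 0)"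
				using True by (intro sum.cong) auto
			also have "... = ?c0" using q1 by simp
			finally show ?thesis using True by (simp add: coefmat_def)
		qed (auto simp: coefmat_def)
		ultimately show ?thesis by simp
	qed
	define b where "b = (\<lambda>k. of_bool (k \<le> d) :: int)"
	have ndvd: "\<not> int q dvd int m" if "0 < m" "m < q" for m using that by (auto dest: dvd_imp_le)
	have b: "coefmat q b \<in> J"
	proof -
		have "[a0 k ^ ?n = b k] (mod int q)" for k
		proof (cases "k \<le> d")
			case True
			have "\<not> q dvd (d choose k)"
			proof
				assume "q dvd (d choose k)"
				then have "q dvd fact d" using binomial_fact_lemma[OF True] by (metis dvd_mult mult.commute)
				then have "q \<le> d" using prime_dvd_fact_iff[OF q] by blast
				then show False using dn by simp
			qed
			then have "\<not> int q dvd a0 k" by (cases "even k") (simp_all add: a0_def)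
			then show ?thesis using unit_power_cong[OF q] True by (simp add: b_def)
		next
			case False
			then show ?thesis using q3 by (simp add: a0_def b_def binomial_eq_0 power_0_left)
		qed
		then have "coefmat q (\<lambda>k. a0 k ^ ?n) = coefmat q b" by (intro coefmat_cong)
		then show ?thesis using coefmat_power[OF a0, of ?n] q3 by simp
	qed
	define c where "c = cycconv ?n b b"
	have c: "coefmat q c \<in> J" unfolding c_def by (rule coefmat_conv[OF b b])
	\<comment> \<open>As \<open>2 * d \<le> q - 1\<close>, the cyclic convolution can wrap around only
	  to degree 0, which is therefore left out.\<close>
	have ck: "c k = int k + 1" if k: "1 \<le> k" "k \<le> d" for k
	proof -
		have "c k = (\<Sum>i<?n. \<Sum>j<?n. of_bool (i \<le> k \<and> j = k - i))" unfolding c_def cycconv_def b_def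
		proof (intro sum.cong refl)
			fix i j assume "i \<in> {..<?n}" "j \<in> {..<?n}"
			have "i \<le> d \<and> j \<le> d \<and> (i + j) mod ?n = k \<longleftrightarrow> i \<le> k \<and> j = k - i"
			proof
				assume a: "i \<le> d \<and> j \<le> d \<and> (i + j) mod ?n = k"
				then have "i + j \<le> ?n" using d by linarith
				then have "i + j = k" using a k by (cases "i + j = ?n") auto
				then show "i \<le> k \<and> j = k - i" by auto
			next
				assume "i \<le> k \<and> j = k - i"
				then show "i \<le> d \<and> j \<le> d \<and> (i + j) mod ?n = k" using k dn by auto
			qed
			then show "of_bool ((i + j) mod ?n = k) * (of_bool (i \<le> d) * of_bool (j \<le> d)) = (of_bool (i \<le> k \<and> j = k - i) :: int)"
				by auto
		qed
		also have "... = (\<Sum>i<?n. of_bool (i \<le> k))"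
		proof (intro sum.cong refl)
			fix i
			have "(\<Sum>j<?n. of_bool (i \<le> k \<and> j = k - i)) = (\<Sum>j<?n. if j = k - i then of_bool (i \<le> k) else (0::int))"
				by (intro sum.cong) auto
			also have "k - i < ?n" using k dn by linarith
			then have "(\<Sum>j<?n. if j = k - i then of_bool (i \<le> k) else (0::int)) = of_bool (i \<le> k)" by simp
			finally show "(\<Sum>j<?n. of_bool (i \<le> k \<and> j = k - i)) = (of_bool (i \<le> k) :: int)" .
		qed
		also have "... = int (card ({..<?n} \<inter> {i. i \<le> k}))" by (simp add: sum_of_bool_eq)
		also have "{..<?n} \<inter> {i. i \<le> k} = {..k}" using k dn by auto
		finally show ?thesis by simp
	qed
	\<comment> \<open>Zero in degree 1, where \<open>c k - 2 = 0\<close>; congruent to 1 for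
	  \<open>2 \<le> k \<le> d\<close>; zero above \<open>d\<close>. Its value in degree 0 is corrected
	  through \<open>e0\<close>.\<close>
	define m where "m = (\<lambda>k. (b k * (c k - 2)) ^ ?n)"
	have "coefmat q (\<lambda>k. 1 * (b k * c k) + (- 2) * b k) \<in> J" by (intro coefmat_lin coefmat_mult b c)
	then have "coefmat q (\<lambda>k. b k * (c k - 2)) \<in> J" by (simp add: algebra_simps)
	then have m: "coefmat q m \<in> J" unfolding m_def using coefmat_power q3 by simp
	define e0 where "e0 = (\<lambda>k::nat. of_bool (k = 0) :: int)"
	have "coefmat q (\<lambda>k. 1 * (1 * b k + (- 1) * m k) + (m 0 - 1) * e0 k) \<in> J"
		using coefmat_0 unfolding e0_def[symmetric] by (intro coefmat_lin b m)
	moreover have "[1 * (1 * b k + (- 1) * m k) + (m 0 - 1) * e0 k = of_bool (k = 1)] (mod int q)" for k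
	proof -
		consider "k = 0" | "k = 1" | "2 \<le> k" "k \<le> d" | "k > d" "k > 1" by linarith
		then show ?thesis
		proof cases
			case 1
			then show ?thesis by (simp add: e0_def b_def)
		next
			case 2
			then have "c k - 2 = 0" using ck[of 1] d by simp
			then have "m k = 0" using q3 by (simp add: m_def)
			then show ?thesis using 2 d by (simp add: e0_def b_def)
		next
			case 3
			have "m k = int (k - 1) ^ ?n" using ck[of k] 3 by (simp add: m_def b_def)
			moreover have "[int (k - 1) ^ ?n = 1] (mod int q)" using 3 dn by (intro unit_power_cong[OF q] ndvd) auto
			ultimately have "[1 - m k = 1 - 1] (mod int q)" by (metis cong_diff cong_refl)
			then show ?thesis using 3 by (simp add: e0_def b_def)
		next
			case 4
			then show ?thesis using q3 by (simp add: e0_def b_def m_def power_0_left)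
		qed
	qed
	ultimately have e1: "coefmat q (\<lambda>k. of_bool (k = 1)) \<in> J"
		using coefmat_cong[of q "\<lambda>k. 1 * (1 * b k + (- 1) * m k) + (m 0 - 1) * e0 k" "\<lambda>k. of_bool (k = 1)"] by simp
	have val: "coefmat q (\<lambda>k. of_bool (k = 1)) x y = (x * y ^ (?n - 1)) mod int q"
		if "\<not> int q dvd x" "\<not> int q dvd y" for x y
	proof -
		have "coefsum q (\<lambda>k. of_bool (k = 1)) x y = (\<Sum>k<?n. if k = 1 then x * y ^ (?n - 1) else 0)"
			unfolding coefsum_def by (intro sum.cong) auto
		also have "... = x * y ^ (?n - 1)" using dn d by simp
		finally show ?thesis using that by (simp add: coefmat_def)
	qed
	have "agrp (1 * int q ^ 1)" using agrp_N Nq by simp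
	from base_pt[OF agrp_1 this _ q] obtain h where h: "coprime h (int q)" "pt h" by auto
	have hq: "\<not> int q dvd h" using h(1) q by (metis coprime_common_divisor dvd_refl not_prime_unit prime_nat_int_transfer)
	show ?thesis unfolding disc_def
	proof (intro allI impI)
		fix t :: int
		show "fib {x. N dvd x - t}"
		proof (cases "int q dvd t")
			case True
			then have "{x. N dvd x - t} = {x. N dvd x}" by (simp add: Nq dvd_diff_left_iff)
			then show ?thesis using fib_agrp[OF agrp_N] by simp
		next
			case False
			let ?E = "{x. N dvd x - h}"
			have "fib ({x. \<exists>y\<in>?E. coefmat q (\<lambda>k. of_bool (k = 1)) x y = (t * h ^ (?n - 1)) mod int q} - {x. N dvd x})"
				using rel_level[OF e1, of "\<lambda>s. s = (t * h ^ (?n - 1)) mod int q"] h(2)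
				by (intro fib_Diff fib_path fib_agrp agrp_N) (auto simp: pt_def)
			moreover have "x \<in> {x. \<exists>y\<in>?E. coefmat q (\<lambda>k. of_bool (k = 1)) x y = (t * h ^ (?n - 1)) mod int q} - {x. N dvd x}
					\<longleftrightarrow> N dvd x - t" for x
			proof (cases "int q dvd x")
				case True
				then show ?thesis using False by (simp add: Nq dvd_diff_right_iff)
			next
				case xq: False
				have cop: "coprime (h ^ (?n - 1)) (int q)" using h(1) by simp
				have "coefmat q (\<lambda>k. of_bool (k = 1)) x y = (t * h ^ (?n - 1)) mod int q \<longleftrightarrow> N dvd x - t"
					if y: "N dvd y - h" for y
				proof -
					have yh: "[y = h] (mod int q)" using y by (simp add: cong_iff_dvd_diff Nq)
					then have "\<not> int q dvd y" using hq cong_dvd_iff by blast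
					then have "coefmat q (\<lambda>k. of_bool (k = 1)) x y = (t * h ^ (?n - 1)) mod int q
							\<longleftrightarrow> [x * y ^ (?n - 1) = t * h ^ (?n - 1)] (mod int q)" unfolding cong_def by (subst val[OF xq]) auto
					also have "... \<longleftrightarrow> [x * h ^ (?n - 1) = t * h ^ (?n - 1)] (mod int q)"
						using cong_mult[OF cong_refl[of x] cong_pow[OF yh, of "?n - 1"]] by (meson cong_sym cong_trans)
					also have "... \<longleftrightarrow> [x = t] (mod int q)" using cong_mult_rcancel[OF cop] by blast
					finally show ?thesis by (simp add: cong_iff_dvd_diff Nq)
				qed
				moreover have "N dvd h - h" by simp
				ultimately show ?thesis using xq Nq by blast
			qed
			then have "{x. \<exists>y\<in>?E. coefmat q (\<lambda>k. of_bool (k = 1)) x y = (t * h ^ (?n - 1)) mod int q} - {x. N dvd x}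
					= {x. N dvd x - t}" by (intro Set.set_eqI) (simp only: mem_Collect_eq)
			ultimately show ?thesis by (simp only:)
		qed
	qed
qed

end

end

section \<open>Layers of prime index at one prime divisor\<close>

locale agcq = ctx + agq
begin

lemma K_near:
	assumes "a > 1" "x \<in> K" "x' \<in> K" "p dvd x' - x"
	shows "N dvd x' - x"
proof -
	obtain k where k: "k \<in> K" "N dvd x' - x * k" "\<forall>e. e dvd N --> e dvd x' - x --> e dvd k - 1" using K_ratio[OF assms(2,3)] .
	have "N dvd k - 1" using K_near_one[OF assms(1) k(1)] k(3) p_N assms(4) by blast
	then show ?thesis using k(2) by Groebner_Basis.algebra
qed

lemma agrp_Q1: "agrp Q" using agrp_Q[of 1] a by simp

lemma coprime_cases: "coprime z N \<longleftrightarrow> \<not> Q dvd z \<and> coprime z r"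
proof
	assume z: "coprime z N"
	then have "\<not> Q dvd z" using Q_N Q_prime by (metis coprime_common_divisor not_prime_unit)
	moreover have "coprime z r" using z r_N coprime_divisors dvd_refl by blast
	ultimately show "\<not> Q dvd z \<and> coprime z r" by blast
next
	assume "\<not> Q dvd z \<and> coprime z r"
	moreover from this have "coprime (Q ^ a) z" using prime_imp_coprime[OF Q_prime] by simp
	ultimately show "coprime z N" unfolding N_eq by (simp add: coprime_commute)
qed

lemma unit_near:
	assumes "\<not> Q dvd y"
	obtains z where "coprime z N" "Q dvd z - y" "r dvd z - 1"
proof -
	have "coprime y (Q ^ a)" using prime_imp_coprime[OF Q_prime assms] by (simp add: coprime_commute)
	then obtain z where z: "coprime z (Q ^ a * r)" "[z = y] (mod Q ^ a)" "[z = 1] (mod r)"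
		using crt_unit[OF cop, of y a 1] by auto
	have "Q dvd Q ^ a" using a by simp
	then have "Q dvd z - y" using z(2) dvd_trans by (auto simp: cong_iff_dvd_diff)
	then show thesis using that z by (simp add: N_eq cong_iff_dvd_diff)
qed

text \<open>A base point \<open>y\<close> in the subgroup of order \<open>q\<close> breaks the
  symmetry of \<open>K\<close>. If \<open>x\<close> and \<open>x - y\<close> are the multiples of
  \<open>z\<close> and \<open>z - y\<close> by elements of \<open>K\<close>, these multipliers agree
  by \<open>K_near\<close> and hence fix \<open>y\<close>; so they are 1 modulo \<open>q\<close>,
  and \<open>x\<close> is congruent to \<open>z\<close>.\<close>

lemma disc_bottom:
	assumes a1: "a > 1"
	shows "disc 1 Q"
proof -
	have "agrp p" using agrp_all[OF p_pos p_N] .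
	moreover have "agrp (p * int q ^ 1)" using agrp_N N_p by (simp add: mult.commute)
	ultimately obtain y where y: "p dvd y" "coprime (y div p) Q" "pt y" using base_pt[of p q 1] q by auto
	obtain y1 where y1: "y = p * y1" using y(1) by (auto elim: dvdE)
	have "coprime y1 Q" using y(2) p_pos by (simp add: y1)
	then have ny1: "\<not> Q dvd y1" using Q_prime by (metis coprime_common_divisor dvd_refl not_prime_unit)
	have Qp: "Q dvd p" using a1 by (simp add: p_def)
	have unit: "fib {x. Q dvd x - z}" if z: "coprime z N" for z
	proof -
		have "\<not> Q dvd z - y" using z coprime_cases Qp y(1) dvd_trans dvd_diff_left_iff by metis
		moreover have "[z = z - y] (mod r)" by (simp add: cong_iff_dvd_diff y1 p_def)
		then have "coprime (z - y) r" using z coprime_cases cong_imp_coprime by blast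
		ultimately have zy: "coprime (z - y) N" using coprime_cases by blast
		let ?S = "bs z \<inter> {x. x - y \<in> bs (z - y)}"
		have fS: "fib ?S" by (intro fib_Int fib_aset fib_shift y(3) aset_bs)
		have SQ: "Q dvd x - z" if x: "x \<in> ?S" for x
		proof -
			obtain k where k: "k \<in> K" "N dvd x - z * k" using bs_unit[OF z] x by blast
			obtain k' where k': "k' \<in> K" "N dvd (x - y) - (z - y) * k'" using bs_unit[OF zy] x by blast
			have "p dvd z * (k - k')" using k(2) k'(2) y(1) p_N by Groebner_Basis.algebra
			moreover have "coprime p z" using z p_N coprime_commute coprime_divisors dvd_refl by blast
			ultimately have "p dvd k - k'" using coprime_dvd_mult_right_iff by blast
			then have kk: "N dvd k - k'" using K_near[OF a1 k'(1) k(1)] by blast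
			have "N dvd (y1 * (1 - k')) * p" using kk k(2) k'(2) y1 by Groebner_Basis.algebra
			then have "Q dvd y1 * (1 - k')" using p_pos by (simp add: N_p)
			then have "Q dvd 1 - k'" using ny1 Q_prime by (simp add: prime_dvd_mult_iff)
			then show ?thesis using kk k(2) Q_N by Groebner_Basis.algebra
		qed
		show ?thesis by (rule fib_cosetI[OF fS _ SQ agrp_Q1]) (use bs_refl in blast)
	qed
	show ?thesis unfolding disc_def
	proof (intro allI impI)
		fix y :: int
		show "fib {x. Q dvd x - y}"
		proof (cases "Q dvd y")
			case True
			then show ?thesis using fib_agrp[OF agrp_Q1] by (simp add: dvd_diff_left_iff)
		next
			case False
			then obtain z where z: "coprime z N" "Q dvd z - y" using unit_near by blast
			have "Q dvd x - y \<longleftrightarrow> Q dvd x - z" for x by (rule dvd_iff_diff) (use z(2) in \<open>simp add: dvd_diff_commute\<close>)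
			then show ?thesis using unit[OF z(1)] by simp
		qed
	qed
qed

text \<open>It is proved for the projectively equivalent section between \<open>Q ^ i * r\<close>
  and \<open>Q ^ Suc i * r\<close>. If \<open>x\<close> in \<open>K\<close> is 1 modulo
  \<open>q\<close> and \<open>x - e\<close> is in the basic set of \<open>1 - e0\<close>, the
  multiplier belonging to \<open>x - e\<close> equals \<open>x\<close> by \<open>K_inj\<close>.
  Being 1 modulo \<open>q\<close>, it moves \<open>e0\<close> only inside its class.\<close>

lemma disc_upper:
	assumes a1: "a > 1" and q2: "q ~= 2" and i: "0 < i" "i < a"
	shows "disc (Q ^ i) (Q ^ Suc i)"
proof -
	let ?u = "Q ^ i * r" and ?v = "Q ^ Suc i * r"
	have "Q ^ i dvd Q ^ a" using i by (intro le_imp_power_dvd) simp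
	moreover have "Q ^ Suc i dvd Q ^ a" using i by (intro le_imp_power_dvd) simp
	ultimately have uN: "?u dvd N" and vN: "?v dvd N" unfolding N_eq by (auto intro!: mult_dvd_mono simp del: power_Suc)
	have pos: "?u > 0" "?v > 0" using Q_gt r_pos by auto
	have au: "agrp ?u" and av: "agrp ?v" using agrp_all pos uN vN by blast+
	have Qu: "Q dvd ?u" using i by simp
	have "disc ?u ?v" unfolding disc_def
	proof (intro allI impI)
		fix e0 assume e0: "?u dvd e0"
		have Qe0: "Q dvd e0" and re0: "r dvd e0" using e0 Qu dvd_trans dvd_mult_right by blast+
		have "\<not> Q dvd 1 - e0" using Qe0 Q_gt by (simp add: dvd_diff_left_iff)
		moreover have "[1 = 1 - e0] (mod r)" using re0 by (simp add: cong_iff_dvd_diff)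
		then have "coprime (1 - e0) r" using cong_imp_coprime by (metis coprime_1_left)
		ultimately have ue: "coprime (1 - e0) N" using coprime_cases by blast
		let ?X = "K \<inter> {x. Q dvd x - 1}"
		have fX: "fib ?X" using disc_bottom[OF a1] by (intro fib_Int[OF fib_aset[OF aset_bs]]) (auto simp: disc_def)
		let ?E = "{e. ?u dvd e} \<inter> {e. \<exists>x\<in>?X. x - e \<in> bs (1 - e0)}"
		have fE: "fib ?E" by (intro fib_Int fib_agrp au fib_path rel_aset aset_bs fX)
		have E1: "?v dvd e - e0" if eE: "e \<in> ?E" for e
		proof -
			obtain x where x: "x \<in> K" "Q dvd x - 1" "x - e \<in> bs (1 - e0)" "?u dvd e" using eE by blast
			obtain k where k: "k \<in> K" "N dvd (x - e) - (1 - e0) * k" using bs_unit[OF ue x(3)] .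
			have "?u dvd ((x - e) - (1 - e0) * k) + (e - e0 * k)"
				by (rule dvd_add[OF dvd_trans[OF uN k(2)] dvd_diff[OF x(4) dvd_mult2[OF e0]]])
			then have "?u dvd x - k" by (simp add: algebra_simps)
			then have xk': "r dvd x - k" "Q dvd x - k" using Qu dvd_trans dvd_mult_right by blast+
			have Nxk: "N dvd x - k" by (rule K_inj[OF k(1) x(1) xk']) (use q2 in auto)
			have "Q dvd k - 1" using x(2) xk'(2) by Groebner_Basis.algebra
			then have "?u * Q dvd e0 * (k - 1)" by (intro mult_dvd_mono e0)
			then have "?v dvd e0 * (k - 1)" by (simp add: ac_simps)
			moreover have "N dvd (e - e0) - e0 * (k - 1)" using Nxk k(2) by Groebner_Basis.algebra
			ultimately show ?thesis using vN dvd_trans dvd_iff_diff by meson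
		qed
		have e0E: "e0 \<in> ?E" using e0 one_K bs_refl[of "1 - e0"] by (auto intro!: bexI[of _ 1])
		show "fib {x. ?v dvd x - e0}" by (rule fib_cosetI[OF fE e0E E1 av])
	qed
	moreover have "?v = lcm ?u (Q ^ Suc i)"
	proof (rule zdvd_antisym_nonneg)
		have "Q ^ Suc i dvd lcm ?u (Q ^ Suc i)" "r dvd lcm ?u (Q ^ Suc i)" by (auto intro: dvd_trans[OF _ dvd_lcm1])
		then show "?v dvd lcm ?u (Q ^ Suc i)" using cop divides_mult by blast
		show "lcm ?u (Q ^ Suc i) dvd ?v" by (rule lcm_least) (auto intro: mult_dvd_mono)
	qed (use pos in auto)
	moreover have "Q ^ i = gcd ?u (Q ^ Suc i)"
	proof (rule zdvd_antisym_nonneg)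
		show "Q ^ i dvd gcd ?u (Q ^ Suc i)" by simp
		have "coprime (gcd ?u (Q ^ Suc i)) r" using cop[of "Suc i"] coprime_divisors[OF gcd_dvd2 dvd_refl] by blast
		moreover have "gcd ?u (Q ^ Suc i) dvd Q ^ i * r" by simp
		ultimately show "gcd ?u (Q ^ Suc i) dvd Q ^ i" using coprime_dvd_mult_left_iff by blast
	qed (use Q_gt in auto)
	ultimately show ?thesis using disc_transfer[of ?u "Q ^ Suc i" ?v "Q ^ i"] au agrp_Q[of "Suc i"] i by simp
qed

lemma r_N_lt: "a = 1 ==> r < N" using mult_strict_right_mono[OF Q_gt r_pos] by (simp add: N_eq)

text \<open>If \<open>K\<close> contains all units that are 1 modulo \<open>r\<close>, it consists
  of all units with the right residue modulo \<open>r\<close>. The idempotent \<open>w\<close>,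
  which is 0 modulo \<open>q\<close> and 1 modulo \<open>r\<close>, carries these residues into the
  subgroup \<open>Q\<close>, where they form the factor \<open>W\<close>.\<close>

lemma full_tens:
	assumes a1: "a = 1" and full: "\<And>m. coprime m N ==> r dvd m - 1 ==> m \<in> K"
	shows "\<exists>W. tens K r Q W"
proof -
	have Nr: "N = Q * r" using a1 by (simp add: N_eq)
	have ar: "agrp r" using agrp_all[OF r_pos r_N] .
	have NQ: "N dvd x \<longleftrightarrow> Q dvd x \<and> r dvd x" for x using dvd_N a1 by simp
	have "coprime Q r" using cop[of 1] by simp
	then obtain w where w: "[w = 0] (mod Q)" "[w = 1] (mod r)" using binary_chinese_remainder_int by blast
	then have wQ: "Q dvd w" and wr: "r dvd w - 1" by (auto simp: cong_iff_dvd_diff)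
	let ?W = "bs w"
	have WQ: "Q dvd b" if "b \<in> ?W" for b using bs_sub[OF agrp_aset[OF agrp_Q1], of w] wQ that by auto
	have full': "t \<in> K" if t: "k \<in> K" "coprime t N" "r dvd t - k" for k t
	proof -
		obtain k' where k': "k' \<in> K" "N dvd k * k' - 1" using K_inverse[OF t(1)] .
		have "r dvd t * k' - 1" using t(3) r_N k'(2) by Groebner_Basis.algebra
		then have "t * k' \<in> K" using full t(2) units[OF k'(1)] by simp
		then have "k * (t * k') \<in> K" using K_mult t(1) by blast
		moreover have "N dvd k * (t * k') - t" using k'(2) by Groebner_Basis.algebra
		ultimately show ?thesis using K_cong by blast
	qed
	have 1: "t \<in> K \<longleftrightarrow> (\<exists>b\<in>?W. r dvd t - b \<and> \<not> N dvd t - b)" for t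
	proof
		assume t: "t \<in> K"
		have "aset (msum ?W {x. r dvd x})" by (intro aset_msum aset_bs agrp_aset ar)
		moreover have "1 \<in> msum ?W {x. r dvd x}"
			using bs_refl[of w] wr by (auto simp: msum_def dvd_diff_commute intro!: bexI[of _ w])
		ultimately have "K \<subseteq> msum ?W {x. r dvd x}" by (rule bs_sub)
		then obtain b where b: "b \<in> ?W" "r dvd t - b" using t by (auto simp: msum_def)
		have "\<not> Q dvd t - b" using K_Q[OF t] WQ[OF b(1)] by (simp add: dvd_diff_left_iff)
		then show "\<exists>b\<in>?W. r dvd t - b \<and> \<not> N dvd t - b" using b NQ by blast
	next
		assume "\<exists>b\<in>?W. r dvd t - b \<and> \<not> N dvd t - b"
		then obtain b where b: "b \<in> ?W" "r dvd t - b" "\<not> N dvd t - b" by blast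
		have "aset (msum K {x. r dvd x})" by (intro aset_msum aset_bs agrp_aset ar)
		moreover have "w \<in> msum K {x. r dvd x}" using one_K wr by (auto simp: msum_def intro!: bexI[of _ 1])
		ultimately have "?W \<subseteq> msum K {x. r dvd x}" by (rule bs_sub)
		then obtain k where k: "k \<in> K" "r dvd b - k" using b(1) by (auto simp: msum_def)
		have tk: "r dvd t - k" using dvd_add[OF b(2) k(2)] by simp
		have "\<not> Q dvd t" using b NQ WQ by (metis dvd_diff_left_iff)
		moreover have "[k = t] (mod r)" using tk by (simp add: cong_iff_dvd_diff dvd_diff_commute)
		then have "coprime t r" using cong_imp_coprime units[OF k(1)] coprime_cases by blast
		ultimately show "t \<in> K" using full' k(1) tk coprime_cases by blast
	qed
	have 2: "y \<in> bs x" if x: "r dvd x" "\<not> N dvd x" and y: "r dvd y" "\<not> N dvd y" for x y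
	proof -
		have u: "w + z \<in> K" if z: "r dvd z" "\<not> N dvd z" for z
		proof (rule full)
			have "\<not> Q dvd z" using z NQ by blast
			then have "\<not> Q dvd w + z" using wQ by (simp add: dvd_add_right_iff)
			moreover have rz: "r dvd w + z - 1" using wr z(1) by Groebner_Basis.algebra
			then have "[1 = w + z] (mod r)" by (simp add: cong_iff_dvd_diff dvd_diff_commute)
			then have "coprime (w + z) r" using cong_imp_coprime coprime_1_left by blast
			ultimately show "coprime (w + z) N" using coprime_cases by blast
			show "r dvd w + z - 1" by (rule rz)
		qed
		have "aset (msum ?W (bs x))" by (intro aset_msum aset_bs)
		moreover have "w + x \<in> msum ?W (bs x)" using bs_refl by (auto simp: msum_def intro!: bexI[of _ w])
		ultimately have "bs (w + x) \<subseteq> msum ?W (bs x)" by (rule bs_sub)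
		moreover have "bs (w + x) = K" using u[OF x] bs_eq by blast
		ultimately obtain b where b: "b \<in> ?W" "w + y - b \<in> bs x" using u[OF y] by (auto simp: msum_def)
		have "r dvd w + y - b" using bs_sub[OF agrp_aset[OF ar], of x] x(1) b(2) by auto
		then have "r dvd w + y - b - y" using y(1) by (rule dvd_diff)
		moreover have "Q dvd w + y - b - y" using wQ WQ[OF b(1)] by simp
		ultimately have "N dvd (w + y - b) - y" using NQ by blast
		then show ?thesis using aset_cong[OF aset_bs] b(2) by blast
	qed
	have "tens K r Q ?W" unfolding tens_def using ar agrp_Q1 \<open>coprime Q r\<close> Nr r_N_lt[OF a1] wQ 1 2
		by (auto simp: coprime_commute mult.commute)
	then show ?thesis by blast
qed

text \<open>The local multipliers in \<open>K\<close> reduce to a proper subgroup \<open>D\<close>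
  of the units modulo \<open>q\<close>. For points \<open>x1\<close>, \<open>y1\<close> of the
  subgroup of order \<open>q\<close>, the algebra determines the ratio of \<open>y1 - x1\<close> to
  \<open>y1\<close> up to \<open>D\<close>, hence its \<open>d\<close>-th power; this is the input
  of \<open>prime_scaling\<close> in that section.\<close>

lemma disc_nonfull:
	assumes a1: "a = 1" and m: "coprime m N" "r dvd m - 1" "m \<notin> K"
	shows "disc 1 Q"
proof -
	have Nr: "N = Q * r" using a1 by (simp add: N_eq)
	have ar: "agrp r" using agrp_all[OF r_pos r_N] .
	have NQ: "N dvd x \<longleftrightarrow> Q dvd x \<and> r dvd x" for x using dvd_N a1 by simp
	define D where "D = {k \<in> {1..<Q}. \<exists>x\<in>K. r dvd x - 1 \<and> Q dvd x - k}"
	have Dsub: "D \<subseteq> {1..<Q}" by (auto simp: D_def)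
	have memD: "x mod Q \<in> D" if x: "x \<in> K" "r dvd x - 1" for x
	proof -
		have "x mod Q ~= 0" using K_Q[OF x(1)] by (simp add: dvd_eq_mod_eq_0)
		moreover have "0 \<le> x mod Q" "x mod Q < Q" using Q_gt by simp_all
		moreover have "Q dvd x - x mod Q" by (simp add: mod_eq_dvd_iff[symmetric])
		ultimately show ?thesis using x by (auto simp: D_def)
	qed
	have Dmult: "k * h mod Q \<in> D" if "k \<in> D" "h \<in> D" for k h
	proof -
		from that(1) obtain x where x: "x \<in> K" "r dvd x - 1" "Q dvd x - k" unfolding D_def by blast
		from that(2) obtain y where y: "y \<in> K" "r dvd y - 1" "Q dvd y - h" unfolding D_def by blast
		have "r dvd x * y - 1" using x(2) y(2) by Groebner_Basis.algebra
		then have "(x * y) mod Q \<in> D" using memD K_mult x(1) y(1) by blast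
		moreover have "[x * y = k * h] (mod Q)" using x(3) y(3) by (intro cong_mult) (auto simp: cong_iff_dvd_diff)
		ultimately show ?thesis by (simp add: cong_def)
	qed
	define d where "d = card D"
	have pw: "[x ^ d = 1] (mod Q)" if x: "x \<in> K" "r dvd x - 1" for x
	proof -
		have "[(x mod Q) ^ d = 1] (mod Q)" unfolding d_def by (rule subgroup_power[OF q Dsub Dmult memD[OF x]])
		moreover have "[x ^ d = (x mod Q) ^ d] (mod Q)" by (intro cong_pow) (simp add: cong_def)
		ultimately show ?thesis using cong_trans by blast
	qed
	have "1 mod Q \<in> D" using memD[OF one_K] by simp
	moreover have "finite D" using Dsub finite_subset by blast
	ultimately have d0: "d > 0" by (auto simp: d_def card_gt_0_iff)
	have d2: "2 * d \<le> q - 1" unfolding d_def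
	proof (rule proper_subgroup_card[OF q Dsub])
		show nm: "\<not> Q dvd m" using m(1) coprime_cases by blast
		fix h assume "h \<in> D"
		then obtain x where x: "x \<in> K" "r dvd x - 1" "Q dvd x - h" unfolding D_def by blast
		show "m * h mod Q \<notin> D"
		proof
			assume "m * h mod Q \<in> D"
			then obtain y where y: "y \<in> K" "r dvd y - 1" "Q dvd y - m * h mod Q" unfolding D_def by blast
			have "Q dvd (m * h mod Q) - m * h" by (simp add: mod_eq_dvd_iff[symmetric])
			then have "Q dvd y - m * x" using y(3) x(3) by Groebner_Basis.algebra
			moreover have "r dvd y - m * x" using y(2) m(2) x(2) by Groebner_Basis.algebra
			ultimately have d: "N dvd y - m * x" using NQ by blast
			obtain x' where x': "x' \<in> K" "N dvd x * x' - 1" using K_inverse[OF x(1)] .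
			have "N dvd y * x' - m" using d x'(2) by Groebner_Basis.algebra
			then show False using K_mult[OF y(1) x'(1)] K_cong m(3) by blast
		qed
	qed
	let ?R = "\<lambda>c x1 y1. r dvd x1 \<and> r dvd y1 \<and> \<not> Q dvd x1 \<and> \<not> Q dvd y1 \<and> [(y1 - x1) ^ d = c * y1 ^ d] (mod Q)"
	have relR: "rel (?R c)" for c
	proof (rule rel_cover)
		fix x x' y y' assume d: "N dvd x - x'" "N dvd y - y'" and R: "?R c x y"
		have dQ: "Q dvd x - x'" "Q dvd y - y'" and dr: "r dvd x - x'" "r dvd y - y'" using d NQ by blast+
		have "[x = x'] (mod Q)" "[y = y'] (mod Q)" using dQ by (auto simp: cong_iff_dvd_diff)
		then have "[(y - x) ^ d = (y' - x') ^ d] (mod Q)" "[c * y ^ d = c * y' ^ d] (mod Q)"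
			by (auto intro!: cong_pow cong_diff cong_mult)
		then show "?R c x' y'" using R dvd_iff_diff[OF dQ(1)] dvd_iff_diff[OF dQ(2)] dvd_iff_diff[OF dr(1)] dvd_iff_diff[OF dr(2)]
			by (meson cong_sym cong_trans)
	next
		fix x0 y0 assume R0: "?R c x0 y0"
		have base_rel: "rel (\<lambda>x1 y1. (r dvd x1 \<and> \<not> Q dvd x1) \<and> (r dvd y1 \<and> \<not> Q dvd y1))"
		proof -
			have "fib ({x. r dvd x} - {x. Q dvd x})" by (intro fib_Diff fib_agrp ar agrp_Q1)
			then show ?thesis
				using rel_and[OF _ rel_fib2, of "\<lambda>x y. x \<in> {x. r dvd x} - {x. Q dvd x}" "{x. r dvd x} - {x. Q dvd x}"]
				by (simp add: fib_def)
		qed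
		show "\<exists>R'. rel R' \<and> R' x0 y0 \<and> (\<forall>x y. R' x y --> ?R c x y)"
		proof (cases "Q dvd y0 - x0")
			case True
			let ?R' = "\<lambda>x1 y1. ((r dvd x1 \<and> \<not> Q dvd x1) \<and> (r dvd y1 \<and> \<not> Q dvd y1)) \<and> y1 - x1 \<in> {x. Q dvd x}"
			have "[(y0 - x0) ^ d = 0] (mod Q)" using True d0 by (metis cong_0_iff dvd_power_same prime_dvd_power_iff[OF Q_prime])
			then have "Q dvd c * y0 ^ d" using R0 by (metis cong_0_iff cong_sym cong_trans)
			then have Qc: "Q dvd c" using R0 Q_prime prime_dvd_power by (metis prime_dvd_mult_iff)
			have "rel ?R'" by (intro rel_and base_rel rel_aset agrp_aset agrp_Q1)
			moreover have "?R' x0 y0" using R0 True by simp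
			moreover have "?R c x y" if r': "?R' x y" for x y
			proof -
				have "Q dvd (y - x) ^ d" using r' d0 prime_dvd_power_iff[OF Q_prime] by simp
				moreover have "Q dvd c * y ^ d" using Qc by simp
				ultimately have "[(y - x) ^ d = c * y ^ d] (mod Q)" by (metis cong_0_iff cong_sym cong_trans)
				then show ?thesis using r' by blast
			qed
			ultimately show ?thesis by blast
		next
			case False
			\<comment> \<open>A unit that agrees with \<open>y0\<close> modulo \<open>q\<close>. Then
			  \<open>z0\<close> and \<open>z0 - x0\<close> are both units, and their basic sets carry the
			  information on \<open>y0\<close> and \<open>y0 - x0\<close>.\<close>
			obtain z0 where z0: "coprime z0 N" "Q dvd z0 - y0" "r dvd z0 - 1" using unit_near R0 by blast
			have zx: "coprime (z0 - x0) N"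
			proof -
				have "Q dvd z0 - x0 ==> Q dvd y0 - x0" using z0(2) by Groebner_Basis.algebra
				then have "\<not> Q dvd z0 - x0" using False by blast
				moreover have "r dvd x0" using R0 by blast
				then have "r dvd 1 - (z0 - x0)" using z0(3) by Groebner_Basis.algebra
				then have "[1 = z0 - x0] (mod r)" by (simp add: cong_iff_dvd_diff)
				then have "coprime (z0 - x0) r" using cong_imp_coprime coprime_1_left by blast
				ultimately show ?thesis using coprime_cases by blast
			qed
			let ?P = "\<lambda>x1 y1. \<exists>z. (z - x1 \<in> bs (z0 - x0) \<and> z \<in> bs z0) \<and> y1 - z \<in> {x. Q dvd x}"
			let ?R' = "\<lambda>x1 y1. ((r dvd x1 \<and> \<not> Q dvd x1) \<and> (r dvd y1 \<and> \<not> Q dvd y1)) \<and> ?P x1 y1"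
			have "rel ?R'" by (intro rel_and[OF base_rel] rel_path rel_and rel_aset rel_fib2 fib_aset aset_bs agrp_aset agrp_Q1)
			moreover have "?P x0 y0" using bs_refl z0(2) by (auto simp: dvd_diff_commute intro!: exI[of _ z0])
			then have "?R' x0 y0" using R0 by blast
			moreover have "?R c x1 y1" if r': "?R' x1 y1" for x1 y1
			proof -
				obtain z where z: "z - x1 \<in> bs (z0 - x0)" "z \<in> bs z0" "Q dvd y1 - z" using r' by blast
				obtain k where k: "k \<in> K" "N dvd z - z0 * k" using bs_unit[OF z0(1) z(2)] .
				obtain k' where k': "k' \<in> K" "N dvd (z - x1) - (z0 - x0) * k'" using bs_unit[OF zx z(1)] .
				have "r dvd x1" "r dvd x0" using r' R0 by auto
				then have "r dvd k - k'" using k(2) k'(2) z0(3) r_N by Groebner_Basis.algebra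
				\<comment> \<open>The two multipliers agree modulo \<open>r\<close>, so their quotient is a
				  local multiplier, whose \<open>d\<close>-th power is 1 modulo \<open>q\<close>.\<close>
				obtain \<delta> where \<delta>: "\<delta> \<in> K" "N dvd k - k' * \<delta>" "\<forall>e. e dvd N --> e dvd k - k' --> e dvd \<delta> - 1"
					using K_ratio[OF k'(1) k(1)] .
				have "r dvd \<delta> - 1" using \<delta>(3) r_N \<open>r dvd k - k'\<close> by blast
				then have p1: "[\<delta> ^ d = 1] (mod Q)" using pw \<delta>(1) by blast
				have "Q dvd k - k' * \<delta>" using \<delta>(2) Q_N by Groebner_Basis.algebra
				then have kk: "[k = k' * \<delta>] (mod Q)" by (simp add: cong_iff_dvd_diff)
				have "Q dvd y1 - y0 * k" using k(2) z0(2) z(3) Q_N by Groebner_Basis.algebra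
				then have y1: "[y1 = y0 * k] (mod Q)" by (simp add: cong_iff_dvd_diff)
				have "Q dvd (y1 - x1) - (y0 - x0) * k'" using k'(2) z0(2) z(3) Q_N by Groebner_Basis.algebra
				then have yx: "[y1 - x1 = (y0 - x0) * k'] (mod Q)" by (simp add: cong_iff_dvd_diff)
				have "[k ^ d = (k' * \<delta>) ^ d] (mod Q)" using kk by (rule cong_pow)
				moreover have "[(k' * \<delta>) ^ d = k' ^ d * 1] (mod Q)" unfolding power_mult_distrib by (intro cong_mult cong_refl p1)
				ultimately have kd: "[k' ^ d = k ^ d] (mod Q)" by (metis cong_sym cong_trans mult_1_right)
				have "[(y1 - x1) ^ d = ((y0 - x0) * k') ^ d] (mod Q)" using yx by (rule cong_pow)
				moreover have "[((y0 - x0) * k') ^ d = (c * y0 ^ d) * k ^ d] (mod Q)"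
					unfolding power_mult_distrib by (intro cong_mult kd) (use R0 in blast)
				moreover have "(c * y0 ^ d) * k ^ d = c * (y0 * k) ^ d" by (simp add: power_mult_distrib mult.assoc)
				moreover have "[c * (y0 * k) ^ d = c * y1 ^ d] (mod Q)" using y1 by (intro cong_mult cong_pow cong_refl) (rule cong_sym)
				ultimately have "[(y1 - x1) ^ d = c * y1 ^ d] (mod Q)" by (metis cong_trans)
				then show ?thesis using r' by blast
			qed
			ultimately show ?thesis by blast
		qed
	qed
	interpret S: ctx_section N I J r N by unfold_locales (use ar agrp_N r_N in auto)
	have M: "N div r = int q" using Nr r_pos by simp
	have rQ: "\<not> Q dvd r" by (rule r)
	have "S.QC.rel (\<lambda>x y. \<not> int q dvd x \<and> \<not> int q dvd y \<and> [(y - x) ^ d = c * y ^ d] (mod int q))" for c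
	proof -
		have "(\<lambda>x y. of_bool (?R c (r * x) (r * y))) \<in> secJ r N"
			by (rule S.secJ_I[OF relR[unfolded rel_def]]) (simp add: rel_cong[OF relR])
		moreover have "?R c (r * x) (r * y) \<longleftrightarrow> \<not> int q dvd x \<and> \<not> int q dvd y \<and> [(y - x) ^ d = c * y ^ d] (mod int q)" for x y
		proof -
			have "coprime (r ^ d) Q" using prime_imp_coprime[OF Q_prime rQ] by (simp add: coprime_commute)
			have "[(r * y - r * x) ^ d = c * (r * y) ^ d] (mod Q) \<longleftrightarrow> [r ^ d * (y - x) ^ d = r ^ d * (c * y ^ d)] (mod Q)"
				by (simp add: right_diff_distrib[symmetric] power_mult_distrib mult.left_commute)
			also have "... \<longleftrightarrow> [(y - x) ^ d = c * y ^ d] (mod Q)" by (rule cong_mult_lcancel) fact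
			finally show ?thesis using rQ Q_prime by (simp add: prime_dvd_mult_iff)
		qed
		ultimately show ?thesis unfolding S.QC.rel_def by simp
	qed
	then have "S.QC.disc 1 (N div r)" using S.QC.prime_scaling[OF q M d0 d2] by blast
	then have "disc (r * 1) (r * (N div r))" by (rule S.sec_disc) simp
	then have "disc r N" using r_N by simp
	moreover have "N = lcm r Q" using cop[of 1] Nr N_pos r_pos Q_gt
		by (simp add: lcm_coprime coprime_commute abs_mult mult.commute)
	moreover have "1 = gcd r Q" using cop[of 1] by (simp add: coprime_iff_gcd_eq_1 gcd.commute)
	ultimately show ?thesis using disc_transfer[of r Q N 1] ar agrp_Q1 by blast
qed

text \<open>For \<open>q = 2\<close> every layer has order 2 and \<open>disc_small\<close> applies,
  which is why \<open>disc_upper\<close> can leave this prime out.\<close>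

lemma layers:
	assumes "i < a"
	shows "disc (Q ^ i) (Q ^ Suc i) \<or> a = 1 \<and> (\<exists>W. tens K r Q W)"
proof (cases "q = 2")
	case True
	have "agrp (Q ^ i)" using agrp_Q[of i] assms by simp
	moreover have "agrp (Q ^ Suc i)" by (rule agrp_Q) (use assms in simp)
	ultimately show ?thesis using disc_small[of "Q ^ i" "Q ^ Suc i" Q] True by (simp add: mult.commute)
next
	case q2: False
	show ?thesis
	proof (cases "a = 1")
		case True
		then have "i = 0" using assms by simp
		then show ?thesis using full_tens[OF True] disc_nonfull[OF True] True by (metis power_0 power_one_right One_nat_def)
	next
		case False
		then have a1: "a > 1" using a by simp
		show ?thesis
		proof (cases "i = 0")
			case True
			then show ?thesis using disc_bottom[OF a1] by simp
		next
			case False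
			then show ?thesis using disc_upper[OF a1 q2] assms by blast
		qed
	qed
qed

end

section \<open>From the prime layers to the whole group\<close>

locale agc = ctx + ag
begin

text \<open>The subgroups separate the even classes, and a base point for the section of order 4
  separates the two odd ones.\<close>

lemma disc_four: "4 dvd N ==> disc 1 4"
proof -
	assume N4: "4 dvd N"
	then have "2 dvd N" by (rule dvd_trans[rotated]) simp
	then have a2: "agrp 2" and a4: "agrp 4" using agrp_all N4 by auto
	have "agrp (1 * int 2 ^ 2)" using a4 by simp
	from base_pt[OF agrp_1 this] obtain h where h: "coprime h 2" "pt h" by auto
	then have odd_h: "odd h" by simp
	have fh: "fib {x. 4 dvd x - h}" by (rule fib_coset[OF h(2) a4])
	show ?thesis unfolding disc_def
	proof (intro allI impI)
		fix y :: int
		consider "4 dvd y" | "even y" "\<not> 4 dvd y" | "4 dvd y - h" | "odd y" "\<not> 4 dvd y - h" by blast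
		then show "fib {x. 4 dvd x - y}"
		proof cases
			case 1
			then show ?thesis using fib_agrp[OF a4] by (simp add: dvd_diff_left_iff)
		next
			case 2
			then have "4 dvd x - y \<longleftrightarrow> 2 dvd x \<and> \<not> 4 dvd x" for x by presburger
			then show ?thesis using fib_Diff[OF fib_agrp[OF a2] fib_agrp[OF a4]] by (simp add: set_diff_eq)
		next
			case 3
			then have "4 dvd x - y \<longleftrightarrow> 4 dvd x - h" for x by presburger
			then show ?thesis using fh by simp
		next
			case 4
			then have "4 dvd x - y \<longleftrightarrow> x \<notin> {x. 2 dvd x} \<and> \<not> 4 dvd x - h" for x using odd_h by simp presburger
			then have "{x. 4 dvd x - y} = UNIV - {x. 2 dvd x} - {x. 4 dvd x - h}" by auto
			then show ?thesis using fib_Diff[OF fib_Diff[OF fib_aset[OF aset_UNIV] fib_agrp[OF a2]] fh] by simp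
		qed
	qed
qed

text \<open>At each prime other than \<open>l\<close> that divides \<open>N\<close>, the geometric
  sum is congruent to \<open>l\<close> and so invertible; this settles the part of \<open>N\<close>
  prime to \<open>l\<close>, and \<open>K_local\<close> does the rest.\<close>

lemma K_radical_power:
	assumes k: "k \<in> K" "\<And>q. prime q ==> int q dvd N ==> int q dvd k - 1" "4 dvd N ==> 4 dvd k - 1"
		and l: "prime l" "N dvd k ^ l - 1"
	shows "N dvd k - 1"
proof -
	let ?S = "\<Sum>i<l. k ^ i"
	have step: "r dvd k - 1" if r: "r dvd N" "r > 0" "\<not> int l dvd r" for r
	proof -
		have "coprime r ?S"
		proof (rule ccontr)
			assume "\<not> coprime r ?S"
			then have "gcd r ?S ~= 1" by (simp add: coprime_iff_gcd_eq_1)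
			moreover have "gcd r ?S > 0" using r by simp
			ultimately have "gcd r ?S > 1" by linarith
			then obtain q where q: "prime q" "int q dvd gcd r ?S" using prime_divisor_int by blast
			then have qr: "int q dvd r" "int q dvd ?S" by auto
			then have "[k = 1] (mod int q)" using k(2)[OF q(1)] r(1) dvd_trans by (auto simp: cong_iff_dvd_diff)
			then have "[k ^ i = 1 ^ i] (mod int q)" for i by (rule cong_pow)
			then have "[?S = (\<Sum>i<l. 1)] (mod int q)" by (intro cong_sum) simp
			then have "int q dvd int l" using qr(2) cong_dvd_iff by fastforce
			then have "q = l" using q(1) l(1) by (simp add: primes_dvd_imp_eq)
			then show False using qr(1) r(3) by simp
		qed
		moreover have "r dvd (k - 1) * ?S" using dvd_trans[OF r(1) l(2)] by (simp add: power_diff_1_eq)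
		ultimately show ?thesis using coprime_dvd_mult_left_iff by blast
	qed
	show ?thesis
	proof (cases "int l dvd N")
		case False
		then show ?thesis using step[of N] N_pos by simp
	next
		case True
		obtain a r where ar: "a > 0" "N = int l ^ a * r" "\<not> int l dvd r" "r > 0"
			using prime_power_split[OF N_pos l(1) True] by metis
		interpret agq N I l a r by unfold_locales (use l ar in auto)
		have "r dvd k - 1" by (rule step) (use ar r_N in auto)
		moreover have "int l dvd k - 1" using k(2) l(1) True by blast
		ultimately have loc: "(l = 2 ==> 4 dvd k - 1) ==> N dvd k - 1" by (rule K_local[OF k(1)])
		show ?thesis
		proof (cases "l = 2 \<and> a = 1")
			case True
			then show ?thesis using \<open>r dvd k - 1\<close> \<open>int l dvd k - 1\<close> dvd_N by simp
		next
			case False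
			have "4 dvd N" if "l = 2"
			proof -
				have "int l ^ 2 dvd int l ^ a" using False that ar(1) by (intro le_imp_power_dvd) simp
				then show ?thesis using that by (simp add: ar(2))
			qed
			then show ?thesis using loc k(3) by blast
		qed
	qed
qed

text \<open>\<open>k\<close> has finite order modulo \<open>N\<close>, and prime factors of an
  exponent \<open>n\<close> with \<open>k ^ n = 1\<close> are removed one at a time.\<close>

lemma K_radical:
	assumes k: "k \<in> K" "\<And>q. prime q ==> int q dvd N ==> int q dvd k - 1" "4 dvd N ==> 4 dvd k - 1"
	shows "N dvd k - 1"
proof -
	have main: "n > 0 ==> N dvd k ^ n - 1 ==> N dvd k - 1" for n
	proof (induction n rule: less_induct)
		case (less n)
		show ?case
		proof (cases "n = 1")
			case True
			then show ?thesis using less.prems by simp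
		next
			case False
			then obtain l where l: "prime l" "l dvd n" using prime_factor_nat by blast
			then obtain j where j: "n = l * j" by (auto elim: dvdE)
			have j0: "j > 0" using less.prems(1) j by simp
			have jn: "j < n" using j j0 prime_gt_1_nat[OF l(1)] by simp
			have cong: "e dvd k ^ j - 1" if "e dvd k - 1" for e
			proof -
				have "[k ^ j = 1 ^ j] (mod e)" using that by (intro cong_pow) (simp add: cong_iff_dvd_diff)
				then show ?thesis by (simp add: cong_iff_dvd_diff)
			qed
			have "N dvd k ^ j - 1"
			proof (rule K_radical_power[OF K_pow[OF k(1)] _ _ l(1)])
				show "N dvd (k ^ j) ^ l - 1" using less.prems(2) by (simp add: j power_mult[symmetric] mult.commute)
			qed (use cong k in blast)+
			then show ?thesis using less.IH[OF jn j0] by blast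
		qed
	qed
	let ?f = "\<lambda>n. k ^ n mod N"
	have "finite (range ?f)" by (rule finite_subset[of _ "{0..<N}"]) (use N_pos in auto)
	then have "\<not> inj ?f" using finite_imageD infinite_UNIV_nat by blast
	then obtain m' n' where mn': "?f m' = ?f n'" "m' ~= n'" unfolding inj_def by blast
	define m n where "m = min m' n'" and "n = max m' n'"
	have mn: "?f m = ?f n" "m < n" using mn' by (auto simp: m_def n_def min_def max_def)
	have "N dvd k ^ n - k ^ m" using mn(1) by (metis mod_eq_dvd_iff)
	moreover have "k ^ n - k ^ m = k ^ m * (k ^ (n - m) - 1)"
		using mn(2) by (simp add: right_diff_distrib power_add[symmetric])
	moreover have "coprime N (k ^ m)" using units[OF k(1)] by (simp add: coprime_commute)
	ultimately have "N dvd k ^ (n - m) - 1" by (metis coprime_dvd_mult_right_iff)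
	then show ?thesis using main[of "n - m"] mn(2) by simp
qed

text \<open>If \<open>h\<close> is fixed, so is \<open>h + 1\<close>: it is the only
  \<open>x\<close> with \<open>x - h\<close> in \<open>K\<close> and the right residues modulo all
  prime divisors, and modulo 4 if 4 divides \<open>N\<close>. Starting from 0, this reaches every
  point.\<close>

lemma disc_from_primes:
	assumes d: "\<And>q. prime q ==> int q dvd N ==> disc 1 (int q)"
	shows "disc 1 N"
proof -
	define Ps where "Ps = {q. prime q \<and> int q dvd N}"
	have finP: "finite Ps"
	proof (rule finite_subset)
		have "q \<le> nat N" if "int q dvd N" for q using zdvd_imp_le[OF that N_pos] by linarith
		then show "Ps \<subseteq> {..nat N}" by (auto simp: Ps_def)
	qed simp
	have primes: "fib {x. \<forall>q\<in>Ps. int q dvd x - y}" for y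
	proof -
		have "finite F ==> F \<subseteq> Ps ==> fib {x. \<forall>q\<in>F. int q dvd x - y}" for F
		proof (induction F rule: finite_induct)
			case empty
			then show ?case using fib_aset[OF aset_UNIV] by simp
		next
			case (insert q F)
			have "fib {x. int q dvd x - y}" using d[of q] insert.prems by (simp add: Ps_def disc_def)
			then have "fib ({x. int q dvd x - y} \<inter> {x. \<forall>q\<in>F. int q dvd x - y})" using insert by (intro fib_Int) auto
			moreover have "{x. int q dvd x - y} \<inter> {x. \<forall>q\<in>F. int q dvd x - y} = {x. \<forall>q\<in>insert q F. int q dvd x - y}" by auto
			ultimately show ?case by simp
		qed
		then show ?thesis using finP by blast
	qed
	have four: "fib {x. 4 dvd N --> 4 dvd x - y}" for y
		using disc_four fib_aset[OF aset_UNIV] by (cases "4 dvd N") (auto simp: disc_def)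
	have next_pt: "pt (h + 1)" if h: "pt h" for h
	proof -
		have "fib ({x. x - h \<in> K} \<inter> {x. \<forall>q\<in>Ps. int q dvd x - (h + 1)} \<inter> {x. 4 dvd N --> 4 dvd x - (h + 1)})"
			by (intro fib_Int fib_shift h aset_bs primes four)
		moreover have "x \<in> {x. x - h \<in> K} \<inter> {x. \<forall>q\<in>Ps. int q dvd x - (h + 1)} \<inter> {x. 4 dvd N --> 4 dvd x - (h + 1)}
				\<longleftrightarrow> N dvd x - (h + 1)" for x
		proof
			assume "x \<in> {x. x - h \<in> K} \<inter> {x. \<forall>q\<in>Ps. int q dvd x - (h + 1)} \<inter> {x. 4 dvd N --> 4 dvd x - (h + 1)}"
			then have "N dvd (x - h) - 1" by (intro K_radical) (auto simp: Ps_def diff_diff_eq)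
			then show "N dvd x - (h + 1)" by (simp add: diff_diff_eq)
		next
			assume x: "N dvd x - (h + 1)"
			then have "N dvd (x - h) - 1" by (simp add: diff_diff_eq)
			then have "x - h \<in> K" using K_cong one_K by blast
			then show "x \<in> {x. x - h \<in> K} \<inter> {x. \<forall>q\<in>Ps. int q dvd x - (h + 1)} \<inter> {x. 4 dvd N --> 4 dvd x - (h + 1)}"
				using x dvd_trans by (auto simp: Ps_def)
		qed
		then have "{x. x - h \<in> K} \<inter> {x. \<forall>q\<in>Ps. int q dvd x - (h + 1)} \<inter> {x. 4 dvd N --> 4 dvd x - (h + 1)}
				= {x. N dvd x - (h + 1)}" by (intro Set.set_eqI) (simp only: mem_Collect_eq)
		ultimately show ?thesis by (simp only: pt_def)
	qed
	have "pt (int n)" for n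
	proof (induction n)
		case 0
		then show ?case using pt_0 by simp
	next
		case (Suc n)
		then show ?case using next_pt[OF Suc] by (simp add: add.commute)
	qed
	then have pts: "pt (y mod N)" for y using N_pos by (metis int_nat_eq pos_mod_sign)
	show ?thesis unfolding disc_def
	proof (intro allI impI)
		fix y
		have "N dvd x - y \<longleftrightarrow> N dvd x - y mod N" for x by (rule dvd_iff_diff) (simp add: mod_eq_dvd_iff[symmetric])
		then show "fib {x. N dvd x - y}" using pts[of y] by (simp add: pt_def)
	qed
qed

end

section \<open>Principal sections\<close>

context sring
begin

text \<open>If no member of the basic set shares a prime with \<open>N\<close>, then
  \<open>t\<close> is a unit, and division by it leads to the basic set of 1.\<close>

lemma principal_cases:
	assumes "principal t"
	shows "(\<exists>c v W. tens (bs t) c v W) \<or> coprime t N \<and> ag N I"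
proof (cases "\<exists>l x. prime l \<and> int l dvd N \<and> x \<in> bs t \<and> int l dvd x")
	case True
	then obtain l x where "prime l" "int l dvd N" "x \<in> bs t" "int l dvd x" by blast
	then have "\<exists>c v W. tens (bs t) c v W" using assms by (intro nonunit_basic_tens[of t l x]) (auto simp: principal_def)
	then show ?thesis by blast
next
	case False
	have units: "coprime x N" if "x \<in> bs t" for x
	proof (rule ccontr)
		assume "\<not> coprime x N"
		then have "gcd x N ~= 1" by (simp add: coprime_iff_gcd_eq_1)
		moreover have "gcd x N > 0" using N_pos by simp
		ultimately have "gcd x N > 1" by linarith
		then obtain q where "prime q" "int q dvd gcd x N" using prime_divisor_int by blast
		then show False using False that by auto
	qed
	have t: "coprime t N" by (rule units[OF bs_refl])
	obtain i where "[t * i = 1] (mod N)" using t cong_solve_coprime_int by blast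
	then have i: "N dvd t * i - 1" by (simp add: cong_iff_dvd_diff)
	have tb: "t * y \<in> bs t \<longleftrightarrow> y \<in> bs 1" for y using bs_mult[OF t, of y 1] by simp
	have "ag N I"
	proof
		show "coprime x N" if "x \<in> bs 1" for x using units[of "t * x"] that tb by simp
		fix e assume e: "e \<in> rad (bs 1)"
		have "t * e \<in> rad (bs t)" unfolding rad_def
		proof (intro CollectI ballI)
			fix x assume x: "x \<in> bs t"
			have d: "N dvd t * (i * x) - x" using i by Groebner_Basis.algebra
			then have "i * x \<in> bs 1" using aset_cong[OF aset_bs d] x tb by blast
			then have "i * x - e \<in> bs 1" using e by (simp add: rad_def)
			then have "t * (i * x - e) \<in> bs t" using tb by blast
			moreover have "N dvd t * (i * x - e) - (x - t * e)" using d by Groebner_Basis.algebra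
			ultimately show "x - t * e \<in> bs t" using aset_cong[OF aset_bs] by blast
		qed
		then have "N dvd t * e" using assms by (auto simp: principal_def)
		then show "N dvd e" using t coprime_dvd_mult_right_iff coprime_commute by blast
	qed
	then show ?thesis using t by blast
qed

lemma tens_triv: "tens T c v W ==> triv c N"
proof -
	assume t: "tens T c v W"
	have "\<exists>z\<in>bs x. N dvd y - z" if "c dvd x" "\<not> N dvd x" "c dvd y" "\<not> N dvd y" for x y
		using t that unfolding tens_def by (intro bexI[of _ y]) auto
	then show ?thesis by (simp add: triv_def)
qed

text \<open>Translation by an element of \<open>c\<close> changes only the
  \<open>c\<close>-component, and the result stays in \<open>T\<close> unless that component becomes
  zero.\<close>

lemma tens_swap:
	assumes t: "tens T c v W" and x: "x \<in> T" "c dvd w"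
	shows "x + w \<in> T \<or> v dvd x + w"
proof -
	obtain b where b: "b \<in> W" "c dvd x - b" using t x by (auto simp: tens_def)
	have cw: "c dvd (x + w) - b" using b(2) x(2) by Groebner_Basis.algebra
	have "v dvd b"
	proof -
		obtain w' where w': "v dvd w'" "W = bs w'" "agrp v" using t by (auto simp: tens_def)
		then show ?thesis using bs_sub[OF agrp_aset, of v w'] b(1) by auto
	qed
	moreover have "v dvd N" using t by (auto simp: tens_def)
	ultimately have "v dvd x + w" if "N dvd (x + w) - b" using that dvd_trans dvd_iff_diff by blast
	then show ?thesis using t b(1) cw by (auto simp: tens_def)
qed

text \<open>A common divisor or a radical of the factor \<open>W\<close> would be one of the product
  \<open>bs t\<close> as well.\<close>

lemma tens_section:
	assumes p: "principal t" and t: "tens (bs t) c v W"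
	shows "\<exists>w. W = bs (v * w) \<and> sring.principal (N div v) (secI v N) w"
proof -
	have v: "agrp v" "v dvd N" "v > 0" and c: "agrp c" "c * v = N" "N div v = c" using t by (auto simp: tens_def agrp_def)
	interpret S: sring_section N I v N by unfold_locales (use v agrp_N in auto)
	obtain w where w: "W = bs (v * w)" using t by (auto simp: tens_def elim!: dvdE)
	have bsw: "z \<in> S.Q.bs w \<longleftrightarrow> v * z \<in> W" for z
		unfolding S.sec_bs w using aset_cong[OF aset_bs] by (metis diff_self dvd_0_right)
	have Wv: "\<exists>b'. b = v * b'" if "b \<in> W" for b using bs_sub[OF agrp_aset[OF v(1)], of "v * w"] that w by (auto elim: dvdE)
	have iff: "x \<in> bs t \<longleftrightarrow> (\<exists>b\<in>W. c dvd x - b \<and> \<not> N dvd x - b)" for x using t by (simp add: tens_def)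
	have "S.Q.principal w" unfolding S.Q.principal_def
	proof (intro conjI allI impI ballI)
		fix e assume e: "e > 0" "e dvd S.M" "\<forall>x\<in>S.Q.bs w. e dvd x"
		have "e dvd x" if x: "x \<in> bs t" for x
		proof -
			obtain b where b: "b \<in> W" "c dvd x - b" using x iff by blast
			obtain b' where "b = v * b'" using Wv[OF b(1)] by blast
			then have "e dvd b" using e(3) bsw b(1) by auto
			moreover have "e dvd x - b" using b(2) e(2) c(3) dvd_trans by auto
			ultimately show ?thesis using dvd_iff_diff by blast
		qed
		moreover have "e dvd N" using e(2) c by auto
		ultimately show "e = 1" using p e(1) by (auto simp: principal_def)
	next
		fix e assume e: "e \<in> S.Q.rad (S.Q.bs w)"
		have "v * e \<in> rad (bs t)" unfolding rad_def
		proof (intro CollectI ballI)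
			fix x assume "x \<in> bs t"
			then obtain b where b: "b \<in> W" "c dvd x - b" "\<not> N dvd x - b" using iff by blast
			obtain b' where b': "b = v * b'" using Wv[OF b(1)] by blast
			then have "b' - e \<in> S.Q.bs w" using e b(1) bsw by (auto simp: S.Q.rad_def)
			then have "b - v * e \<in> W" unfolding bsw b' by (simp add: right_diff_distrib)
			then show "x - v * e \<in> bs t" using b by (subst iff) (auto intro!: bexI[of _ "b - v * e"])
		qed
		then have "N dvd v * e" using p by (auto simp: principal_def)
		then show "S.M dvd e" using c v by (metis dvd_mult_cancel_left mult.commute less_irrefl)
	qed
	then show ?thesis using w by blast
qed

end

lemma (in ctx_section) sec_disc':
	assumes "disc (u * d) (u * e)" "e dvd M" "agrp (u * e)"
	shows "QC.disc d e" unfolding QC.disc_def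
proof (intro allI impI)
	fix y assume "d dvd y"
	then have "fib {x. u * e dvd x - u * y}" using assms(1) by (auto simp: disc_def)
	then have "(\<lambda>x z. of_bool (u * e dvd x - u * y)) \<in> J" by (simp add: fib_def rel_def)
	moreover have "(of_bool (u * e dvd x - u * y) :: int) = of_bool (u * e dvd x' - u * y)" if "v dvd x - x'" for x x'
	proof -
		have "u * e dvd v" using assms(2) by (simp add: dvd_v)
		then have "u * e dvd (x - u * y) - (x' - u * y)" using that dvd_trans by auto
		from dvd_iff_diff[OF this] show ?thesis by simp
	qed
	ultimately have "(\<lambda>x z. of_bool (u * e dvd u * x - u * y)) \<in> secJ u v" by (intro secJ_I) blast+
	then show "QC.fib {x. e dvd x - y}" using u_pos by (simp add: QC.fib_def QC.rel_def right_diff_distrib[symmetric])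
qed

context ctx
begin

text \<open>A prime filter of the lattice of \<open>agrp\<close>-divisors that no discrete section separates.\<close>

definition pfilter :: "(int => bool) => bool" where
	"pfilter P \<longleftrightarrow> P 1 \<and> \<not> P N \<and> (\<forall>a b. agrp a --> agrp b -->
		 (P (lcm a b) \<longleftrightarrow> P a \<and> P b) \<and> (P (gcd a b) \<longleftrightarrow> P a \<or> P b) \<and>
		 (a dvd b --> P a --> \<not> P b --> \<not> disc a b))"

text \<open>The consequence of quasinormality on which the induction for principal sections
  rests.\<close>

definition GA :: bool where
	"GA \<longleftrightarrow> (\<forall>u v. agrp u --> agrp v --> u dvd v --> triv u v --> disc u v)"

end

context ctx_section
begin

lemma GA_section:
	assumes ga: "GA"
	shows "QC.GA" unfolding QC.GA_def
proof (intro allI impI)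
	fix d e assume de: "Q.agrp d" "Q.agrp e" "d dvd e" "Q.triv d e"
	then have e: "e dvd M" "agrp (u * d)" "agrp (u * e)" using sec_agrp by blast+
	have "disc (u * d) (u * e)" using ga[unfolded GA_def, rule_format, OF e(2,3) _ sec_triv[OF de(4,3) e(1)]] de(3) by simp
	then show "QC.disc d e" using sec_disc' e by blast
qed

lemma pfilter_section:
	assumes P: "pfilter P" and uv: "P u" "\<not> P v"
	shows "QC.pfilter (\<lambda>k. P (u * k))"
proof -
	have ag: "agrp (u * a)" if "Q.agrp a" for a using sec_agrp that by blast
	have lg: "u * lcm a b = lcm (u * a) (u * b)" "u * gcd a b = gcd (u * a) (u * b)" for a b
		using u_pos by (auto simp: lcm_mult_left gcd_mult_left abs_mult)
	show ?thesis unfolding QC.pfilter_def lg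
	proof (intro conjI allI impI)
		show "P (u * 1)" "\<not> P (u * M)" using uv uM by simp_all
		fix a b assume ab: "Q.agrp a" "Q.agrp b"
		show "P (lcm (u * a) (u * b)) \<longleftrightarrow> P (u * a) \<and> P (u * b)" "P (gcd (u * a) (u * b)) \<longleftrightarrow> P (u * a) \<or> P (u * b)"
			using P ag[OF ab(1)] ag[OF ab(2)] by (auto simp: pfilter_def)
		assume "a dvd b" "P (u * a)" "\<not> P (u * b)"
		then have "\<not> disc (u * a) (u * b)" using P ag[OF ab(1)] ag[OF ab(2)] by (auto simp: pfilter_def)
		then show "\<not> QC.disc a b" using sec_disc ab by (auto simp: Q.agrp_def)
	qed
qed

end

context ctx
begin

lemma disc_coprime:
	assumes "agrp c" "agrp v" "coprime c v" "c * v = N"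
	shows "disc c N \<longleftrightarrow> disc 1 v"
proof (rule disc_transfer)
	show "N = lcm c v" using assms N_pos by (simp add: lcm_coprime)
	show "1 = gcd c v" using assms(3) by (simp add: coprime_iff_gcd_eq_1)
qed (use assms in auto)

text \<open>Some prime power lies outside the filter, since lcm preserves membership. For the least
  such power of \<open>q\<close> the layer below it is not discrete, and \<open>layers\<close> then
  leaves only the product decomposition.\<close>

lemma pfilter_ag:
	assumes ag: "ag N I" and P: "pfilter P"
	shows "\<exists>c m W. agrp c \<and> agrp m \<and> P c \<and> \<not> P m \<and> tens (bs 1) c m W"
proof -
	interpret ag N I by fact
	have gl: "P (lcm a b) \<longleftrightarrow> P a \<and> P b" "P (gcd a b) \<longleftrightarrow> P a \<or> P b"
		"a dvd b ==> P a ==> \<not> P b ==> \<not> disc a b" if "agrp a" "agrp b" for a b using P that by (auto simp: pfilter_def)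
	have "\<exists>q j. prime q \<and> int q ^ j dvd d \<and> \<not> P (int q ^ j)" if "d > 0" "d dvd N" "\<not> P d" for d using that
	proof (induction "nat d" arbitrary: d rule: less_induct)
		case less
		have "d ~= 1" using less.prems P by (auto simp: pfilter_def)
		then have "d > 1" using less.prems by simp
		then obtain q where q: "prime q" "int q dvd d" using prime_divisor_int by blast
		obtain j m where jm: "j > 0" "d = int q ^ j * m" "\<not> int q dvd m" "m > 0" "m < d"
			using prime_power_split[OF less.prems(1) q] .
		have cop: "coprime (int q ^ j) m" using prime_imp_coprime[of "int q" m] q(1) jm(3) by simp
		have q0: "int q ^ j > 0" using prime_gt_0_nat[OF q(1)] by simp
		have "agrp (int q ^ j)" "agrp m" using agrp_all q0 jm less.prems(2) dvd_trans[of _ d N] by auto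
		moreover have "lcm (int q ^ j) m = d" using cop jm(2,4) q0 by (simp add: lcm_coprime abs_mult)
		ultimately have "\<not> P (int q ^ j) \<or> \<not> P m" using gl(1) less.prems(3) by metis
		then show ?case
		proof
			assume "\<not> P m"
			then obtain q' j' where "prime q'" "int q' ^ j' dvd m" "\<not> P (int q' ^ j')"
				using less.hyps[of m] jm less.prems dvd_trans[of m d N] by auto
			then show ?thesis using jm(2) by (metis dvd_mult)
		next
			assume "\<not> P (int q ^ j)"
			then show ?thesis using q(1) jm(2) dvd_triv_left by blast
		qed
	qed
	then obtain q j0 where q: "prime q" "int q ^ j0 dvd N" "\<not> P (int q ^ j0)"
		using P N_pos unfolding pfilter_def by (metis dvd_refl)
	define j where "j = (LEAST j. \<not> P (int q ^ j))"
	have j: "\<not> P (int q ^ j)" "j \<le> j0" unfolding j_def using q(3) LeastI[of "\<lambda>j. \<not> P (int q ^ j)"] by (auto intro: Least_le)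
	have j0': "j ~= 0" using j(1) P by (auto simp: pfilter_def intro: ccontr)
	then obtain i where i: "j = Suc i" by (cases j) auto
	have Pi: "P (int q ^ i)" using not_less_Least[of i "\<lambda>j. \<not> P (int q ^ j)"] i by (auto simp: j_def)
	have jN: "int q ^ j dvd N" using q(2) le_imp_power_dvd[OF j(2)] dvd_trans by blast
	then have "int q dvd N" using i dvd_mult_left by auto
	then obtain a r where ar: "a > 0" "N = int q ^ a * r" "\<not> int q dvd r" using prime_power_split[OF N_pos q(1)] by metis
	interpret agcq N I J q a r by unfold_locales (use q ar in auto)
	have "int q ^ j dvd int q ^ a" using jN ar(2) prime_imp_coprime[OF Q_prime r] by (simp add: coprime_dvd_mult_left_iff)
	then have "int q ^ j \<le> int q ^ a" using Q_gt by (intro zdvd_imp_le) auto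
	then have ia: "i < a" using Q_gt i power_le_imp_le_exp by (metis Suc_le_eq)
	have "\<not> disc (Q ^ i) (Q ^ Suc i)"
	proof (rule gl(3))
		show "agrp (Q ^ i)" "agrp (Q ^ Suc i)" using agrp_Q[of i] agrp_Q[of "Suc i"] ia by simp_all
	qed (use Pi j i in auto)
	then obtain W where W: "a = 1" "tens (bs 1) r Q W" using layers[OF ia] by blast
	then have "\<not> P Q" using ia i j(1) by simp
	moreover have c: "agrp r" "agrp Q" "gcd r Q = 1" using W(2) by (auto simp: tens_def)
	then have "P r" using gl(2)[OF c(1,2)] P \<open>\<not> P Q\<close> by (simp add: pfilter_def)
	ultimately show ?thesis using c W(2) by blast
qed

end

text \<open>Induction on the modulus. In a product of \<open>c\<close> and \<open>v\<close> exactly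
  one factor belongs to the filter, since the lcm \<open>N\<close> is outside and the gcd 1 inside.
  If it is \<open>c\<close>, \<open>tens_swap\<close> gives the claim; otherwise the filter
  restricts to the section between \<open>v\<close> and \<open>N\<close>, where \<open>W\<close> is
  principal.\<close>

lemma principal_filter:
	assumes "ctx N I J" "sring.principal N I t" "ctx.pfilter N I J P"
	shows "\<exists>c m. sring.agrp N I c \<and> sring.agrp N I m \<and> P c \<and> \<not> P m \<and>
		(\<forall>x\<in>sring.bs I t. \<forall>w. c dvd w --> x + w \<in> sring.bs I t \<or> m dvd x + w)" using assms
proof (induction "nat N" arbitrary: N I J t P rule: less_induct)
	case less
	interpret ctx N I J by fact
	note p = less.prems(2) and P = less.prems(3)
	have gl: "P (lcm a b) \<longleftrightarrow> P a \<and> P b" "P (gcd a b) \<longleftrightarrow> P a \<or> P b"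
		"a dvd b ==> P a ==> \<not> P b ==> \<not> disc a b" if "agrp a" "agrp b" for a b using P that by (auto simp: pfilter_def)
	consider (tens) c v W where "tens (bs t) c v W" | (ag) "coprime t N" "ag N I" using principal_cases[OF p] by blast
	then show ?case
	proof cases
		case tens
		then have cv: "agrp c" "agrp v" "coprime c v" "c * v = N" "c < N" by (auto simp: tens_def)
		then have "lcm c v = N" "gcd c v = 1" by (auto simp: lcm_coprime abs_mult agrp_def coprime_iff_gcd_eq_1)
		then have Pcv: "P c ~= P v" using gl(1,2)[OF cv(1,2)] P by (auto simp: pfilter_def)
		show ?thesis
		proof (cases "P c")
			case True
			then show ?thesis using Pcv cv tens_swap[OF tens] by blast
		next
			case False
			then have Pv: "P v" using Pcv by blast
			have v0: "v > 0" "c > 0" using cv by (auto simp: agrp_def)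
			have M: "N div v = c" using cv(4) v0 by auto
			interpret S: ctx_section N I J v N by unfold_locales (use cv agrp_N in auto)
			obtain w where w: "W = bs (v * w)" "S.Q.principal w" using tens_section[OF p tens] by blast
			have ag: "agrp (v * a)" if "S.Q.agrp a" for a using S.sec_agrp that by blast
			have "S.QC.pfilter (\<lambda>k. P (v * k))" using S.pfilter_section P Pv by (simp add: pfilter_def)
			then obtain c' m' where cm: "S.Q.agrp c'" "S.Q.agrp m'" "P (v * c')" "\<not> P (v * m')"
				"\<forall>x\<in>S.Q.bs w. \<forall>w'. c' dvd w' --> x + w' \<in> S.Q.bs w \<or> m' dvd x + w'"
				using less.hyps[OF _ S.QC.ctx_axioms w(2)] M cv(5) v0 by simp metis
			have bsw: "z \<in> S.Q.bs w \<longleftrightarrow> v * z \<in> W" for z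
				unfolding S.sec_bs w(1) using aset_cong[OF aset_bs] by (metis diff_self dvd_0_right)
			\<comment> \<open>If the \<open>W\<close>-component falls into \<open>m'\<close>, the sum falls
			  into the span of \<open>v * m'\<close> and \<open>c\<close>. Neither of these is in the filter,
			  hence neither is their gcd.\<close>
			have "x + y \<in> bs t \<or> gcd (v * m') c dvd x + y" if x: "x \<in> bs t" and y: "v * c' dvd y" for x y
			proof -
				obtain b where b: "b \<in> W" "c dvd x - b" "\<not> N dvd x - b" using x tens by (auto simp: tens_def)
				obtain b' where b': "b = v * b'" using bs_sub[OF agrp_aset[OF cv(2)], of "v * w"] b(1) w by (auto elim: dvdE)
				obtain y' where y': "y = v * y'" using y by (meson dvd_mult_left dvdE)
				have "c' dvd y'" using y v0 by (simp add: y')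
				moreover have "b' \<in> S.Q.bs w" using b(1) bsw b' by simp
				ultimately have "b' + y' \<in> S.Q.bs w \<or> m' dvd b' + y'" using cm(5) by blast
				then show ?thesis
				proof
					assume "b' + y' \<in> S.Q.bs w"
					then have "b + y \<in> W" using bsw by (simp add: b' y' distrib_left)
					then have "x + y \<in> bs t" using b tens by (auto simp: tens_def intro!: bexI[of _ "b + y"])
					then show ?thesis by blast
				next
					assume "m' dvd b' + y'"
					then have "v * m' dvd b + y" by (simp add: b' y' distrib_left[symmetric])
					then have "gcd (v * m') c dvd (b + y) + (x - b)"
						using b(2) by (intro dvd_add[of _ "b + y" "x - b"]) (meson gcd_dvd1 gcd_dvd2 dvd_trans)+
					then show ?thesis by (simp add: algebra_simps)
				qed
			qed
			moreover have "\<not> P (gcd (v * m') c)" using gl(2)[OF ag[OF cm(2)] cv(1)] cm(4) False by simp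
			ultimately show ?thesis using ag cm agrp_gcd[OF ag[OF cm(2)] cv(1)] by blast
		qed
	next
		case ag
		obtain c m W where cm: "agrp c" "agrp m" "P c" "\<not> P m" "tens (bs 1) c m W" using pfilter_ag[OF ag(2) P] by blast
		obtain i where "[t * i = 1] (mod N)" using ag(1) cong_solve_coprime_int by blast
		then have i: "N dvd t * i - 1" by (simp add: cong_iff_dvd_diff)
		have tb: "t * y \<in> bs t \<longleftrightarrow> y \<in> bs 1" for y using bs_mult[OF ag(1), of y 1] by simp
		have ti: "N dvd t * (i * x) - x" for x using i by Groebner_Basis.algebra
		have "x + w \<in> bs t \<or> m dvd x + w" if x: "x \<in> bs t" and w: "c dvd w" for x w
		proof -
			have "i * x \<in> bs 1" using aset_cong[OF aset_bs ti] x tb by blast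
			then have "i * x + i * w \<in> bs 1 \<or> m dvd i * x + i * w" using tens_swap[OF cm(5)] w by simp
			moreover have e: "N dvd t * (i * x + i * w) - (x + w)" using i by Groebner_Basis.algebra
			have "m dvd x + w" if "m dvd i * x + i * w"
			proof -
				have "m dvd N" using cm(2) by (simp add: agrp_def)
				then show ?thesis using that e by Groebner_Basis.algebra
			qed
			moreover have "x + w \<in> bs t" if "i * x + i * w \<in> bs 1" using that tb aset_cong[OF aset_bs e] by blast
			ultimately show ?thesis by blast
		qed
		then show ?thesis using cm by blast
	qed
qed

text \<open>In a product the factor \<open>c\<close> carries a trivial section, discrete by
  \<open>GA\<close>, and the section of \<open>W\<close> is discrete by induction; projective
  equivalence and lcm put the two together. Without a product, it remains to treat the layer between
  1 and \<open>q\<close> for each prime \<open>q\<close>.\<close>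

lemma principal_disc:
	assumes "ctx N I J" "sring.principal N I t" "ctx.GA N I J"
	shows "ctx.disc J 1 N" using assms
proof (induction "nat N" arbitrary: N I J t rule: less_induct)
	case less
	interpret ctx N I J by fact
	note p = less.prems(2) and ga = less.prems(3)[unfolded GA_def, rule_format]
	consider (tens) c v W where "tens (bs t) c v W" | (ag) "ag N I" using principal_cases[OF p] by blast
	then show ?case
	proof cases
		case tens
		then have cv: "agrp c" "agrp v" "coprime c v" "c * v = N" "c < N" by (auto simp: tens_def)
		have v0: "v > 0" "c > 0" using cv by (auto simp: agrp_def)
		have M: "N div v = c" using cv(4) v0 by auto
		have "disc c N" by (rule ga[OF cv(1) agrp_N _ tens_triv[OF tens]]) (use cv(4) in auto)
		then have 1: "disc 1 v" using disc_coprime[OF cv(1-4)] by blast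
		interpret S: ctx_section N I J v N by unfold_locales (use cv agrp_N in auto)
		obtain w where w: "W = bs (v * w)" "S.Q.principal w" using tens_section[OF p tens] by blast
		have "S.QC.GA" by (rule S.GA_section[OF less.prems(3)])
		then have "S.QC.disc 1 S.M" using less.hyps[OF _ S.QC.ctx_axioms w(2)] M cv(5) v0 by simp
		then have "disc v N" using S.sec_disc[of 1 S.M] cv(4) M by (simp add: mult.commute)
		then have "disc 1 c" using disc_coprime[OF cv(2,1)] cv(3,4) by (simp add: coprime_commute mult.commute)
		have "lcm c v = N" using cv(3,4) N_pos by (simp add: lcm_coprime)
		then show ?thesis using disc_lcm[OF \<open>disc 1 c\<close> 1] by simp
	next
		case ag
		interpret agc N I J using ag less.prems(1) by (simp add: agc_def)
		show ?thesis
		proof (rule disc_from_primes)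
			fix q :: nat assume q: "prime q" "int q dvd N"
			obtain a r where ar: "a > 0" "N = int q ^ a * r" "\<not> int q dvd r" using prime_power_split[OF N_pos q] by metis
			interpret agcq N I J q a r by unfold_locales (use q ar in auto)
			show "disc 1 Q"
			proof (cases "disc 1 Q")
				case False
				then obtain W where W: "a = 1" "tens (bs 1) r Q W" using layers[of 0] a by auto
				have "disc r N" by (rule ga[OF _ agrp_N r_N tens_triv[OF W(2)]]) (use W(2) in \<open>simp add: tens_def\<close>)
				moreover have "agrp r" "agrp Q" "coprime r Q" "r * Q = N" using W(2) by (auto simp: tens_def)
				ultimately show ?thesis using disc_coprime by blast
			qed
		qed
	qed
qed

section \<open>Trivial subsections of normal sections\<close>

context sring
begin

text \<open>The stabiliser of \<open>0\<close> in the automorphism group consists of group automorphisms.\<close>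

definition nrm :: bool where
	"nrm \<longleftrightarrow> (\<forall>f. (\<forall>x y. f x - f y \<in> bs (x - y)) --> f 0 = 0 -->
		(\<forall>x y. N dvd f (x + y) - (f x + f y)))"

text \<open>A section group strictly between would be a union of basic sets that splits the nonzero
  classes of the section.\<close>

lemma triv_between:
	assumes "triv u v" "agrp w" "u dvd w" "w dvd v" "\<not> v dvd u"
	shows "w dvd u \<or> v dvd w"
proof (rule ccontr)
	assume a: "\<not> (w dvd u \<or> v dvd w)"
	then obtain z where z: "z \<in> bs w" "v dvd u - z" using assms unfolding triv_def by (meson dvd_refl)
	have "w dvd z" using bs_sub[OF agrp_aset[OF assms(2)], of w] z(1) by auto
	moreover have "w dvd u - z" using assms(4) z(2) dvd_trans by blast
	ultimately show False using a dvd_iff_diff by blast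
qed

text \<open>As for \<open>disc\<close>, Bezout moves representatives between projectively equivalent
  sections.\<close>

lemma triv_transfer:
	assumes a: "agrp u" "agrp v'" "v = lcm u v'" "u' = gcd u v'"
	shows "triv u v \<longleftrightarrow> triv u' v'"
proof
	assume t: "triv u' v'"
	show "triv u v" unfolding triv_def
	proof (intro allI impI)
		fix x y assume x: "u dvd x" "\<not> v dvd x" and y: "u dvd y" "\<not> v dvd y"
		have "u' dvd u" using a by simp
		then have "u' dvd x" "u' dvd y" using x y dvd_trans by blast+
		then obtain z where z: "z \<in> bs x" "v' dvd y - z" using t x y a(3) unfolding triv_def by (meson lcm_least)
		have "u dvd z" using bs_sub[OF agrp_aset[OF a(1)], of x] z(1) x(1) by auto
		then have "v dvd y - z" using z(2) y(1)  \<open>u dvd z\<close> unfolding a(3) by (metis lcm_least dvd_diff)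
		then show "\<exists>z\<in>bs x. v dvd y - z" using z(1) by blast
	qed
next
	assume t: "triv u v"
	show "triv u' v'" unfolding triv_def
	proof (intro allI impI)
		fix x y assume x: "u' dvd x" "\<not> v' dvd x" and y: "u' dvd y" "\<not> v' dvd y"
		obtain s r where sr: "s * u + r * v' = u'" using bezout_int a(4) by blast
		have *: "\<exists>x1. u dvd x1 \<and> v' dvd x - x1" if "u' dvd x" for x
		proof -
			from that obtain k where "x = u' * k" by (elim dvdE)
			then have "x - u * (s * k) = v' * (r * k)" unfolding sr[symmetric] by (simp add: algebra_simps)
			then show ?thesis by (intro exI[of _ "u * (s * k)"]) simp
		qed
		obtain x1 y1 where x1: "u dvd x1" "v' dvd x - x1" and y1: "u dvd y1" "v' dvd y - y1" using * x(1) y(1) by meson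
		have "v' dvd v" by (simp add: a(3))
		then have "\<not> v dvd x1" "\<not> v dvd y1" using x y dvd_iff_diff[OF x1(2)] dvd_iff_diff[OF y1(2)] dvd_trans by blast+
		then obtain z1 where z1: "z1 \<in> bs x1" "v dvd y1 - z1" using t x1 y1 unfolding triv_def by blast
		have "v' dvd x1 - x" using x1(2) by (simp add: dvd_diff_commute)
		then have "x1 \<in> {s. \<exists>z\<in>bs x. v' dvd s - z}" using bs_refl by blast
		then obtain z where z: "z \<in> bs x" "v' dvd z1 - z" using bs_sub[OF aset_per_msum[OF aset_bs a(2)]] z1(1) by blast
		have "v' dvd y1 - z1" using z1(2) \<open>v' dvd v\<close> dvd_trans by blast
		then have "v' dvd y - z" using y1(2) z(2) by Groebner_Basis.algebra
		then show "\<exists>z\<in>bs x. v' dvd y - z" using z(1) by blast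
	qed
qed

text \<open>\<open>g\<close> is the span and \<open>r\<close> the radical of the basic set; in the
  section between them the image of the set spans everything and has trivial radical.\<close>

lemma bs_section_principal:
	fixes x
	assumes g: "agrp g" "\<And>y. y \<in> bs x ==> g dvd y" "\<And>e. e dvd N ==> (\<And>y. y \<in> bs x ==> e dvd y) ==> e dvd g"
		and r: "agrp r" "rad (bs x) = {x. r dvd x}" and gr: "g dvd r"
	shows "sring.principal (r div g) (secI g r) (x div g)"
proof -
	interpret S: sring_section N I g r by unfold_locales (use g r gr in auto)
	have x: "x = g * (x div g)" using g(2)[OF bs_refl] by simp
	have inv: "y \<in> bs x" if "z \<in> bs x" "r dvd y - z" for y z
	proof -
		have "z - y \<in> rad (bs x)" using that r(2) by (simp add: dvd_diff_commute)
		then have "z - (z - y) \<in> bs x" using that(1) unfolding rad_def by blast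
		then show ?thesis by simp
	qed
	have bsx: "z \<in> S.Q.bs (x div g) \<longleftrightarrow> g * z \<in> bs x" for z using inv x unfolding S.sec_bs by (metis diff_self dvd_0_right)
	show ?thesis unfolding S.Q.principal_def
	proof (intro conjI allI impI ballI)
		fix e assume e: "e > 0" "e dvd S.M" "\<forall>y\<in>S.Q.bs (x div g). e dvd y"
		have "g * e dvd y" if "y \<in> bs x" for y
		proof -
			have "y = g * (y div g)" using g(2) that by simp
			then show ?thesis using e(3) bsx that by (metis mult_dvd_mono dvd_refl)
		qed
		moreover have "g * e dvd N" using e(2) S.dvd_v S.v_N dvd_trans by blast
		ultimately have "g * e dvd g * 1" using g(3) by simp
		then show "e = 1" using e(1) S.u_pos by simp
	next
		fix e assume e: "e \<in> S.Q.rad (S.Q.bs (x div g))"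
		have "y - g * e \<in> bs x" if "y \<in> bs x" for y
		proof -
			obtain y' where y': "y = g * y'" using g(2)[OF \<open>y \<in> bs x\<close>] by (elim dvdE)
			then have "y' - e \<in> S.Q.bs (x div g)" using e that by (simp add: S.Q.rad_def bsx)
			then show ?thesis by (simp add: bsx y' right_diff_distrib)
		qed
		then have "r dvd g * e" using r(2) by (auto simp: rad_def)
		then show "S.M dvd e" using S.dvd_M[of e 0] by simp
	qed
qed

end

context ctx
begin

lemma disc_left: "disc a b ==> a dvd a' ==> disc a' b" unfolding disc_def using dvd_trans by blast

text \<open>A nondiscrete trivial section gives a prime filter of undetermined section positions.\<close>

lemma triv_pfilter:
	assumes u: "agrp u" and v: "agrp v" and uv: "u dvd v" "\<not> v dvd u" and t: "triv u v" and nd: "\<not> disc u v"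
	shows "pfilter (\<lambda>d. \<not> v dvd lcm d u)"
proof -
	\<comment> \<open>No section group lies strictly between \<open>u\<close> and \<open>v\<close>, so
	  \<open>d\<close> cuts the section at one of its two ends; the filter consists of the
	  \<open>d\<close> that cut it at \<open>u\<close>.\<close>
	have c: "gcd (lcm d u) v = (if v dvd lcm d u then v else u)" if "agrp d" for d
	proof -
		have ag: "agrp (gcd (lcm d u) v)" using that u v agrp_lcm agrp_gcd by blast
		have "u dvd gcd (lcm d u) v" using uv by simp
		from triv_between[OF t ag this _ uv(2)] this show ?thesis using u v by (auto simp: agrp_def intro: zdvd_antisym_nonneg)
	qed
	have ne: "u ~= v" using uv by auto
	have pos: "u > 0" "v > 0" using u v by (auto simp: agrp_def)
	show ?thesis unfolding pfilter_def
	proof (intro conjI allI impI)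
		show "\<not> v dvd lcm 1 u" using uv(2) by simp
		have "v dvd lcm N u" using v dvd_lcmI1 by (simp add: agrp_def)
		then show "\<not> \<not> v dvd lcm N u" by blast
		fix a b assume ab: "agrp a" "agrp b"
		have "lcm (lcm a b) u = lcm (lcm a u) (lcm b u)" by (metis lcm.assoc lcm.commute lcm.left_idem)
		then have "gcd (lcm (lcm a b) u) v = lcm (gcd (lcm a u) v) (gcd (lcm b u) v)"
			by (simp only: gcd.commute[of _ v] gcd_lcm_distrib)
		moreover have "lcm u v = v" using uv pos by (simp add: lcm_proj2_if_dvd)
		ultimately show "\<not> v dvd lcm (lcm a b) u \<longleftrightarrow> \<not> v dvd lcm a u \<and> \<not> v dvd lcm b u"
			using c[OF agrp_lcm[OF ab]] c[OF ab(1)] c[OF ab(2)] ne pos by (auto simp: lcm.commute[of v u] split: if_splits)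
		have "lcm (gcd a b) u = gcd (lcm a u) (lcm b u)" by (simp only: lcm.commute[of _ u] lcm_gcd_distrib)
		then show "\<not> v dvd lcm (gcd a b) u \<longleftrightarrow> \<not> v dvd lcm a u \<or> \<not> v dvd lcm b u" by simp
		assume d: "a dvd b" "\<not> v dvd lcm a u" "\<not> \<not> v dvd lcm b u"
		show "\<not> disc a b"
		proof
			assume "disc a b"
			then have "disc (lcm a u) b" by (rule disc_left) simp
			then have "disc (lcm a u) (lcm b (lcm a u))" using disc_lcm disc_refl agrp_lcm[OF ab(1) u] by blast
			moreover have "lcm (lcm a u) v dvd lcm b (lcm a u)" using d(3) dvd_trans[of v "lcm b u" "lcm b (lcm a u)"] by simp
			ultimately have "disc (lcm a u) (lcm (lcm a u) v)" using disc_dvd agrp_lcm[OF agrp_lcm[OF ab(1) u] v] by blast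
			moreover have "gcd (lcm a u) v = u" using c[OF ab(1)] d(2) by simp
			ultimately show False using disc_transfer[OF agrp_lcm[OF ab(1) u] v] nd by simp
		qed
	qed
qed

text \<open>The filter is closed under lcm and its complement under gcd, and both are finite; so the
  largest member of the one and the smallest of the other are extreme for divisibility.\<close>

lemma pfilter_bounds:
	assumes P: "pfilter P"
	obtains u0 l1 where "agrp u0" "agrp l1" "P u0" "\<not> P l1"
		"\<And>d. agrp d ==> P d ==> d dvd u0" "\<And>d. agrp d ==> \<not> P d ==> l1 dvd d"
proof -
	have fin: "finite {d. agrp d \<and> Q d}" for Q
		using N_pos by (intro finite_subset[OF _ finite_atLeastAtMost_int[of 1 N]]) (auto simp: agrp_def zdvd_imp_le)
	let ?A = "{d. agrp d \<and> P d}" and ?B = "{d. agrp d \<and> \<not> P d}"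
	have P1: "P 1" "\<not> P N" using P by (auto simp: pfilter_def)
	have A: "Max ?A \<in> ?A" by (rule Max_in[OF fin]) (use P1 agrp_1 in auto)
	have B: "Min ?B \<in> ?B" by (rule Min_in[OF fin]) (use P1 agrp_N in auto)
	have "d dvd Max ?A" if "agrp d" "P d" for d
	proof -
		have "lcm d (Max ?A) \<in> ?A" using that A P agrp_lcm by (auto simp: pfilter_def)
		then have "lcm d (Max ?A) \<le> Max ?A" using fin by simp
		moreover have "lcm d (Max ?A) \<ge> Max ?A" using \<open>lcm d (Max ?A) \<in> ?A\<close> by (intro zdvd_imp_le) (auto simp: agrp_def)
		ultimately show ?thesis by (metis antisym dvd_lcm1)
	qed
	moreover have "Min ?B dvd d" if "agrp d" "\<not> P d" for d
	proof -
		have "gcd d (Min ?B) \<in> ?B" using that B P agrp_gcd by (auto simp: pfilter_def)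
		then have "Min ?B \<le> gcd d (Min ?B)" using fin by simp
		moreover have "gcd d (Min ?B) \<le> Min ?B" using B by (intro zdvd_imp_le) (auto simp: agrp_def)
		ultimately show ?thesis by (metis antisym gcd_dvd1)
	qed
	ultimately show ?thesis using that[of "Max ?A" "Min ?B"] A B by blast
qed

text \<open>If the radical of \<open>bs x\<close> is in the filter, it contains \<open>w\<close>.
  Otherwise the filter separates the span of \<open>bs x\<close> from its radical and restricts to
  the section between them, where \<open>principal_filter\<close> applies. The extreme choices
  \<open>u0\<close> and \<open>l1\<close> work for all \<open>x\<close> at once.\<close>

lemma pfilter_swap:
	assumes P: "pfilter P" and u0: "\<And>d. agrp d ==> P d ==> d dvd u0" and l1: "\<And>d. agrp d ==> \<not> P d ==> l1 dvd d"
		and x: "\<not> l1 dvd x" and w: "u0 dvd w"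
	shows "x + w \<in> bs x \<or> l1 dvd x + w"
proof -
	obtain g where g: "agrp g" "\<And>y. y \<in> bs x ==> g dvd y" "\<And>e. e dvd N ==> (\<And>y. y \<in> bs x ==> e dvd y) ==> e dvd g"
		using gen_agrp[OF aset_bs[of x]] by metis
	obtain r where r: "agrp r" "rad (bs x) = {x. r dvd x}" using rad_agrp[OF aset_bs] by metis
	have gx: "g dvd x" by (rule g(2)[OF bs_refl])
	have inv: "y \<in> bs x" if "z \<in> bs x" "r dvd y - z" for y z
	proof -
		have "z - y \<in> rad (bs x)" using that r(2) by (simp add: dvd_diff_commute)
		then have "z - (z - y) \<in> bs x" using that(1) unfolding rad_def by blast
		then show ?thesis by simp
	qed
	have "x - r \<in> bs x" by (rule inv[OF bs_refl]) simp
	then have "g dvd x - r" by (rule g(2))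
	then have gr: "g dvd r" using gx dvd_diff_right_iff by blast
	have Pg: "P g" using l1[OF g(1)] x gx dvd_trans by blast
	show ?thesis
	proof (cases "P r")
		case True
		then have "r dvd (x + w) - x" using u0[OF r(1)] w dvd_trans by simp
		then show ?thesis using inv[OF bs_refl] by blast
	next
		case False
		interpret S: ctx_section N I J g r by unfold_locales (use g r gr in auto)
		have ag: "agrp (g * a)" if "S.Q.agrp a" for a using S.sec_agrp that by blast

		from principal_filter[OF S.QC.ctx_axioms bs_section_principal[OF g r gr] S.pfilter_section[OF P Pg False]]
		obtain c m where cm: "S.Q.agrp c" "S.Q.agrp m" "P (g * c)" "\<not> P (g * m)"
			"\<forall>y\<in>S.Q.bs (x div g). \<forall>w. c dvd w --> y + w \<in> S.Q.bs (x div g) \<or> m dvd y + w" by blast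
		have "g * c dvd w" using u0[OF ag[OF cm(1)] cm(3)] w dvd_trans by blast
		then obtain w' where w': "w = g * (c * w')" by (elim dvdE) (simp only: mult.assoc)
		obtain x' where x': "x = g * x'" using gx by (elim dvdE)
		have "x' + c * w' \<in> S.Q.bs x' \<or> m dvd x' + c * w'" using cm(5) S.Q.bs_refl S.u_pos by (simp add: x')
		then show ?thesis
		proof
			assume "x' + c * w' \<in> S.Q.bs x'"
			then obtain z where "z \<in> bs x" "r dvd (x + w) - z" unfolding S.sec_bs by (auto simp: x' w' distrib_left)
			then show ?thesis using inv by blast
		next
			assume "m dvd x' + c * w'"
			then have "g * m dvd x + w" by (simp add: x' w' distrib_left[symmetric])
			then show ?thesis using l1[OF ag[OF cm(2)] cm(4)] dvd_trans by blast
		qed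
	qed
qed

text \<open>If a trivial section were not discrete, exchanging two cosets of \<open>l1\<close> by translations would be
	an automorphism that is not additive.\<close>

lemma normal_triv_disc:
	assumes n: nrm and u: "agrp u" and v: "agrp v" and uv: "u dvd v" and t: "triv u v"
	shows "disc u v"
proof (rule ccontr)
	assume nd: "\<not> disc u v"
	have pos: "u > 0" "v > 0" using u v by (auto simp: agrp_def)
	obtain b where b: "v = u * b" using uv by (elim dvdE)
	\<comment> \<open>The multiples by 1, 2 and 3 are those that occur below: \<open>u0\<close> and
	  \<open>2 * u0\<close> represent the cosets to be exchanged, and \<open>3 * u0\<close> measures
	  the failure of additivity.\<close>
	have "b > 3" using disc_small[OF u v b] nd by linarith
	then have "\<not> b dvd 1" "\<not> b dvd 2" "\<not> b dvd 3" using zdvd_imp_le[of b] by force+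
	then have bk: "\<not> v dvd u * k" if "k \<in> {1, 2, 3}" for k using that pos by (auto simp: b)
	define P where "P = (\<lambda>d. \<not> v dvd lcm d u)"
	have P: "pfilter P" unfolding P_def by (rule triv_pfilter[OF u v uv _ t nd]) (use bk[of 1] in simp)
	obtain u0 l1 where ul: "agrp u0" "agrp l1" "P u0" "\<not> P l1"
		"\<And>d. agrp d ==> P d ==> d dvd u0" "\<And>d. agrp d ==> \<not> P d ==> l1 dvd d" using pfilter_bounds[OF P] by metis
	have uu0: "u dvd u0" using ul(5)[OF u] bk[of 1] pos by (simp add: P_def)
	\<comment> \<open>If \<open>l1\<close> divided \<open>k * u0\<close>, then \<open>v\<close> would
	  divide \<open>k * gcd u0 v\<close>; by \<open>triv_between\<close> the latter gcd divides
	  \<open>u\<close>.\<close>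
	have lk: "\<not> l1 dvd k * u0" if k: "k \<in> {1, 2, 3}" for k
	proof
		assume l: "l1 dvd k * u0"
		have ag: "agrp (gcd u0 v)" using agrp_gcd ul(1) v by blast
		have "u dvd gcd u0 v" using uu0 uv by simp
		then have "gcd u0 v dvd u \<or> v dvd gcd u0 v" using triv_between[OF t ag] bk[of 1] by simp
		moreover have "\<not> v dvd u0" using ul(3) dvd_trans[of v u0 "lcm u0 u"] by (auto simp: P_def)
		ultimately have g: "gcd u0 v dvd u" by simp
		have "v dvd lcm l1 u" using ul(4) by (simp add: P_def)
		moreover have "lcm l1 u dvd k * u0" using l uu0 by simp
		ultimately have "v dvd gcd (k * u0) (k * v)" using dvd_trans by (meson dvd_triv_right gcd_greatest)
		also have "gcd (k * u0) (k * v) = k * gcd u0 v" using k by (auto simp: gcd_mult_left)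
		also have "... dvd u * k" using g by (simp add: mult.commute)
		finally show False using bk[OF k] by blast
	qed
	\<comment> \<open>Exchanges the cosets of \<open>l1\<close> through \<open>u0\<close> and
	  \<open>2 * u0\<close> and fixes all other points. It sends \<open>u0 + u0\<close> to
	  \<open>u0\<close>, where additivity would require \<open>4 * u0\<close>.\<close>
	define f where "f = (\<lambda>x. if l1 dvd x - u0 then x + u0 else if l1 dvd x - 2 * u0 then x - u0 else x)"
	have lc: "l1 dvd x - a \<longleftrightarrow> l1 dvd y - a" if "l1 dvd x - y" for x y a using that by (intro dvd_iff_diff) simp
	have fs: "f x - x = f y - y" if "l1 dvd x - y" for x y using lc[OF that] by (simp add: f_def)
	have l12: "\<not> l1 dvd u0" "\<not> l1 dvd 2 * u0" "\<not> l1 dvd 3 * u0" using lk[of 1] lk[of 2] lk[of 3] by auto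
	have ff: "f (f x) = x" for x
	proof -
		consider "l1 dvd x - u0" | "\<not> l1 dvd x - u0" "l1 dvd x - 2 * u0" | "\<not> l1 dvd x - u0" "\<not> l1 dvd x - 2 * u0" by blast
		then show ?thesis
		proof cases
			case 1
			then have "\<not> l1 dvd x" using l12(1) dvd_iff_diff by blast
			then show ?thesis using 1 by (simp add: f_def)
		next
			case 2
			moreover have "x - u0 - u0 = x - 2 * u0" by simp
			ultimately show ?thesis by (simp add: f_def)
		qed (simp add: f_def)
	qed
	have "f x - f y \<in> bs (x - y)" for x y
	proof (cases "l1 dvd x - y")
		case True
		then have "f x - f y = x - y" using fs[OF True] by simp
		then show ?thesis using bs_refl by simp
	next
		case False
		have "u0 dvd f x - x" for x by (simp add: f_def)
		then have d: "u0 dvd (f x - x) - (f y - y)" using dvd_diff by blast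
		have "\<not> l1 dvd f x - f y"
		proof
			assume l: "l1 dvd f x - f y"
			from fs[OF this] have "f x - f y = x - y" by (simp add: ff)
			then show False using l False by simp
		qed
		moreover have "x - y + ((f x - x) - (f y - y)) = f x - f y" by simp
		ultimately show ?thesis using pfilter_swap[OF P ul(5,6) False d] by simp
	qed
	moreover have "f 0 = 0" using l12 by (simp add: f_def)
	ultimately have "N dvd f (u0 + u0) - (f u0 + f u0)" using n unfolding nrm_def by blast
	moreover have "f u0 = 2 * u0" "f (u0 + u0) = u0" using l12 by (auto simp: f_def)
	ultimately have "N dvd - (3 * u0)" by simp
	then have "l1 dvd 3 * u0" using ul(2) dvd_trans unfolding agrp_def by (metis dvd_minus_iff)
	then show False using l12 by blast
qed

end

lemma (in ctx_section) normal_section_disc: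
	assumes n: "Q.nrm" and ab: "agrp a" "agrp b" "u dvd a" "a dvd b" "b dvd v" and t: "triv a b"
	shows "disc a b"
proof -
	obtain a' b' where a': "a = u * a'" and b': "b = u * b'" using ab dvd_trans by (meson dvdE)
	have d: "a' dvd b'" "a' dvd M" "b' dvd M" using ab u_pos dvd_trans[of a b v] unfolding a' b' dvd_v[symmetric] by auto
	have "Q.triv a' b'" unfolding Q.triv_def
	proof (intro allI impI)
		fix x y assume "a' dvd x" "\<not> b' dvd x" "a' dvd y" "\<not> b' dvd y"
		then obtain z where z: "z \<in> bs (u * x)" "b dvd u * y - z"
			using t[unfolded triv_def, rule_format, of "u * x" "u * y"] u_pos by (auto simp: a' b')
		have "u dvd z" using bs_sub[OF agrp_aset[OF u], of "u * x"] z(1) by auto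
		then obtain z' where z': "z = u * z'" by (elim dvdE)
		have "z' \<in> Q.bs x" using z(1) unfolding sec_bs z' by (intro bexI[of _ "u * z'"]) auto
		moreover have "b' dvd y - z'" using z(2) u_pos by (simp add: z' b' right_diff_distrib[symmetric])
		ultimately show "\<exists>z\<in>Q.bs x. b' dvd y - z" by blast
	qed
	then have "QC.disc a' b'" using QC.normal_triv_disc[OF n] ab d by (simp add: sec_agrp a' b')
	then show ?thesis using sec_disc d by (simp add: a' b')
qed

section \<open>Coherent configurations and coherent algebras\<close>

text \<open>The adjacency algebra in functional form, with integer values; closure under all
  pointwise operations makes level sets available without linear algebra.\<close>

definition cc_alg :: "('a \<times> 'a) set set => ('a => 'a => int) set" where
	"cc_alg T = {F. \<forall>t\<in>T. \<forall>a b c d. (a, b) \<in> t --> (c, d) \<in> t --> F a b = F c d}"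

definition alg_cc :: "'a set => ('a => 'a => int) set => ('a \<times> 'a) set set" where
	"alg_cc V A = (\<lambda>(c, d). {(a, b) \<in> V \<times> V. \<forall>F\<in>A. F a b = F c d}) ` (V \<times> V)"

lemma coherent_cell:
	assumes "coherent_configuration V T" "a \<in> V" "b \<in> V"
	obtains t where "t \<in> T" "(a, b) \<in> t"
	using assms partition_onD1[of "V \<times> V" T] unfolding coherent_configuration_def by blast

lemma coherent_cell_unique:
	assumes "coherent_configuration V T" "t \<in> T" "t' \<in> T" "p \<in> t" "p \<in> t'"
	shows "t = t'" using assms partition_onD2[of "V \<times> V" T] unfolding coherent_configuration_def disjoint_def by blast

lemma coherent_card:
	assumes "coherent_configuration V T" "r \<in> T" "s \<in> T" "t \<in> T" "(a, c) \<in> t" "(a', c') \<in> t"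
	shows "card {b. (a, b) \<in> r \<and> (b, c) \<in> s} = card {b. (a', b) \<in> r \<and> (b, c') \<in> s}"
proof -
	have "\<exists>k. \<forall>(a, c)\<in>t. card {b. (a, b) \<in> r \<and> (b, c) \<in> s} = k"
		using assms(1)[unfolded coherent_configuration_def] assms(2-4) by (elim conjE) simp
	then obtain k where k: "\<forall>(a, c)\<in>t. card {b. (a, b) \<in> r \<and> (b, c) \<in> s} = k" ..
	from bspec[OF k assms(5)] bspec[OF k assms(6)] show ?thesis by simp
qed

lemma coherent_nonempty: "coherent_configuration V T ==> t \<in> T ==> \<exists>a b. (a, b) \<in> t"
	using partition_onD3[of "V \<times> V" T] unfolding coherent_configuration_def by (metis all_not_in_conv surj_pair)

lemma coherent_sub: "coherent_configuration V T ==> t \<in> T ==> t \<subseteq> V \<times> V"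
	using partition_onD1[of "V \<times> V" T] unfolding coherent_configuration_def by blast

lemma cc_algD: "F \<in> cc_alg T ==> t \<in> T ==> (a, b) \<in> t ==> (c, d) \<in> t ==> F a b = F c d" unfolding cc_alg_def by blast

lemma cc_algI: "(\<And>t a b c d. t \<in> T ==> (a, b) \<in> t ==> (c, d) \<in> t ==> F a b = F c d) ==> F \<in> cc_alg T" unfolding cc_alg_def by blast

lemma cc_alg_map2: "F \<in> cc_alg T ==> G \<in> cc_alg T ==> (\<lambda>a b. h (F a b) (G a b)) \<in> cc_alg T" by (rule cc_algI) (metis cc_algD)

lemma union_of_basis_iff:
	assumes T: "coherent_configuration V T"
	shows "union_of_basis T r \<longleftrightarrow> r \<subseteq> V \<times> V \<and> (\<lambda>a b. of_bool ((a, b) \<in> r)) \<in> cc_alg T"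
proof
	assume "union_of_basis T r"
	then obtain K where K: "K \<subseteq> T" "r = \<Union>K" by (auto simp: union_of_basis_def)
	have *: "p \<in> r ==> q \<in> r" if t: "t \<in> T" "p \<in> t" "q \<in> t" for t p q
	proof -
		assume "p \<in> r"
		then obtain s where s: "s \<in> T" "s \<in> K" "p \<in> s" using K by auto
		have "s = t" by (rule coherent_cell_unique[OF T s(1) t(1) s(3) t(2)])
		then show ?thesis using K(2) s(2) t(3) by auto
	qed
	have "(\<lambda>a b. of_bool ((a, b) \<in> r)) \<in> cc_alg T"
	proof (rule cc_algI)
		fix t a b c d assume t: "t \<in> T" "(a, b) \<in> t" "(c, d) \<in> t"
		have "(a, b) \<in> r \<longleftrightarrow> (c, d) \<in> r" using *[OF t] *[OF t(1,3,2)] by blast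
		then show "of_bool ((a, b) \<in> r) = (of_bool ((c, d) \<in> r) :: int)" by simp
	qed
	moreover have "r \<subseteq> V \<times> V" unfolding K(2) using K(1) by (intro Union_least coherent_sub[OF T]) auto
	ultimately show "r \<subseteq> V \<times> V \<and> (\<lambda>a b. of_bool ((a, b) \<in> r)) \<in> cc_alg T" by blast
next
	assume r: "r \<subseteq> V \<times> V \<and> (\<lambda>a b. of_bool ((a, b) \<in> r)) \<in> cc_alg T"
	have "(a, b) \<in> \<Union>{t \<in> T. t \<subseteq> r}" if "(a, b) \<in> r" for a b
	proof -
		have "a \<in> V" "b \<in> V" using r that by auto
		then obtain t where t: "t \<in> T" "(a, b) \<in> t" by (rule coherent_cell[OF T])
		have "(c, d) \<in> r" if "(c, d) \<in> t" for c d
		proof -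
			have "of_bool ((a, b) \<in> r) = (of_bool ((c, d) \<in> r) :: int)" using cc_algD[OF conjunct2[OF r] t that] .
			then show ?thesis using \<open>(a, b) \<in> r\<close> by (simp split: if_splits add: of_bool_def)
		qed
		then show ?thesis using t by auto
	qed
	then have "r = \<Union>{t \<in> T. t \<subseteq> r}" by auto
	then show "union_of_basis T r" unfolding union_of_basis_def by (intro exI[of _ "{t \<in> T. t \<subseteq> r}"]) simp
qed

lemma union_of_basis_cell: "t \<in> T ==> union_of_basis T t" unfolding union_of_basis_def by (intro exI[of _ "{t}"]) simp

lemma cc_alg_cell: "coherent_configuration V T ==> t \<in> T ==> (\<lambda>a b. of_bool ((a, b) \<in> t)) \<in> cc_alg T"
	using union_of_basis_iff union_of_basis_cell by blast

lemma cc_alg_tr: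
	assumes T: "coherent_configuration V T" and F: "F \<in> cc_alg T"
	shows "(\<lambda>a b. F b a) \<in> cc_alg T"
proof -
	have "t\<inverse> \<in> T" if "t \<in> T" for t using T that by (auto simp: coherent_configuration_def)
	then show ?thesis by (intro cc_algI) (meson cc_algD[OF F] converse_iff)
qed

text \<open>Both factors are combinations of indicators of basis relations, and the products of
  those have the intersection numbers as coefficients.\<close>

lemma cc_alg_mul:
	assumes T: "coherent_configuration V T" and F: "F \<in> cc_alg T" and G: "G \<in> cc_alg T"
	shows "(\<lambda>a c. \<Sum>b\<in>V. F a b * G b c) \<in> cc_alg T"
proof -
	have fin: "finite V" using T by (simp add: coherent_configuration_def)
	have "T \<subseteq> Pow (V \<times> V)" using coherent_sub[OF T] by blast
	then have finT: "finite T" using fin by (meson finite_SigmaI finite_Pow_iff finite_subset)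
	define v :: "('a => 'a => int) => ('a \<times> 'a) set => int"
		where "v = (\<lambda>F t. F (fst (SOME p. p \<in> t)) (snd (SOME p. p \<in> t)))"
	have v: "H a b = (\<Sum>t\<in>T. of_bool ((a, b) \<in> t) * v H t)" if H: "H \<in> cc_alg T" and ab: "a \<in> V" "b \<in> V" for H a b
	proof -
		obtain t where t: "t \<in> T" "(a, b) \<in> t" using coherent_cell[OF T ab] .
		have "v H t = H a b"
			unfolding v_def by (rule cc_algD[OF H t(1) _ t(2)]) (use someI[of "\<lambda>p. p \<in> t" "(a, b)"] t(2) in simp)
		moreover have "(a, b) \<in> t' \<longleftrightarrow> t' = t" if "t' \<in> T" for t' using coherent_cell_unique[OF T, of t' t] t that by blast
		ultimately have "(\<Sum>t'\<in>T. of_bool ((a, b) \<in> t') * v H t') = (\<Sum>t'\<in>T. if t' = t then H a b else 0)"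
			by (intro sum.cong) auto
		then show ?thesis using finT t by simp
	qed
	have e: "(\<Sum>b\<in>V. F a b * G b c)
			= (\<Sum>r\<in>T. \<Sum>s\<in>T. v F r * v G s * int (card {b. (a, b) \<in> r \<and> (b, c) \<in> s}))" if ac: "a \<in> V" "c \<in> V" for a c
	proof -
		have "(\<Sum>b\<in>V. F a b * G b c)
				= (\<Sum>b\<in>V. \<Sum>r\<in>T. \<Sum>s\<in>T. v F r * v G s * of_bool ((a, b) \<in> r \<and> (b, c) \<in> s))"
		proof (rule sum.cong[OF refl])
			fix b assume "b \<in> V"
			then show "F a b * G b c = (\<Sum>r\<in>T. \<Sum>s\<in>T. v F r * v G s * of_bool ((a, b) \<in> r \<and> (b, c) \<in> s))"
				unfolding v[OF F ac(1) \<open>b \<in> V\<close>] v[OF G \<open>b \<in> V\<close> ac(2)] sum_product by (intro sum.cong) (auto simp: of_bool_conj)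
		qed
		also have "... = (\<Sum>r\<in>T. \<Sum>s\<in>T. \<Sum>b\<in>V. v F r * v G s * of_bool ((a, b) \<in> r \<and> (b, c) \<in> s))"
			by (subst sum.swap) (intro sum.cong refl, rule sum.swap)
		also have "... = (\<Sum>r\<in>T. \<Sum>s\<in>T. v F r * v G s * int (card {b. (a, b) \<in> r \<and> (b, c) \<in> s}))"
		proof (intro sum.cong refl)
			fix r s assume "r \<in> T" "s \<in> T"
			then have "{b. (a, b) \<in> r \<and> (b, c) \<in> s} = {b \<in> V. (a, b) \<in> r \<and> (b, c) \<in> s}" using coherent_sub[OF T] by blast
			then show "(\<Sum>b\<in>V. v F r * v G s * of_bool ((a, b) \<in> r \<and> (b, c) \<in> s))
					= v F r * v G s * int (card {b. (a, b) \<in> r \<and> (b, c) \<in> s})"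
				using fin by (simp add: sum_distrib_left[symmetric] of_bool_def sum.If_cases Int_def)
		qed
		finally show ?thesis .
	qed
	show ?thesis
	proof (rule cc_algI)
		fix t a c a' c' assume t: "t \<in> T" "(a, c) \<in> t" "(a', c') \<in> t"
		have "card {b. (a, b) \<in> r \<and> (b, c) \<in> s} = card {b. (a', b) \<in> r \<and> (b, c') \<in> s}" if "r \<in> T" "s \<in> T" for r s
			using coherent_card[OF T that t] .
		then have "(\<Sum>r\<in>T. \<Sum>s\<in>T. v F r * v G s * int (card {b. (a, b) \<in> r \<and> (b, c) \<in> s}))
				= (\<Sum>r\<in>T. \<Sum>s\<in>T. v F r * v G s * int (card {b. (a', b) \<in> r \<and> (b, c') \<in> s}))" by (intro sum.cong) auto
		moreover have "a \<in> V" "c \<in> V" "a' \<in> V" "c' \<in> V" using coherent_sub[OF T t(1)] t(2,3) by auto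
		ultimately show "(\<Sum>b\<in>V. F a b * G b c) = (\<Sum>b\<in>V. F a' b * G b c')" by (simp only: e)
	qed
qed

text \<open>The cells are the joint level sets of \<open>A\<close>. Closure under pointwise
  operations provides elements of \<open>A\<close> that agree on \<open>V\<close> with their
  indicators, and the coherence conditions then follow from the closure properties of
  \<open>A\<close>.\<close>

lemma alg_cc_coherent:
	assumes fin: "finite V"
		and m: "\<And>F G h. F \<in> A ==> G \<in> A ==> (\<lambda>a b. h (F a b) (G a b) :: int) \<in> A"
		and tr: "\<And>F. F \<in> A ==> (\<lambda>a b. F b a) \<in> A"
		and mul: "\<And>F G. F \<in> A ==> G \<in> A ==> (\<lambda>a c. \<Sum>b\<in>V. F a b * G b c) \<in> A"
		and i: "(\<lambda>a b. of_bool ((a, b) \<in> Id_on V)) \<in> A"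
	shows "coherent_configuration V (alg_cc V A)" and "A \<subseteq> cc_alg (alg_cc V A)"
proof -
	let ?c = "\<lambda>c d. {(a, b) \<in> V \<times> V. \<forall>F\<in>A. F a b = F c d}"
	show sub: "A \<subseteq> cc_alg (alg_cc V A)" by (auto simp: alg_cc_def intro!: cc_algI)
	have ind: "\<exists>H\<in>A. \<forall>a\<in>V. \<forall>b\<in>V. H a b = of_bool ((a, b) \<in> ?c c d)" for c d
	proof -
		let ?K = "{p \<in> V \<times> V. p \<notin> ?c c d}"
		have "\<forall>p\<in>?K. \<exists>F\<in>A. F (fst p) (snd p) ~= F c d" by auto
		then have "\<forall>p. \<exists>F. p \<in> ?K --> F \<in> A \<and> F (fst p) (snd p) ~= F c d" by blast
		from choice[OF this] obtain W where
			W: "\<And>p. p \<in> ?K ==> W p \<in> A \<and> W p (fst p) (snd p) ~= W p c d" by blast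
		have "(\<lambda>a b. of_bool (\<forall>p\<in>K. W p a b = W p c d)) \<in> A" if "finite K" "K \<subseteq> ?K" for K using that
		proof (induction K)
			case empty
			then show ?case using m[OF i i, of "\<lambda>_ _. 1"] by simp
		next
			case (insert p K)
			then show ?case using m[of "W p" "\<lambda>a b. of_bool (\<forall>p\<in>K. W p a b = W p c d)" "\<lambda>x y. of_bool (x = W p c d) * y"] W
				by (simp add: of_bool_conj)
		qed
		moreover have "finite ?K" using fin by (intro finite_subset[of ?K "V \<times> V"]) auto
		ultimately have "(\<lambda>a b. of_bool (\<forall>p\<in>?K. W p a b = W p c d)) \<in> A" by blast
		moreover have "(\<forall>p\<in>?K. W p a b = W p c d) \<longleftrightarrow> (a, b) \<in> ?c c d" if "a \<in> V" "b \<in> V" for a b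
		proof
			show "(a, b) \<in> ?c c d" if *: "\<forall>p\<in>?K. W p a b = W p c d"
			proof (rule ccontr)
				assume "(a, b) \<notin> ?c c d"
				then have "(a, b) \<in> ?K" using \<open>a \<in> V\<close> \<open>b \<in> V\<close> by simp
				then show False using W[of "(a, b)"] * by simp
			qed
			show "\<forall>p\<in>?K. W p a b = W p c d" if "(a, b) \<in> ?c c d" using W that by simp
		qed
		ultimately show ?thesis by (intro bexI) auto
	qed
	have part: "partition_on (V \<times> V) (alg_cc V A)"
	proof (rule partition_onI)
		fix p q assume "p \<in> alg_cc V A" "q \<in> alg_cc V A" "p ~= q"
		then show "disjnt p q" unfolding alg_cc_def disjnt_def by (auto 0 3)
	qed (auto simp: alg_cc_def)
	have id: "p \<in> Id_on V \<longleftrightarrow> q \<in> Id_on V" if "t \<in> alg_cc V A" "p \<in> t" "q \<in> t" for t p q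
		using cc_algD[OF subsetD[OF sub i] that(1), of "fst p" "snd p" "fst q" "snd q"] that(2,3)
		by (simp del: Id_on_iff split: if_splits add: of_bool_def)
	have "\<exists>t\<in>{t \<in> alg_cc V A. t \<subseteq> Id_on V}. p \<in> t" if p: "p \<in> Id_on V" for p
	proof -
		have "p \<in> V \<times> V" using p by auto
		then obtain t where "t \<in> alg_cc V A" "p \<in> t" using partition_onD1[OF part] by blast
		then show ?thesis using id[of t _ p] p by (intro bexI[of _ t]) auto
	qed
	then have "Id_on V = \<Union>{t \<in> alg_cc V A. t \<subseteq> Id_on V}" by blast
	then have "union_of_basis (alg_cc V A) (Id_on V)"
		unfolding union_of_basis_def by (intro exI[of _ "{t \<in> alg_cc V A. t \<subseteq> Id_on V}"]) simp
	moreover have "t\<inverse> \<in> alg_cc V A" if "t \<in> alg_cc V A" for t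
	proof -
		from that obtain c d where cd: "c \<in> V" "d \<in> V" "t = ?c c d" by (auto simp: alg_cc_def)
		have "(\<forall>F\<in>A. F a b = F c d) \<longleftrightarrow> (\<forall>F\<in>A. F b a = F d c)" for a b using tr by meson
		then have "t\<inverse> = ?c d c" using cd by auto
		then show ?thesis using cd by (auto simp: alg_cc_def)
	qed
	moreover have "\<exists>k. \<forall>(a, b)\<in>t. card {g. (a, g) \<in> r \<and> (g, b) \<in> s} = k"
		if rst: "r \<in> alg_cc V A" "s \<in> alg_cc V A" "t \<in> alg_cc V A" for r s t
	proof -
		have ind': "\<exists>H\<in>A. \<forall>a\<in>V. \<forall>b\<in>V. H a b = of_bool ((a, b) \<in> t)" if t: "t \<in> alg_cc V A" for t
		proof -
			obtain c d where "t = ?c c d" using t unfolding alg_cc_def by (elim imageE) auto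
			then show ?thesis using ind by simp
		qed
		obtain R S where R: "R \<in> A" "\<And>a b. a \<in> V ==> b \<in> V ==> R a b = of_bool ((a, b) \<in> r)"
			and S: "S \<in> A" "\<And>a b. a \<in> V ==> b \<in> V ==> S a b = of_bool ((a, b) \<in> s)" using ind'[OF rst(1)] ind'[OF rst(2)] by blast
		have rs: "r \<subseteq> V \<times> V" "t \<subseteq> V \<times> V" using rst partition_onD1[OF part] by blast+
		have e: "int (card {g. (a, g) \<in> r \<and> (g, b) \<in> s}) = (\<Sum>g\<in>V. R a g * S g b)" if "a \<in> V" "b \<in> V" for a b
		proof -
			have "{g. (a, g) \<in> r \<and> (g, b) \<in> s} = {g \<in> V. (a, g) \<in> r \<and> (g, b) \<in> s}" using rs by blast
			moreover have "(\<Sum>g\<in>V. R a g * S g b) = (\<Sum>g\<in>V. of_bool ((a, g) \<in> r \<and> (g, b) \<in> s))"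
				using R(2) S(2) that by (intro sum.cong) (auto simp: of_bool_conj)
			ultimately show ?thesis using fin by (simp add: of_bool_def sum.If_cases Int_def)
		qed
		have "(\<Sum>g\<in>V. R a g * S g b) = (\<Sum>g\<in>V. R a' g * S g b')" if "(a, b) \<in> t" "(a', b') \<in> t" for a b a' b'
			by (rule cc_algD[OF subsetD[OF sub mul[OF R(1) S(1)]] rst(3) that])
		note mul' = this
		have *: "card {g. (a, g) \<in> r \<and> (g, b) \<in> s} = card {g. (a', g) \<in> r \<and> (g, b') \<in> s}"
			if "(a, b) \<in> t" "(a', b') \<in> t" for a b a' b'
		proof -
			have "a \<in> V" "b \<in> V" "a' \<in> V" "b' \<in> V" using subsetD[OF rs(2) that(1)] subsetD[OF rs(2) that(2)] by auto
			from e[OF this(1,2)] e[OF this(3,4)] mul'[OF that]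
			have "int (card {g. (a, g) \<in> r \<and> (g, b) \<in> s}) = int (card {g. (a', g) \<in> r \<and> (g, b') \<in> s})" by simp
			then show ?thesis by simp
		qed
		show ?thesis
		proof (cases "\<exists>a b. (a, b) \<in> t")
			case True
			then obtain a b where "(a, b) \<in> t" by blast
			then show ?thesis using * by blast
		qed auto
	qed
	ultimately show "coherent_configuration V (alg_cc V A)" using fin part unfolding coherent_configuration_def by blast
qed

lemma cc_le_iff:
	assumes "coherent_configuration V S" "coherent_configuration V T"
	shows "cc_le S T \<longleftrightarrow> (\<forall>s\<in>S. (\<lambda>a b. of_bool ((a, b) \<in> s)) \<in> cc_alg T)"
	unfolding cc_le_def union_of_basis_iff[OF assms(2)] using coherent_sub[OF assms(1)] by blast

lemma cc_alg_mono:
	assumes ST: "coherent_configuration V S" "coherent_configuration V T" and le: "cc_le S T"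
	shows "cc_alg S \<subseteq> cc_alg T"
proof -
	have "\<exists>s\<in>S. t \<subseteq> s" if t: "t \<in> T" for t
	proof -
		obtain a b where ab: "(a, b) \<in> t" using coherent_nonempty[OF ST(2) t] by blast
		then obtain s where s: "s \<in> S" "(a, b) \<in> s" using coherent_cell[OF ST(1)] coherent_sub[OF ST(2) t] by blast
		have "union_of_basis T s" using le s(1) by (simp add: cc_le_def)
		then obtain K where "K \<subseteq> T" "s = \<Union>K" unfolding union_of_basis_def by blast
		then obtain t' where t': "t' \<in> T" "(a, b) \<in> t'" "t' \<subseteq> s" using s(2) by blast
		then show ?thesis using s(1) coherent_cell_unique[OF ST(2) t'(1) t t'(2) ab] by blast
	qed
	then show ?thesis by (intro subsetI cc_algI) (meson cc_algD subsetD)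
qed

lemma cc_le_antisym:
	assumes ST: "coherent_configuration V S" "coherent_configuration V T" and le: "cc_le S T" "cc_le T S"
	shows "S = T"
proof -
	have *: "S \<subseteq> T" if ST: "coherent_configuration V S" "coherent_configuration V T" "cc_le S T" "cc_le T S"
		for S T :: "('a \<times> 'a) set set"
	proof
		fix s assume s: "s \<in> S"
		then obtain K where K: "K \<subseteq> T" "s = \<Union>K" using ST by (auto simp: cc_le_def union_of_basis_def)
		obtain t p where t: "t \<in> T" "t \<subseteq> s" "p \<in> t" using coherent_nonempty[OF ST(1) s] K by auto
		have "union_of_basis S t" using ST(4) t(1) by (simp add: cc_le_def)
		then obtain L where L: "L \<subseteq> S" "t = \<Union>L" unfolding union_of_basis_def by blast
		then obtain s' where s': "s' \<in> S" "p \<in> s'" "s' \<subseteq> t" using t(3) by blast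
		have "s' = s" by (rule coherent_cell_unique[OF ST(1) s'(1) s s'(2)]) (use t in blast)
		then have "s \<subseteq> t" using s' by simp
		then show "s \<in> T" using t by auto
	qed
	show ?thesis using *[OF ST le] *[OF ST(2,1) le(2,1)] by blast
qed

text \<open>The intersection of the algebras of all point extensions is the algebra of the smallest one.\<close>

lemma point_extension_exists:
	assumes S: "coherent_configuration V S" and x: "set x \<subseteq> V"
	shows "is_point_extension V S x (point_extension V S x)"
proof -
	have fin: "finite V" using S by (simp add: coherent_configuration_def)
	let ?E = "{T. is_point_extension V S x T}"
	have E: "coherent_configuration V T" "cc_le S T" "\<And>a. a \<in> set x ==> {(a, a)} \<in> T" if "T \<in> ?E" for T
		using that by (auto simp: is_point_extension_def)
	define A where "A = (\<Inter>T\<in>?E. cc_alg T)"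
	note A = alg_cc_coherent[OF fin, of A]
	have i: "(\<lambda>a b. of_bool ((a, b) \<in> Id_on V)) \<in> A"
	proof -
		have "(\<lambda>a b. of_bool ((a, b) \<in> Id_on V)) \<in> cc_alg T" if "T \<in> ?E" for T
		proof -
			have "union_of_basis T (Id_on V)" using E(1)[OF that] by (simp add: coherent_configuration_def)
			then show ?thesis using union_of_basis_iff[OF E(1)[OF that]] by blast
		qed
		then show ?thesis unfolding A_def by blast
	qed
	have co: "coherent_configuration V (alg_cc V A)" "A \<subseteq> cc_alg (alg_cc V A)"
		by (intro A; use E(1) i in \<open>auto simp: A_def intro: cc_alg_map2 cc_alg_tr cc_alg_mul\<close>)+
	have T0: "is_point_extension V S x (alg_cc V A)" unfolding is_point_extension_def
	proof (intro conjI ballI co(1))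
		show "cc_le S (alg_cc V A)"
			unfolding cc_le_iff[OF S co(1)] using co(2) E(1,2) cc_le_iff[OF S] by (fastforce simp: A_def)
		fix a assume a: "a \<in> set x"
		have "(\<lambda>c d. of_bool ((c, d) \<in> {(a, a)})) \<in> A" unfolding A_def using E a by (intro INT_I cc_alg_cell) auto
		then have "{(b, c) \<in> V \<times> V. \<forall>F\<in>A. F b c = F a a} = {(a, a)}"
			using a x by (auto dest!: bspec split: if_splits simp: of_bool_def)
		then show "{(a, a)} \<in> alg_cc V A" unfolding alg_cc_def using a x by (intro image_eqI[of _ _ "(a, a)"]) auto
	qed
	moreover have "cc_le (alg_cc V A) T" if T: "is_point_extension V S x T" for T
	proof -
		have "A \<subseteq> cc_alg T" unfolding A_def using T by blast
		then show ?thesis unfolding cc_le_iff[OF co(1) E(1)[simplified, OF T]]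
		proof (intro ballI cc_algI)
			fix s t a b c d assume s: "s \<in> alg_cc V A" and t: "t \<in> T" "(a, b) \<in> t" "(c, d) \<in> t"
			have "\<forall>F\<in>A. F a b = F c d" using cc_algD[OF _ t] \<open>A \<subseteq> cc_alg T\<close> by blast
			moreover have "t \<subseteq> V \<times> V" using coherent_sub E(1) T t(1) by blast
			ultimately show "of_bool ((a, b) \<in> s) = (of_bool ((c, d) \<in> s) :: int)"
				using s t by (clarsimp simp: alg_cc_def) (metis (lifting) mem_Sigma_iff subsetD)
		qed
	qed
	\<comment> \<open>Uniqueness comes from antisymmetry of \<open>cc_le\<close>; it gives the definite
	  description in \<open>point_extension\<close> its value.\<close>
	ultimately have "\<exists>!T. is_point_extension V S x T \<and> (\<forall>T'. is_point_extension V S x T' --> cc_le T T')"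
		using E(1) cc_le_antisym[of V] by (metis mem_Collect_eq)
	from theI'[OF this] show ?thesis unfolding point_extension_def by blast
qed

section \<open>Circulant schemes as Schur rings\<close>

locale circulant = group G for G :: "('a, 'b) monoid_scheme" (structure) +
	fixes S :: "('a \<times> 'a) set set" and g :: 'a
	assumes fin: "finite (carrier G)" and g: "g \<in> carrier G" and gen: "carrier G = range (\<lambda>k::int. g [^] k)"
		and S: "circulant_scheme G S"
begin

abbreviation N :: int where "N \<equiv> int (ord g)"
abbreviation pw :: "int => 'a" where "pw k \<equiv> g [^] k"

definition J :: "('a \<times> 'a) set set => (int => int => int) set" where
	"J T = {\<lambda>x y. F (pw x) (pw y) | F. F \<in> cc_alg T}"

text \<open>The translation-invariant part of the algebra, recorded as functions of the difference
  of the two arguments.\<close>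

definition II :: "(int => int) set" where
	"II = {f. (\<lambda>x y. f (y - x)) \<in> J S}"

definition grp :: "int => 'a set" where
	"grp d = pw ` {x. d dvd x}"

lemma N0: "N > 0" using ord_ge_1[OF fin g] by simp

lemma pw [simp]: "pw k \<in> carrier G" using g by simp

lemma pw_add: "pw a \<otimes> pw b = pw (a + b)" using g by (simp add: int_pow_mult)

lemma pw_eq: "pw a = pw b \<longleftrightarrow> N dvd a - b" using int_pow_eq[OF g] by (simp add: dvd_diff_commute)

lemma pw_surj: "x \<in> carrier G ==> \<exists>k. x = pw k" using gen by blast

lemma SC: "coherent_configuration (carrier G) S" using S by (simp add: circulant_scheme_def)

lemma grp_mem: "d dvd N ==> pw x \<in> grp d \<longleftrightarrow> d dvd x"
proof
	assume d: "d dvd N" and "pw x \<in> grp d"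
	then obtain y where "d dvd y" "N dvd x - y" by (auto simp: grp_def pw_eq)
	then show "d dvd x" using dvd_iff_diff[OF dvd_trans[OF d]] by blast
qed (auto simp: grp_def)

lemma sum_carrier: "(\<Sum>b\<in>carrier G. h b) = rsum N (\<lambda>y. h (pw y))"
proof -
	have "bij_betw pw {0..<N} (carrier G)" unfolding bij_betw_def
	proof
		show "inj_on pw {0..<N}" by (rule inj_onI) (simp add: pw_eq mod_eq_dvd_iff[symmetric])
		have "pw k \<in> pw ` {0..<N}" for k
			using N0 by (intro image_eqI[of _ _ "k mod N"]) (auto simp: pw_eq mod_eq_dvd_iff[symmetric])
		then show "pw ` {0..<N} = carrier G" using gen by auto
	qed
	from sum.reindex_bij_betw[OF this, of h] show ?thesis by simp
qed

context
	fixes T assumes T: "coherent_configuration (carrier G) T"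
begin

lemma J_congD: "F \<in> J T ==> N dvd x - x' ==> N dvd y - y' ==> F x y = F x' y'"
	using pw_eq[of x x'] pw_eq[of y y'] by (auto simp: J_def)

lemma J_cell: "F \<in> J T ==> t \<in> T ==> (pw x, pw y) \<in> t ==> (pw x', pw y') \<in> t ==> F x y = F x' y'"
	unfolding J_def by (clarify, rule cc_algD)

lemma J_union: "union_of_basis T r ==> (\<lambda>x y. of_bool ((pw x, pw y) \<in> r)) \<in> J T"
	unfolding union_of_basis_iff[OF T] J_def by auto

lemma J_mapI: "F \<in> J T ==> H \<in> J T ==> (\<lambda>x y. h (F x y) (H x y)) \<in> J T"
	unfolding J_def using cc_alg_map2[of _ T _ h] by fastforce

lemma J_trI: "F \<in> J T ==> (\<lambda>x y. F y x) \<in> J T" unfolding J_def using cc_alg_tr[OF T] by fastforce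

lemma J_mulI: "F \<in> J T ==> H \<in> J T ==> (\<lambda>x z. rsum N (\<lambda>y. F x y * H y z)) \<in> J T"
	unfolding J_def using cc_alg_mul[OF T] by (fastforce simp: sum_carrier)

end

lemma II_iff: "f \<in> II \<longleftrightarrow> (\<lambda>x y. f (y - x)) \<in> J S" by (simp add: II_def)

lemma II_per: "f \<in> II ==> per N f" using J_congD[OF SC, of "\<lambda>x y. f (y - x)" 0 0] by (fastforce simp: II_def per_def)

sublocale sring N II
proof
	show "N > 0" by (rule N0)
	fix f assume f: "f \<in> II"
	then show p: "per N f" by (rule II_per)
	show "(\<lambda>x. f (- x)) \<in> II" using J_trI[OF SC] f by (force simp: II_def)
	fix h assume h: "h \<in> II"
	show "(\<lambda>x. k (f x) (h x)) \<in> II" for k using J_mapI[OF SC, of _ _ k] f h by (auto simp: II_def)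
	have "rsum N (\<lambda>y. f (y - x) * h (z - y)) = conv N f h (z - x)" for x z
	proof -
		have "per N (\<lambda>y. f y * h (z - x - y))"
		proof (rule perI)
			fix a b assume d: "N dvd a - b"
			have "N dvd (z - x - a) - (z - x - b)" using d by (simp add: dvd_diff_commute)
			then show "f a * h (z - x - a) = f b * h (z - x - b)"
				using per_cong[OF p d] per_cong[OF II_per[OF h], of "z - x - a" "z - x - b"] by simp
		qed
		from rsum_shift[OF N0 this, of "- x"] show ?thesis by (simp add: conv_def)
	qed
	then show "conv N f h \<in> II" using J_mulI[OF SC, of "\<lambda>x y. f (y - x)" "\<lambda>x y. h (y - x)"] f h by (simp add: II_def)
next
	have "(pw x, pw y) \<in> Id_on (carrier G) \<longleftrightarrow> N dvd y - x" for x y by (auto simp: Id_on_def pw_eq dvd_diff_commute)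
	then show "delta N \<in> II"
		using J_union[OF SC, of "Id_on (carrier G)"] SC by (simp add: II_def delta_def coherent_configuration_def)
qed

lemma S_shift: "s \<in> S ==> (pw x, pw y) \<in> s \<longleftrightarrow> (pw (x + k), pw (y + k)) \<in> s"
proof -
	have *: "(pw (x + k), pw (y + k)) \<in> s" if "s \<in> S" "(pw x, pw y) \<in> s" for x y k
	proof -
		have "\<forall>(a, b)\<in>s. \<forall>g\<in>carrier G. (a \<otimes> g, b \<otimes> g) \<in> s" using S that(1) by (simp add: circulant_scheme_def)
		from bspec[OF this that(2)] have "(pw x \<otimes> pw k, pw y \<otimes> pw k) \<in> s" using pw[of k] by blast
		then show ?thesis by (simp only: pw_add)
	qed
	show "s \<in> S ==> (pw x, pw y) \<in> s \<longleftrightarrow> (pw (x + k), pw (y + k)) \<in> s" using *[of x y k] *[of "x + k" "y + k" "- k"] by auto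
qed

text \<open>Translation invariance identifies a basis relation with its set of differences, whose
  indicator is in the ring and which no ring element can split.\<close>

lemma S_cell:
	assumes s: "s \<in> S" "(pw a, pw b) \<in> s"
	shows "(pw i, pw j) \<in> s \<longleftrightarrow> j - i \<in> bs (b - a)"
proof
	assume "(pw i, pw j) \<in> s"
	from J_cell[OF SC _ s(1) this s(2)] have "\<And>f. f \<in> II ==> f (j - i) = f (b - a)" by (simp only: II_iff)
	then show "j - i \<in> bs (b - a)" by (simp add: bs_def)
next
	assume j: "j - i \<in> bs (b - a)"
	have e: "(pw 0, pw (y - x)) \<in> s \<longleftrightarrow> (pw x, pw y) \<in> s" for x y using S_shift[OF s(1), of 0 "y - x" x] by simp
	have "(\<lambda>z. of_bool ((pw 0, pw z) \<in> s)) \<in> II"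
		unfolding II_iff using J_union[OF SC union_of_basis_cell[OF s(1)]] by (simp only: e)
	from I_bs[OF this j] show "(pw i, pw j) \<in> s" using s(2) by (simp only: e) (simp split: if_splits add: of_bool_def)
qed

lemma coset_relation_iff:
	assumes H: "subgroup H G"
	shows "(pw x, pw y) \<in> coset_relation G H \<longleftrightarrow> pw (y - x) \<in> H"
proof
	assume "(pw x, pw y) \<in> coset_relation G H"
	then obtain a h k where a: "a \<in> carrier G" "h \<in> H" "k \<in> H" "pw x = h \<otimes> a" "pw y = k \<otimes> a"
		by (auto simp: coset_relation_def RCOSETS_def r_coset_def)
	obtain i where i: "a = pw i" using pw_surj[OF a(1)] ..
	obtain j where j: "h = pw j" using pw_surj[OF subsetD[OF subgroup.subset[OF H] a(2)]] ..
	obtain l where "k = pw l" using pw_surj[OF subsetD[OF subgroup.subset[OF H] a(3)]] ..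
	note e = i j this
	have "N dvd x - (j + i)" "N dvd y - (l + i)" using a(4,5) by (simp_all add: e pw_add pw_eq)
	then have "N dvd (y - (l + i)) - (x - (j + i))" by (rule dvd_diff[rotated])
	then have "pw (y - x) = pw (l - j)" by (simp add: pw_eq algebra_simps)
	also have "... = k \<otimes> inv h" using g by (simp add: e int_pow_diff)
	finally show "pw (y - x) \<in> H" using a H by (simp add: subgroup.m_closed subgroup.m_inv_closed)
next
	assume "pw (y - x) \<in> H"
	then have "pw y \<in> H #> pw x" unfolding r_coset_def using pw_add[of "y - x" x] by force
	moreover have "pw x \<in> H #> pw x" by (rule rcos_self[OF pw H])
	moreover have "H #> pw x \<in> rcosets H" using rcosetsI[OF subgroup.subset[OF H] pw] .
	ultimately show "(pw x, pw y) \<in> coset_relation G H" unfolding coset_relation_def by blast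
qed

lemma scheme_group_iff: "scheme_group G S H \<longleftrightarrow> (\<exists>d. agrp d \<and> H = grp d)"
proof
	assume H: "scheme_group G S H"
	then have sg: "subgroup H G" and "union_of_basis S (coset_relation G H)" by (auto simp: scheme_group_def)
	from J_union[OF SC this(2)] have "(\<lambda>x y. of_bool (pw (y - x) \<in> H)) \<in> J S" by (simp only: coset_relation_iff[OF sg])
	then have "aset {x. pw x \<in> H}" by (simp add: aset_def II_iff)
	moreover have "0 \<in> {x. pw x \<in> H}" using subgroup.one_closed[OF sg] by simp
	moreover have "x + y \<in> {x. pw x \<in> H}" if "x \<in> {x. pw x \<in> H}" "y \<in> {x. pw x \<in> H}" for x y
		using that subgroup.m_closed[OF sg] by (simp add: pw_add[symmetric])
	ultimately obtain d where d: "agrp d" "{x. pw x \<in> H} = {x. d dvd x}" using subgroup_dvd by metis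
	have "H = pw ` {x. pw x \<in> H}" using subgroup.subset[OF sg] pw_surj by blast
	then show "\<exists>d. agrp d \<and> H = grp d" using d by (auto simp: grp_def)
next
	assume "\<exists>d. agrp d \<and> H = grp d"
	then obtain d where d: "agrp d" "H = grp d" by blast
	then have dN: "d dvd N" by (simp add: agrp_def)
	have sg: "subgroup H G"
	proof (rule subgroupI)
		show "inv a \<in> H" if "a \<in> H" for a using that g by (auto simp: d(2) grp_def int_pow_neg[symmetric] intro!: image_eqI)
		show "a \<otimes> b \<in> H" if "a \<in> H" "b \<in> H" for a b using that by (auto simp: d(2) grp_def pw_add)
	qed (auto simp: d(2) grp_def)
	have "(\<lambda>x. of_bool (d dvd x)) \<in> II" using d(1) by (simp add: agrp_def aset_def)
	then have j: "(\<lambda>x y. of_bool (d dvd y - x)) \<in> J S" by (simp add: II_iff)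
	have m: "(pw x, pw y) \<in> coset_relation G H \<longleftrightarrow> d dvd y - x" for x y
		using coset_relation_iff[OF sg] grp_mem[OF dN] d(2) by simp
	have "coset_relation G H \<subseteq> carrier G \<times> carrier G" unfolding coset_relation_def using rcosets_subset_PowG[OF sg] by blast
	moreover have "(\<lambda>a b. of_bool ((a, b) \<in> coset_relation G H)) \<in> cc_alg S"
	proof (rule cc_algI)
		fix s a b c e assume s: "s \<in> S" "(a, b) \<in> s" "(c, e) \<in> s"
		then obtain x y x' y' where "a = pw x" "b = pw y" "c = pw x'" "e = pw y'"
			using coherent_sub[OF SC s(1)] pw_surj by (metis mem_Sigma_iff subsetD)
		then show "of_bool ((a, b) \<in> coset_relation G H) = (of_bool ((c, e) \<in> coset_relation G H) :: int)"
			using J_cell[OF SC j s(1), of x y x' y'] s by (simp add: m)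
	qed
	ultimately show "scheme_group G S H" using sg by (simp add: scheme_group_def union_of_basis_iff[OF SC])
qed

text \<open>Larger subgroups have smaller divisors: \<open>u\<close> belongs to the numerator of the
  section and \<open>v\<close> to its denominator.\<close>

definition secd :: "'a sec => int => int => bool" where
	"secd A u v \<longleftrightarrow> agrp u \<and> agrp v \<and> u dvd v \<and> A = (grp u, grp v)"

lemma grp_subset: "agrp u ==> agrp v ==> grp v \<subseteq> grp u \<longleftrightarrow> u dvd v"
proof -
	assume a: "agrp u" "agrp v"
	have "pw v \<in> grp v" by (auto simp: grp_def)
	then have "grp v \<subseteq> grp u ==> u dvd v" using grp_mem[of u v] a(1) by (auto simp: agrp_def)
	then show ?thesis by (auto simp: grp_def intro: dvd_trans)
qed

lemma Sec1_iff: "A \<in> Sec1 G S \<longleftrightarrow> (\<exists>u v. secd A u v)" using grp_subset by (auto simp: Sec1_def scheme_group_iff secd_def)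

text \<open>Intersection and product of subgroups become lcm and gcd of divisors, in the form
  expected by \<open>disc_transfer\<close> and \<open>triv_transfer\<close>.\<close>

lemma multiple_of_secd:
	assumes m: "multiple_of G A B" and A: "secd A u v" and B: "secd B u' v'"
	shows "v' = lcm u' v" "u = gcd u' v"
proof -
	have d: "u dvd N" "v dvd N" "u' dvd N" "v' dvd N" and p: "u > 0" "v' > 0" using A B by (auto simp: secd_def agrp_def)
	have "grp v' = grp u' \<inter> grp v" "grp u = grp u' <#> grp v" using m A B by (auto simp: multiple_of_def secd_def)
	note m = this[THEN eqset_imp_iff]
	have "v' dvd x \<longleftrightarrow> lcm u' v dvd x" for x using m(1)[of "pw x"] d by (simp add: grp_mem)
	from this[of v'] this[of "lcm u' v"] show "v' = lcm u' v" using p by (intro zdvd_antisym_nonneg) auto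
	have "u dvd gcd u' v"
	proof (rule gcd_greatest)
		have "pw u' \<otimes> pw 0 \<in> grp u' <#> grp v" "pw 0 \<otimes> pw v \<in> grp u' <#> grp v"
			unfolding set_mult_def grp_def by (fastforce intro: exI[of _ u'] exI[of _ v] exI[of _ 0])+
		then have "pw u' \<in> grp u" "pw v \<in> grp u" using m(2) by (auto simp: pw_add)
		then show "u dvd u'" "u dvd v" using d by (auto simp: grp_mem)
	qed
	moreover have "pw u \<in> grp u' <#> grp v" using m(2)[of "pw u"] d by (simp add: grp_mem)
	then obtain a b where ab: "u' dvd a" "v dvd b" "pw u = pw (a + b)" unfolding set_mult_def grp_def by (auto simp: pw_add)
	then have "gcd u' v dvd a" "gcd u' v dvd b" "gcd u' v dvd u - (a + b)"
		using dvd_trans[OF gcd_dvd1] dvd_trans[OF gcd_dvd2] dvd_trans[OF dvd_trans[OF gcd_dvd1 d(3)]] by (simp_all only: pw_eq)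
	then have "gcd u' v dvd u" using dvd_iff_diff by (meson dvd_add)
	ultimately show "u = gcd u' v" using p by (intro zdvd_antisym_nonneg) auto
qed

text \<open>Each step of the equivalence exchanges lcm and gcd as assumed for \<open>P\<close>.
  Quantifying over \<open>secd\<close> avoids choosing divisors for a section.\<close>

lemma proj_equiv_invariant:
	assumes e: "proj_equiv G S A B" and P: "\<And>u v u' v'. agrp u ==> agrp v' ==> v = lcm u v' ==> u' = gcd u v' ==> P u v \<longleftrightarrow> P u' v'"
	shows "(\<forall>u v. secd A u v --> P u v) \<longleftrightarrow> (\<forall>u v. secd B u v --> P u v)"
proof -
	let ?D = "\<lambda>A. \<forall>u v. secd A u v --> P u v"
	have s: "?D A \<longleftrightarrow> ?D B" if "A \<in> Sec1 G S" "B \<in> Sec1 G S" "multiple_of G A B" for A B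
	proof -
		have "P u' v' \<longleftrightarrow> P u v" if "secd A u v" "secd B u' v'" for u v u' v'
			using multiple_of_secd[OF \<open>multiple_of G A B\<close> that] that by (intro P) (auto simp: secd_def)
		then show ?thesis using that Sec1_iff by metis
	qed
	have "equivclp (\<lambda>A B. A \<in> Sec1 G S \<and> B \<in> Sec1 G S \<and> multiple_of G A B) A B" using e by (simp add: proj_equiv_def)
	then show ?thesis
	proof (induction rule: equivclp_induct)
		case (step y z)
		then have "?D y \<longleftrightarrow> ?D z" using s[of y z] s[of z y] by blast
		then show ?case using step by simp
	qed simp
qed

end

section \<open>Quotient schemes in integer coordinates\<close>

locale circulant_section = circulant +
	fixes u v :: int
	assumes sec: "agrp u" "agrp v" "u dvd v"
begin

sublocale sring_section N II u v by unfold_locales (use sec in auto)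

abbreviation K :: "'a set monoid" where "K \<equiv> sec_group G (grp u, grp v)"

text \<open>The coset of \<open>grp v\<close> through \<open>pw (u * k)\<close>; with this numbering
  the section becomes the integers modulo \<open>M\<close>.\<close>

definition c :: "int => 'a set" where
	"c k = pw ` {x. v dvd x - u * k}"

definition R :: "int => ('a set \<times> 'a set) set" where
	"R m = {(c k, c l) | k l. l - k \<in> Q.bs m}"

lemma c_mem: "pw x \<in> c k \<longleftrightarrow> v dvd x - u * k"
proof
	assume "pw x \<in> c k"
	then obtain y where y: "v dvd y - u * k" "N dvd x - y" by (auto simp: c_def pw_eq)
	then show "v dvd x - u * k" using dvd_add[OF dvd_trans[OF v_N y(2)] y(1)] by simp
qed (auto simp: c_def)

lemma c_eq: "c k = c l \<longleftrightarrow> M dvd k - l"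
proof
	assume "c k = c l"
	then have "pw (u * k) \<in> c l" using c_mem[of "u * k" k] by simp
	then show "M dvd k - l" by (simp add: c_mem dvd_M)
next
	assume "M dvd k - l"
	then have *: "v dvd u * k - u * l" by (simp add: dvd_M)
	have "v dvd x - u * k \<longleftrightarrow> v dvd x - u * l" for x using * by (intro dvd_iff_diff) (simp add: dvd_diff_commute)
	then show "c k = c l" by (simp add: c_def)
qed

lemma carrier_K: "carrier K = range c"
proof -
	have "grp v #> pw (u * k) = c k" for k
	proof (rule Set.set_eqI)
		fix y
		have "y \<in> grp v #> pw (u * k) \<longleftrightarrow> (\<exists>x. v dvd x \<and> y = pw (x + u * k))" by (auto simp: grp_def r_coset_def pw_add)
		also have "... \<longleftrightarrow> y \<in> c k" unfolding c_def by (auto intro: image_eqI exI[of _ "_ - u * k"])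
		finally show "y \<in> grp v #> pw (u * k) \<longleftrightarrow> y \<in> c k" .
	qed
	moreover have "grp u = range (\<lambda>k. pw (u * k))" by (auto simp: grp_def)
	ultimately show ?thesis by (auto simp: sec_group_def FactGroup_def RCOSETS_def r_coset_def)
qed

lemma mult_K: "c k \<otimes>\<^bsub>K\<^esub> c l = c (k + l)"
proof (rule Set.set_eqI)
	fix y
	have "y \<in> c k \<otimes>\<^bsub>K\<^esub> c l \<longleftrightarrow> (\<exists>a b. v dvd a - u * k \<and> v dvd b - u * l \<and> y = pw (a + b))"
		by (auto simp: sec_group_def FactGroup_def set_mult_def c_def pw_add)
	also have "... \<longleftrightarrow> (\<exists>x. v dvd x - u * (k + l) \<and> y = pw x)"
	proof
		assume "\<exists>a b. v dvd a - u * k \<and> v dvd b - u * l \<and> y = pw (a + b)"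
		then obtain a b where ab: "v dvd a - u * k" "v dvd b - u * l" "y = pw (a + b)" by blast
		have "v dvd (a + b) - u * (k + l)" using dvd_add[OF ab(1,2)] by (simp add: algebra_simps)
		then show "\<exists>x. v dvd x - u * (k + l) \<and> y = pw x" using ab(3) by blast
	next
		assume "\<exists>x. v dvd x - u * (k + l) \<and> y = pw x"
		then obtain x where "v dvd x - u * (k + l)" "y = pw x" by blast
		then show "\<exists>a b. v dvd a - u * k \<and> v dvd b - u * l \<and> y = pw (a + b)"
			by (intro exI[of _ "u * k"] exI[of _ "x - u * k"]) (simp add: algebra_simps)
	qed
	finally show "y \<in> c k \<otimes>\<^bsub>K\<^esub> c l \<longleftrightarrow> y \<in> c (k + l)" by (auto simp: c_def)
qed

lemma one_K: "\<one>\<^bsub>K\<^esub> = c 0" by (simp add: sec_group_def FactGroup_def c_def grp_def)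

lemma inv_K: "inv\<^bsub>K\<^esub> (c k) = c (- k)" unfolding m_inv_def carrier_K one_K
proof (rule the_equality)
	fix y assume "y \<in> range c \<and> c k \<otimes>\<^bsub>K\<^esub> y = c 0 \<and> y \<otimes>\<^bsub>K\<^esub> c k = c 0"
	then obtain l where l: "y = c l" "c (k + l) = c 0" by (auto simp: mult_K)
	then have "M dvd l - (- k)" using c_eq[of "k + l" 0] by (simp add: add.commute)
	then show "y = c (- k)" using l(1) c_eq by blast
qed (simp add: mult_K)

text \<open>Everything generated by \<open>c t\<close> has a multiple of \<open>t\<close> as
  coordinate, in particular \<open>c 1\<close>.\<close>

lemma generator_K:
	assumes "group_generator K (c t)"
	shows "\<exists>n. M dvd n * t - 1"
proof -
	have "x \<in> generate K {c t} ==> \<exists>n. x = c (n * t)" for x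
	proof (induction rule: generate.induct)
		case one
		then show ?case by (auto simp: one_K intro!: exI[of _ 0])
	next
		case (incl h)
		then show ?case by (auto intro!: exI[of _ 1])
	next
		case (inv h)
		then show ?case by (auto simp: inv_K intro!: exI[of _ "- 1"])
	next
		case (eng h1 h2)
		then show ?case by (auto simp: mult_K distrib_right[symmetric])
	qed
	moreover have "c 1 \<in> generate K {c t}" using assms carrier_K by (simp add: group_generator_def)
	ultimately obtain n where "c 1 = c (n * t)" by blast
	then have "M dvd n * t - 1" using c_eq[of "n * t" 1] by simp
	then show ?thesis ..
qed

lemma order_K: "Coset.order K = nat M"
proof -
	have M: "M > 0" by (rule Q.N_pos)
	have "inj_on c {0..<M}" by (rule inj_onI) (simp add: c_eq mod_eq_dvd_iff[symmetric])
	moreover have "c k \<in> c ` {0..<M}" for k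
		using M by (intro image_eqI[of _ _ "k mod M"]) (auto simp: c_eq mod_eq_dvd_iff[symmetric])
	then have "c ` {0..<M} = range c" by auto
	ultimately have "card (range c) = nat M" using card_image by fastforce
	then show ?thesis by (simp add: Coset.order_def carrier_K)
qed

lemma sec_elem_c: "h \<in> grp u ==> \<exists>k. h = pw (u * k) \<and> sec_elem G (grp u, grp v) h = c k"
proof -
	assume h: "h \<in> grp u"
	then obtain k where k: "h = pw (u * k)" by (auto simp: grp_def)
	have "h <# grp v = c k"
	proof (rule Set.set_eqI)
		fix y
		have "y \<in> h <# grp v \<longleftrightarrow> (\<exists>x. v dvd x \<and> y = pw (u * k + x))" by (auto simp: grp_def l_coset_def pw_add k)
		also have "... \<longleftrightarrow> y \<in> c k" unfolding c_def by (auto intro: image_eqI exI[of _ "_ - u * k"])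
		finally show "y \<in> h <# grp v \<longleftrightarrow> y \<in> c k" .
	qed
	then show ?thesis using h k by (auto simp: sec_elem_def)
qed

lemma R_mem: "(c k, c l) \<in> R m \<longleftrightarrow> l - k \<in> Q.bs m"
proof
	assume "(c k, c l) \<in> R m"
	then obtain k' l' where *: "M dvd k - k'" "M dvd l - l'" "l' - k' \<in> Q.bs m" by (auto simp: R_def c_eq)
	have "M dvd (l - k) - (l' - k')" using dvd_diff[OF *(2,1)] by (simp add: algebra_simps)
	then show "l - k \<in> Q.bs m" using Q.aset_cong[OF Q.aset_bs] *(3) by blast
qed (auto simp: R_def)

lemma R_sub: "R m \<subseteq> carrier K \<times> carrier K" by (auto simp: R_def carrier_K)

lemma pairs_eqI:
	assumes "\<And>k l. (c k, c l) \<in> r \<longleftrightarrow> (c k, c l) \<in> r'" "r \<subseteq> carrier K \<times> carrier K" "r' \<subseteq> carrier K \<times> carrier K"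
	shows "r = r'"
proof (rule Set.set_eqI)
	fix p
	show "p \<in> r \<longleftrightarrow> p \<in> r'"
	proof (cases "p \<in> carrier K \<times> carrier K")
		case True
		then obtain k l where "p = (c k, c l)" unfolding carrier_K by (elim SigmaE rangeE) simp
		then show ?thesis using assms(1) by simp
	qed (use assms(2,3) in blast)
qed

text \<open>\<open>s\<close> corresponds to one basic set of differences. Its image modulo
  \<open>v\<close> is a basic set of the quotient ring by \<open>sec_bs\<close>, and this is what
  \<open>R\<close> records.\<close>

lemma sec_cell:
	assumes s: "s \<in> S" "(pw i0, pw j0) \<in> s" and ij0: "v dvd i0 - u * k0" "v dvd j0 - u * l0"
	shows "{(C, D) \<in> carrier K \<times> carrier K. s \<inter> (C \<times> D) ~= {}} = R (l0 - k0)"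
proof -
	let ?z = "j0 - i0" and ?m = "u * (l0 - k0)"
	have zm: "v dvd ?z - ?m" using dvd_diff[OF ij0(2,1)] by (simp add: algebra_simps)
	have "(\<exists>p. p \<in> s \<inter> (c k \<times> c l)) \<longleftrightarrow> l - k \<in> Q.bs (l0 - k0)" for k l unfolding sec_bs
	proof
		assume "\<exists>p. p \<in> s \<inter> (c k \<times> c l)"
		then obtain i j where ij: "v dvd i - u * k" "v dvd j - u * l" "(pw i, pw j) \<in> s" by (auto simp: c_def)
		have "?z \<in> {y. \<exists>z'\<in>bs ?m. v dvd y - z'}" using zm bs_refl by blast
		from bs_sub[OF aset_per_msum[OF aset_bs v] this] ij(3) S_cell[OF s]
		obtain z' where z': "z' \<in> bs ?m" "v dvd (j - i) - z'" by blast
		have "v dvd ((j - i) - z') - ((j - u * l) - (i - u * k))" using ij(1,2) z'(2) by (simp only: dvd_diff)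
		then show "\<exists>z'\<in>bs ?m. v dvd u * (l - k) - z'" using z'(1) by (intro bexI[of _ z']) (simp_all add: algebra_simps)
	next
		assume "\<exists>z'\<in>bs ?m. v dvd u * (l - k) - z'"
		then obtain z' where z': "z' \<in> bs ?m" "v dvd u * (l - k) - z'" by blast
		have "?m \<in> {y. \<exists>z'\<in>bs ?z. v dvd y - z'}" using zm bs_refl dvd_diff_commute by blast
		from bs_sub[OF aset_per_msum[OF aset_bs v] this] z'(1)
		obtain z where z: "z \<in> bs ?z" "v dvd z' - z" by blast
		have "(pw (u * k), pw (u * k + z)) \<in> s" using S_cell[OF s] z(1) by simp
		moreover have "v dvd (u * k + z) - u * l"
			using dvd_add[OF z'(2) z(2)] dvd_minus_iff[of v "u * k + z - u * l"] by (simp add: algebra_simps)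
		ultimately show "\<exists>p. p \<in> s \<inter> (c k \<times> c l)" unfolding c_def by fastforce
	qed
	then have "(c k, c l) \<in> {(C, D) \<in> carrier K \<times> carrier K. s \<inter> (C \<times> D) ~= {}} \<longleftrightarrow> (c k, c l) \<in> R (l0 - k0)" for k l
		unfolding R_mem by (simp only: mem_Collect_eq prod.case mem_Sigma_iff carrier_K rangeI simp_thms ex_in_conv)
	then show ?thesis by (rule pairs_eqI) (use R_sub in auto)
qed

lemma sec_cc_eq: "sec_cc G S (grp u, grp v) = range R"
proof (intro equalityI subsetI)
	fix r assume "r \<in> sec_cc G S (grp u, grp v)"
	then obtain s where s: "s \<in> S" "r = {(C, D) \<in> carrier K \<times> carrier K. s \<inter> (C \<times> D) ~= {}}" "r ~= {}"
		by (auto simp: sec_cc_def)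
	then obtain k l p where p: "p \<in> s" "p \<in> c k \<times> c l" unfolding carrier_K by blast
	then obtain i j where "p = (pw i, pw j)" "v dvd i - u * k" "v dvd j - u * l" by (auto simp: c_def)
	then show "r \<in> range R" using sec_cell[OF s(1)] p(1) s(2) by blast
next
	fix r assume "r \<in> range R"
	then obtain m where m: "r = R m" by blast
	obtain s where s: "s \<in> S" "(pw 0, pw (u * m)) \<in> s" using coherent_cell[OF SC pw pw] .
	have "{(C, D) \<in> carrier K \<times> carrier K. s \<inter> (C \<times> D) ~= {}} = r" using sec_cell[OF s, of 0 m] m by simp
	moreover have "(c 0, c m) \<in> r" unfolding m R_mem using Q.bs_refl by simp
	ultimately show "r \<in> sec_cc G S (grp u, grp v)" using s(1) unfolding sec_cc_def by blast
qed

lemma trivial_sec_iff: "trivial_sec G S (grp u, grp v) \<longleftrightarrow> triv u v"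
proof -
	have t: "triv u v \<longleftrightarrow> (\<forall>k l. \<not> M dvd k --> \<not> M dvd l --> l \<in> Q.bs k)"
		unfolding triv_def sec_bs using dvd_M[of _ 0] by (auto elim!: dvdE)
	have z: "l \<in> Q.bs k ==> M dvd l \<longleftrightarrow> M dvd k" for k l using Q.aset_bs_iff[OF Q.aset_N] by blast
	let ?I = "Id_on (carrier K)" and ?D = "carrier K \<times> carrier K - Id_on (carrier K)"
	have I: "(c k, c l) \<in> ?I \<longleftrightarrow> M dvd l - k" "(c k, c l) \<in> ?D \<longleftrightarrow> \<not> M dvd l - k" for k l
		unfolding carrier_K Diff_iff mem_Sigma_iff Id_on_iff c_eq by (simp_all only: rangeI simp_thms dvd_diff_commute)
	have Is: "?I \<subseteq> carrier K \<times> carrier K" "?D \<subseteq> carrier K \<times> carrier K" by auto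
	show ?thesis unfolding trivial_sec_def trivial_cc_def sec_cc_eq t
	proof
		assume r: "range R = {?I, ?D} - {{}}"
		show "\<forall>k l. \<not> M dvd k --> \<not> M dvd l --> l \<in> Q.bs k"
		proof (intro allI impI)
			fix k l assume kl: "\<not> M dvd k" "\<not> M dvd l"
			have "R k = ?I \<or> R k = ?D" using DiffD1[OF rangeI[of R k, unfolded r]] by (simp only: insert_iff empty_iff simp_thms)
			moreover have "(c 0, c k) \<in> R k" using Q.bs_refl by (simp add: R_mem)
			ultimately have "R k = ?D" using I[of 0 k] kl(1) by auto
			then have "(c 0, c l) \<in> R k" using I(2)[of 0 l] kl(2) by simp
			then show "l \<in> Q.bs k" by (simp add: R_mem)
		qed
	next
		assume t: "\<forall>k l. \<not> M dvd k --> \<not> M dvd l --> l \<in> Q.bs k"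
		have RI: "R m = ?I" if "M dvd m" for m
		proof (rule pairs_eqI[OF _ R_sub Is(1)])
			have "l \<in> Q.bs m \<longleftrightarrow> M dvd l" for l using z[of l m] that Q.bs_cong[of l m] by auto
			then show "(c k, c l) \<in> R m \<longleftrightarrow> (c k, c l) \<in> ?I" for k l by (simp only: R_mem I)
		qed
		have RD: "R m = ?D" if "\<not> M dvd m" for m
		proof (rule pairs_eqI[OF _ R_sub Is(2)])
			have "l \<in> Q.bs m \<longleftrightarrow> \<not> M dvd l" for l using z[of l m] that t by blast
			then show "(c k, c l) \<in> R m \<longleftrightarrow> (c k, c l) \<in> ?D" for k l by (simp only: R_mem I)
		qed
		have "R m ~= {}" for m using R_mem[of 0 m m] Q.bs_refl by force
		then have "range R \<subseteq> {?I, ?D} - {{}}" using RI RD by blast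
		moreover have "?I \<in> range R" using RI[of 0] by (metis dvd_0_right rangeI)
		moreover have "?D \<in> range R" if D: "?D ~= {}"
		proof -
			obtain p where "p \<in> ?D" using D by blast
			then obtain k l where "(c k, c l) \<in> ?D" unfolding carrier_K by (cases p) blast
			then show ?thesis using RD[of "l - k"] I(2) by (metis rangeI)
		qed
		ultimately show "range R = {?I, ?D} - {{}}" by blast
	qed
qed

text \<open>The generator \<open>h\<close> has an invertible coordinate \<open>t\<close>, so no
  divisor of \<open>M\<close> above 1 divides it; the radical of the scheme translates into
  \<open>Q.rad\<close>.\<close>

lemma principal_sec_principal:
	assumes "principal_sec G S (grp u, grp v)"
	shows "\<exists>t. Q.principal t"
proof -
	obtain h where h: "group_generator K h" "radical K (range R) h = {\<one>\<^bsub>K\<^esub>}"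
		using assms by (auto simp: principal_sec_def sec_cc_eq)
	obtain t where t: "h = c t" using h(1) carrier_K by (auto simp: group_generator_def)
	obtain n where n: "M dvd n * t - 1" using generator_K h(1) t by blast
	have nb: "neighbours_of_one K (range R) h = c ` Q.bs t"
	proof -
		have "(\<exists>r\<in>range R. (c 0, c t) \<in> r \<and> (c 0, y) \<in> r) \<longleftrightarrow> y \<in> c ` Q.bs t" for y
		proof
			assume "\<exists>r\<in>range R. (c 0, c t) \<in> r \<and> (c 0, y) \<in> r"
			then obtain m where m: "(c 0, c t) \<in> R m" "(c 0, y) \<in> R m" by blast
			then obtain l where l: "y = c l" by (auto simp: R_def)
			have "t \<in> Q.bs m" "l \<in> Q.bs m" using m unfolding l R_mem by simp_all
			then show "y \<in> c ` Q.bs t" using Q.bs_eq l by blast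
		next
			assume "y \<in> c ` Q.bs t"
			then show "\<exists>r\<in>range R. (c 0, c t) \<in> r \<and> (c 0, y) \<in> r" using R_mem[of 0 _ t] Q.bs_refl by auto
		qed
		then show ?thesis by (simp add: neighbours_of_one_def one_K t)
	qed
	have "Q.principal t" unfolding Q.principal_def
	proof (intro conjI allI impI ballI)
		fix e assume e: "e > 0" "e dvd M" "\<forall>x\<in>Q.bs t. e dvd x"
		then have "e dvd n * t" "e dvd n * t - 1" using Q.bs_refl n dvd_trans by auto
		then have "e dvd 1" using dvd_iff_diff[of e "n * t" 1] by blast
		then show "e = 1" using e(1) by simp
	next
		fix e assume e: "e \<in> Q.rad (Q.bs t)"
		obtain d where d: "Q.rad (Q.bs t) = {x. d dvd x}" using Q.rad_agrp[OF Q.aset_bs] by metis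
		then have "- e \<in> Q.rad (Q.bs t)" using e by simp
		then have pm: "x - e \<in> Q.bs t" "x + e \<in> Q.bs t" if "x \<in> Q.bs t" for x
		proof -
			have "x - e \<in> Q.bs t" "x - (- e) \<in> Q.bs t" using e \<open>- e \<in> Q.rad (Q.bs t)\<close> that unfolding Q.rad_def by blast+
			then show "x - e \<in> Q.bs t" "x + e \<in> Q.bs t" by simp_all
		qed
		have "c ` Q.bs t #>\<^bsub>K\<^esub> c e = c ` Q.bs t"
		proof (intro equalityI subsetI)
			fix y assume "y \<in> c ` Q.bs t #>\<^bsub>K\<^esub> c e"
			then show "y \<in> c ` Q.bs t" using pm by (auto simp: r_coset_def mult_K)
		next
			fix y assume "y \<in> c ` Q.bs t"
			then obtain x where x: "x \<in> Q.bs t" "y = c (x - e) \<otimes>\<^bsub>K\<^esub> c e" by (auto simp: mult_K)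
			then show "y \<in> c ` Q.bs t #>\<^bsub>K\<^esub> c e" using pm(1)[OF x(1)] unfolding r_coset_def by blast
		qed
		then have "c e \<in> radical K (range R) h" by (simp add: radical_def nb carrier_K)
		then show "M dvd e" using h(2) one_K c_eq[of e 0] by simp
	qed
	then show ?thesis ..
qed

text \<open>A map preserving the basic sets of differences induces an automorphism \<open>F\<close>.
  By normality, \<open>F\<close> after the translation by \<open>x\<close> is some translation after
  \<open>F\<close>; evaluation at 0 identifies the latter as the translation by
  \<open>f x\<close>.\<close>

lemma normal_sec_nrm:
	assumes n: "normal_sec G S (grp u, grp v)"
	shows "Q.nrm" unfolding Q.nrm_def
proof (intro allI impI)
	fix f :: "int => int" and x y
	assume f: "\<forall>x y. f x - f y \<in> Q.bs (x - y)" and f0: "f 0 = 0"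
	have fM: "M dvd f k - f l \<longleftrightarrow> M dvd k - l" for k l using Q.aset_bs_iff[OF Q.aset_N] f by blast
	let ?C = "carrier K"
	\<comment> \<open>\<open>f\<close> respects congruence modulo \<open>M\<close>, so the coordinate
	  chosen by \<open>SOME\<close> does not matter.\<close>
	define F where "F = (\<lambda>C\<in>?C. c (f (SOME k. c k = C)))"
	have F: "F (c k) = c (f k)" for k
	proof -
		have "c (SOME l. c l = c k) = c k" by (rule someI) (rule refl)
		then have "c (f (SOME l. c l = c k)) = c (f k)" by (simp only: c_eq fM)
		then show ?thesis by (simp add: F_def carrier_K)
	qed
	have fC: "finite ?C" using order_K Q.N_pos by (metis card_gt_0_iff Coset.order_def zero_less_nat_eq)
	have inj: "inj_on F ?C"
	proof (rule inj_onI)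
		fix a b assume "a \<in> ?C" "b \<in> ?C" and ab: "F a = F b"
		then obtain k l where "a = c k" "b = c l" by (auto simp: carrier_K)
		then show "a = b" using ab by (simp only: F c_eq fM)
	qed
	have "F ` ?C = ?C" by (rule endo_inj_surj[OF fC _ inj]) (auto simp: carrier_K F)
	then have FB: "F \<in> Bij ?C" using inj by (simp add: Bij_def bij_betw_def F_def)

	have "map_prod F F ` R m = R m" for m
	proof (rule endo_inj_surj)
		show "finite (R m)" using R_sub fC by (meson finite_SigmaI finite_subset)
		show "inj_on (map_prod F F) (R m)" using inj map_prod_inj_on[OF inj inj] R_sub inj_on_subset by blast
		show "map_prod F F ` R m \<subseteq> R m"
		proof
			fix p assume "p \<in> map_prod F F ` R m"
			then obtain k l where p: "p = (c (f k), c (f l))" "l - k \<in> Q.bs m" by (auto simp: R_def F)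
			then show "p \<in> R m" using f Q.bs_eq unfolding p(1) R_mem by metis
		qed
	qed
	then have FA: "F \<in> Aut_cc ?C (range R)" using FB by (auto simp: Aut_cc_def)
	let ?B = "(BijGroup ?C)\<lparr>carrier := Aut_cc ?C (range R)\<rparr>" and ?H = "right_translations K"
	have nH: "?H \<lhd> ?B" using n by (simp add: normal_sec_def normal_scheme_def sec_cc_eq)
	have HB: "?H \<subseteq> Bij ?C" using subgroup.subset[OF normal_imp_subgroup[OF nH]] by (auto simp: Aut_cc_def)
	define T where "T = (\<lambda>z\<in>?C. z \<otimes>\<^bsub>K\<^esub> c x)"
	have T: "T \<in> ?H" unfolding T_def right_translations_def using carrier_K by blast
	have "F \<otimes>\<^bsub>?B\<^esub> T \<in> F <#\<^bsub>?B\<^esub> ?H" using T by (auto simp: l_coset_def)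
	also have "F <#\<^bsub>?B\<^esub> ?H = ?H #>\<^bsub>?B\<^esub> F" using normal.coset_eq[OF nH] FA by simp
	finally obtain W where W: "W \<in> ?H" "F \<otimes>\<^bsub>?B\<^esub> T = W \<otimes>\<^bsub>?B\<^esub> F" by (auto simp: r_coset_def)
	then obtain w where w: "W = (\<lambda>z\<in>?C. z \<otimes>\<^bsub>K\<^esub> c w)" by (auto simp: right_translations_def carrier_K)
	have "compose ?C F T = compose ?C W F"     using W(2) FB subsetD[OF HB T] subsetD[OF HB W(1)] by (simp add: BijGroup_def)
	then have "compose ?C F T (c k) = compose ?C W F (c k)" for k by simp
	then have *: "M dvd f (k + x) - (f k + w)" for k
		using rangeI[of c] by (simp only: compose_def restrict_def T_def w carrier_K mult_K F c_eq if_True)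
	from dvd_diff[OF *[of y] *[of 0]] show "M dvd f (x + y) - (f x + f y)" by (simp add: f0 add.commute algebra_simps)
qed

end

section \<open>From the point extension to discreteness\<close>

context circulant
begin

text \<open>Multiplication by the constant function 1 turns the relation with a single pair into a
  function of the first argument alone.\<close>

lemma J_point:
	assumes T: "coherent_configuration (carrier G) T" and p: "{(pw p, pw p)} \<in> T"
	shows "(\<lambda>x z. of_bool (N dvd x - p)) \<in> J T"
proof -
	let ?F = "\<lambda>x y. of_bool ((pw x, pw y) \<in> {(pw p, pw p)}) :: int"
	have F: "?F \<in> J T" by (rule J_union[OF T union_of_basis_cell[OF p]])
	have "rsum N (\<lambda>y. ?F x y * 1) = of_bool (N dvd x - p)" for x
	proof -
		have "per N (\<lambda>y. of_bool (N dvd x - p) :: int)" by (simp add: per_def)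
		from rsum_delta[OF N0 this, of p] show ?thesis by (simp add: pw_eq of_bool_conj mult.commute)
	qed
	then show ?thesis using J_mulI[OF T F J_mapI[OF T F F, of "\<lambda>_ _. 1"]] by simp
qed

text \<open>For a section of prime power order the base tuple contains an element whose coordinate
  generates modulo \<open>p ^ k\<close> and is therefore prime to \<open>p\<close>.\<close>

lemma point_extension_ctx:
	assumes b: "base_tuple G S xs" and P: "is_point_extension (carrier G) S xs P"
	shows "ctx N II (J P)"
proof -
	have T: "coherent_configuration (carrier G) P" and le: "cc_le S P" and pts: "\<And>a. a \<in> set xs ==> {(a, a)} \<in> P"
		using P by (auto simp: is_point_extension_def)
	show ?thesis
	proof
		show "F x y = F x' y'" if "F \<in> J P" "N dvd x - x'" "N dvd y - y'" for F x x' y y' using J_congD[OF T that] .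
		show "(\<lambda>x y. h (F x y) (H x y)) \<in> J P" if "F \<in> J P" "H \<in> J P" for F H h using J_mapI[OF T that] .
		show "(\<lambda>x y. F y x) \<in> J P" if "F \<in> J P" for F using J_trI[OF T that] .
		show "(\<lambda>x z. rsum N (\<lambda>y. F x y * H y z)) \<in> J P" if "F \<in> J P" "H \<in> J P" for F H using J_mulI[OF T that] .
		have "J S \<subseteq> J P" unfolding J_def using cc_alg_mono[OF SC T le] by blast
		then show "(\<lambda>x y. f (y - x)) \<in> J P" if "f \<in> II" for f using that by (auto simp: II_iff)
		have "{(pw 0, pw 0)} \<in> P" using pts b by (simp add: base_tuple_def)
		from J_point[OF T this] show "(\<lambda>x y. of_bool (N dvd x)) \<in> J P" by simp
		fix u p k assume a: "agrp u" "agrp (u * int p ^ k)" and k: "k > 0" "prime p"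
		interpret C: circulant_section G S g u "u * int p ^ k" by unfold_locales (use a in auto)
		have M: "C.M = int p ^ k" using a(1) by (simp add: agrp_def)
		have "primepow (Coset.order C.K)" unfolding C.order_K M using k by (auto simp: primepow_def nat_power_eq)
		moreover have "(grp u, grp (u * int p ^ k)) \<in> Sec1 G S" unfolding Sec1_iff secd_def using a by (intro exI conjI) (auto intro: refl)
		ultimately obtain h where h: "h \<in> set xs" "h \<in> grp u" "group_generator C.K (sec_elem G (grp u, grp (u * int p ^ k)) h)"
			using b unfolding base_tuple_def by fastforce
		obtain t where t: "h = pw (u * t)" "group_generator C.K (C.c t)" using C.sec_elem_c[OF h(2)] h(3) by auto
		obtain n where n: "int p ^ k dvd n * t - 1" using C.generator_K[OF t(2)] M by auto
		have "int p dvd int p ^ k" using k by simp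
		then have pn: "int p dvd n * t - 1" using n dvd_trans by blast
		have "coprime t (int p)"
		proof (rule coprimeI)
			fix e assume e: "e dvd t" "e dvd int p"
			then have "e dvd n * t" "e dvd n * t - 1" using pn dvd_trans by auto
			then show "is_unit e" using dvd_iff_diff[of e "n * t" 1] by blast
		qed
		moreover have "{(pw (u * t), pw (u * t))} \<in> P" using pts h(1) t(1) by simp
		ultimately show "\<exists>y. u dvd y \<and> coprime (y div u) (int p) \<and> (\<lambda>x z. of_bool (N dvd x - y)) \<in> J P"
			using J_point[OF T] a(1) by (intro exI[of _ "u * t"]) (auto simp: agrp_def)
	qed
qed

text \<open>If a basis relation met two different pairs of cosets, the indicator of one of these
  cosets would not be constant on it.\<close>

lemma disc_discrete:
	assumes c: "ctx N II (J P)" and T: "coherent_configuration (carrier G) P"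
		and sd: "secd A u v" and d: "ctx.disc (J P) u v"
	shows "discrete_cc (sec_cc G P A)"
proof -
	interpret ctx N II "J P" by fact
	interpret C: circulant_section G S g u v by unfold_locales (use sd in \<open>auto simp: secd_def\<close>)
	have A: "A = (grp u, grp v)" using sd by (simp add: secd_def)
	have *: "C.c k = C.c k' \<and> C.c l = C.c l'"
		if s: "s \<in> P" "s \<inter> (C.c k \<times> C.c l) ~= {}" "s \<inter> (C.c k' \<times> C.c l') ~= {}" for s k l k' l'
	proof -
		obtain i j i' j' where ij: "(pw i, pw j) \<in> s" "v dvd i - u * k" "v dvd j - u * l"
			and ij': "(pw i', pw j') \<in> s" "v dvd i' - u * k'" "v dvd j' - u * l'" using s(2,3) by (auto simp: C.c_def)
		have f: "(\<lambda>x y. of_bool (v dvd x - u * m)) \<in> J P" for m using d by (simp add: disc_def fib_def rel_def)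
		have "of_bool (v dvd i - u * k) = (of_bool (v dvd i' - u * k) :: int)" using J_cell[OF T f s(1) ij(1) ij'(1)] .
		moreover have "of_bool (v dvd j - u * l) = (of_bool (v dvd j' - u * l) :: int)"
			using J_cell[OF T J_tr[OF f] s(1) ij(1) ij'(1)] .
		ultimately have "v dvd i' - u * k" "v dvd j' - u * l" using ij(2,3) by (simp_all split: if_splits add: of_bool_def)
		then have "v dvd (i' - u * k') - (i' - u * k)" "v dvd (j' - u * l') - (j' - u * l)" using ij'(2,3) dvd_diff by blast+
		then show ?thesis by (simp add: C.c_eq C.dvd_M)
	qed
	show ?thesis unfolding discrete_cc_def
	proof
		fix r assume "r \<in> sec_cc G P A"
		then obtain s where s: "s \<in> P" "r = {(D, E) \<in> carrier C.K \<times> carrier C.K. s \<inter> (D \<times> E) ~= {}}" "r ~= {}"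
			by (auto simp: sec_cc_def A)
		then obtain p where p: "p \<in> r" by blast
		have rc: "\<exists>k l. q = (C.c k, C.c l) \<and> s \<inter> (C.c k \<times> C.c l) ~= {}" if "q \<in> r" for q
			using that unfolding s(2) C.carrier_K by blast
		have "q = p" if "q \<in> r" for q using rc[OF that] rc[OF p] *[OF s(1)] by metis
		then have "r = {p}" using p by blast
		then show "is_singleton r" by (simp add: is_singleton_def)
	qed
qed

text \<open>Triviality is moved along the projective equivalence to a subsection of a normal
  section; discreteness is obtained there and moved back.\<close>

lemma quasinormal_GA:
	assumes c: "ctx N II (J P)" and q: "quasinormal G S"
	shows "ctx.GA N II (J P)"
proof -
	interpret ctx N II "J P" by fact
	show ?thesis unfolding GA_def
	proof (intro allI impI)
		fix u v assume uv: "agrp u" "agrp v" "u dvd v" and t: "triv u v"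
		let ?A = "(grp u, grp v)"
		interpret C: circulant_section G S g u v by unfold_locales (use uv in auto)
		have A: "secd ?A u v" using uv by (simp add: secd_def)
		then have A1: "?A \<in> Sec1 G S" "trivial_sec G S ?A" using Sec1_iff C.trivial_sec_iff t by blast+
		then obtain B K where B: "B \<in> Sec1 G S" "K \<in> Sec1 G S" "proj_equiv G S ?A B" "subsection_of B K" "normal_sec G S K"
			using q unfolding quasinormal_def by blast
		obtain k l where K: "secd K k l" using B(2) Sec1_iff by blast
		interpret K: circulant_section G S g k l by unfold_locales (use K in \<open>auto simp: secd_def\<close>)
		interpret KC: ctx_section N II "J P" k l by unfold_locales
		have n: "K.Q.nrm" using K.normal_sec_nrm B(5) K by (simp add: secd_def)
		have "\<forall>u' v'. secd ?A u' v' --> triv u' v'"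
		proof (intro allI impI)
			fix u' v' assume A': "secd ?A u' v'"
			interpret C': circulant_section G S g u' v' by unfold_locales (use A' in \<open>auto simp: secd_def\<close>)
			show "triv u' v'" using C'.trivial_sec_iff A1(2) A' by (simp add: secd_def)
		qed
		then have tB: "\<forall>u v. secd B u v --> triv u v" using proj_equiv_invariant[OF B(3), of triv] triv_transfer by blast
		have "\<forall>u v. secd B u v --> disc u v"
		proof (intro allI impI)
			fix a b assume ab: "secd B a b"
			then have "k dvd a" "a dvd b" "b dvd l" "agrp a" "agrp b"
				using B(4) K grp_subset by (auto simp: subsection_of_def secd_def)
			then show "disc a b" using KC.normal_section_disc[OF n] tB ab by blast
		qed
		then show "disc u v" using proj_equiv_invariant[OF B(3), of disc] disc_transfer A by blast
	qed
qed

lemma Sec0_discrete: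
	assumes q: "quasinormal G S" and b: "base_tuple G S xs" and A: "A \<in> Sec0 G S"
	shows "discrete_cc (sec_cc G (point_extension (carrier G) S xs) A)"
proof -
	let ?P = "point_extension (carrier G) S xs"
	have P: "is_point_extension (carrier G) S xs ?P"
		by (rule point_extension_exists[OF SC]) (use b in \<open>simp add: base_tuple_def\<close>)
	then have T: "coherent_configuration (carrier G) ?P" by (simp add: is_point_extension_def)
	have c: "ctx N II (J ?P)" by (rule point_extension_ctx[OF b P])
	then interpret ctx N II "J ?P" .

	obtain B where B: "B \<in> Sec1 G S" "principal_sec G S B" "proj_equiv G S A B" using A by (auto simp: Sec0_def)
	have "\<forall>u v. secd B u v --> disc u v"
	proof (intro allI impI)
		fix u v assume uv: "secd B u v"
		interpret C: circulant_section G S g u v by unfold_locales (use uv in \<open>auto simp: secd_def\<close>)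
		interpret CC: ctx_section N II "J ?P" u v by unfold_locales
		obtain t where t: "C.Q.principal t" using C.principal_sec_principal B(2) uv by (auto simp: secd_def)
		from principal_disc[OF CC.QC.ctx_axioms t CC.GA_section[OF quasinormal_GA[OF c q]]] have "disc (u * 1) (u * C.M)" by (rule CC.sec_disc) simp
		then show "disc u v" by (simp add: C.uM)
	qed
	then have dA: "\<forall>u v. secd A u v --> disc u v" using proj_equiv_invariant[OF B(3), of disc] disc_transfer by blast
	obtain u v where "secd A u v" using A Sec1_iff by (auto simp: Sec0_def)
	then show ?thesis using disc_discrete[OF c T] dA by blast
qed

end

theorem theorem6p4:
  fixes G :: "('a, 'b) monoid_scheme"
    and S :: "('a \<times> 'a) set set"
    and x :: "'a list"
  assumes "cyclic_group G"
    and "group G"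
    and "finite (carrier G)"
    and "circulant_scheme G S"
    and "quasinormal G S"
    and "base_tuple G S x"
  shows "\<forall>A \<in> Sec0 G S. discrete_cc (sec_cc G (point_extension (carrier G) S x) A)"
proof -
	obtain g where g: "g \<in> carrier G" "carrier G = range (\<lambda>k::int. g [^]\<^bsub>G\<^esub> k)"
		using assms(1) group.cyclic_group[OF assms(2)] by blast
	interpret circulant G S g using assms g by (simp add: circulant_def circulant_axioms_def)
	show ?thesis using Sec0_discrete assms(5,6) by blast
qed

end
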